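(* Let $\Omega\subset\mathbb{R}^N$ be a bounded smooth domain and $p_1,p_2\in C_+(\overline{\Omega})$. Let $f:\Omega\times\mathbb{R}\to\mathbb{R}$ satisfy: (f$_0$) $f$ is Carathéodory and $|f(x,t)|\le C_1+C_2|t|^{\alpha(x)-1}$ for all $(x,t)\in\Omega\times\mathbb{R}$, where $\alpha\in C_+(\overline\Omega)$, $\alpha(x)<p_M^*(x)$ for all $x\in\overline\Omega$, and $\alpha^->p_M^+$; (f$_1$) there exist $M>0$ and $\theta>p_M^+$ such that $0<\theta F(x,t)\le tf(x,t)$ for all $|t|\ge M$, $x\in\Omega$, where $F(x,t)=\int_0^tf(x,s)ds$; (f$_2$) $f(x,t)=o(|t|^{p_M^+-1})$ as $t\to0$, uniformly for $x\in\Omega$. Then the problem $$-\mathrm{div}(|\nabla u|^{p_1(x)-2}\nabla u)-\mathrm{div}(|\nabla u|^{p_2(x)-2}\nabla u)=f(x,u)\ \text{in }\Omega,\qquad u=0\ \text{on }\partial\Omega$$ has a nontrivial weak solution.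
   Context: $C_+(\overline{\Omega})=\{h\in C(\overline{\Omega}):h>1\text{ on }\overline\Omega\}$; $h^+=\max_{\overline\Omega}h$, $h^-=\min_{\overline\Omega}h$. $p_M(x)=\max\{p_1(x),p_2(x)\}$; for $p\in C_+(\overline\Omega)$, $p^*(x)=\frac{Np(x)}{N-p(x)}$ if $p(x)<N$, $p^*(x)=\infty$ otherwise. $L^{p(x)}(\Omega)$ is the variable exponent Lebesgue space with Luxemburg norm, $W^{1,p(x)}(\Omega)=\{u\in L^{p(x)}:|\nabla u|\in L^{p(x)}\}$ with norm $|u|_{p(x)}+|\nabla u|_{p(x)}$, $W_0^{1,p(x)}(\Omega)$ the closure of $C_0^\infty(\Omega)$ in it. $X:=W_0^{1,p_1(x)}(\Omega)\cap W_0^{1,p_2(x)}(\Omega)$. A weak solution is $u\in X$ with $\int_\Omega|\nabla u|^{p_1(x)-2}\nabla u\cdot\nabla v\,dx+\int_\Omega|\nabla u|^{p_2(x)-2}\nabla u\cdot\nabla v\,dx=\int_\Omega f(x,u)v\,dx$ for all $v\in X$; nontrivial means $u\neq0$. *)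

theory Defs
  imports "HOL-Analysis.Analysis"
begin

fun Ck :: "nat \<Rightarrow> ('a::euclidean_space \<Rightarrow> real) \<Rightarrow> bool" where
  "Ck 0 f = continuous_on UNIV f"
| "Ck (Suc k) f = ((\<forall>x. f differentiable (at x)) \<and>
      (\<forall>i\<in>Basis. Ck k (\<lambda>x. frechet_derivative f (at x) i)))"

definition smooth_fun :: "('a::euclidean_space \<Rightarrow> real) \<Rightarrow> bool" where
  "smooth_fun f \<longleftrightarrow> (\<forall>k. Ck k f)"

definition bounded_smooth_domain :: "'a::euclidean_space set \<Rightarrow> bool" where
  "bounded_smooth_domain \<Omega> \<longleftrightarrow> \<Omega> \<noteq> {} \<and> bounded \<Omega> \<and> connected \<Omega> \<and>
     (\<exists>\<rho>. smooth_fun \<rho> \<and> \<Omega> = {x. \<rho> x < 0} \<and>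
        (\<forall>x. \<rho> x = 0 \<longrightarrow> frechet_derivative \<rho> (at x) \<noteq> (\<lambda>_. 0)))"

definition grad :: "('a::euclidean_space \<Rightarrow> real) \<Rightarrow> 'a \<Rightarrow> 'a" where
  "grad \<phi> x = (\<Sum>i\<in>Basis. frechet_derivative \<phi> (at x) i *\<^sub>R i)"

definition test_fun :: "'a::euclidean_space set \<Rightarrow> ('a \<Rightarrow> real) \<Rightarrow> bool" where
  "test_fun \<Omega> \<phi> \<longleftrightarrow> smooth_fun \<phi> \<and> compact (closure {x. \<phi> x \<noteq> 0}) \<and>
      closure {x. \<phi> x \<noteq> 0} \<subseteq> \<Omega>"

definition C_plus :: "'a::euclidean_space set \<Rightarrow> ('a \<Rightarrow> real) \<Rightarrow> bool" where
  "C_plus \<Omega> h \<longleftrightarrow> continuous_on (closure \<Omega>) h \<and> (\<forall>x\<in>closure \<Omega>. h x > 1)"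

definition sup_exp :: "'a::euclidean_space set \<Rightarrow> ('a \<Rightarrow> real) \<Rightarrow> real" where
  "sup_exp \<Omega> h = Sup (h ` closure \<Omega>)"

definition inf_exp :: "'a::euclidean_space set \<Rightarrow> ('a \<Rightarrow> real) \<Rightarrow> real" where
  "inf_exp \<Omega> h = Inf (h ` closure \<Omega>)"

definition crit_exp :: "nat \<Rightarrow> real \<Rightarrow> ereal" where
  "crit_exp N p = (if p < real N then ereal (real N * p / (real N - p)) else \<infinity>)"

definition modular :: "'a::euclidean_space set \<Rightarrow> ('a \<Rightarrow> real) \<Rightarrow> ('a \<Rightarrow> real) \<Rightarrow> ennreal" where
  "modular \<Omega> p u = (\<integral>\<^sup>+ x. ennreal (\<bar>u x\<bar> powr p x) \<partial>lebesgue_on \<Omega>)"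

definition Lp_var :: "'a::euclidean_space set \<Rightarrow> ('a \<Rightarrow> real) \<Rightarrow> ('a \<Rightarrow> real) \<Rightarrow> bool" where
  "Lp_var \<Omega> p u \<longleftrightarrow> u \<in> borel_measurable (lebesgue_on \<Omega>) \<and>
     (\<exists>c>0. modular \<Omega> p (\<lambda>x. u x / c) < \<infinity>)"

definition lux_norm :: "'a::euclidean_space set \<Rightarrow> ('a \<Rightarrow> real) \<Rightarrow> ('a \<Rightarrow> real) \<Rightarrow> real" where
  "lux_norm \<Omega> p u = Inf {c::real. c > 0 \<and> modular \<Omega> p (\<lambda>x. u x / c) \<le> 1}"

definition weak_grad :: "'a::euclidean_space set \<Rightarrow> ('a \<Rightarrow> real) \<Rightarrow> ('a \<Rightarrow> 'a) \<Rightarrow> bool" where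
  "weak_grad \<Omega> u g \<longleftrightarrow>
     (\<forall>K. compact K \<and> K \<subseteq> \<Omega> \<longrightarrow> set_integrable lebesgue K u \<and>
         (\<forall>i\<in>Basis. set_integrable lebesgue K (\<lambda>x. g x \<bullet> i))) \<and>
     (\<forall>\<phi>. test_fun \<Omega> \<phi> \<longrightarrow> (\<forall>i\<in>Basis.
        (\<integral>x. u x * frechet_derivative \<phi> (at x) i \<partial>lebesgue_on \<Omega>)
          = - (\<integral>x. (g x \<bullet> i) * \<phi> x \<partial>lebesgue_on \<Omega>)))"

definition W1p_grad :: "'a::euclidean_space set \<Rightarrow> ('a \<Rightarrow> real) \<Rightarrow> ('a \<Rightarrow> real) \<Rightarrow> ('a \<Rightarrow> 'a) \<Rightarrow> bool" where
  "W1p_grad \<Omega> p u g \<longleftrightarrow> Lp_var \<Omega> p u \<and> weak_grad \<Omega> u g \<and>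
     g \<in> borel_measurable (lebesgue_on \<Omega>) \<and> Lp_var \<Omega> p (\<lambda>x. norm (g x))"

definition W01p :: "'a::euclidean_space set \<Rightarrow> ('a \<Rightarrow> real) \<Rightarrow> ('a \<Rightarrow> real) \<Rightarrow> bool" where
  "W01p \<Omega> p u \<longleftrightarrow> (\<exists>g. W1p_grad \<Omega> p u g \<and>
     (\<exists>\<phi>::nat \<Rightarrow> 'a \<Rightarrow> real. (\<forall>k. test_fun \<Omega> (\<phi> k)) \<and>
        (\<lambda>k. lux_norm \<Omega> p (\<lambda>x. \<phi> k x - u x)
             + lux_norm \<Omega> p (\<lambda>x. norm (grad (\<phi> k) x - g x))) \<longlonglongrightarrow> 0))"

definition X_space :: "'a::euclidean_space set \<Rightarrow> ('a \<Rightarrow> real) \<Rightarrow> ('a \<Rightarrow> real) \<Rightarrow> ('a \<Rightarrow> real) \<Rightarrow> bool" where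
  "X_space \<Omega> p1 p2 u \<longleftrightarrow> W01p \<Omega> p1 u \<and> W01p \<Omega> p2 u"

definition caratheodory :: "'a::euclidean_space set \<Rightarrow> ('a \<Rightarrow> real \<Rightarrow> real) \<Rightarrow> bool" where
  "caratheodory \<Omega> f \<longleftrightarrow> (\<forall>t. (\<lambda>x. f x t) \<in> borel_measurable (lebesgue_on \<Omega>)) \<and>
     (AE x in lebesgue_on \<Omega>. continuous_on UNIV (f x))"

definition primitive :: "('a \<Rightarrow> real \<Rightarrow> real) \<Rightarrow> 'a \<Rightarrow> real \<Rightarrow> real" where
  "primitive f x t = (LBINT s=0..t. f x s)"

definition weak_solution :: "'a::euclidean_space set \<Rightarrow> ('a \<Rightarrow> real) \<Rightarrow> ('a \<Rightarrow> real)
     \<Rightarrow> ('a \<Rightarrow> real \<Rightarrow> real) \<Rightarrow> ('a \<Rightarrow> real) \<Rightarrow> bool" where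
  "weak_solution \<Omega> p1 p2 f u \<longleftrightarrow> X_space \<Omega> p1 p2 u \<and>
     (\<exists>g. weak_grad \<Omega> u g \<and>
       (\<forall>v h. X_space \<Omega> p1 p2 v \<and> weak_grad \<Omega> v h \<longrightarrow>
          (\<integral>x. norm (g x) powr (p1 x - 2) * (g x \<bullet> h x) \<partial>lebesgue_on \<Omega>)
          + (\<integral>x. norm (g x) powr (p2 x - 2) * (g x \<bullet> h x) \<partial>lebesgue_on \<Omega>)
          = (\<integral>x. f x (u x) * v x \<partial>lebesgue_on \<Omega>)))"

end

theory Submission imports Defs "HOL-Library.Function_Algebras" "HOL-Complex_Analysis.Great_Picard"
begin

text \<open>Weak solutions are critical points of the energy \<open>J\<close>, found by the mountain pass theorem. An element of
 \<open>W\<^sub>0\<close> is represented by a pair (function, gradient) that is a limit, in the modular, of pairs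
 \<open>(\<phi>, grad \<phi>)\<close> with \<open>\<phi>\<close> a test function. Instead of Ekeland's principle, a path is lowered by finitely many
 explicit deformations; this only needs uniform continuity of the derivative on bounded sets and yields almost
 critical points in an incomplete seminormed space. The Palais--Smale condition replaces weak compactness by two
 facts: the gradient part is uniformly monotone, and the embedding into the variable exponent space of exponent
 \<open>\<alpha>\<close> is compact. The latter follows from comparing a function with its mean over small balls: the
 error is estimated by averages of the gradient along rays, where the exponents may be treated as nearly constant, and
 strict subcriticality on the compact closure makes the resulting power of the radius integrable.\<close>

subsection \<open>Power inequalities and the p-Laplacian vector field\<close>

text \<open>The exponents are merely continuous, so a Sobolev inequality at the critical exponent
  may fail; the proof lives on the positive gap to criticality that compactness of
  \<open>closure \<Omega>\<close> provides, and a small loss in the exponent is affordable. Both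
  gradient exponents are handled at once through the sum \<open>\<rho>\<close> of their gradient
  modulars, which dominates the modular for max(p1, p2), the exponent in the subcriticality
  hypothesis. The seminorm on the pair space is the gauge of \<open>\<rho>\<close>. It does not see
  the function component, which is controlled only through the embedding. Pairs are genuine
  functions, not classes modulo null sets, and gradients obtained in different ways are identified
  by uniqueness of weak gradients. Completeness of the pair space enters only once, in the
  Palais--Smale argument, where one almost everywhere limit has to serve both exponents. All
  constants have to be uniform in the exponent, which is why the bounds \<open>lo\<close> > 1 and
  \<open>hi\<close> occur throughout.\<close>

lemma powr_add_le:
 fixes x y p :: real
 assumes "0 <= x" "0 <= y" "0 <= p"
 shows "(x + y) powr p <= 2 powr p * (x powr p + y powr p)"
proof -
 have "(x + y) powr p <= (2 * max x y) powr p" using assms by (intro powr_mono2) auto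
 also have "... = 2 powr p * max x y powr p" using assms by (simp add: powr_mult)
 also have "... <= 2 powr p * (x powr p + y powr p)" by (intro mult_left_mono) (auto simp: max_def)
 finally show ?thesis .
qed

lemma norm_add_powr_le:
 fixes a b :: "'v::real_normed_vector"
 assumes "0 <= p" "p <= hi"
 shows "norm (a + b) powr p <= 2 powr hi * (norm a powr p + norm b powr p)"
proof -
 have "norm (a + b) powr p <= (norm a + norm b) powr p"
  using assms by (intro powr_mono2 norm_triangle_ineq) auto
 also have "... <= 2 powr p * (norm a powr p + norm b powr p)" using assms by (intro powr_add_le) auto
 also have "... <= 2 powr hi * (norm a powr p + norm b powr p)" using assms by (intro mult_right_mono powr_mono) auto
 finally show ?thesis .
qed

text \<open>Convexity for positive points is supplemented at the end points: when one of the points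
  is 0, only \<open>s powr p <= s\<close> for s in [0,1] is left.\<close>

lemma powr_convex_nonneg:
 fixes x y p t :: real
 assumes "1 <= p" "0 <= x" "0 <= y" "0 <= t" "t <= 1"
 shows "((1-t) * x + t * y) powr p <= (1-t) * x powr p + t * y powr p"
proof -
 have scal: "(s * z) powr p <= s * z powr p" if "0 <= s" "s <= 1" "0 <= z" for s z :: real
 proof -
  have "s powr p <= s powr 1" using that assms by (intro powr_mono') auto
  then show ?thesis using that by (simp add: powr_mult mult_right_mono)
 qed
 consider "x = 0" | "y = 0" | "x > 0" "y > 0" using assms by linarith
 then show ?thesis
 proof cases
  case 3
  then show ?thesis using convex_onD[OF powr_convex[OF assms(1)], of t x y] assms by auto
 qed (use assms scal[of t y] scal[of "1-t" x] in auto)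
qed

lemma norm_convex_powr:
 fixes a b :: "'v::real_normed_vector"
 assumes "1 <= p" "0 <= t" "t <= 1"
 shows "norm ((1-t) *\<^sub>R a + t *\<^sub>R b) powr p <= (1-t) * norm a powr p + t * norm b powr p"
proof -
 have "norm ((1-t) *\<^sub>R a + t *\<^sub>R b) <= (1-t) * norm a + t * norm b"
  using norm_triangle_ineq[of "(1-t) *\<^sub>R a" "t *\<^sub>R b"] assms by simp
 then have "norm ((1-t) *\<^sub>R a + t *\<^sub>R b) powr p <= ((1-t) * norm a + t * norm b) powr p"
  using assms by (intro powr_mono2) auto
 also have "... <= (1-t) * norm a powr p + t * norm b powr p" using assms by (intro powr_convex_nonneg) auto
 finally show ?thesis .
qed

text \<open>The split a b = (a/\<epsilon>) (\<epsilon> b) puts the small factor on b. The constant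
  must not depend on p: the conjugate exponent p/(p-1) decreases in p, hence is at most lo/(lo-1),
  which is the power of 1/\<epsilon> that appears.\<close>

lemma Youngs_epsilon:
 fixes a b p \<epsilon> lo :: real
 assumes lo: "1 < lo" "lo <= p" and ab: "0 <= a" "0 <= b" and \<epsilon>: "0 < \<epsilon>" "\<epsilon> <= 1"
 shows "a * b <= \<epsilon> * b powr p + (1/\<epsilon>) powr (lo/(lo-1)) * a powr (p/(p-1))"
proof -
 define q where "q = p/(p-1)"
 have p: "1 < p" using lo by simp
 have q: "1 < q" "1/q + 1/p = 1" "q <= lo/(lo-1)" using lo by (auto simp: q_def field_simps)
 have "a * b = (a/\<epsilon>) * (\<epsilon> * b)" using \<epsilon> by simp
 also have "... <= (a/\<epsilon>) powr q / q + (\<epsilon> * b) powr p / p"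
  using q p ab \<epsilon> by (intro Youngs_inequality) auto
 also have "... <= (a/\<epsilon>) powr q + (\<epsilon> * b) powr p"
 proof -
  have d: "x / z <= x" if "x >= 0" "z > 1" for x z :: real using that by (simp add: pos_divide_le_eq mult_le_cancel_left1)
  show ?thesis using q(1) p by (intro add_mono d) auto
 qed
 also have "(a/\<epsilon>) powr q = (1/\<epsilon>) powr q * a powr q" using ab \<epsilon> by (simp add: powr_divide)
 also have "... <= (1/\<epsilon>) powr (lo/(lo-1)) * a powr q"
  using q \<epsilon> by (intro mult_right_mono powr_mono) auto
 also have "(\<epsilon> * b) powr p = \<epsilon> powr p * b powr p" using ab \<epsilon> by (simp add: powr_mult)
 also have "... <= \<epsilon> powr 1 * b powr p" using \<epsilon> p by (intro mult_right_mono powr_mono') auto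
 finally show ?thesis using \<epsilon> by (simp add: q_def)
qed

text \<open>A compactness substitute for the explicit vector inequalities on \<open>|a|\<^sup>p\<^sup>-\<^sup>2a\<close>: it suffices to
 compare the zero sets of two homogeneous functions.\<close>

lemma homogeneous_compactness:
 fixes Q R :: "real => 'z::euclidean_space => real"
 assumes lo: "0 < lo" and \<epsilon>: "0 < \<epsilon>"
  and contQ: "continuous_on ({lo..hi} \<times> UNIV) (\<lambda>(p,z). Q p z)"
  and contR: "continuous_on ({lo..hi} \<times> UNIV) (\<lambda>(p,z). R p z)"
  and homQ: "\<And>p z c. p \<in> {lo..hi} ==> 0 < c ==> Q p (c *\<^sub>R z) = c powr p * Q p z"
  and homR: "\<And>p z c. p \<in> {lo..hi} ==> 0 < c ==> R p (c *\<^sub>R z) = c powr p * R p z"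
  and R0: "\<And>p z. p \<in> {lo..hi} ==> 0 <= R p z"
  and zero: "\<And>p z. p \<in> {lo..hi} ==> R p z = 0 ==> Q p z <= 0"
 obtains C where "0 <= C" "\<And>p z. p \<in> {lo..hi} ==> Q p z <= \<epsilon> * norm z powr p + C * R p z"
proof -
 define S where "S = {lo..hi} \<times> (sphere 0 1 :: 'z set)"
 \<comment> \<open>Within [lo,hi] times the unit sphere only the part \<open>A\<close> where Q >=
   \<epsilon> needs R. There R cannot vanish, so it has a positive minimum m, while Q has a maximum
   B; C = B/m works.\<close>
 define A where "A = {pz \<in> S. \<epsilon> <= (\<lambda>(p,z). Q p z) pz}"
 have S: "compact S" "S \<subseteq> {lo..hi} \<times> UNIV" by (auto simp: S_def intro: compact_Times)
 have "closedin (top_of_set S) (S \<inter> (\<lambda>(p,z). Q p z) -` {\<epsilon>..})"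
  by (intro continuous_closedin_preimage continuous_on_subset[OF contQ S(2)]) auto
 moreover have "S \<inter> (\<lambda>(p,z). Q p z) -` {\<epsilon>..} = A" by (auto simp: A_def)
 ultimately have A: "compact A" using S(1) closedin_compact by metis
 have "\<exists>C\<ge>0. \<forall>(p,z)\<in>S. Q p z <= \<epsilon> + C * R p z"
 proof (cases "A = {}")
  case True
  then show ?thesis by (intro exI[of _ 0]) (force simp: A_def)
 next
  case False
  have AS: "A \<subseteq> {lo..hi} \<times> UNIV" using S by (auto simp: A_def)
  obtain a where a: "a \<in> A" "\<And>b. b \<in> A ==> (\<lambda>(p,z). R p z) a <= (\<lambda>(p,z). R p z) b"
   using continuous_attains_inf[OF A False continuous_on_subset[OF contR AS]] by blast
  obtain b where b: "b \<in> A" "\<And>c. c \<in> A ==> (\<lambda>(p,z). Q p z) c <= (\<lambda>(p,z). Q p z) b"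
   using continuous_attains_sup[OF A False continuous_on_subset[OF contQ AS]] by blast
  define m where "m = (\<lambda>(p,z). R p z) a"
  define B where "B = (\<lambda>(p,z). Q p z) b"
  obtain pa za where pza: "a = (pa, za)" by (cases a)
  have pa: "pa \<in> {lo..hi}" "\<epsilon> <= Q pa za" using a(1) AS by (auto simp: A_def pza)
  have m: "m > 0" using R0[OF pa(1), of za] zero[OF pa(1), of za] pa(2) \<epsilon> by (auto simp: m_def pza less_le)
  have B: "B >= \<epsilon>" using b(1) by (auto simp: A_def B_def)
  show ?thesis
  proof (intro exI[of _ "B/m"] conjI ballI)
   show "0 <= B/m" using B \<epsilon> m by simp
   fix x assume x: "x \<in> S"
   obtain p z where pz: "x = (p,z)" by (cases x)
   show "case x of (p,z) => Q p z <= \<epsilon> + B/m * R p z"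
   proof (cases "x \<in> A")
    case True
    then have "Q p z <= B" "m <= R p z" using a(2)[OF True] b(2)[OF True] by (auto simp: pz m_def B_def)
    moreover have "B <= B/m * R p z" using \<open>m <= R p z\<close> m B \<epsilon> by (simp add: field_simps)
    ultimately show ?thesis using \<epsilon> by (simp add: pz)
   next
    case False
    then have "Q p z <= \<epsilon>" using x by (auto simp: A_def pz)
    moreover have "0 <= B/m * R p z" using B \<epsilon> m R0[of p z] x by (auto simp: S_def pz)
    ultimately show ?thesis by (simp add: pz)
   qed
  qed
 qed
 then obtain C where C: "C >= 0" "\<And>p z. (p,z) \<in> S ==> Q p z <= \<epsilon> + C * R p z" by auto
 show thesis
 proof (rule that[OF C(1)])
  fix p and z :: 'z assume p: "p \<in> {lo..hi}"
  show "Q p z <= \<epsilon> * norm z powr p + C * R p z"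
  proof (cases "z = 0")
   \<comment> \<open>At z = 0 homogeneity with the factor 2 gives Q = 2^p Q, and likewise for R, so
     both vanish.\<close>
   case True
   have "2 powr p > (1::real)" using p lo by (intro gr_one_powr) auto
   moreover have "Q p 0 = 2 powr p * Q p 0" "R p 0 = 2 powr p * R p 0" using homQ[OF p, of 2 0] homR[OF p, of 2 0] by auto
   ultimately show ?thesis using True by auto
  next
   case False
   define y where "y = inverse (norm z) *\<^sub>R z"
   have y: "(p,y) \<in> S" "z = norm z *\<^sub>R y" using False p by (auto simp: S_def y_def)
   have n: "norm z > 0" using False by simp
   have "Q p z = norm z powr p * Q p y" "R p z = norm z powr p * R p y"
    using homQ[OF p n, of y] homR[OF p n, of y] y(2) by auto
   then show ?thesis using mult_left_mono[OF C(2)[OF y(1)], of "norm z powr p"] by (simp add: algebra_simps)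
  qed
 qed
qed

text \<open>The vector field of the p-Laplacian, the gradient of |a|^p / p; the formula gives 0 at
  the origin also for p < 2, where the coefficient is unbounded nearby.\<close>

definition pvec :: "real => 'v::real_normed_vector => 'v" where
 "pvec p a = norm a powr (p - 2) *\<^sub>R a"

lemma pvec_zero [simp]: "pvec p 0 = 0" by (simp add: pvec_def)

lemma norm_pvec: "norm (pvec p a) = norm a powr (p - 1)"
proof (cases "a = 0")
 case False
 then have "norm a powr (p-1) = norm a powr (p-2) * norm a powr 1" by (subst powr_add[symmetric]) simp
 then show ?thesis using False by (simp add: pvec_def)
qed (simp add: pvec_def)

lemma pvec_self: "pvec p a \<bullet> a = norm a powr p" for a :: "'v::real_inner"
proof (cases "a = 0")
 case False
 then have "norm a powr p = norm a powr (p-2) * norm a powr 2" by (subst powr_add[symmetric]) simp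
 then show ?thesis using False by (simp add: pvec_def dot_square_norm)
qed (simp add: pvec_def)

lemma pvec_scale: assumes "c > 0" shows "pvec p (c *\<^sub>R a) = c powr (p-1) *\<^sub>R pvec p a"
proof -
 have "c powr (p-2) * c = c powr (p-1)" using assms powr_add[of c "p-2" 1] by simp
 then show ?thesis using assms by (simp add: pvec_def powr_mult mult.commute mult.left_commute)
qed

text \<open>Joint continuity in exponent and vector is what the compactness argument consumes. At a
  = 0 the product formula is of no help for p < 2; there the norm |a|^(p-1) is used, which is
  continuous because p >= lo > 1.\<close>

lemma continuous_on_pvec:
 assumes "1 < lo"
 shows "continuous_on ({lo..hi} \<times> UNIV) (\<lambda>(p,a::'v::real_normed_vector). pvec p a)"
proof (unfold continuous_on_def, intro ballI)
 fix x :: "real \<times> 'v" assume x: "x \<in> {lo..hi} \<times> UNIV"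
 show "((\<lambda>(p,a). pvec p a) \<longlongrightarrow> (case x of (p,a) => pvec p a)) (at x within {lo..hi} \<times> UNIV)"
 proof (cases "snd x = 0")
  case False
  then show ?thesis
   unfolding pvec_def split_beta by (intro tendsto_intros) auto
 next
  case True
  have "continuous_on ({lo..hi} \<times> UNIV) (\<lambda>z::real\<times>'v. norm (snd z) powr (fst z - 1))"
   using assms by (intro continuous_on_powr' continuous_intros) auto
  then have "((\<lambda>z::real\<times>'v. norm (snd z) powr (fst z - 1)) \<longlongrightarrow> norm (snd x) powr (fst x - 1)) (at x within {lo..hi} \<times> UNIV)"
   using x by (auto simp: continuous_on_def)
  then have "((\<lambda>z::real\<times>'v. norm (case z of (p,a) => pvec p a)) \<longlongrightarrow> 0) (at x within {lo..hi} \<times> UNIV)"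
   using True by (simp add: split_beta norm_pvec)
  from tendsto_norm_zero_cancel[OF this] show ?thesis using True by (simp add: case_prod_unfold)
 qed
qed

lemma continuous_on_pvec_compose:
 assumes "1 < lo" "continuous_on S f" "continuous_on S g" "f ` S \<subseteq> {lo..hi}"
 shows "continuous_on S (\<lambda>x. pvec (f x) (g x))"
 using continuous_on_compose2[OF continuous_on_pvec[OF assms(1), of hi] continuous_on_Pair[OF assms(2,3)]] assms(4)
 by auto

text \<open>With r = |a| and s = |b| the pairing splits into (r^(p-1) - s^(p-1)) (r - s) and
  (r^(p-2) + s^(p-2)) (r s - a.b), nonnegative by monotonicity of the scalar power and by
  Cauchy--Schwarz. If the sum is 0, the first part forces r = s, and then both vectors carry the
  same coefficient.\<close>

lemma pvec_monotone:
 fixes a b :: "'v::real_inner"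
 assumes "1 < p"
 shows "0 <= (pvec p a - pvec p b) \<bullet> (a - b)"
  and "(pvec p a - pvec p b) \<bullet> (a - b) = 0 ==> a = b"
proof -
 define r s where "r = norm a" and "s = norm b"
 have rs: "r >= 0" "s >= 0" by (auto simp: r_def s_def)
 have ab: "a \<bullet> b <= r * s" by (auto simp: r_def s_def norm_cauchy_schwarz)
 have powr2: "z powr (p-2) * z = z powr (p-1)" if "z >= 0" for z
 proof (cases "z = 0")
  case False then show ?thesis using that powr_add[of z "p-2" 1] by simp
 qed simp
 have "(pvec p a - pvec p b) \<bullet> (a - b) = pvec p a \<bullet> a + pvec p b \<bullet> b - (r powr (p-2) + s powr (p-2)) * (a \<bullet> b)"
  by (simp add: inner_diff_left inner_diff_right inner_commute pvec_def r_def s_def algebra_simps)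
 also have "pvec p a \<bullet> a = r powr (p-1) * r" using powr2[OF rs(1)] by (simp add: pvec_def r_def dot_square_norm power2_eq_square mult.assoc[symmetric])
 also have "pvec p b \<bullet> b = s powr (p-1) * s" using powr2[OF rs(2)] by (simp add: pvec_def s_def dot_square_norm power2_eq_square mult.assoc[symmetric])
 finally have eq: "(pvec p a - pvec p b) \<bullet> (a - b) = (r powr (p-1) - s powr (p-1)) * (r - s) + (r powr (p-2) + s powr (p-2)) * (r * s - a \<bullet> b)"
  using powr2[OF rs(1)] powr2[OF rs(2)] by (simp add: algebra_simps)
 have 1: "0 <= (r powr (p-1) - s powr (p-1)) * (r - s)"
 proof (cases "r <= s")
  case True
  then have "r powr (p-1) <= s powr (p-1)" using assms rs by (intro powr_mono2) auto
  then show ?thesis using True by (intro mult_nonpos_nonpos) auto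
 next
  case False
  then have "s powr (p-1) <= r powr (p-1)" using assms rs by (intro powr_mono2) auto
  then show ?thesis using False by (intro mult_nonneg_nonneg) auto
 qed
 have 2: "0 <= (r powr (p-2) + s powr (p-2)) * (r * s - a \<bullet> b)" using ab by (intro mult_nonneg_nonneg) auto
 show "0 <= (pvec p a - pvec p b) \<bullet> (a - b)" using 1 2 eq by simp
 assume 0: "(pvec p a - pvec p b) \<bullet> (a - b) = 0"
 have "(r powr (p-1) - s powr (p-1)) * (r - s) = 0" using 0 1 2 eq by linarith
 then have "r = s"
  using powr_less_mono2[of "p-1" r s] powr_less_mono2[of "p-1" s r] assms rs by (metis diff_gt_0_iff_gt less_irrefl linorder_neqE_linordered_idom mult_eq_0_iff right_minus_eq)
 show "a = b"
 proof (cases "r = 0")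
  case True then show ?thesis using \<open>r = s\<close> by (simp add: r_def s_def)
 next
  case False
  have "r powr (p-2) *\<^sub>R (a - b) = pvec p a - pvec p b" using \<open>r = s\<close> by (simp add: pvec_def r_def s_def scaleR_diff_right)
  then have "r powr (p-2) * ((a - b) \<bullet> (a - b)) = 0" using 0 by (metis inner_scaleR_left)
  then show ?thesis using False rs by simp
 qed
qed

lemma scale_bound:
 fixes \<epsilon> k x t :: real
 assumes "x <= k * t" "0 < k" "0 < \<epsilon>"
 shows "\<epsilon> / k * x <= \<epsilon> * t"
 using mult_left_mono[OF assms(1), of "\<epsilon> / k"] assms by simp

text \<open>Compactness is applied to pairs z = (a,b), with R the monotone pairing, which vanishes
  only on the diagonal. The \<epsilon> term lets one inequality serve p < 2 and p >= 2 alike;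
  \<epsilon> is divided by \<open>2 powr hi\<close> to pay for the passage from |(a,b)| to |a| +
  |b|.\<close>

lemma pvec_uniformly_monotone:
 fixes lo hi \<epsilon> :: real
 assumes lo: "1 < lo" and \<epsilon>: "0 < \<epsilon>"
 obtains C where "0 <= C" "\<And>p (a::'v::euclidean_space) b. p \<in> {lo..hi} ==>
  norm (a - b) powr p <= \<epsilon> * (norm a powr p + norm b powr p) + C * ((pvec p a - pvec p b) \<bullet> (a - b))"
proof -
 let ?Q = "\<lambda>p (z::'v\<times>'v). norm (fst z - snd z) powr p"
 let ?R = "\<lambda>p (z::'v\<times>'v). (pvec p (fst z) - pvec p (snd z)) \<bullet> (fst z - snd z)"
 have lo0: "0 < lo" using lo by simp
 have cp: "continuous_on ({lo..hi} \<times> UNIV) (\<lambda>z::real\<times>('v\<times>'v). pvec (fst z) (fst (snd z)))"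
      "continuous_on ({lo..hi} \<times> UNIV) (\<lambda>z::real\<times>('v\<times>'v). pvec (fst z) (snd (snd z)))"
  by (rule continuous_on_pvec_compose[OF lo, where hi=hi], (intro continuous_intros), (intro continuous_intros), force)+
 have e: "\<epsilon> / 2 powr hi > 0" using \<epsilon> by simp
 obtain C where C: "0 <= C" "\<And>p z. p \<in> {lo..hi} ==> ?Q p z <= (\<epsilon> / 2 powr hi) * norm z powr p + C * ?R p z"
 proof (rule homogeneous_compactness[OF lo0 e, of hi ?Q ?R])
  show "continuous_on ({lo..hi} \<times> UNIV) (\<lambda>(p, z). ?Q p z)"
   unfolding split_beta using lo by (intro continuous_on_powr' continuous_intros) auto
  show "continuous_on ({lo..hi} \<times> UNIV) (\<lambda>(p, z). ?R p z)"
   unfolding split_beta by (intro continuous_intros cp)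
  fix p c and z :: "'v\<times>'v" assume p: "p \<in> {lo..hi}" 
  show "0 <= ?R p z" using pvec_monotone(1)[of p "fst z" "snd z"] p lo by auto
  show "?R p z = 0 ==> ?Q p z <= 0" using pvec_monotone(2)[of p "fst z" "snd z"] p lo by auto
  assume c: "0 < (c::real)"
  have "c powr (p - 1) * c = c powr p" using c powr_add[of c "p-1" 1] by simp
  then show "?R p (c *\<^sub>R z) = c powr p * ?R p z"
   using c by (simp add: pvec_scale scaleR_diff_right[symmetric] mult.assoc[symmetric] mult.commute)
  show "?Q p (c *\<^sub>R z) = c powr p * ?Q p z"
   using c by (simp add: scaleR_diff_right[symmetric] powr_mult)
 qed blast
 show thesis
 proof (rule that[OF C(1)])
  fix p and a b :: 'v assume p: "p \<in> {lo..hi}"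
  have "norm (a,b) <= norm a + norm b" by (rule norm_Pair_le)
  then have "norm (a,b) powr p <= (norm a + norm b) powr p" using p lo by (intro powr_mono2) auto
  also have "... <= 2 powr p * (norm a powr p + norm b powr p)" using p lo by (intro powr_add_le) auto
  also have "... <= 2 powr hi * (norm a powr p + norm b powr p)" using p by (intro mult_right_mono powr_mono) auto
  finally have "(\<epsilon> / 2 powr hi) * norm (a,b) powr p <= \<epsilon> * (norm a powr p + norm b powr p)"
   by (rule scale_bound) (use \<epsilon> in auto)
  then show "norm (a - b) powr p <= \<epsilon> * (norm a powr p + norm b powr p) + C * ((pvec p a - pvec p b) \<bullet> (a - b))"
   using C(2)[OF p, of "(a,b)"] by simp
 qed
qed

text \<open>The same compactness on triples z = (a,b,v) with R = |a-b|^p; including the test vector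
  v makes Q homogeneous of degree p. The constant \<open>4 powr hi\<close> comes from splitting the
  norm of a triple twice.\<close>

lemma pvec_uniformly_continuous:
 fixes lo hi \<epsilon> :: real
 assumes lo: "1 < lo" and \<epsilon>: "0 < \<epsilon>"
 obtains C where "0 <= C" "\<And>p (a::'v::euclidean_space) b v. p \<in> {lo..hi} ==>
  \<bar>(pvec p a - pvec p b) \<bullet> v\<bar> <= \<epsilon> * (norm a powr p + norm b powr p + norm v powr p) + C * norm (a - b) powr p"
proof -
 let ?Q = "\<lambda>p (z::'v\<times>'v\<times>'v). \<bar>(pvec p (fst z) - pvec p (fst (snd z))) \<bullet> snd (snd z)\<bar>"
 let ?R = "\<lambda>p (z::'v\<times>'v\<times>'v). norm (fst z - fst (snd z)) powr p"
 have lo0: "0 < lo" using lo by simp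
 have cp: "continuous_on ({lo..hi} \<times> UNIV) (\<lambda>z::real\<times>('v\<times>'v\<times>'v). pvec (fst z) (fst (snd z)))"
      "continuous_on ({lo..hi} \<times> UNIV) (\<lambda>z::real\<times>('v\<times>'v\<times>'v). pvec (fst z) (fst (snd (snd z))))"
  by (rule continuous_on_pvec_compose[OF lo, where hi=hi], (intro continuous_intros), (intro continuous_intros), force)+
 have e: "\<epsilon> / (4 powr hi) > 0" using \<epsilon> by simp
 obtain C where C: "0 <= C" "\<And>p z. p \<in> {lo..hi} ==> ?Q p z <= (\<epsilon> / (4 powr hi)) * norm z powr p + C * ?R p z"
 proof (rule homogeneous_compactness[OF lo0 e, of hi ?Q ?R])
  show "continuous_on ({lo..hi} \<times> UNIV) (\<lambda>(p, z). ?R p z)"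
   unfolding split_beta using lo by (intro continuous_on_powr' continuous_intros) auto
  show "continuous_on ({lo..hi} \<times> UNIV) (\<lambda>(p, z). ?Q p z)"
   unfolding split_beta by (intro continuous_intros cp)
  fix p c and z :: "'v\<times>'v\<times>'v" assume p: "p \<in> {lo..hi}" 
  show "0 <= ?R p z" by simp
  show "?R p z = 0 ==> ?Q p z <= 0" by simp
  assume c: "0 < (c::real)"
  have "c powr (p - 1) * c = c powr p" using c powr_add[of c "p-1" 1] by simp
  then show "?Q p (c *\<^sub>R z) = c powr p * ?Q p z"
   using c by (simp add: pvec_scale scaleR_diff_right[symmetric] abs_mult mult.assoc[symmetric] mult.commute)
  show "?R p (c *\<^sub>R z) = c powr p * ?R p z"
   using c by (simp add: scaleR_diff_right[symmetric] powr_mult)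
 qed blast
 show thesis
 proof (rule that[OF C(1)])
  fix p and a b v :: 'v assume p: "p \<in> {lo..hi}"
  define T where "T = norm a powr p + norm b powr p + norm v powr p"
  have "norm (a,b,v) <= norm a + (norm b + norm v)" using norm_Pair_le[of a "(b,v)"] norm_Pair_le[of b v] by linarith
  then have "norm (a,b,v) powr p <= (norm a + (norm b + norm v)) powr p" using p lo by (intro powr_mono2) auto
  also have "... <= 2 powr p * (norm a powr p + (norm b + norm v) powr p)" using p lo by (intro powr_add_le) auto
  also have "... <= 2 powr p * (norm a powr p + 2 powr p * (norm b powr p + norm v powr p))"
   using p lo by (intro mult_left_mono add_left_mono powr_add_le) auto
  also have "... <= 2 powr p * (2 powr p * norm a powr p + 2 powr p * (norm b powr p + norm v powr p))"
   using p lo ge_one_powr_ge_zero[of 2 p] by (intro mult_left_mono add_right_mono) (auto simp: mult_le_cancel_right1)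
  also have "... = 4 powr p * T"
   using powr_mult[of 2 2 p] by (simp add: T_def algebra_simps)
  also have "... <= 4 powr hi * T" using p by (intro mult_right_mono powr_mono) (auto simp: T_def)
  finally have "(\<epsilon> / (4 powr hi)) * norm (a,b,v) powr p <= \<epsilon> * T"
   by (rule scale_bound) (use \<epsilon> in auto)
  then show "\<bar>(pvec p a - pvec p b) \<bullet> v\<bar> <= \<epsilon> * (norm a powr p + norm b powr p + norm v powr p) + C * norm (a - b) powr p"
   using C(2)[OF p, of "(a,b,v)"] by (simp add: T_def)
 qed
qed

text \<open>Away from the origin |y|^p = (y.y)^(p/2) and the chain rule applies. At the origin the
  difference quotient has modulus |t|^(p-1) |h|^p / p, which tends to 0 because p > 1.\<close>

lemma DERIV_norm_powr:
 fixes a h :: "'v::real_inner"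
 assumes p: "1 < p"
 shows "((\<lambda>s. norm (a + s *\<^sub>R h) powr p / p) has_real_derivative pvec p (a + s *\<^sub>R h) \<bullet> h) (at s)"
proof (cases "a + s *\<^sub>R h = 0")
 case False
 define y where "y s = a + s *\<^sub>R h" for s
 have pos: "y s \<bullet> y s > 0" using False by (simp add: y_def)
 have n: "norm (y t) powr q = (y t \<bullet> y t) powr (q/2)" for t q
  by (simp add: norm_eq_sqrt_inner powr_half_sqrt[symmetric] powr_powr)
 have quad: "y t \<bullet> y t = a \<bullet> a + 2 * t * (a \<bullet> h) + t * t * (h \<bullet> h)" for t
  by (simp add: y_def inner_add_left inner_add_right inner_commute algebra_simps)
 have d: "((\<lambda>t. y t \<bullet> y t) has_real_derivative 2 * (y s \<bullet> h)) (at s)"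
  unfolding quad by (auto intro!: derivative_eq_intros simp: y_def inner_add_left algebra_simps)
 have "((\<lambda>t. (y t \<bullet> y t) powr (p/2) / p) has_real_derivative (p/2 * (y s \<bullet> y s) powr (p/2 - 1) * (2 * (y s \<bullet> h))) / p) (at s)"
  by (intro DERIV_cdivide DERIV_chain2[OF has_real_derivative_powr[OF pos] d])
 also have "(p/2 * (y s \<bullet> y s) powr (p/2 - 1) * (2 * (y s \<bullet> h))) / p = (y s \<bullet> y s) powr ((p-2)/2) * (y s \<bullet> h)"
  using p by (simp add: field_simps)
 also have "(y s \<bullet> y s) powr ((p-2)/2) * (y s \<bullet> h) = pvec p (y s) \<bullet> h"
  by (simp add: pvec_def n)
 finally show ?thesis unfolding n[symmetric] by (simp add: y_def)
next
 case True
 then have y: "a + t *\<^sub>R h = (t - s) *\<^sub>R h" for t by (simp add: scaleR_left_diff_distrib add_eq_0_iff)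
 have "((\<lambda>t. norm ((t - s) *\<^sub>R h) powr p / p) has_real_derivative 0) (at s)"
  unfolding DERIV_def
 proof (rule tendsto_rabs_zero_cancel)
  have "((\<lambda>t. \<bar>t\<bar> powr (p - 1) * (norm h powr p / p)) \<longlongrightarrow> \<bar>0\<bar> powr (p-1) * (norm h powr p / p)) (at (0::real))"
   using p by (intro tendsto_intros) auto
  moreover have "\<forall>\<^sub>F t in at 0. \<bar>t\<bar> powr (p - 1) * (norm h powr p / p)
   = \<bar>(norm ((s + t - s) *\<^sub>R h) powr p / p - norm ((s - s) *\<^sub>R h) powr p / p) / t\<bar>"
  proof (rule eventually_at_topological[THEN iffD2], intro exI[of _ UNIV] conjI ballI impI)
   fix t :: real assume "t \<noteq> 0"
   then have "\<bar>t\<bar> powr p = \<bar>t\<bar> powr (p-1) * \<bar>t\<bar>" using powr_add[of "\<bar>t\<bar>" "p-1" 1] by simp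
   then show "\<bar>t\<bar> powr (p - 1) * (norm h powr p / p)
    = \<bar>(norm ((s + t - s) *\<^sub>R h) powr p / p - norm ((s - s) *\<^sub>R h) powr p / p) / t\<bar>"
    using \<open>t \<noteq> 0\<close> p by (simp add: powr_mult abs_mult)
  qed auto
  ultimately show "((\<lambda>t. \<bar>(norm ((s + t - s) *\<^sub>R h) powr p / p - norm ((s - s) *\<^sub>R h) powr p / p) / t\<bar>) \<longlongrightarrow> 0) (at 0)"
   using p by (auto elim!: Lim_transform_eventually)
 qed
 then show ?thesis using True unfolding y by simp
qed

subsection \<open>Modulars with variable exponent\<close>

definition pmod :: "'x measure => ('x => real) => ('x => 'v::real_normed_vector) => ennreal" where
 "pmod M p w = (\<integral>\<^sup>+x. ennreal (norm (w x) powr p x) \<partial>M)"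

lemma pmod_cong_AE: "AE x in M. norm (v x) = norm (w x) ==> pmod M p v = pmod M p w"
 unfolding pmod_def by (intro nn_integral_cong_AE) auto

text \<open>Either d <= t, or d^(1-p) <= t^(1-p) <= (1/t)^hi. The constant is uniform in p, so
  integration over a set of finite measure bounds means by modulars.\<close>

lemma le_add_powr:
 fixes t d p hi :: real
 assumes "0 < t" "t <= 1" "0 <= d" "1 <= p" "p <= hi"
 shows "d <= t + (1/t) powr hi * d powr p"
proof (cases "d <= t")
 case True
 then show ?thesis by (simp add: add_increasing2)
next
 case False
 then have d: "d > 0" "d >= t" using assms by auto
 have "d = d powr (1 - p) * d powr p" using d by (simp add: powr_add[symmetric])
 also have "d powr (1-p) <= t powr (1-p)" using assms d by (intro powr_mono2') auto
 also have "t powr (1-p) = (1/t) powr (p-1)" using assms by (simp add: powr_divide powr_diff)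
 also have "(1/t) powr (p-1) <= (1/t) powr hi" using assms by (intro powr_mono) auto
 finally have "d <= (1/t) powr hi * d powr p" by (simp add: mult_right_mono)
 then show ?thesis using assms by simp
qed

locale var_exponent = finite_measure M for M :: "'x measure" +
 fixes p :: "'x => real" and lo hi :: real
 assumes p_measurable [measurable]: "p \<in> borel_measurable M"
  and p_lo: "x \<in> space M ==> lo <= p x" and p_hi: "x \<in> space M ==> p x <= hi"
  and lo: "1 < lo" and lohi: "lo <= hi"
begin

lemma p_range: "x \<in> space M ==> p x \<in> {lo..hi}"
 using p_lo p_hi by simp

lemma pmod_mono: "AE x in M. norm (v x) <= norm (w x) ==> pmod M p v <= pmod M p w"
 unfolding pmod_def
proof (intro nn_integral_mono_AE, erule AE_mp, intro AE_I2 impI ennreal_leI powr_mono2)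
 fix x assume "x \<in> space M" then show "0 <= p x" using p_lo[of x] lo by simp
qed auto

lemma pmod_finite_iff:
 fixes w :: "'x => 'v::euclidean_space"
 assumes [measurable]: "w \<in> borel_measurable M"
 shows "pmod M p w < \<infinity> \<longleftrightarrow> integrable M (\<lambda>x. norm (w x) powr p x)"
 unfolding pmod_def integrable_iff_bounded by simp

lemma pmod_eq_integral:
 fixes w :: "'x => 'v::euclidean_space"
 assumes "integrable M (\<lambda>x. norm (w x) powr p x)"
 shows "pmod M p w = ennreal (LINT x|M. norm (w x) powr p x)"
 unfolding pmod_def using assms by (intro nn_integral_eq_integral) auto

lemma pmod_add:
 fixes v w :: "'x => 'v::euclidean_space"
 assumes [measurable]: "v \<in> borel_measurable M" "w \<in> borel_measurable M"
 shows "pmod M p (\<lambda>x. v x + w x) <= ennreal (2 powr hi) * (pmod M p v + pmod M p w)"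
proof -
 have "pmod M p (\<lambda>x. v x + w x) <= (\<integral>\<^sup>+x. ennreal (2 powr hi) * (ennreal (norm (v x) powr p x) + ennreal (norm (w x) powr p x)) \<partial>M)"
  unfolding pmod_def
 proof (intro nn_integral_mono)
  fix x assume "x \<in> space M"
  then have "norm (v x + w x) powr p x <= 2 powr hi * (norm (v x) powr p x + norm (w x) powr p x)"
   using p_range[of x] lo by (intro norm_add_powr_le) auto
  then show "ennreal (norm (v x + w x) powr p x) <= ennreal (2 powr hi) * (ennreal (norm (v x) powr p x) + ennreal (norm (w x) powr p x))"
   by (simp add: ennreal_mult[symmetric] ennreal_plus[symmetric] ennreal_leI del: ennreal_plus)
 qed
 also have "... = ennreal (2 powr hi) * (pmod M p v + pmod M p w)"
  unfolding pmod_def by (subst nn_integral_cmult) (auto simp: nn_integral_add)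
 finally show ?thesis .
qed

lemma pmod_uminus: "pmod M p (\<lambda>x. - w x) = pmod M p w"
 by (simp add: pmod_def)

lemma pmod_diff:
 fixes v w :: "'x => 'v::euclidean_space"
 assumes [measurable]: "v \<in> borel_measurable M" "w \<in> borel_measurable M"
 shows "pmod M p (\<lambda>x. v x - w x) <= ennreal (2 powr hi) * (pmod M p v + pmod M p w)"
 using pmod_add[of v "\<lambda>x. - w x"] by (simp add: pmod_uminus)

lemma pmod_scale:
 fixes w :: "'x => 'v::euclidean_space"
 assumes [measurable]: "w \<in> borel_measurable M"
 shows "pmod M p (\<lambda>x. c *\<^sub>R w x) <= ennreal (max (\<bar>c\<bar> powr lo) (\<bar>c\<bar> powr hi)) * pmod M p w"
proof -
 have "pmod M p (\<lambda>x. c *\<^sub>R w x) <= (\<integral>\<^sup>+x. ennreal (max (\<bar>c\<bar> powr lo) (\<bar>c\<bar> powr hi)) * ennreal (norm (w x) powr p x) \<partial>M)"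
  unfolding pmod_def
 proof (intro nn_integral_mono)
  fix x assume x: "x \<in> space M"
  have "\<bar>c\<bar> powr p x <= max (\<bar>c\<bar> powr lo) (\<bar>c\<bar> powr hi)"
  proof (cases "\<bar>c\<bar> <= 1")
   case True then show ?thesis using p_range[OF x] by (auto simp: le_max_iff_disj intro!: disjI1 powr_mono')
  next
   case False then show ?thesis using p_range[OF x] by (auto simp: le_max_iff_disj intro!: disjI2 powr_mono)
  qed
  then have "norm (c *\<^sub>R w x) powr p x <= max (\<bar>c\<bar> powr lo) (\<bar>c\<bar> powr hi) * norm (w x) powr p x"
   by (simp add: powr_mult mult_right_mono)
  then show "ennreal (norm (c *\<^sub>R w x) powr p x) <= ennreal (max (\<bar>c\<bar> powr lo) (\<bar>c\<bar> powr hi)) * ennreal (norm (w x) powr p x)"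
   by (subst ennreal_mult[symmetric]) (auto simp: le_max_iff_disj intro!: ennreal_leI simp del: norm_scaleR)
 qed
 also have "... = ennreal (max (\<bar>c\<bar> powr lo) (\<bar>c\<bar> powr hi)) * pmod M p w"
  unfolding pmod_def by (subst nn_integral_cmult) auto
 finally show ?thesis .
qed

lemma pmod_scale_le:
 fixes w :: "'x => 'v::euclidean_space"
 assumes [measurable]: "w \<in> borel_measurable M" and c: "0 <= c" "c <= 1"
 shows "pmod M p (\<lambda>x. c *\<^sub>R w x) <= ennreal (c powr lo) * pmod M p w"
proof -
 have "c powr hi <= c powr lo" using c lohi by (intro powr_mono') auto
 then show ?thesis using pmod_scale[of w c] c by simp
qed

lemma pmod_Fatou:
 fixes v :: "nat => 'x => 'v::euclidean_space"
 assumes [measurable]: "\<And>k. v k \<in> borel_measurable M" "v' \<in> borel_measurable M"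
  and lim: "AE x in M. (\<lambda>k. v k x) \<longlonglongrightarrow> v' x"
  and le: "eventually (\<lambda>k. pmod M p (v k) <= c) sequentially"
 shows "pmod M p v' <= c"
proof -
 have "pmod M p v' = (\<integral>\<^sup>+x. liminf (\<lambda>k. ennreal (norm (v k x) powr p x)) \<partial>M)"
  unfolding pmod_def
 proof (rule nn_integral_cong_AE)
  show "AE x in M. ennreal (norm (v' x) powr p x) = liminf (\<lambda>k. ennreal (norm (v k x) powr p x))"
   using lim
  proof (rule AE_mp, intro AE_I2 impI)
   fix x assume x: "x \<in> space M" "(\<lambda>k. v k x) \<longlonglongrightarrow> v' x"
   have "(\<lambda>k. ennreal (norm (v k x) powr p x)) \<longlonglongrightarrow> ennreal (norm (v' x) powr p x)"
    using p_lo[OF x(1)] lo by (intro tendsto_ennrealI tendsto_powr' tendsto_norm x tendsto_const) auto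
   then show "ennreal (norm (v' x) powr p x) = liminf (\<lambda>k. ennreal (norm (v k x) powr p x))"
    by (intro lim_imp_Liminf[symmetric]) auto
  qed
 qed
 also have "... <= liminf (\<lambda>k. pmod M p (v k))"
  unfolding pmod_def by (intro nn_integral_liminf) auto
 also have "... <= liminf (\<lambda>k. c)"
  by (rule Liminf_mono) (rule le)
 also have "... = c" by (simp add: Liminf_const)
 finally show ?thesis .
qed

lemma pmod_Cauchy_subseq:
 fixes w :: "nat => 'x => 'v::euclidean_space"
 assumes [measurable]: "\<And>k. w k \<in> borel_measurable M"
  and Cauchy: "\<And>\<epsilon>. 0 < \<epsilon> ==> \<exists>n0. \<forall>m\<ge>n0. \<forall>n\<ge>n0. pmod M p (\<lambda>x. w m x - w n x) <= ennreal \<epsilon>"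
 obtains r w' where "strict_mono (r :: nat => nat)" "w' \<in> borel_measurable M"
  "AE x in M. (\<lambda>k. w (r k) x) \<longlonglongrightarrow> w' x"
proof -
 \<comment> \<open>The tolerance is matched to \<open>le_add_powr\<close> with t = 2^-k: the weight
   there is the \<open>b k\<close> defined below, and \<open>b k * e k\<close> = 2^-k is summable.
   Hence the increments along the subsequence are summable almost everywhere.\<close>
 define e where "e k = (1/2::real)^k * ((1/2)^k) powr hi" for k :: nat
 have e: "e k > 0" for k by (simp add: e_def)
 obtain N where N: "\<And>k m n. m >= N k ==> n >= N k ==> pmod M p (\<lambda>x. w m x - w n x) <= ennreal (e k)"
  using Cauchy[OF e] by metis
 \<comment> \<open>The summand k makes \<open>r\<close> strictly increasing, and the partial sums
   keep \<open>r k\<close> above \<open>N k\<close>.\<close>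
 define r where "r k = k + (\<Sum>i\<le>k. N i)" for k
 have r: "strict_mono r" unfolding strict_mono_Suc_iff by (simp add: r_def)
 have rN: "r k >= N k" for k using member_le_sum[of k "{..k}" N] by (simp add: r_def)
 have rN': "r (Suc k) >= N k" for k using rN[of k] strict_monoD[OF r, of k "Suc k"] by simp
 define d where "d k x = norm (w (r (Suc k)) x - w (r k) x)" for k x
 have [measurable]: "d k \<in> borel_measurable M" for k unfolding d_def by measurable
 define b where "b k = (1 / (1/2)^k) powr hi" for k :: nat
 have b0: "b k >= 0" for k by (simp add: b_def)
 have be: "b k * e k = (1/2)^k" for k
 proof -
  have "(1 / (1/2::real)^k) powr hi * ((1/2)^k) powr hi = (1 / (1/2)^k * (1/2)^k) powr hi"
   by (rule powr_mult[symmetric])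
  then have "(1 / (1/2::real)^k) powr hi * ((1/2)^k * ((1/2)^k) powr hi) = (1/2)^k" by simp
  then show ?thesis unfolding b_def e_def .
 qed
 have "(\<integral>\<^sup>+x. (\<Sum>k. ennreal (b k * d k x powr p x)) \<partial>M) = (\<Sum>k. (\<integral>\<^sup>+x. ennreal (b k * d k x powr p x) \<partial>M))"
  by (intro nn_integral_suminf) auto
 also have "... <= (\<Sum>k. ennreal ((1/2)^k))"
 proof (intro suminf_le)
  fix k
  have "(\<integral>\<^sup>+x. ennreal (b k * d k x powr p x) \<partial>M) = ennreal (b k) * pmod M p (\<lambda>x. w (r (Suc k)) x - w (r k) x)"
   unfolding pmod_def d_def by (subst nn_integral_cmult[symmetric]) (auto simp: ennreal_mult b_def)
  also have "... <= ennreal (b k) * ennreal (e k)" by (intro mult_left_mono N rN rN') auto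
  also have "... = ennreal ((1/2)^k)" using e[of k] b0[of k] by (simp add: ennreal_mult[symmetric] be less_imp_le)
  finally show "(\<integral>\<^sup>+x. ennreal (b k * d k x powr p x) \<partial>M) <= ennreal ((1/2)^k)" .
 qed auto
 also have "... < \<infinity>"
  by (subst suminf_ennreal2) (auto intro!: summable_geometric)
 finally have "AE x in M. (\<Sum>k. ennreal (b k * d k x powr p x)) \<noteq> \<infinity>"
  by (intro nn_integral_PInf_AE) auto
 then have conv: "AE x in M. convergent (\<lambda>k. w (r k) x)"
 proof (rule AE_mp, intro AE_I2 impI)
  fix x assume x: "x \<in> space M" "(\<Sum>k. ennreal (b k * d k x powr p x)) \<noteq> \<infinity>"
  have "summable (\<lambda>k. b k * d k x powr p x)"
   using x(2) by (intro summable_suminf_not_top) (auto simp: b_def)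
  then have "summable (\<lambda>k. (1/2)^k + b k * d k x powr p x)"
   by (intro summable_add summable_geometric) auto
  then have "summable (\<lambda>k. d k x)"
  proof (rule summable_comparison_test[rotated], intro exI[of _ 0] allI impI)
   fix k
   have "d k x <= (1/2)^k + (1 / (1/2)^k) powr hi * d k x powr p x"
    using p_range[OF x(1)] lo by (intro le_add_powr) (auto simp: d_def power_le_one)
   then show "norm (d k x) <= (1/2)^k + b k * d k x powr p x" by (simp add: b_def d_def)
  qed
  then have "summable (\<lambda>k. w (r (Suc k)) x - w (r k) x)"
   unfolding d_def by (rule summable_norm_cancel)
  then have "convergent (\<lambda>n. \<Sum>k<n. w (r (Suc k)) x - w (r k) x)" by (simp add: summable_iff_convergent)
  then have "convergent (\<lambda>n. w (r n) x - w (r 0) x)" by (simp only: sum_lessThan_telescope[of "\<lambda>n. w (r n) x"])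
  then have "convergent (\<lambda>n. (w (r n) x - w (r 0) x) + w (r 0) x)" by (intro convergent_add convergent_const)
  then show "convergent (\<lambda>n. w (r n) x)" by simp
 qed
 show thesis
 proof (rule that[OF r])
  show "(\<lambda>x. lim (\<lambda>k. w (r k) x)) \<in> borel_measurable M" by measurable
  show "AE x in M. (\<lambda>k. w (r k) x) \<longlonglongrightarrow> lim (\<lambda>k. w (r k) x)"
   using conv by (simp add: convergent_LIMSEQ_iff)
 qed
qed

text \<open>Fatou in k for \<open>w n - w (r k)\<close> turns the Cauchy estimate into one for
  \<open>w n - w'\<close>. The limit function is given rather than constructed, so that one function
  can serve as limit for two exponents.\<close>

lemma pmod_tendsto_of_AE_subseq:
 fixes w :: "nat => 'x => 'v::euclidean_space"
 assumes [measurable]: "\<And>k. w k \<in> borel_measurable M" "w' \<in> borel_measurable M"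
  and Cauchy: "\<And>\<epsilon>. 0 < \<epsilon> ==> \<exists>n0. \<forall>m\<ge>n0. \<forall>n\<ge>n0. pmod M p (\<lambda>x. w m x - w n x) <= ennreal \<epsilon>"
  and r: "strict_mono r" and lim: "AE x in M. (\<lambda>k. w (r k) x) \<longlonglongrightarrow> w' x"
 shows "(\<lambda>n. pmod M p (\<lambda>x. w n x - w' x)) \<longlonglongrightarrow> 0"
proof (rule tendsto_zero_ennreal)
 fix c :: real assume c: "0 < c"
 define \<epsilon> where "\<epsilon> = c/2"
 have \<epsilon>: "0 < \<epsilon>" "ennreal \<epsilon> < ennreal c" using c by (auto simp: \<epsilon>_def ennreal_less_iff)
 obtain n0 where n0: "\<And>m n. m >= n0 ==> n >= n0 ==> pmod M p (\<lambda>x. w m x - w n x) <= ennreal \<epsilon>"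
  using Cauchy[OF \<epsilon>(1)] by blast
 have "pmod M p (\<lambda>x. w n x - w' x) <= ennreal \<epsilon>" if "n >= n0" for n
 proof (rule pmod_Fatou)
  show "AE x in M. (\<lambda>k. w n x - w (r k) x) \<longlonglongrightarrow> w n x - w' x"
   using lim by eventually_elim (intro tendsto_intros)
  show "\<forall>\<^sub>F k in sequentially. pmod M p (\<lambda>x. w n x - w (r k) x) <= ennreal \<epsilon>"
   using eventually_ge_at_top[of n0] by eventually_elim (intro n0 that, rule le_trans, assumption, rule seq_suble[OF r])
 qed measurable
 then show "\<forall>\<^sub>F n in sequentially. pmod M p (\<lambda>x. w n x - w' x) < ennreal c"
  using \<epsilon>(2) unfolding eventually_sequentially by (intro exI[of _ n0] allI impI) (rule le_less_trans)
qed

lemma pmod_complete: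
 fixes w :: "nat => 'x => 'v::euclidean_space"
 assumes [measurable]: "\<And>k. w k \<in> borel_measurable M"
  and Cauchy: "\<And>\<epsilon>. 0 < \<epsilon> ==> \<exists>n0. \<forall>m\<ge>n0. \<forall>n\<ge>n0. pmod M p (\<lambda>x. w m x - w n x) <= ennreal \<epsilon>"
 obtains r w' where "strict_mono (r :: nat => nat)" "w' \<in> borel_measurable M"
  "AE x in M. (\<lambda>k. w (r k) x) \<longlonglongrightarrow> w' x" "(\<lambda>n. pmod M p (\<lambda>x. w n x - w' x)) \<longlonglongrightarrow> 0"
proof -
 obtain r w' where r: "strict_mono (r :: nat => nat)" "w' \<in> borel_measurable M"
  "AE x in M. (\<lambda>k. w (r k) x) \<longlonglongrightarrow> w' x"
  using pmod_Cauchy_subseq[OF assms] by blast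
 with pmod_tendsto_of_AE_subseq[OF assms(1) r(2) Cauchy r(1,3)] show thesis using that by blast
qed

lemma pmod_Cauchy_of_tendsto:
 fixes w :: "nat => 'x => 'v::euclidean_space"
 assumes [measurable]: "\<And>k. w k \<in> borel_measurable M" "w' \<in> borel_measurable M"
  and lim: "(\<lambda>n. pmod M p (\<lambda>x. w n x - w' x)) \<longlonglongrightarrow> 0" and \<epsilon>: "0 < \<epsilon>"
 shows "\<exists>n0. \<forall>m\<ge>n0. \<forall>n\<ge>n0. pmod M p (\<lambda>x. w m x - w n x) <= ennreal \<epsilon>"
proof -
 define e where "e = \<epsilon> / 2 powr hi / 2"
 have e: "e > 0" "2 powr hi * (e + e) = \<epsilon>" using \<epsilon> by (auto simp: e_def)
 obtain n0 where n0: "\<And>n. n >= n0 ==> pmod M p (\<lambda>x. w n x - w' x) < ennreal e"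
  using order_tendstoD(2)[OF lim, of "ennreal e"] e by (auto simp: eventually_sequentially)
 have "pmod M p (\<lambda>x. w m x - w n x) <= ennreal \<epsilon>" if "m >= n0" "n >= n0" for m n
 proof -
  have "pmod M p (\<lambda>x. w m x - w n x) = pmod M p (\<lambda>x. (w m x - w' x) - (w n x - w' x))" by simp
  also have "... <= ennreal (2 powr hi) * (pmod M p (\<lambda>x. w m x - w' x) + pmod M p (\<lambda>x. w n x - w' x))"
   by (rule pmod_diff) auto
  also have "... <= ennreal (2 powr hi) * (ennreal e + ennreal e)"
   using n0 that by (intro mult_left_mono add_mono) (auto intro: less_imp_le)
  also have "... = ennreal \<epsilon>" using e by (simp add: ennreal_mult[symmetric] ennreal_plus[symmetric] del: ennreal_plus)
  finally show ?thesis .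
 qed
 then show ?thesis by blast
qed

lemma pmod_zero_AE:
 fixes w :: "'x => 'v::euclidean_space"
 assumes [measurable]: "w \<in> borel_measurable M" and "pmod M p w = 0"
 shows "AE x in M. w x = 0"
proof -
 have "AE x in M. ennreal (norm (w x) powr p x) = 0"
  using assms(2) unfolding pmod_def by (subst (asm) nn_integral_0_iff_AE) auto
 then show ?thesis by eventually_elim (auto simp: powr_eq_0_iff)
qed

text \<open>The subsequence extracted from the Cauchy property converges to some v; Fatou applied to
  \<open>w (r k) - w'\<close> shows that v and w' agree almost everywhere.\<close>

lemma pmod_tendsto_AE_subseq:
 fixes w :: "nat => 'x => 'v::euclidean_space"
 assumes [measurable]: "\<And>k. w k \<in> borel_measurable M" "w' \<in> borel_measurable M"
  and lim: "(\<lambda>n. pmod M p (\<lambda>x. w n x - w' x)) \<longlonglongrightarrow> 0"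
 obtains r where "strict_mono (r :: nat => nat)" "AE x in M. (\<lambda>k. w (r k) x) \<longlonglongrightarrow> w' x"
proof -
 obtain r v where r: "strict_mono (r :: nat => nat)" and [measurable]: "v \<in> borel_measurable M"
  and v: "AE x in M. (\<lambda>k. w (r k) x) \<longlonglongrightarrow> v x"
  using pmod_Cauchy_subseq[OF assms(1) pmod_Cauchy_of_tendsto[OF assms]] by blast
 have "pmod M p (\<lambda>x. v x - w' x) <= ennreal e" if e: "0 < e" for e
 proof (rule pmod_Fatou)
  show "AE x in M. (\<lambda>k. w (r k) x - w' x) \<longlonglongrightarrow> v x - w' x"
   using v by eventually_elim (intro tendsto_intros)
  have "(\<lambda>k. pmod M p (\<lambda>x. w (r k) x - w' x)) \<longlonglongrightarrow> 0"
   using LIMSEQ_subseq_LIMSEQ[OF lim r] by (simp add: comp_def)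
  from order_tendstoD(2)[OF this, of "ennreal e"] e
  show "\<forall>\<^sub>F k in sequentially. pmod M p (\<lambda>x. w (r k) x - w' x) <= ennreal e"
   by (auto elim!: eventually_mono)
 qed measurable
 from ennreal_le_epsilon[of 0, simplified, OF this] have "pmod M p (\<lambda>x. v x - w' x) = 0" by blast
 then have "AE x in M. v x - w' x = 0" by (intro pmod_zero_AE) auto
 with v have "AE x in M. (\<lambda>k. w (r k) x) \<longlonglongrightarrow> w' x" by eventually_elim simp
 with r that show thesis by blast
qed

text \<open>The growth bound only controls \<open>f(x,u\<^sub>n)\<close> by an integrable function plus a term tending to \<open>0\<close>
 in mean, so dominated convergence is applied to the minimum with the integrable part.\<close>

lemma Nemytskii_tendsto:
 fixes f :: "'x => real => real" and u :: "nat => 'x => real" and v :: "nat => 'x => real"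
 assumes f_meas: "case_prod f \<in> borel_measurable (M \<Otimes>\<^sub>M borel)"
  and f_cont: "\<And>x. x \<in> space M ==> continuous_on UNIV (f x)"
  and f_growth: "\<And>x t. x \<in> space M ==> \<bar>f x t\<bar> <= C * (1 + \<bar>t\<bar> powr (p x - 1))" and C: "1 <= C"
  and u [measurable]: "\<And>n. u n \<in> borel_measurable M" "u' \<in> borel_measurable M" and v [measurable]: "\<And>n. v n \<in> borel_measurable M"
  and u'_fin: "pmod M p u' < \<infinity>" and u_lim: "(\<lambda>n. pmod M p (\<lambda>x. u n x - u' x)) \<longlonglongrightarrow> 0"
  and AE_lim: "AE x in M. (\<lambda>n. u n x) \<longlonglongrightarrow> u' x"
  and v_bdd: "\<And>n. pmod M p (v n) <= ennreal B" and B: "0 <= B"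
 shows "(\<lambda>n. \<integral>\<^sup>+x. ennreal (\<bar>f x (u n x) - f x (u' x)\<bar> * \<bar>v n x\<bar>) \<partial>M) \<longlonglongrightarrow> 0"
proof -
 define q where "q x = p x / (p x - 1)" for x
 define Q where "Q = lo / (lo - 1)"
 have q: "1 < q x" "q x <= Q" "(p x - 1) * q x = p x" if "x \<in> space M" for x
  using p_range[OF that] lo by (auto simp: q_def Q_def field_simps)
 have [measurable]: "q \<in> borel_measurable M" unfolding q_def by measurable
 have [measurable]: "(\<lambda>x. f x (g x)) \<in> borel_measurable M" if [measurable]: "g \<in> borel_measurable M" for g
  using measurable_compose[OF measurable_Pair[OF measurable_ident_sets[OF refl] that] f_meas] by simp
 define X where "X n x = \<bar>f x (u n x) - f x (u' x)\<bar> powr q x" for n x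
 define D where "D = (4 * C) powr Q * 4 powr Q * (2 powr hi + 1)"
 have D: "D >= 0" by (simp add: D_def)
 define G where "G x = D * (1 + \<bar>u' x\<bar> powr p x)" for x
 define Y where "Y n x = D * \<bar>u n x - u' x\<bar> powr p x" for n x
 have [measurable]: "X n \<in> borel_measurable M" "G \<in> borel_measurable M" "Y n \<in> borel_measurable M" for n
  unfolding X_def G_def Y_def by measurable
 \<comment> \<open>Because (p-1) q = p, the conjugate power of the growth bound is a p-th power. The
   part |u n|^p is split into |u'|^p, which goes into the fixed integrable majorant
   \<open>G\<close>, and |u n - u'|^p, which goes into \<open>Y\<close> and tends to 0 in
   mean.\<close>
 have XGY: "X n x <= G x + Y n x" if x: "x \<in> space M" for n x
 proof -
  define s t where "s = u n x" and "t = u' x"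
  have "\<bar>f x s - f x t\<bar> <= C * (1 + \<bar>s\<bar> powr (p x - 1)) + C * (1 + \<bar>t\<bar> powr (p x - 1))"
   using f_growth[OF x, of s] f_growth[OF x, of t] by linarith
  also have "... <= C * (1 + max \<bar>s\<bar> \<bar>t\<bar> powr (p x - 1)) + C * (1 + max \<bar>s\<bar> \<bar>t\<bar> powr (p x - 1))"
   using C p_range[OF x] lo by (intro add_mono mult_left_mono powr_mono2) auto
  also have "... <= (4 * C) * (max 1 (max \<bar>s\<bar> \<bar>t\<bar>) powr (p x - 1))"
  proof -
   have "1 <= max 1 (max \<bar>s\<bar> \<bar>t\<bar>) powr (p x - 1)" "max \<bar>s\<bar> \<bar>t\<bar> powr (p x - 1) <= max 1 (max \<bar>s\<bar> \<bar>t\<bar>) powr (p x - 1)"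
    using p_range[OF x] lo by (auto intro!: ge_one_powr_ge_zero powr_mono2)
   then have "1 + max \<bar>s\<bar> \<bar>t\<bar> powr (p x - 1) <= 2 * max 1 (max \<bar>s\<bar> \<bar>t\<bar>) powr (p x - 1)" by linarith
   from mult_left_mono[OF this, of C] show ?thesis using C by simp
  qed
  finally have "X n x <= ((4 * C) * (max 1 (max \<bar>s\<bar> \<bar>t\<bar>) powr (p x - 1))) powr q x"
   unfolding X_def s_def t_def using q[OF x] by (intro powr_mono2) auto
  also have "... = (4 * C) powr q x * max 1 (max \<bar>s\<bar> \<bar>t\<bar>) powr p x"
   using C q(3)[OF x] by (simp add: powr_mult powr_powr)
  also have "... <= (4 * C) powr Q * (1 + \<bar>s\<bar> powr p x + \<bar>t\<bar> powr p x)"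
  proof (intro mult_mono)
   show "(4 * C) powr q x <= (4 * C) powr Q" using C q[OF x] by (intro powr_mono) auto
   show "max 1 (max \<bar>s\<bar> \<bar>t\<bar>) powr p x <= 1 + \<bar>s\<bar> powr p x + \<bar>t\<bar> powr p x"
    by (auto simp: max_def)
  qed auto
  also have "... <= (4 * C) powr Q * ((2 powr hi + 1) * (1 + \<bar>t\<bar> powr p x) + (2 powr hi + 1) * \<bar>s - t\<bar> powr p x)"
  proof (intro mult_left_mono)
   have "\<bar>s\<bar> powr p x <= 2 powr hi * \<bar>s - t\<bar> powr p x + 2 powr hi * \<bar>t\<bar> powr p x"
    using norm_add_powr_le[of "p x" hi "s - t" t] p_range[OF x] lo by (simp add: distrib_left)
   moreover have "0 <= \<bar>s - t\<bar> powr p x" "0 <= \<bar>t\<bar> powr p x" "(0::real) <= 2 powr hi" by auto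
   ultimately show "1 + \<bar>s\<bar> powr p x + \<bar>t\<bar> powr p x <= (2 powr hi + 1) * (1 + \<bar>t\<bar> powr p x) + (2 powr hi + 1) * \<bar>s - t\<bar> powr p x"
    by (simp only: distrib_right distrib_left mult_1_left mult_1_right)
  qed auto
  also have "... <= 4 powr Q * ((4 * C) powr Q * ((2 powr hi + 1) * (1 + \<bar>t\<bar> powr p x) + (2 powr hi + 1) * \<bar>s - t\<bar> powr p x))"
  proof -
   have "1 <= 4 powr Q" using lo by (intro ge_one_powr_ge_zero) (auto simp: Q_def)
   moreover have "0 <= (4 * C) powr Q * ((2 powr hi + 1) * (1 + \<bar>t\<bar> powr p x) + (2 powr hi + 1) * \<bar>s - t\<bar> powr p x)"
    by (intro mult_nonneg_nonneg add_nonneg_nonneg) auto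
   ultimately show ?thesis using mult_right_mono[of 1 "4 powr Q"] by (simp only: mult_1)
  qed
  also have "... = G x + Y n x"
  proof -
   have "q * (c * (k * (1 + b) + k * a)) = (c * q * k) * (1 + b) + (c * q * k) * a" for q c k a b :: real
    by (simp add: algebra_simps)
   then show ?thesis unfolding G_def Y_def D_def s_def t_def .
  qed
  finally show ?thesis .
 qed
 have X0: "X n x >= 0" for n x by (simp add: X_def)
 have G0: "G x >= 0" and Y0: "Y n x >= 0" for n x using D by (auto simp: G_def Y_def)
 have G_fin: "(\<integral>\<^sup>+x. ennreal (G x) \<partial>M) < \<infinity>"
 proof -
  have "(\<integral>\<^sup>+x. ennreal (G x) \<partial>M) = (\<integral>\<^sup>+x. ennreal D + ennreal D * ennreal (norm (u' x) powr p x) \<partial>M)"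
   unfolding G_def using D by (intro nn_integral_cong) (simp add: distrib_left ennreal_mult)
  also have "... = ennreal D * emeasure M (space M) + ennreal D * pmod M p u'"
   unfolding pmod_def by (simp add: nn_integral_add nn_integral_cmult)
  finally have "(\<integral>\<^sup>+x. ennreal (G x) \<partial>M) = ennreal D * emeasure M (space M) + ennreal D * pmod M p u'" .
  then show ?thesis using u'_fin by (auto simp: ennreal_mult_eq_top_iff emeasure_eq_measure less_top[symmetric])
 qed
 have lim1: "(\<lambda>n. \<integral>\<^sup>+x. ennreal (min (X n x) (G x)) \<partial>M) \<longlonglongrightarrow> (\<integral>\<^sup>+x. 0 \<partial>M)"
 proof (rule nn_integral_dominated_convergence[where w="\<lambda>x. ennreal (G x)"])
  show "AE x in M. (\<lambda>n. ennreal (min (X n x) (G x))) \<longlonglongrightarrow> 0"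
   using AE_lim
  proof (rule AE_mp, intro AE_I2 impI)
   fix x assume x: "x \<in> space M" "(\<lambda>n. u n x) \<longlonglongrightarrow> u' x"
   have "(\<lambda>n. f x (u n x)) \<longlonglongrightarrow> f x (u' x)"
    using continuous_on_tendsto_compose[OF f_cont[OF x(1)] x(2)] by simp
   then have "(\<lambda>n. \<bar>f x (u n x) - f x (u' x)\<bar> powr q x) \<longlonglongrightarrow> \<bar>f x (u' x) - f x (u' x)\<bar> powr q x"
    using q(1)[OF x(1)] by (intro tendsto_powr' tendsto_intros) auto
   then have "(\<lambda>n. X n x) \<longlonglongrightarrow> 0" by (simp add: X_def)
   then have "(\<lambda>n. min (X n x) (G x)) \<longlonglongrightarrow> min 0 (G x)" by (intro tendsto_intros)
   then have "(\<lambda>n. ennreal (min (X n x) (G x))) \<longlonglongrightarrow> ennreal (min 0 (G x))" by (rule tendsto_ennrealI)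
   then show "(\<lambda>n. ennreal (min (X n x) (G x))) \<longlonglongrightarrow> 0" using G0[of x] by simp
  qed
 qed (use G_fin in \<open>auto simp: ennreal_leI\<close>)
 have lim2: "(\<lambda>n. \<integral>\<^sup>+x. ennreal (Y n x) \<partial>M) \<longlonglongrightarrow> 0"
 proof -
  have "(\<lambda>n. ennreal D * pmod M p (\<lambda>x. u n x - u' x)) \<longlonglongrightarrow> ennreal D * 0"
   using u_lim by (intro ennreal_tendsto_cmult) auto
  moreover have "(\<integral>\<^sup>+x. ennreal (Y n x) \<partial>M) = ennreal D * pmod M p (\<lambda>x. u n x - u' x)" for n
   unfolding Y_def pmod_def using D by (subst nn_integral_cmult[symmetric]) (auto simp: ennreal_mult)
  ultimately show ?thesis by simp
 qed
 have limX: "(\<lambda>n. \<integral>\<^sup>+x. ennreal (X n x) \<partial>M) \<longlonglongrightarrow> 0"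
 proof (rule tendsto_sandwich[OF _ _ tendsto_const])
  show "(\<lambda>n. (\<integral>\<^sup>+x. ennreal (min (X n x) (G x)) \<partial>M) + (\<integral>\<^sup>+x. ennreal (Y n x) \<partial>M)) \<longlonglongrightarrow> 0"
   using tendsto_add[OF lim1 lim2] by simp
  show "\<forall>\<^sub>F n in sequentially. (\<integral>\<^sup>+x. ennreal (X n x) \<partial>M) <= (\<integral>\<^sup>+x. ennreal (min (X n x) (G x)) \<partial>M) + (\<integral>\<^sup>+x. ennreal (Y n x) \<partial>M)"
  proof (intro always_eventually allI)
   fix n
   have "(\<integral>\<^sup>+x. ennreal (X n x) \<partial>M) <= (\<integral>\<^sup>+x. ennreal (min (X n x) (G x)) + ennreal (Y n x) \<partial>M)"
   proof (intro nn_integral_mono)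
    fix x assume "x \<in> space M"
    then have "X n x <= min (X n x) (G x) + Y n x" using XGY[of x n] Y0[of n x] by auto
    then show "ennreal (X n x) <= ennreal (min (X n x) (G x)) + ennreal (Y n x)"
     using X0 G0 Y0 by (simp add: ennreal_plus[symmetric] ennreal_leI del: ennreal_plus)
   qed
   then show "(\<integral>\<^sup>+x. ennreal (X n x) \<partial>M) <= (\<integral>\<^sup>+x. ennreal (min (X n x) (G x)) \<partial>M) + (\<integral>\<^sup>+x. ennreal (Y n x) \<partial>M)"
    by (simp add: nn_integral_add)
  qed
 qed auto
 show ?thesis
 proof (rule tendsto_zero_ennreal)
  fix e :: real assume e: "0 < e"
  \<comment> \<open>Young's inequality splits the product into \<epsilon> times the modular of
    \<open>v n\<close>, kept below e/2 by the bound B, and a fixed multiple of the integral of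
    \<open>X n\<close>, which tends to 0.\<close>
  define \<epsilon> where "\<epsilon> = min 1 (e / (2 * (B + 1)))"
  have \<epsilon>: "0 < \<epsilon>" "\<epsilon> <= 1" using e B by (auto simp: \<epsilon>_def)
  have "\<epsilon> * (2 * (B + 1)) <= e" using B by (subst pos_le_divide_eq[symmetric]) (auto simp: \<epsilon>_def)
  then have \<epsilon>B: "\<epsilon> * B < e/2" using \<epsilon> by (simp add: algebra_simps)
  define K where "K = (1/\<epsilon>) powr Q"
  have "(\<lambda>n. ennreal K * (\<integral>\<^sup>+x. ennreal (X n x) \<partial>M)) \<longlonglongrightarrow> ennreal K * 0"
   using limX by (intro ennreal_tendsto_cmult) auto
  from order_tendstoD(2)[OF this, of "ennreal (e/2)"] e
  have "\<forall>\<^sub>F n in sequentially. ennreal K * (\<integral>\<^sup>+x. ennreal (X n x) \<partial>M) < ennreal (e/2)" by simp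
  then show "\<forall>\<^sub>F n in sequentially. (\<integral>\<^sup>+x. ennreal (\<bar>f x (u n x) - f x (u' x)\<bar> * \<bar>v n x\<bar>) \<partial>M) < ennreal e"
  proof eventually_elim
   case (elim n)
   have "(\<integral>\<^sup>+x. ennreal (\<bar>f x (u n x) - f x (u' x)\<bar> * \<bar>v n x\<bar>) \<partial>M) \<le>
    (\<integral>\<^sup>+x. ennreal \<epsilon> * ennreal (norm (v n x) powr p x) + ennreal K * ennreal (X n x) \<partial>M)"
   proof (intro nn_integral_mono)
    fix x assume "x \<in> space M"
    then have "\<bar>f x (u n x) - f x (u' x)\<bar> * \<bar>v n x\<bar> <= \<epsilon> * \<bar>v n x\<bar> powr p x + K * X n x"
     unfolding K_def Q_def X_def q_def using p_lo \<epsilon> by (intro Youngs_epsilon[OF lo]) auto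
    then show "ennreal (\<bar>f x (u n x) - f x (u' x)\<bar> * \<bar>v n x\<bar>) <= ennreal \<epsilon> * ennreal (norm (v n x) powr p x) + ennreal K * ennreal (X n x)"
     using \<epsilon> X0[of n x] by (simp add: ennreal_mult[symmetric] ennreal_plus[symmetric] K_def ennreal_leI del: ennreal_plus)
   qed
   also have "... = ennreal \<epsilon> * pmod M p (v n) + ennreal K * (\<integral>\<^sup>+x. ennreal (X n x) \<partial>M)"
    by (simp add: nn_integral_add nn_integral_cmult pmod_def)
   also have "... <= ennreal \<epsilon> * ennreal B + ennreal K * (\<integral>\<^sup>+x. ennreal (X n x) \<partial>M)"
    by (intro add_right_mono mult_left_mono v_bdd) auto
   also have "... < ennreal (e/2) + ennreal (e/2)"
    using elim \<epsilon>B \<epsilon> B by (intro add_strict_mono) (auto simp: ennreal_mult[symmetric] ennreal_less_iff)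
   also have "... = ennreal e" using e by (simp add: ennreal_plus[symmetric] del: ennreal_plus)
   finally show ?case .
  qed
 qed
qed

end

section \<open>Caratheodory functions and differentiation under the integral\<close>

lemma caratheodory_joint_measurable:
 fixes f :: "'x => real => real"
 assumes [measurable]: "\<And>t. (\<lambda>x. f x t) \<in> borel_measurable M"
  and cont: "\<And>x. x \<in> space M ==> continuous_on UNIV (f x)"
 shows "case_prod f \<in> borel_measurable (M \<Otimes>\<^sub>M borel)"
proof (rule borel_measurable_LIMSEQ_metric)
 \<comment> \<open>Rounding t down to a multiple of 1/(n+1) leaves countably many sections, each
   measurable by assumption; continuity in t gives the limit.\<close>
 define F where "F n z = f (fst z) (real_of_int \<lfloor>real (Suc n) * snd z\<rfloor> / real (Suc n))" for n and z :: "'x \<times> real"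
 show "F n \<in> borel_measurable (M \<Otimes>\<^sub>M borel)" for n
  unfolding F_def
  by (rule measurable_compose_countable[where f="\<lambda>i z. f (fst z) (real_of_int i / real (Suc n))" and g="\<lambda>z. \<lfloor>real (Suc n) * snd z\<rfloor>"]) measurable
 show "(\<lambda>n. F n z) \<longlonglongrightarrow> case_prod f z" if z: "z \<in> space (M \<Otimes>\<^sub>M borel)" for z
 proof -
  have "(\<lambda>n. real_of_int \<lfloor>real (Suc n) * snd z\<rfloor> / real (Suc n)) \<longlonglongrightarrow> snd z"
  proof (rule tendsto_sandwich)
   show "(\<lambda>n. snd z - inverse (real (Suc n))) \<longlonglongrightarrow> snd z"
    using tendsto_diff[OF tendsto_const LIMSEQ_inverse_real_of_nat, of "snd z"] by simp
   show "\<forall>\<^sub>F n in sequentially. snd z - inverse (real (Suc n)) <= real_of_int \<lfloor>real (Suc n) * snd z\<rfloor> / real (Suc n)"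
   proof (intro always_eventually allI)
    fix n
    have "real (Suc n) * snd z - 1 <= real_of_int \<lfloor>real (Suc n) * snd z\<rfloor>" by linarith
    then have "(real (Suc n) * snd z - 1) / real (Suc n) <= real_of_int \<lfloor>real (Suc n) * snd z\<rfloor> / real (Suc n)"
     by (intro divide_right_mono) auto
    then show "snd z - inverse (real (Suc n)) <= real_of_int \<lfloor>real (Suc n) * snd z\<rfloor> / real (Suc n)"
     by (simp add: diff_divide_distrib inverse_eq_divide)
   qed
   show "\<forall>\<^sub>F n in sequentially. real_of_int \<lfloor>real (Suc n) * snd z\<rfloor> / real (Suc n) <= snd z"
    by (intro always_eventually allI) (simp add: pos_divide_le_eq mult.commute del: of_nat_Suc)
  qed simp
  moreover have "fst z \<in> space M" using z by (auto simp: space_pair_measure)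
  ultimately show ?thesis
   using continuous_on_tendsto_compose[OF cont[of "fst z"]] by (auto simp: F_def case_prod_beta)
 qed
qed

text \<open>The mean value theorem bounds the difference quotients by the majorant of the
  derivative, and dominated convergence is applied along an arbitrary sequence of
  increments.\<close>

lemma DERIV_integral:
 fixes H H' :: "'x => real => real"
 assumes int: "\<And>s. integrable M (\<lambda>x. H x s)" and meas: "(\<lambda>x. H' x s0) \<in> borel_measurable M"
  and der: "\<And>x s. x \<in> space M ==> ((\<lambda>s. H x s) has_real_derivative H' x s) (at s)"
  and bound: "\<And>x s. x \<in> space M ==> \<bar>s - s0\<bar> <= 1 ==> \<bar>H' x s\<bar> <= G x" and G: "integrable M G"
 shows "((\<lambda>s. LINT x|M. H x s) has_real_derivative (LINT x|M. H' x s0)) (at s0)"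
 unfolding DERIV_def tendsto_at_iff_sequentially
proof (intro allI impI)
 fix X :: "nat => real" assume X: "\<forall>i. X i \<in> UNIV - {0}" "X \<longlonglongrightarrow> 0"
 \<comment> \<open>Increments longer than 1 are replaced by 1, since the majorant is available only
   within distance 1 of s0; eventually nothing changes.\<close>
 define Y where "Y i = (if \<bar>X i\<bar> <= 1 then X i else 1)" for i
 have Y: "Y i \<noteq> 0" "\<bar>Y i\<bar> <= 1" for i using X(1) by (auto simp: Y_def)
 have "\<forall>\<^sub>F i in sequentially. \<bar>X i\<bar> < 1" using order_tendstoD(2)[OF tendsto_rabs[OF X(2)], of 1] by simp
 then have ev: "\<forall>\<^sub>F i in sequentially. Y i = X i" by eventually_elim (simp add: Y_def)
 have Y0: "Y \<longlonglongrightarrow> 0" by (rule Lim_transform_eventually[OF X(2)]) (use ev in \<open>auto elim: eventually_mono\<close>)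
 have "(\<lambda>i. LINT x|M. (H x (s0 + Y i) - H x s0) / Y i) \<longlonglongrightarrow> (LINT x|M. H' x s0)"
 proof (rule integral_dominated_convergence[OF meas _ G])
  show "(\<lambda>x. (H x (s0 + Y i) - H x s0) / Y i) \<in> borel_measurable M" for i
   using int by (intro borel_measurable_divide borel_measurable_diff borel_measurable_const) auto
  show "AE x in M. (\<lambda>i. (H x (s0 + Y i) - H x s0) / Y i) \<longlonglongrightarrow> H' x s0"
  proof (intro AE_I2)
   fix x assume "x \<in> space M"
   from der[OF this, of s0, unfolded DERIV_def tendsto_at_iff_sequentially] Y Y0
   show "(\<lambda>i. (H x (s0 + Y i) - H x s0) / Y i) \<longlonglongrightarrow> H' x s0" by (auto simp: comp_def)
  qed
  show "AE x in M. norm ((H x (s0 + Y i) - H x s0) / Y i) <= G x" for i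
  proof (intro AE_I2)
   fix x assume x: "x \<in> space M"
   have "((\<lambda>t. H x (s0 + t * Y i)) has_real_derivative H' x (s0 + t * Y i) * Y i) (at t)" for t
    by (rule DERIV_chain2[OF der[OF x]]) (auto intro!: derivative_eq_intros)
   then obtain t where t: "0 < t" "t < 1" "H x (s0 + 1 * Y i) - H x (s0 + 0 * Y i) = (1 - 0) * (H' x (s0 + t * Y i) * Y i)"
    using MVT2[of 0 1 "\<lambda>t. H x (s0 + t * Y i)" "\<lambda>t. H' x (s0 + t * Y i) * Y i"] by auto
   have "\<bar>t * Y i\<bar> <= 1" using t Y(2)[of i] by (auto simp: abs_mult intro: mult_le_one)
   then have "\<bar>H' x (s0 + t * Y i)\<bar> <= G x" by (intro bound x) auto
   then show "norm ((H x (s0 + Y i) - H x s0) / Y i) <= G x" using t Y(1)[of i] by simp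
  qed
 qed
 moreover have "\<forall>\<^sub>F i in sequentially. (LINT x|M. (H x (s0 + Y i) - H x s0) / Y i)
  = ((\<lambda>h. ((LINT x|M. H x (s0 + h)) - (LINT x|M. H x s0)) / h) \<circ> X) i"
  using ev by eventually_elim (simp add: int)
 ultimately show "((\<lambda>h. ((LINT x|M. H x (s0 + h)) - (LINT x|M. H x s0)) / h) \<circ> X) \<longlonglongrightarrow> (LINT x|M. H' x s0)"
  by (rule Lim_transform_eventually)
qed

subsection \<open>Test functions and weak gradients\<close>

lemma Ck_differentiable: "Ck (Suc k) f ==> f differentiable (at x)"
 by simp

lemma Ck_Suc_imp: "Ck (Suc k) f ==> Ck k f"
proof (induction k arbitrary: f)
 case 0
 then have "f differentiable (at x)" for x by simp
 then show ?case by (auto intro!: continuous_at_imp_continuous_on differentiable_imp_continuous_within)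
next
 case (Suc k)
 then show ?case by (auto simp del: Ck.simps(2) simp: Ck.simps(2)[of "Suc k"] Ck.simps(2)[of k f])
qed

lemma Ck_const: "Ck k (\<lambda>_. c)"
 by (induction k arbitrary: c) auto

lemma frechet_derivative_eq: "(f has_derivative f') (at x) ==> frechet_derivative f (at x) = f'"
 using frechet_derivative_at by metis

lemma Ck_add: "Ck k f ==> Ck k g ==> Ck k (\<lambda>x. f x + g x)"
proof (induction k arbitrary: f g)
 case 0 then show ?case by (auto intro: continuous_intros)
next
 case (Suc k)
 have "frechet_derivative (\<lambda>x. f x + g x) (at x) i = frechet_derivative f (at x) i + frechet_derivative g (at x) i" for x i
 proof -
  have "((\<lambda>x. f x + g x) has_derivative (\<lambda>h. frechet_derivative f (at x) h + frechet_derivative g (at x) h)) (at x)"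
   using Suc.prems by (intro has_derivative_add) (simp_all add: frechet_derivative_works[symmetric])
  from frechet_derivative_eq[OF this] show ?thesis by simp
 qed
 with Suc show ?case by (auto intro!: differentiable_add)
qed

lemma Ck_mult: "Ck k f ==> Ck k g ==> Ck k (\<lambda>x. f x * g x)"
proof (induction k arbitrary: f g)
 case 0 then show ?case by (auto intro: continuous_intros)
next
 case (Suc k)
 have "frechet_derivative (\<lambda>x. f x * g x) (at x) i = f x * frechet_derivative g (at x) i + frechet_derivative f (at x) i * g x" for x i
 proof -
  have "((\<lambda>x. f x * g x) has_derivative (\<lambda>h. f x * frechet_derivative g (at x) h + frechet_derivative f (at x) h * g x)) (at x)"
   using Suc.prems by (intro has_derivative_mult) (simp_all add: frechet_derivative_works[symmetric])
  from frechet_derivative_eq[OF this] show ?thesis by simp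
 qed
 moreover have "Ck k f" "Ck k g" using Suc.prems Ck_Suc_imp by blast+
 ultimately show ?case using Suc by (auto intro!: differentiable_mult Ck_add)
qed

lemma Ck_prod: "finite A ==> (\<And>i. i \<in> A ==> Ck k (f i)) ==> Ck k (\<lambda>x. \<Prod>i\<in>A. f i x)"
 by (induction rule: finite_induct) (auto intro: Ck_const Ck_mult)

section \<open>Smooth bump functions on boxes\<close>

definition flat :: "nat => real => real" where
 "flat n t = (if t > 0 then (1/t)^n * exp (- (1/t)) else 0)"

lemma flat_tendsto_0: "((\<lambda>t. flat n t) \<longlongrightarrow> 0) (at 0)"
proof (subst filterlim_at_split, rule conjI)
 have "eventually (\<lambda>t. flat n t = 0) (at_left (0::real))"
  by (auto simp: eventually_at_filter flat_def)
 then show "((\<lambda>t. flat n t) \<longlongrightarrow> 0) (at_left 0)"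
  by (rule tendsto_eventually)
 have "((\<lambda>t. (inverse t) ^ n / exp (inverse t)) \<longlongrightarrow> 0) (at_right (0::real))"
  by (rule filterlim_compose[OF tendsto_power_div_exp_0 filterlim_inverse_at_top_right])
 moreover have "eventually (\<lambda>t. (inverse t) ^ n / exp (inverse t) = flat n t) (at_right (0::real))"
  by (auto simp: eventually_at_filter flat_def exp_minus field_simps)
 ultimately show "((\<lambda>t. flat n t) \<longlongrightarrow> 0) (at_right 0)"
  by (rule Lim_transform_eventually)
qed

text \<open>The functions t^-n exp(-1/t) are closed under differentiation up to linear combination,
  which reduces smoothness of every order to an induction. At 0 the difference quotient of
  \<open>flat n\<close> is \<open>flat (n+1)\<close>, which tends to 0.\<close>

lemma flat_deriv: "(flat n has_real_derivative (flat (n+2) t - real n * flat (n+1) t)) (at t)"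
proof -
 consider "t > 0" | "t < 0" | "t = 0" by linarith
 then show ?thesis
 proof cases
  case 1
  define y where "y = 1/t"
  have dy: "((\<lambda>t. 1/t) has_real_derivative - (y\<^sup>2)) (at t)"
   using 1 by (auto intro!: derivative_eq_intros simp: y_def power2_eq_square)
  have dh: "((\<lambda>y. y^n * exp (- y)) has_real_derivative (real n * y^(n-1) * exp (- y) - y^n * exp (- y))) (at y)"
   by (auto intro!: derivative_eq_intros)
  have A: "real n * y^(n-1) * y\<^sup>2 = real n * y^(n+1)"
   by (cases n) (simp_all add: power2_eq_square)
  have gen: "(a * z - b * z) * - w = b * w * z - a * w * z" for a b z w :: real by (simp add: algebra_simps)
  have "(real n * y^(n-1) * exp (- y) - y^n * exp (- y)) * - (y\<^sup>2) = y^(n+2) * exp (- y) - real n * y^(n+1) * exp (- y)"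
   unfolding gen A by (simp add: power_add power2_eq_square)
  also have "... = flat (n+2) t - real n * flat (n+1) t" using 1 by (simp add: flat_def y_def)
  finally have "((\<lambda>t. (1/t)^n * exp (- (1/t))) has_real_derivative (flat (n+2) t - real n * flat (n+1) t)) (at t)"
   using DERIV_chain2[OF dh[unfolded y_def] dy] by (simp add: y_def)
  then show ?thesis
   by (rule has_field_derivative_transform_within_open[where S="{0<..}"]) (use 1 in \<open>auto simp: flat_def\<close>)
 next
  case 2
  have "((\<lambda>t. 0) has_real_derivative (flat (n+2) t - real n * flat (n+1) t)) (at t)"
   using 2 by (auto simp: flat_def)
  then show ?thesis
   by (rule has_field_derivative_transform_within_open[where S="{..<0}"]) (use 2 in \<open>auto simp: flat_def\<close>)
 next
  case 3
  have "((\<lambda>h. (flat n (0 + h) - flat n 0) / h) \<longlongrightarrow> 0) (at 0)"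
   by (rule Lim_transform_eventually[OF flat_tendsto_0[of "n+1"]]) (auto simp: flat_def eventually_at_filter)
  then show ?thesis using 3 by (simp add: DERIV_def flat_def)
 qed
qed

text \<open>Induction on the order of differentiation with n left free: each directional derivative
  is a combination of \<open>flat (n+2)\<close> and \<open>flat (n+1)\<close> at the same affine
  argument.\<close>

lemma Ck_flat: "Ck k (\<lambda>x::'a::euclidean_space. flat n (x \<bullet> v + d))"
proof (induction k arbitrary: n)
 case 0
 have "continuous_on UNIV (flat n)"
  using flat_deriv by (auto intro!: continuous_at_imp_continuous_on DERIV_isCont)
 moreover have "continuous_on UNIV (\<lambda>x. x \<bullet> v + d)" by (intro continuous_intros)
 ultimately show ?case using continuous_on_compose2[of UNIV "flat n" UNIV "\<lambda>x. x \<bullet> v + d"] by simp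
next
 case (Suc k)
 have der: "((\<lambda>x. flat n (x \<bullet> v + d)) has_derivative (\<lambda>h. (h \<bullet> v) * (flat (n+2) (x \<bullet> v + d) - real n * flat (n+1) (x \<bullet> v + d)))) (at x)" for x
  by (rule has_derivative_compose[where g="flat n" and g'="\<lambda>h. h * (flat (n+2) (x \<bullet> v + d) - real n * flat (n+1) (x \<bullet> v + d))"])
    (auto intro!: derivative_eq_intros flat_deriv[unfolded has_field_derivative_def, THEN has_derivative_eq_rhs] simp: fun_eq_iff mult.commute)
 have eq: "(\<lambda>x. frechet_derivative (\<lambda>x. flat n (x \<bullet> v + d)) (at x) i)
   = (\<lambda>x. (i \<bullet> v) * (flat (n+2) (x \<bullet> v + d) + (- real n) * flat (n+1) (x \<bullet> v + d)))" for i
  by (rule ext) (simp add: frechet_derivative_eq[OF der])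
 have "Ck k (\<lambda>x. (i \<bullet> v) * (flat (n+2) (x \<bullet> v + d) + (- real n) * flat (n+1) (x \<bullet> v + d)))" for i
  by (intro Ck_mult Ck_add Ck_const Suc)
 with der eq show ?case by (auto simp: differentiable_def)
qed

text \<open>Positive exactly on the open box. The factor \<open>Suc k\<close> sends exp(-1/((k+1)
  t)) to 1 for every t > 0, so the bumps converge to the indicator of the box while staying bounded
  by 1.\<close>

definition bump :: "'a::euclidean_space => 'a => nat => 'a => real" where
 "bump a b k x = (\<Prod>i\<in>Basis. flat 0 (real (Suc k) * (x \<bullet> i - a \<bullet> i)) * flat 0 (real (Suc k) * (b \<bullet> i - x \<bullet> i)))"

lemma smooth_bump: "smooth_fun (bump a b k)"
 unfolding smooth_fun_def
proof (intro allI)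
 fix n
 have "Ck n (\<lambda>x. flat 0 (real (Suc k) * (x \<bullet> i - a \<bullet> i)) * flat 0 (real (Suc k) * (b \<bullet> i - x \<bullet> i)))" for i
  using Ck_mult[OF Ck_flat[of n 0 "real (Suc k) *\<^sub>R i" "- real (Suc k) * (a \<bullet> i)"]
   Ck_flat[of n 0 "- real (Suc k) *\<^sub>R i" "real (Suc k) * (b \<bullet> i)"]] by (simp add: algebra_simps)
 then show "Ck n (bump a b k)"
  unfolding bump_def[abs_def] by (intro Ck_prod) auto
qed

lemma flat0_bounds: "0 <= flat 0 t" "flat 0 t <= 1" "0 < flat 0 t \<longleftrightarrow> 0 < t"
 by (auto simp: flat_def)

lemma bump_bounds: "0 <= bump a b k x" "bump a b k x <= 1" 
 unfolding bump_def by (auto intro!: prod_nonneg prod_le_1 mult_le_one mult_nonneg_nonneg flat0_bounds)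

lemma bump_pos_iff: "0 < bump a b k x \<longleftrightarrow> x \<in> box a b"
proof
 assume x: "x \<in> box a b"
 show "0 < bump a b k x" unfolding bump_def
 proof (intro prod_pos mult_pos_pos)
  fix i :: 'a assume "i \<in> Basis"
  then have "a \<bullet> i < x \<bullet> i" "x \<bullet> i < b \<bullet> i" using x by (auto simp: mem_box)
  then have "0 < real (Suc k) * (x \<bullet> i - a \<bullet> i)" "0 < real (Suc k) * (b \<bullet> i - x \<bullet> i)" by (intro mult_pos_pos; simp)+
  then show "0 < flat 0 (real (Suc k) * (x \<bullet> i - a \<bullet> i))" "0 < flat 0 (real (Suc k) * (b \<bullet> i - x \<bullet> i))"
   by (simp_all only: flat0_bounds(3))
 qed
next
 assume pos: "0 < bump a b k x"
 show "x \<in> box a b"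
 proof (rule ccontr)
  assume "x \<notin> box a b"
  then obtain i where i: "i \<in> Basis" "x \<bullet> i - a \<bullet> i <= 0 \<or> b \<bullet> i - x \<bullet> i <= 0"
   unfolding mem_box by force
  have neg: "flat 0 (real (Suc k) * t) = 0" if "t <= 0" for t
  proof -
   have "real (Suc k) * t <= 0" using that by (intro mult_nonneg_nonpos) auto
   then show ?thesis by (simp add: flat_def)
  qed
  have "bump a b k x = 0"
   unfolding bump_def using i neg by (intro prod_zero bexI[of _ i]) auto
  then show False using pos by simp
 qed
qed

lemma bump_tendsto: "(\<lambda>k. bump a b k x) \<longlonglongrightarrow> indicator (box a b) x"
proof (cases "x \<in> box a b")
 case True
 have flat1: "(\<lambda>k. flat 0 (real (Suc k) * t)) \<longlonglongrightarrow> 1" if "t > 0" for t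
 proof -
  have "(\<lambda>k. exp (- (inverse (real (Suc k)) * (1/t)))) \<longlonglongrightarrow> exp (- (0 * (1/t)))"
   by (intro tendsto_intros LIMSEQ_inverse_real_of_nat)
  then show ?thesis using that by (simp add: flat_def zero_less_mult_iff divide_inverse mult.commute)
 qed
 have "(\<lambda>k. bump a b k x) \<longlonglongrightarrow> (\<Prod>i\<in>(Basis::'a set). 1 * 1)"
  unfolding bump_def using True by (intro tendsto_prod tendsto_mult flat1) (auto simp: mem_box)
 then show ?thesis using True by simp
next
 case False
 then have "bump a b k x = 0" for k using bump_pos_iff[of a b k x] bump_bounds(1)[of a b k x] by (auto simp: less_le)
 then show ?thesis using False by simp
qed

lemma bump_support: "closure {x. bump a b k x \<noteq> 0} \<subseteq> cbox a b"
proof (rule closure_minimal)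
 show "{x. bump a b k x \<noteq> 0} \<subseteq> cbox a b"
  using bump_pos_iff[of a b k] bump_bounds(1)[of a b k] box_subset_cbox by (force simp: less_le)
qed auto

lemma test_fun_bump: "cbox a b \<subseteq> \<Omega> ==> test_fun \<Omega> (bump a b k)"
 unfolding test_fun_def using bump_support[of a b k] smooth_bump
 by (auto simp: compact_eq_bounded_closed intro: bounded_subset[OF bounded_cbox])

section \<open>Algebra, supports and gradients of test functions\<close>

lemma test_fun_add: "test_fun \<Omega> \<phi> ==> test_fun \<Omega> \<psi> ==> test_fun \<Omega> (\<lambda>x. \<phi> x + \<psi> x)"
proof -
 assume *: "test_fun \<Omega> \<phi>" "test_fun \<Omega> \<psi>"
 have "closure {x. \<phi> x + \<psi> x \<noteq> 0} \<subseteq> closure ({x. \<phi> x \<noteq> 0} \<union> {x. \<psi> x \<noteq> 0})"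
  by (intro closure_mono) auto
 then have sub: "closure {x. \<phi> x + \<psi> x \<noteq> 0} \<subseteq> closure {x. \<phi> x \<noteq> 0} \<union> closure {x. \<psi> x \<noteq> 0}"
  by (simp add: closure_Un)
 then have "compact (closure {x. \<phi> x + \<psi> x \<noteq> 0})"
  using * by (intro compact_closure[THEN iffD2] bounded_subset[OF _ order_trans[OF closure_subset sub]])
   (auto simp: test_fun_def intro: compact_imp_bounded)
 with sub * show ?thesis by (auto simp: test_fun_def smooth_fun_def intro: Ck_add)
qed

lemma test_fun_mult:
 assumes "test_fun \<Omega> \<phi>" "smooth_fun \<psi>" shows "test_fun \<Omega> (\<lambda>x. \<phi> x * \<psi> x)"
proof -
 have sub: "closure {x. \<phi> x * \<psi> x \<noteq> 0} \<subseteq> closure {x. \<phi> x \<noteq> 0}" by (intro closure_mono) auto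
 then have "compact (closure {x. \<phi> x * \<psi> x \<noteq> 0})"
  using assms by (intro compact_closure[THEN iffD2] bounded_subset[OF _ order_trans[OF closure_subset sub]])
   (auto simp: test_fun_def intro: compact_imp_bounded)
 with sub assms show ?thesis by (auto simp: test_fun_def smooth_fun_def intro: Ck_mult)
qed

lemma test_fun_cmult: "test_fun \<Omega> \<phi> ==> test_fun \<Omega> (\<lambda>x. c * \<phi> x)"
 using test_fun_mult[of \<Omega> \<phi> "\<lambda>_. c"] by (simp add: smooth_fun_def Ck_const mult.commute)

lemma test_fun_zero: "test_fun \<Omega> (\<lambda>_. 0)"
 by (simp add: test_fun_def smooth_fun_def Ck_const)

lemma grad_inner: 
 assumes "f differentiable (at x)"
 shows "frechet_derivative f (at x) h = grad f x \<bullet> h"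
proof -
 interpret bounded_linear "frechet_derivative f (at x)"
  using assms by (auto simp: frechet_derivative_works has_derivative_def)
 have "frechet_derivative f (at x) h = frechet_derivative f (at x) (\<Sum>i\<in>Basis. (h \<bullet> i) *\<^sub>R i)"
  by (simp add: euclidean_representation)
 also have "... = (\<Sum>i\<in>Basis. (h \<bullet> i) * frechet_derivative f (at x) i)" by (simp add: sum scaleR)
 also have "... = grad f x \<bullet> h" by (simp add: grad_def inner_sum_left inner_commute[of h] mult.commute)
 finally show ?thesis .
qed

lemma has_derivative_grad:
 assumes "f differentiable (at x)"
 shows "(f has_derivative (\<lambda>h. grad f x \<bullet> h)) (at x)"
proof -
 have "frechet_derivative f (at x) = (\<lambda>h. grad f x \<bullet> h)" using grad_inner[OF assms] by (rule ext)
 then show ?thesis using assms unfolding frechet_derivative_works by simp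
qed

lemma grad_eqI:
 assumes "(f has_derivative (\<lambda>h. g \<bullet> h)) (at x)" shows "grad f x = g"
 unfolding grad_def frechet_derivative_eq[OF assms] by (simp add: euclidean_representation)

lemma test_fun_differentiable: "test_fun \<Omega> \<phi> ==> \<phi> differentiable (at x)"
 using Ck_differentiable[of 0 \<phi> x] by (auto simp: test_fun_def smooth_fun_def simp del: Ck.simps)

lemma test_fun_continuous: "test_fun \<Omega> \<phi> ==> continuous_on S \<phi>"
 by (auto intro!: continuous_at_imp_continuous_on differentiable_imp_continuous_within test_fun_differentiable)

lemma continuous_on_grad: assumes "test_fun \<Omega> \<phi>" shows "continuous_on S (grad \<phi>)"
proof -
 have "Ck (Suc 0) \<phi>" using assms by (simp only: test_fun_def smooth_fun_def)
 then have "continuous_on UNIV (grad \<phi>)" unfolding grad_def[abs_def] by (intro continuous_intros) auto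
 then show ?thesis by (rule continuous_on_subset) auto
qed

lemma grad_add: "test_fun \<Omega> \<phi> ==> test_fun \<Omega> \<psi> ==> grad (\<lambda>x. \<phi> x + \<psi> x) x = grad \<phi> x + grad \<psi> x"
 by (rule grad_eqI) (auto intro!: derivative_eq_intros has_derivative_grad test_fun_differentiable simp: inner_add_left)

lemma grad_cmult: "test_fun \<Omega> \<phi> ==> grad (\<lambda>x. c * \<phi> x) x = c *\<^sub>R grad \<phi> x"
 by (rule grad_eqI) (auto intro!: derivative_eq_intros has_derivative_grad test_fun_differentiable)

lemma grad_mult: "test_fun \<Omega> \<phi> ==> test_fun \<Omega> \<psi> ==> grad (\<lambda>x. \<phi> x * \<psi> x) x = \<phi> x *\<^sub>R grad \<psi> x + \<psi> x *\<^sub>R grad \<phi> x"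
 by (rule grad_eqI) (auto intro!: derivative_eq_intros has_derivative_grad test_fun_differentiable simp: inner_add_left)

lemma grad_const: "grad (\<lambda>_. c) x = 0"
 by (rule grad_eqI) auto

lemma test_fun_support:
 assumes "test_fun \<Omega> \<phi>"
 obtains S where "compact S" "S \<subseteq> \<Omega>" "\<And>x. x \<notin> S ==> \<phi> x = 0" "\<And>x. x \<notin> S ==> grad \<phi> x = 0"
proof
 let ?S = "closure {x. \<phi> x \<noteq> 0}"
 show "compact ?S" "?S \<subseteq> \<Omega>" using assms by (auto simp: test_fun_def)
 show z: "\<phi> x = 0" if "x \<notin> ?S" for x
  using that set_mp[OF closure_subset, of x "{x. \<phi> x \<noteq> 0}"] by blast
 show "grad \<phi> x = 0" if "x \<notin> ?S" for x
 proof (rule grad_eqI)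
  have "((\<lambda>_. 0) has_derivative (\<lambda>h. 0 \<bullet> h)) (at x)" by simp
  then show "(\<phi> has_derivative (\<lambda>h. 0 \<bullet> h)) (at x)"
  proof (rule has_derivative_transform_within_open[where s="- ?S"])
   show "open (- ?S)" by (intro open_Compl closed_closure)
   show "x \<in> - ?S" using that by blast
   show "0 = \<phi> y" if "y \<in> - ?S" for y using z[of y] that by simp
  qed
 qed
qed

lemma test_fun_outside: assumes "test_fun \<Omega> \<phi>" "x \<notin> \<Omega>" shows "\<phi> x = 0" "grad \<phi> x = 0"
proof -
 obtain S where S: "compact S" "S \<subseteq> \<Omega>" "\<And>x. x \<notin> S ==> \<phi> x = 0" "\<And>x. x \<notin> S ==> grad \<phi> x = 0"
  by (rule test_fun_support[OF assms(1)]) (rule that)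
 then show "\<phi> x = 0" "grad \<phi> x = 0" using assms(2) S(3,4)[of x] by auto
qed

lemma test_fun_bounded:
 assumes "test_fun \<Omega> \<phi>"
 obtains B where "0 < B" "\<And>x. \<bar>\<phi> x\<bar> <= B" "\<And>x. norm (grad \<phi> x) <= B"
proof -
 obtain S where S: "compact S" "S \<subseteq> \<Omega>" "\<And>x. x \<notin> S ==> \<phi> x = 0" "\<And>x. x \<notin> S ==> grad \<phi> x = 0"
  by (rule test_fun_support[OF assms]) (rule that)
 have "bounded (\<phi> ` S)" "bounded (grad \<phi> ` S)"
  by (intro compact_imp_bounded compact_continuous_image S(1) test_fun_continuous[OF assms] continuous_on_grad[OF assms])+
 then obtain B1 B2 where "0 < B1" "\<forall>x\<in>S. norm (\<phi> x) <= B1" "0 < B2" "\<forall>x\<in>S. norm (grad \<phi> x) <= B2"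
  unfolding bounded_pos by auto
 then have "norm (\<phi> x) <= max B1 B2" "norm (grad \<phi> x) <= max B1 B2" for x
  using S(3,4)[of x] by (cases "x \<in> S"; force simp: le_max_iff_disj)+
 then show thesis using \<open>0 < B1\<close> by (intro that[of "max B1 B2"]) auto
qed

lemma borel_measurable_test [measurable (raw)]:
 assumes "test_fun \<Omega> \<phi>"
 shows "\<phi> \<in> borel_measurable borel" "grad \<phi> \<in> borel_measurable borel"
 by (intro borel_measurable_continuous_onI test_fun_continuous[OF assms] continuous_on_grad[OF assms])+

lemma integrable_test:
 assumes "test_fun \<Omega> \<phi>"
 shows "integrable lborel \<phi>" "integrable lborel (grad \<phi>)"
proof -
 obtain S where S: "compact S" "S \<subseteq> \<Omega>" "\<And>x. x \<notin> S ==> \<phi> x = 0" "\<And>x. x \<notin> S ==> grad \<phi> x = 0"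
  by (rule test_fun_support[OF assms]) (rule that)
 have "(\<lambda>x. indicator S x *\<^sub>R \<phi> x) = \<phi>" "(\<lambda>x. indicator S x *\<^sub>R grad \<phi> x) = grad \<phi>"
  using S(3,4) by (auto simp: fun_eq_iff indicator_def)
 then show "integrable lborel \<phi>" "integrable lborel (grad \<phi>)"
  using borel_integrable_compact[OF S(1) test_fun_continuous[OF assms]] borel_integrable_compact[OF S(1) continuous_on_grad[OF assms]] by auto
qed

section \<open>Translation invariance, integration by parts and limits of test functions\<close>

lemma lborel_nn_integral_translate:
 fixes f :: "'a::euclidean_space => ennreal"
 assumes [measurable]: "f \<in> borel_measurable borel"
 shows "(\<integral>\<^sup>+x. f (c + x) \<partial>lborel) = (\<integral>\<^sup>+x. f x \<partial>lborel)"
proof -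
 have "(\<integral>\<^sup>+x. f x \<partial>lborel) = (\<integral>\<^sup>+x. f x \<partial>distr lborel borel ((+) c))" by (simp add: lborel_distr_plus)
 also have "... = (\<integral>\<^sup>+x. f (c + x) \<partial>lborel)" by (subst nn_integral_distr) auto
 finally show ?thesis by simp
qed

lemma lborel_integral_translate:
 fixes f :: "'a::euclidean_space => real"
 assumes [measurable]: "f \<in> borel_measurable borel"
 shows "(LINT x|lborel. f (c + x)) = (LINT x|lborel. f x)"
proof -
 have "(LINT x|lborel. f x) = (\<integral>x. f x \<partial>distr lborel borel ((+) c))" by (simp add: lborel_distr_plus)
 also have "... = (LINT x|lborel. f (c + x))" by (subst integral_distr) auto
 finally show ?thesis by simp
qed

lemma test_fun_line_deriv:
 assumes "test_fun \<Omega> \<phi>"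
 shows "((\<lambda>s. \<phi> (x + s *\<^sub>R v)) has_real_derivative grad \<phi> (x + s *\<^sub>R v) \<bullet> v) (at s)"
proof -
 have "((\<lambda>s. \<phi> (x + s *\<^sub>R v)) has_derivative (\<lambda>h. grad \<phi> (x + s *\<^sub>R v) \<bullet> (h *\<^sub>R v))) (at s)"
  by (rule has_derivative_compose[OF _ has_derivative_grad[OF test_fun_differentiable[OF assms]]])
    (auto intro!: derivative_eq_intros)
 then show ?thesis by (simp add: has_field_derivative_def mult_commute_abs)
qed

text \<open>The integral of \<phi>(x + s v) over x does not depend on s; differentiating it under
  the integral at s = 0 gives the claim. The majorant lives on a ball enlarged by |v|, since only
  |s| <= 1 matters.\<close>

lemma integral_grad_test:
 assumes "test_fun \<Omega> \<phi>" 
 shows "(LINT x|lborel. grad \<phi> x \<bullet> v) = 0"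
proof -
 obtain S where S: "compact S" "S \<subseteq> \<Omega>" "\<And>x. x \<notin> S ==> \<phi> x = 0" "\<And>x. x \<notin> S ==> grad \<phi> x = 0"
  by (rule test_fun_support[OF assms]) (rule that)
 obtain B where B0: "0 < B" "\<And>x. \<bar>\<phi> x\<bar> <= B" "\<And>x. norm (grad \<phi> x) <= B" by (rule test_fun_bounded[OF assms]) (rule that)
 note B = B0(1,3)
 obtain R where R: "\<And>x. x \<in> S ==> norm x <= R" using compact_imp_bounded[OF S(1)] by (auto simp: bounded_iff)
 note [measurable] = borel_measurable_test[OF assms]
 have "((\<lambda>s. LINT x|lborel. \<phi> (x + s *\<^sub>R v)) has_real_derivative (LINT x|lborel. grad \<phi> (x + 0 *\<^sub>R v) \<bullet> v)) (at 0)"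
 proof (rule DERIV_integral[where G="\<lambda>x. B * norm v * indicator (cball 0 (R + norm v)) x"])
  show "integrable lborel (\<lambda>x. \<phi> (x + s *\<^sub>R v))" for s
  proof -
   have "integrable (distr lborel borel ((+) (s *\<^sub>R v))) \<phi>"
    using integrable_test(1)[OF assms] by (simp add: lborel_distr_plus)
   then show ?thesis by (subst (asm) integrable_distr_eq) (auto simp: add.commute)
  qed
  show "integrable lborel (\<lambda>x. B * norm v * indicator (cball 0 (R + norm v)) x :: real)"
   by (intro integrable_mult_right integrable_real_indicator) (use emeasure_bounded_finite[OF bounded_cball] in \<open>auto simp: less_top\<close>)
  show "\<bar>grad \<phi> (x + s *\<^sub>R v) \<bullet> v\<bar> <= B * norm v * indicator (cball 0 (R + norm v)) x" if "\<bar>s - 0\<bar> <= 1" for x s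
  proof (cases "x + s *\<^sub>R v \<in> S")
   case True
   have "norm x <= norm (x + s *\<^sub>R v) + norm (s *\<^sub>R v)" using norm_triangle_ineq4[of "x + s *\<^sub>R v" "s *\<^sub>R v"] by simp
   also have "... <= R + norm v" using R[OF True] that by (auto intro!: add_mono mult_left_le_one_le)
   finally have "x \<in> cball 0 (R + norm v)" by simp
   moreover have "\<bar>grad \<phi> (x + s *\<^sub>R v) \<bullet> v\<bar> <= norm (grad \<phi> (x + s *\<^sub>R v)) * norm v" by (rule Cauchy_Schwarz_ineq2)
   then have "\<bar>grad \<phi> (x + s *\<^sub>R v) \<bullet> v\<bar> <= B * norm v" using B(2)[of "x + s *\<^sub>R v"] by (meson mult_right_mono norm_ge_zero order_trans)
   ultimately show ?thesis by simp
  next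
   case False
   then show ?thesis using S(4)[of "x + s *\<^sub>R v"] B by simp
  qed
  show "(\<lambda>x. grad \<phi> (x + 0 *\<^sub>R v) \<bullet> v) \<in> borel_measurable lborel" by measurable
 qed (rule test_fun_line_deriv[OF assms])
 moreover have "(LINT x|lborel. \<phi> (x + s *\<^sub>R v)) = (LINT x|lborel. \<phi> x)" for s
  using lborel_integral_translate[of \<phi> "s *\<^sub>R v"] by (simp add: add.commute)
 ultimately have "((\<lambda>s. LINT x|lborel. \<phi> x) has_real_derivative (LINT x|lborel. grad \<phi> x \<bullet> v)) (at 0)" by simp
 from DERIV_unique[OF this DERIV_const] show ?thesis .
qed

lemma integral_by_parts_test:
 assumes \<phi>: "test_fun \<Omega> \<phi>" and \<psi>: "test_fun \<Omega> \<psi>"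
 shows "(LINT x|lborel. \<phi> x * (grad \<psi> x \<bullet> v)) = - (LINT x|lborel. (grad \<phi> x \<bullet> v) * \<psi> x)"
proof -
 note [measurable] = borel_measurable_test[OF \<phi>] borel_measurable_test[OF \<psi>]
 obtain B where B: "0 < B" "\<And>x. \<bar>\<phi> x\<bar> <= B" "\<And>x. norm (grad \<phi> x) <= B" by (rule test_fun_bounded[OF \<phi>]) (rule that)
 have i1: "integrable lborel (\<lambda>x. \<phi> x * (grad \<psi> x \<bullet> v))"
 proof (rule Bochner_Integration.integrable_bound)
  show "integrable lborel (\<lambda>x. B * (grad \<psi> x \<bullet> v))" using integrable_test(2)[OF \<psi>] by simp
 qed (use B in \<open>auto simp: abs_mult intro!: mult_right_mono AE_I2\<close>)
 have i2: "integrable lborel (\<lambda>x. (grad \<phi> x \<bullet> v) * \<psi> x)"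
 proof (rule Bochner_Integration.integrable_bound)
  show "integrable lborel (\<lambda>x. (B * norm v) * \<psi> x)" using integrable_test(1)[OF \<psi>] by simp
  show "AE x in lborel. norm ((grad \<phi> x \<bullet> v) * \<psi> x) <= norm ((B * norm v) * \<psi> x)"
  proof (intro AE_I2)
   fix x
   have "\<bar>grad \<phi> x \<bullet> v\<bar> <= norm (grad \<phi> x) * norm v" by (rule Cauchy_Schwarz_ineq2)
   also have "... <= B * norm v" using B by (intro mult_right_mono) auto
   finally show "norm ((grad \<phi> x \<bullet> v) * \<psi> x) <= norm ((B * norm v) * \<psi> x)"
    using B by (auto simp: abs_mult intro!: mult_right_mono)
  qed
 qed measurable
 have "(\<lambda>x. \<phi> x * (grad \<psi> x \<bullet> v) + (grad \<phi> x \<bullet> v) * \<psi> x) = (\<lambda>x. grad (\<lambda>x. \<phi> x * \<psi> x) x \<bullet> v)"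
  by (simp add: grad_mult[OF \<phi> \<psi>] inner_add_left mult.commute)
 moreover have "test_fun \<Omega> (\<lambda>x. \<phi> x * \<psi> x)" using \<phi> \<psi> by (intro test_fun_mult) (auto simp: test_fun_def)
 ultimately have "(LINT x|lborel. \<phi> x * (grad \<psi> x \<bullet> v) + (grad \<phi> x \<bullet> v) * \<psi> x) = 0"
  using integral_grad_test by simp
 then show ?thesis using i1 i2 by simp
qed

lemma integral_lebesgue_on_eq:
 fixes f :: "'a::euclidean_space => real"
 assumes "\<Omega> \<in> sets borel" and [measurable]: "f \<in> borel_measurable borel" and "\<And>x. x \<notin> \<Omega> ==> f x = 0"
 shows "(LINT x|(lebesgue_on \<Omega>). f x) = (LINT x|lborel. f x)"
proof -
 have "(LINT x|(lebesgue_on \<Omega>). f x) = (\<integral>x. indicator \<Omega> x *\<^sub>R f x \<partial>lebesgue)"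
  using assms(1) by (intro integral_restrict_space) auto
 also have "(\<lambda>x. indicator \<Omega> x *\<^sub>R f x) = f" using assms(3) by (auto simp: fun_eq_iff indicator_def)
 also have "integral\<^sup>L lebesgue f = integral\<^sup>L lborel f" by (intro integral_completion) auto
 finally show ?thesis .
qed

lemma integral_by_parts_test_on:
 assumes \<Omega>: "open \<Omega>" and \<phi>: "test_fun \<Omega> \<phi>" and \<psi>: "test_fun \<Omega> \<psi>"
 shows "(LINT x|(lebesgue_on \<Omega>). \<phi> x * (grad \<psi> x \<bullet> v)) = - (LINT x|(lebesgue_on \<Omega>). (grad \<phi> x \<bullet> v) * \<psi> x)"
proof -
 note [measurable] = borel_measurable_test[OF \<phi>] borel_measurable_test[OF \<psi>]
 show ?thesis
  using integral_by_parts_test[OF \<phi> \<psi>, of v] \<Omega>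
  by (subst (1 2) integral_lebesgue_on_eq) (auto simp: test_fun_outside[OF \<phi>])
qed

lemma borel_measurable_test_on:
 assumes "test_fun \<Omega> \<phi>" shows "\<phi> \<in> borel_measurable (lebesgue_on S)" "grad \<phi> \<in> borel_measurable (lebesgue_on S)"
 using borel_measurable_test[OF assms] by (auto intro!: measurable_restrict_space1 measurable_completion)

lemma set_integrable_of_integrable:
 fixes u :: "'a::euclidean_space => real"
 assumes "integrable (lebesgue_on \<Omega>) u" "open \<Omega>" "compact K" "K \<subseteq> \<Omega>"
 shows "set_integrable lebesgue K u"
proof -
 have "set_integrable lebesgue \<Omega> u"
  using assms unfolding set_integrable_def by (subst integrable_restrict_space[symmetric]) auto
 then show ?thesis by (rule set_integrable_subset) (use assms fmeasurableD[OF lmeasurable_compact[OF assms(3)]] in auto)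
qed

lemma tendsto_integral_mult_bounded:
 fixes u :: "'x => real" and b :: "'x => real"
 assumes b [measurable]: "b \<in> borel_measurable M" and B: "\<And>x. \<bar>b x\<bar> <= B"
  and u: "integrable M u" "\<And>k. integrable M (v k)"
  and lim: "(\<lambda>k. \<integral>\<^sup>+x. ennreal \<bar>v k x - u x\<bar> \<partial>M) \<longlonglongrightarrow> 0"
 shows "(\<lambda>k. LINT x|M. v k x * b x) \<longlonglongrightarrow> (LINT x|M. u x * b x)"
proof (rule tendsto_L1_int)
 have [measurable]: "u \<in> borel_measurable M" "\<And>k. v k \<in> borel_measurable M" using u by auto
 have int: "integrable M (\<lambda>x. w x * b x)" if w: "integrable M w" for w
 proof (rule Bochner_Integration.integrable_bound)
  show "integrable M (\<lambda>x. B * w x)" using w by simp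
  have [measurable]: "w \<in> borel_measurable M" using w by auto
  show "(\<lambda>x. w x * b x) \<in> borel_measurable M" by measurable
  show "AE x in M. norm (w x * b x) <= norm (B * w x)"
  proof (intro AE_I2)
   fix x have "\<bar>b x\<bar> * \<bar>w x\<bar> <= \<bar>B\<bar> * \<bar>w x\<bar>" using B[of x] by (intro mult_right_mono) auto
   then show "norm (w x * b x) <= norm (B * w x)" by (simp add: abs_mult mult.commute)
  qed
 qed
 show "integrable M (\<lambda>x. v k x * b x)" "integrable M (\<lambda>x. u x * b x)" for k by (intro int u)+
 show "(\<lambda>k. \<integral>\<^sup>+x. ennreal (norm (v k x * b x - u x * b x)) \<partial>M) \<longlonglongrightarrow> 0"
 proof (rule tendsto_sandwich[OF _ _ tendsto_const])
  have "(\<lambda>k. ennreal \<bar>B\<bar> * (\<integral>\<^sup>+x. ennreal \<bar>v k x - u x\<bar> \<partial>M)) \<longlonglongrightarrow> ennreal \<bar>B\<bar> * 0"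
   using lim by (intro ennreal_tendsto_cmult) auto
  then show "(\<lambda>k. ennreal \<bar>B\<bar> * (\<integral>\<^sup>+x. ennreal \<bar>v k x - u x\<bar> \<partial>M)) \<longlonglongrightarrow> 0" by simp
  have "(\<integral>\<^sup>+x. ennreal (norm (v k x * b x - u x * b x)) \<partial>M) <= (\<integral>\<^sup>+x. ennreal \<bar>B\<bar> * ennreal \<bar>v k x - u x\<bar> \<partial>M)" for k
  proof (intro nn_integral_mono)
   fix x have "\<bar>b x\<bar> * \<bar>v k x - u x\<bar> <= \<bar>B\<bar> * \<bar>v k x - u x\<bar>" using B[of x] by (intro mult_right_mono) auto
   then have "norm (v k x * b x - u x * b x) <= \<bar>B\<bar> * \<bar>v k x - u x\<bar>"
    using abs_mult[of "b x" "v k x - u x"] by (simp add: right_diff_distrib mult.commute)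
   then show "ennreal (norm (v k x * b x - u x * b x)) <= ennreal \<bar>B\<bar> * ennreal \<bar>v k x - u x\<bar>"
    by (simp add: ennreal_mult[symmetric] ennreal_leI)
  qed
  then show "\<forall>\<^sub>F k in sequentially. (\<integral>\<^sup>+x. ennreal (norm (v k x * b x - u x * b x)) \<partial>M) <= ennreal \<bar>B\<bar> * (\<integral>\<^sup>+x. ennreal \<bar>v k x - u x\<bar> \<partial>M)"
   by (intro always_eventually allI) (simp add: nn_integral_cmult)
 qed auto
qed

text \<open>A test function and its gradient are bounded, so convergence in mean of functions and
  gradients suffices to pass to the limit in the integration by parts formula.\<close>

lemma weak_grad_of_approx:
 fixes u :: "'a::euclidean_space => real" and g :: "'a => 'a"
 assumes \<Omega>: "open \<Omega>" and u: "integrable (lebesgue_on \<Omega>) u" and g: "integrable (lebesgue_on \<Omega>) g"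
  and \<phi>: "\<And>k. test_fun \<Omega> (\<phi> k)" and \<phi>_int: "\<And>k. integrable (lebesgue_on \<Omega>) (\<phi> k)" "\<And>k. integrable (lebesgue_on \<Omega>) (grad (\<phi> k))"
  and lim: "(\<lambda>k. \<integral>\<^sup>+x. ennreal \<bar>\<phi> k x - u x\<bar> \<partial>lebesgue_on \<Omega>) \<longlonglongrightarrow> 0"
   "(\<lambda>k. \<integral>\<^sup>+x. ennreal (norm (grad (\<phi> k) x - g x)) \<partial>lebesgue_on \<Omega>) \<longlonglongrightarrow> 0"
 shows "weak_grad \<Omega> u g"
 unfolding weak_grad_def
proof (intro conjI allI impI ballI)
 fix K :: "'a set" assume K: "compact K \<and> K \<subseteq> \<Omega>"
 show "set_integrable lebesgue K u" using K by (intro set_integrable_of_integrable[OF u \<Omega>]) auto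
 fix i :: 'a
 show "set_integrable lebesgue K (\<lambda>x. g x \<bullet> i)" using K g by (intro set_integrable_of_integrable[OF _ \<Omega>]) auto
next
 fix \<psi> and i :: 'a assume \<psi>: "test_fun \<Omega> \<psi>" and i: "i \<in> Basis"
 note [measurable] = borel_measurable_test_on[OF \<psi>]
 obtain B where B: "0 < B" "\<And>x. \<bar>\<psi> x\<bar> <= B" "\<And>x. norm (grad \<psi> x) <= B" by (rule test_fun_bounded[OF \<psi>]) (rule that)
 have bi: "\<bar>grad \<psi> x \<bullet> i\<bar> <= B" for x using B(3)[of x] Basis_le_norm[OF i, of "grad \<psi> x"] by linarith
 have l1: "(\<lambda>k. LINT x|(lebesgue_on \<Omega>). \<phi> k x * (grad \<psi> x \<bullet> i)) \<longlonglongrightarrow> (LINT x|(lebesgue_on \<Omega>). u x * (grad \<psi> x \<bullet> i))"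
  by (rule tendsto_integral_mult_bounded[where B=B]) (use bi u \<phi>_int lim in \<open>auto\<close>)
 have "(\<lambda>k. \<integral>\<^sup>+x. ennreal \<bar>grad (\<phi> k) x \<bullet> i - g x \<bullet> i\<bar> \<partial>lebesgue_on \<Omega>) \<longlonglongrightarrow> 0"
 proof (rule tendsto_sandwich[OF _ _ tendsto_const lim(2)])
  have "\<bar>grad (\<phi> k) x \<bullet> i - g x \<bullet> i\<bar> <= norm (grad (\<phi> k) x - g x)" for k x
   using Basis_le_norm[OF i, of "grad (\<phi> k) x - g x"] by (simp add: inner_diff_left)
  then show "\<forall>\<^sub>F k in sequentially. (\<integral>\<^sup>+x. ennreal \<bar>grad (\<phi> k) x \<bullet> i - g x \<bullet> i\<bar> \<partial>lebesgue_on \<Omega>) <= (\<integral>\<^sup>+x. ennreal (norm (grad (\<phi> k) x - g x)) \<partial>lebesgue_on \<Omega>)"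
   by (intro always_eventually allI nn_integral_mono ennreal_leI)
 qed auto
 then have "(\<lambda>k. LINT x|(lebesgue_on \<Omega>). (grad (\<phi> k) x \<bullet> i) * \<psi> x) \<longlonglongrightarrow> (LINT x|(lebesgue_on \<Omega>). (g x \<bullet> i) * \<psi> x)"
  by (intro tendsto_integral_mult_bounded[where B=B]) (use B g \<phi>_int in \<open>auto\<close>)
 from tendsto_minus[OF this] have l2: "(\<lambda>k. LINT x|(lebesgue_on \<Omega>). \<phi> k x * (grad \<psi> x \<bullet> i)) \<longlonglongrightarrow> - (LINT x|(lebesgue_on \<Omega>). (g x \<bullet> i) * \<psi> x)"
  by (simp add: integral_by_parts_test_on[OF \<Omega> \<phi> \<psi>])
 from LIMSEQ_unique[OF l1 l2]
 show "(LINT x|(lebesgue_on \<Omega>). u x * frechet_derivative \<psi> (at x) i) = - (LINT x|(lebesgue_on \<Omega>). (g x \<bullet> i) * \<psi> x)"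
  by (simp add: grad_inner[OF test_fun_differentiable[OF \<psi>]])
qed

section \<open>The fundamental lemma and uniqueness of weak gradients\<close>

lemma AE_zero_of_box_integrals:
 fixes f :: "'a::euclidean_space => real"
 assumes f: "integrable lborel f" and box: "\<And>a b. (LINT x|lborel. indicator (box a b) x * f x) = 0"
  and tot: "(LINT x|lborel. f x) = 0"
 shows "AE x in lborel. f x = 0"
proof -
 have [measurable]: "f \<in> borel_measurable borel" using f by auto
 have intA: "integrable lborel (\<lambda>x. indicator A x * f x)" if "A \<in> sets borel" for A
  using integrable_mult_indicator[OF _ f, of A] that by simp
 \<comment> \<open>Open boxes form a generator of the Borel sets that is closed under intersection,
   so Dynkin's theorem applies. The total integral is a separate hypothesis because complements call
   for it and the whole space is not a box.\<close>
 have Z: "(LINT x|lborel. indicator A x * f x) = 0" if A: "A \<in> sets borel" for A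
 proof -
  have "Int_stable (range (\<lambda>(a, b). box a b :: 'a set))" by (auto simp: Int_stable_def box_Int_box)
  moreover have "(range (\<lambda>(a, b). box a b :: 'a set)) \<subseteq> Pow UNIV" by auto
  moreover have "A \<in> sigma_sets UNIV (range (\<lambda>(a, b). box a b))" using A unfolding borel_eq_box by simp
  ultimately show ?thesis
  proof (induction rule: sigma_sets_induct_disjoint)
   case (basic A) then show ?case using box by auto
  next
   case empty then show ?case by simp
  next
   case (compl A)
   then have "A \<in> sets borel" by (simp add: borel_eq_box)
   have "(\<lambda>x. indicator (UNIV - A) x * f x) = (\<lambda>x. f x - indicator A x * f x)" by (auto simp: fun_eq_iff indicator_def)
   then show ?case using compl tot f intA[OF \<open>A \<in> sets borel\<close>] by simp
  next
   case (union F)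
   then have F: "F i \<in> sets borel" for i by (simp add: borel_eq_box subset_eq)
   have U: "\<Union>(range F) \<in> sets borel" using F by auto
   have "(LINT x:(\<Union>i. F i)|lborel. f x) = (\<Sum>i. (LINT x:F i|lborel. f x))"
   proof (rule lebesgue_integral_countable_add)
    show "F i \<inter> F j = {}" if "i \<noteq> j" for i j using union(1) that by (auto simp: disjoint_family_on_def)
    show "set_integrable lborel (\<Union>i. F i) f" using intA[OF U] by (simp add: set_integrable_def)
   qed (use F in auto)
   then show ?case using union by (simp add: set_lebesgue_integral_def)
  qed
 qed
 have pos: "AE x in lborel. \<not> 0 < s * f x" if s: "s = 1 \<or> s = -1" for s :: real
 proof -
  define A where "A = {x. 0 < s * f x}"
  have A: "A \<in> sets borel" unfolding A_def by measurable
  have "(LINT x|lborel. s * (indicator A x * f x)) = 0" using Z[OF A] by simp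
  moreover have "integrable lborel (\<lambda>x. s * (indicator A x * f x))" using intA[OF A] by simp
  moreover have "AE x in lborel. 0 <= s * (indicator A x * f x)" by (auto simp: A_def indicator_def)
  ultimately have "AE x in lborel. s * (indicator A x * f x) = 0" using integral_nonneg_eq_0_iff_AE by blast
  then show ?thesis by eventually_elim (auto simp: A_def indicator_def)
 qed
 show ?thesis using pos[of 1, simplified] pos[of "-1", simplified] by eventually_elim auto
qed

text \<open>Bumps tend to indicators of boxes, so w integrates to 0 over every open box whose closed
  box lies in \<Omega>. Within a fixed closed box this forces w to vanish almost everywhere, and
  countably many closed boxes exhaust \<Omega>.\<close>

lemma du_Bois_Reymond:
 fixes w :: "'a::euclidean_space => real"
 assumes \<Omega>: "open \<Omega>" and int: "\<And>K. compact K ==> K \<subseteq> \<Omega> ==> set_integrable lebesgue K w"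
  and zero: "\<And>\<phi>. test_fun \<Omega> \<phi> ==> (LINT x|(lebesgue_on \<Omega>). w x * \<phi> x) = 0"
 shows "AE x in lebesgue. x \<in> \<Omega> --> w x = 0"
proof -
 have box0: "(\<integral>x. indicator (box a b) x * w x \<partial>lebesgue) = 0" if ab: "cbox a b \<subseteq> \<Omega>" for a b
 proof -
  have sc: "set_integrable lebesgue (cbox a b) w" using int ab by auto
  have sb: "set_integrable lebesgue (box a b) w" by (rule set_integrable_subset[OF sc]) (auto simp: box_subset_cbox)
  have eq: "(LINT x|(lebesgue_on \<Omega>). w x * bump a b k x) = (\<integral>x. (indicator (cbox a b) x * w x) * bump a b k x \<partial>lebesgue)" for k
  proof -
   have "bump a b k x = 0" if "x \<notin> cbox a b" for x
    using that box_subset_cbox[of a b] bump_pos_iff[of a b k x] bump_bounds(1)[of a b k x] by (auto simp: less_le)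
   then have "(\<lambda>x. indicator \<Omega> x *\<^sub>R (w x * bump a b k x)) = (\<lambda>x. (indicator (cbox a b) x * w x) * bump a b k x)"
    using ab by (auto simp: fun_eq_iff indicator_def)
   moreover have "(LINT x|(lebesgue_on \<Omega>). w x * bump a b k x) = (\<integral>x. indicator \<Omega> x *\<^sub>R (w x * bump a b k x) \<partial>lebesgue)"
    using \<Omega> by (intro integral_restrict_space) auto
   ultimately show ?thesis by simp
  qed
  have "(\<lambda>k. \<integral>x. (indicator (cbox a b) x * w x) * bump a b k x \<partial>lebesgue) \<longlonglongrightarrow> (\<integral>x. indicator (box a b) x * w x \<partial>lebesgue)"
  proof (rule integral_dominated_convergence[where w="\<lambda>x. \<bar>indicator (cbox a b) x * w x\<bar>"])
   show "integrable lebesgue (\<lambda>x. \<bar>indicator (cbox a b) x * w x\<bar>)" using sc by (simp add: set_integrable_def)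
   have [measurable]: "(\<lambda>x. indicator (cbox a b) x * w x) \<in> borel_measurable lebesgue"
    using sc by (auto simp: set_integrable_def)
   have [measurable]: "bump a b k \<in> borel_measurable lebesgue" for k
    using borel_measurable_test(1)[OF test_fun_bump[OF ab]] by (intro measurable_completion) auto
   show "(\<lambda>x. indicator (box a b) x * w x) \<in> borel_measurable lebesgue"
    using sb by (auto simp: set_integrable_def)
   show "(\<lambda>x. (indicator (cbox a b) x * w x) * bump a b k x) \<in> borel_measurable lebesgue" for k by measurable
   show "AE x in lebesgue. (\<lambda>k. (indicator (cbox a b) x * w x) * bump a b k x) \<longlonglongrightarrow> indicator (box a b) x * w x"
   proof (intro AE_I2)
    fix x
    have "(\<lambda>k. (indicator (cbox a b) x * w x) * bump a b k x) \<longlonglongrightarrow> (indicator (cbox a b) x * w x) * indicator (box a b) x"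
     by (intro tendsto_intros bump_tendsto)
    then show "(\<lambda>k. (indicator (cbox a b) x * w x) * bump a b k x) \<longlonglongrightarrow> indicator (box a b) x * w x"
     using box_subset_cbox[of a b] by (auto simp: indicator_def split: if_splits)
   qed
   show "AE x in lebesgue. norm ((indicator (cbox a b) x * w x) * bump a b k x) <= \<bar>indicator (cbox a b) x * w x\<bar>" for k
    using bump_bounds[of a b k] by (intro AE_I2) (simp add: abs_mult mult_left_le)
  qed
  moreover have "(\<integral>x. (indicator (cbox a b) x * w x) * bump a b k x \<partial>lebesgue) = 0" for k
   using zero[OF test_fun_bump[OF ab]] eq by simp
  ultimately show ?thesis by (simp add: LIMSEQ_const_iff)
 qed
 have cb: "AE x in lebesgue. x \<in> cbox c d --> w x = 0" if cd: "cbox c d \<subseteq> \<Omega>" for c d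
 proof -
  have "set_integrable lebesgue (box c d) w"
   by (rule set_integrable_subset[of _ "cbox c d"]) (use int cd box_subset_cbox[of c d] in auto)
  then have W: "integrable lebesgue (\<lambda>x. indicator (box c d) x * w x)" by (simp add: set_integrable_def)
  \<comment> \<open>A Borel version is taken because the box criterion is formulated for
    \<open>lborel\<close>.\<close>
  then obtain W' where W'[measurable]: "W' \<in> borel_measurable lborel" and WW: "AE x in lborel. indicator (box c d) x * w x = W' x"
   using completion_ex_borel_measurable_real[of "\<lambda>x. indicator (box c d) x * w x" lborel] by blast
  have WW': "AE x in lebesgue. indicator (box c d) x * w x = W' x" by (rule AE_completion[OF WW])
  have W'm[measurable]: "W' \<in> borel_measurable lebesgue" using W' by (intro measurable_completion)
  have "integrable lebesgue W'" using W WW' by (subst integrable_cong_AE[symmetric, OF _ _ WW']) auto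
  then have W'i: "integrable lborel W'" by (simp add: integrable_completion)
  have ib: "(LINT x|lborel. indicator (box a b) x * W' x) = 0" for a b
  proof -
   have "(LINT x|lborel. indicator (box a b) x * W' x) = (\<integral>x. indicator (box a b) x * W' x \<partial>lebesgue)"
    by (rule integral_completion[symmetric]) measurable
   also have "... = (\<integral>x. indicator (box a b) x * (indicator (box c d) x * w x) \<partial>lebesgue)"
   proof (rule integral_cong_AE)
    show "(\<lambda>x. indicator (box a b) x * (indicator (box c d) x * w x)) \<in> borel_measurable lebesgue"
     by (intro borel_measurable_times[OF _ borel_measurable_integrable[OF W]] borel_measurable_indicator) auto
    show "AE x in lebesgue. indicator (box a b) x * W' x = indicator (box a b) x * (indicator (box c d) x * w x)"
     using WW' by eventually_elim simp
    show "(\<lambda>x. indicator (box a b) x * W' x) \<in> borel_measurable lebesgue"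
     by (intro borel_measurable_times W'm borel_measurable_indicator) auto
   qed
   also have "... = (\<integral>x. indicator (box a b \<inter> box c d) x * w x \<partial>lebesgue)"
    by (simp add: indicator_inter_arith mult.assoc)
   also have "... = 0"
   proof (cases "box a b \<inter> box c d = {}")
    case False
    obtain a' b' where eq: "box a b \<inter> box c d = box a' b'" by (simp add: box_Int_box)
    then have "box a' b' \<noteq> {}" "box a' b' \<subseteq> box c d" using False by auto
    \<comment> \<open>A nonempty open box has the closed box as its closure, so the smaller box
      stays inside \<Omega> together with its boundary.\<close>
    then have "cbox a' b' \<subseteq> cbox c d"
     by (metis closure_box closure_mono box_eq_empty(1) subset_empty)
    then show ?thesis using box0[of a' b'] cd eq by auto
   qed simp
   finally show ?thesis .
  qed
  have "(LINT x|lborel. W' x) = (LINT x|lborel. indicator (box c d) x * W' x)"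
   using WW by (intro integral_cong_AE) (auto simp: indicator_def elim: eventually_mono)
  then have "AE x in lborel. W' x = 0" using AE_zero_of_box_integrals[OF W'i ib] ib by simp
  then have "AE x in lebesgue. W' x = 0" by (rule AE_completion)
  moreover have "AE x in lebesgue. x \<notin> cbox c d - box c d"
   using negligible_frontier_interval[of c d] negligible_iff_null_sets AE_not_in by blast
  ultimately show ?thesis using WW' by eventually_elim (auto simp: indicator_def split: if_splits)
 qed
 obtain D where D: "countable D" "D \<subseteq> Pow \<Omega>" "\<And>X. X \<in> D ==> \<exists>a b. X = cbox a b" "\<Union>D = \<Omega>"
  by (rule open_countable_Union_open_cbox[OF \<Omega>]) (rule that)
 have "AE x in lebesgue. x \<in> X --> w x = 0" if X: "X \<in> D" for X
 proof -
  obtain a b where "X = cbox a b" using D(3)[OF X] by blast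
  moreover have "X \<subseteq> \<Omega>" using D(2) X by auto
  ultimately show ?thesis using cb[of a b] by simp
 qed
 then have "AE x in lebesgue. \<forall>X\<in>D. x \<in> X --> w x = 0"
  by (intro AE_ball_countable[OF D(1), THEN iffD2] ballI)
 then show ?thesis
 proof eventually_elim
  case (elim x)
  show ?case using elim D(4) by blast
 qed
qed

text \<open>The fundamental lemma is applied to each component of g - h. This makes the pair
  representation consistent: the gradients belonging to the two exponents and the one quantified
  over in the weak formulation agree almost everywhere.\<close>

lemma weak_grad_unique:
 assumes \<Omega>: "open \<Omega>" and g: "weak_grad \<Omega> u g" and h: "weak_grad \<Omega> u h"
 shows "AE x in lebesgue_on \<Omega>. g x = h x"
proof -
 have i: "AE x in lebesgue. x \<in> \<Omega> --> (g x - h x) \<bullet> i = 0" if i: "i \<in> Basis" for i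
 proof (rule du_Bois_Reymond[OF \<Omega>])
  have gi: "set_integrable lebesgue K (\<lambda>x. g x \<bullet> i)" and hi: "set_integrable lebesgue K (\<lambda>x. h x \<bullet> i)" if "compact K" "K \<subseteq> \<Omega>" for K
   using g h that i by (auto simp: weak_grad_def)
  show "set_integrable lebesgue K (\<lambda>x. (g x - h x) \<bullet> i)" if "compact K" "K \<subseteq> \<Omega>" for K
   using set_integral_diff(1)[OF gi[OF that] hi[OF that]] by (simp add: inner_diff_left)
  fix \<phi> assume \<phi>: "test_fun \<Omega> \<phi>"
  obtain S where S: "compact S" "S \<subseteq> \<Omega>" "\<And>x. x \<notin> S ==> \<phi> x = 0" "\<And>x. x \<notin> S ==> grad \<phi> x = 0"
   by (rule test_fun_support[OF \<phi>]) (rule that)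
  obtain B where B: "0 < B" "\<And>x. \<bar>\<phi> x\<bar> <= B" "\<And>x. norm (grad \<phi> x) <= B" by (rule test_fun_bounded[OF \<phi>]) (rule that)
  have int: "integrable (lebesgue_on \<Omega>) (\<lambda>x. k x * \<phi> x)" if k: "set_integrable lebesgue S k" for k :: "'a => real"
  proof -
   have k': "integrable lebesgue (\<lambda>x. indicator S x * k x)" using k by (simp add: set_integrable_def)
   have [measurable]: "\<phi> \<in> borel_measurable lebesgue" using borel_measurable_test(1)[OF \<phi>] by (intro measurable_completion) auto
   have "integrable lebesgue (\<lambda>x. (indicator S x * k x) * \<phi> x)"
   proof (rule Bochner_Integration.integrable_bound)
    show "integrable lebesgue (\<lambda>x. B * (indicator S x * k x))" using k' by simp
    show "(\<lambda>x. (indicator S x * k x) * \<phi> x) \<in> borel_measurable lebesgue" by (rule borel_measurable_times[OF borel_measurable_integrable[OF k']]) simp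
    show "AE x in lebesgue. norm ((indicator S x * k x) * \<phi> x) <= norm (B * (indicator S x * k x))"
    proof (intro AE_I2)
     fix x
     have "\<bar>\<phi> x\<bar> * \<bar>indicator S x * k x\<bar> <= B * \<bar>indicator S x * k x\<bar>" using B by (intro mult_right_mono) auto
     then show "norm ((indicator S x * k x) * \<phi> x) <= norm (B * (indicator S x * k x))"
      using B by (simp add: abs_mult mult.commute mult.left_commute)
    qed
   qed
   moreover have "(\<lambda>x. (indicator S x * k x) * \<phi> x) = (\<lambda>x. indicator \<Omega> x *\<^sub>R (k x * \<phi> x))"
    using S(2,3) by (auto simp: fun_eq_iff indicator_def)
   ultimately show ?thesis using \<Omega> by (subst integrable_restrict_space) auto
  qed
  have "(LINT x|(lebesgue_on \<Omega>). u x * frechet_derivative \<phi> (at x) i) = - (LINT x|(lebesgue_on \<Omega>). (g x \<bullet> i) * \<phi> x)"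
   using g \<phi> i unfolding weak_grad_def by blast
  moreover have "(LINT x|(lebesgue_on \<Omega>). u x * frechet_derivative \<phi> (at x) i) = - (LINT x|(lebesgue_on \<Omega>). (h x \<bullet> i) * \<phi> x)"
   using h \<phi> i unfolding weak_grad_def by blast
  ultimately have "(LINT x|(lebesgue_on \<Omega>). (g x \<bullet> i) * \<phi> x) = (LINT x|(lebesgue_on \<Omega>). (h x \<bullet> i) * \<phi> x)" by simp
  then show "(LINT x|(lebesgue_on \<Omega>). ((g x - h x) \<bullet> i) * \<phi> x) = 0"
   using int[OF gi[OF S(1,2)]] int[OF hi[OF S(1,2)]] by (simp add: inner_diff_left left_diff_distrib)
 qed
 have "AE x in lebesgue. \<forall>i\<in>Basis. x \<in> \<Omega> --> (g x - h x) \<bullet> i = 0"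
  using i by (subst AE_ball_countable) (auto intro: countable_finite)
 then have "AE x in lebesgue. x \<in> \<Omega> --> g x = h x"
 proof eventually_elim
  case (elim x)
  then show ?case using euclidean_all_zero_iff[of "g x - h x"] by auto
 qed
 then show ?thesis using \<Omega> by (subst AE_restrict_space_iff) auto
qed

lemma weak_grad_zero:
 assumes "open \<Omega>" "AE x in lebesgue_on \<Omega>. u x = 0" shows "weak_grad \<Omega> u (\<lambda>_. 0)"
 unfolding weak_grad_def
proof (intro conjI allI impI ballI)
 fix K assume K: "compact K \<and> K \<subseteq> \<Omega>"
 have "AE x in lebesgue. x \<in> \<Omega> --> u x = 0" using assms by (subst (asm) AE_restrict_space_iff) auto
 then have ae: "AE x in lebesgue. 0 = indicator K x *\<^sub>R u x" by eventually_elim (use K in \<open>auto simp: indicator_def\<close>)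
 have "(\<lambda>x. indicator K x *\<^sub>R u x) \<in> borel_measurable lebesgue" by (rule borel_measurable_AE[OF _ ae]) auto
 then show "set_integrable lebesgue K u" unfolding set_integrable_def
  by (subst integrable_cong_AE[OF _ _ ae, symmetric]) auto
 show "set_integrable lebesgue K (\<lambda>x. 0 \<bullet> i)" for i :: 'a by (simp add: set_integrable_def)
next
 fix \<phi> and i :: 'a
 have "(LINT x|(lebesgue_on \<Omega>). u x * frechet_derivative \<phi> (at x) i) = 0"
  using assms(2) by (intro integral_eq_zero_AE) (auto elim: eventually_mono)
 then show "(LINT x|(lebesgue_on \<Omega>). u x * frechet_derivative \<phi> (at x) i) = - (LINT x|(lebesgue_on \<Omega>). (0 \<bullet> i) * \<phi> x)" by simp
qed

subsection \<open>Mollification by ball averages\<close>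

text \<open>A probability measure, so that the mean of u over the ball of radius s about x is the
  integral of \<open>u (x + s *\<^sub>R y)\<close> over y; this form suits both Fubini and a varying
  radius.\<close>

definition unif_ball :: "'a::euclidean_space measure" where
 "unif_ball = uniform_measure lborel (cball 0 1)"

lemma sets_unif_ball [simp, measurable_cong]: "sets unif_ball = sets borel"
 by (simp add: unif_ball_def)

lemma space_unif_ball [simp]: "space unif_ball = UNIV"
 by (simp add: unif_ball_def)

lemma emeasure_unit_ball: "emeasure lborel (cball 0 1 :: 'a::euclidean_space set) = ennreal (measure lborel (cball 0 1 :: 'a set))"
 using emeasure_bounded_finite[OF bounded_cball, of "0::'a" 1] by (intro emeasure_eq_ennreal_measure) (auto simp: less_top)

lemma measure_unit_ball_pos: "0 < measure lborel (cball 0 1 :: 'a::euclidean_space set)"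
 using content_cball_pos[of 1 "0::'a"] by simp

lemma emeasure_unif_ball: "emeasure (unif_ball :: 'a::euclidean_space measure) UNIV = 1"
proof -
 define v where "v = measure lborel (cball 0 1 :: 'a set)"
 have v: "0 < v" "emeasure lborel (cball 0 1 :: 'a set) = ennreal v"
  by (auto simp: v_def measure_unit_ball_pos emeasure_unit_ball)
 have "emeasure (unif_ball :: 'a measure) UNIV = ennreal v / ennreal v"
  unfolding unif_ball_def by (subst emeasure_uniform_measure) (auto simp: v(2))
 then show ?thesis using v by (simp add: divide_ennreal)
qed

interpretation unif_ball: finite_measure "unif_ball :: 'a::euclidean_space measure"
 by (rule finite_measureI) (simp add: emeasure_unif_ball)

lemma measure_unif_ball: "measure (unif_ball :: 'a::euclidean_space measure) UNIV = 1"
 by (simp add: measure_def emeasure_unif_ball)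

interpretation unif_lborel: pair_sigma_finite "unif_ball :: 'a::euclidean_space measure" "lborel :: 'b::euclidean_space measure" ..

lemma AE_unif_ball: "AE y in (unif_ball :: 'a::euclidean_space measure). norm y <= 1"
 unfolding unif_ball_def by (rule AE_uniform_measureI) auto

abbreviation ball_const :: "'a::euclidean_space itself => real => real" where
 "ball_const _ s \<equiv> 1 / (measure lborel (cball 0 1 :: 'a set) * s ^ DIM('a))"

text \<open>A change of variables, followed by enlarging the ball to the whole space. The factor is
  the inverse volume of a ball of radius s and is the source of the loss s^-N, with N the
  dimension.\<close>

lemma nn_integral_unif_ball_le:
 fixes h :: "'a::euclidean_space => ennreal"
 assumes [measurable]: "h \<in> borel_measurable borel" and s: "0 < s"
 shows "(\<integral>\<^sup>+y. h (x + s *\<^sub>R y) \<partial>unif_ball) <= ennreal (ball_const TYPE('a) s) * (\<integral>\<^sup>+z. h z \<partial>lborel)"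
proof -
 define v where "v = measure lborel (cball 0 1 :: 'a set)"
 have v: "0 < v" "emeasure lborel (cball 0 1 :: 'a set) = ennreal v"
  by (auto simp: v_def measure_unit_ball_pos emeasure_unit_ball)
 have "(\<integral>\<^sup>+z. h z \<partial>lborel) = ennreal (s ^ DIM('a)) * (\<integral>\<^sup>+y. h (x + s *\<^sub>R y) \<partial>lborel)"
  using s by (subst lborel_affine[of s x]) (auto simp: nn_integral_density nn_integral_distr nn_integral_cmult)
 then have *: "ennreal (1 / s ^ DIM('a)) * (\<integral>\<^sup>+z. h z \<partial>lborel) = (\<integral>\<^sup>+y. h (x + s *\<^sub>R y) \<partial>lborel)"
  using s by (simp add: mult.assoc[symmetric] ennreal_mult[symmetric])
 have "(\<integral>\<^sup>+y. h (x + s *\<^sub>R y) \<partial>unif_ball) = (\<integral>\<^sup>+y. h (x + s *\<^sub>R y) * indicator (cball 0 1) y \<partial>lborel) / ennreal v"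
  unfolding unif_ball_def v(2)[symmetric] by (rule nn_integral_uniform_measure) auto
 also have "... <= (\<integral>\<^sup>+y. h (x + s *\<^sub>R y) \<partial>lborel) / ennreal v"
  by (intro divide_right_mono_ennreal nn_integral_mono) (auto simp: indicator_def)
 also have "... = (ennreal (1 / s ^ DIM('a)) * (\<integral>\<^sup>+z. h z \<partial>lborel)) * ennreal (1 / v)"
  using v by (simp add: * divide_ennreal_def inverse_ennreal inverse_eq_divide)
 also have "... = ennreal (1 / (v * s ^ DIM('a))) * (\<integral>\<^sup>+z. h z \<partial>lborel)"
  using v s by (simp add: mult.commute[of _ "ennreal (1/v)"] mult.assoc[symmetric] ennreal_mult[symmetric])
 finally show ?thesis by (simp add: v_def)
qed

lemma nn_integral_unif_ball_translate:
 fixes h :: "'a::euclidean_space => ennreal"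
 assumes [measurable]: "h \<in> borel_measurable borel"
 shows "(\<integral>\<^sup>+x. \<integral>\<^sup>+y. h (x + s *\<^sub>R y) \<partial>unif_ball \<partial>lborel) = (\<integral>\<^sup>+z. h z \<partial>lborel)"
proof -
 have "(\<integral>\<^sup>+x. \<integral>\<^sup>+y. h (x + s *\<^sub>R y) \<partial>unif_ball \<partial>lborel) = (\<integral>\<^sup>+y. \<integral>\<^sup>+x. h (x + s *\<^sub>R y) \<partial>lborel \<partial>unif_ball)"
  by (rule unif_lborel.Fubini'[where f="\<lambda>y x. h (x + s *\<^sub>R y)"]) measurable
 also have "... = (\<integral>\<^sup>+y. (\<integral>\<^sup>+z. h z \<partial>lborel) \<partial>(unif_ball :: 'a measure))"
 proof -
  have "(\<integral>\<^sup>+x. h (x + c) \<partial>lborel) = (\<integral>\<^sup>+z. h z \<partial>lborel)" for c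
   using lborel_nn_integral_translate[OF assms, of c] by (simp add: add.commute)
  then show ?thesis by simp
 qed
 also have "... = (\<integral>\<^sup>+z. h z \<partial>lborel)" by (simp add: emeasure_unif_ball)
 finally show ?thesis .
qed

definition mollify :: "real => ('a::euclidean_space => real) => 'a => real" where
 "mollify \<eta> u x = (LINT y|unif_ball. u (x + \<eta> *\<^sub>R y))"

text \<open>The mean over the unit ball of the integrals of G along the rays x + s y, 0 <= s <=
  \<eta>, but with the radial integral outside: for fixed s the inner mean over a ball can then be
  estimated by itself.\<close>

definition line_avg :: "real => ('a::euclidean_space => ennreal) => 'a => ennreal" where
 "line_avg \<eta> G x = (\<integral>\<^sup>+s. indicator {0..\<eta>} s * (\<integral>\<^sup>+y. G (x + s *\<^sub>R y) \<partial>unif_ball) \<partial>lborel)"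

lemma borel_measurable_line_avg [measurable]:
 assumes [measurable]: "G \<in> borel_measurable borel"
 shows "line_avg \<eta> G \<in> borel_measurable borel"
 unfolding line_avg_def by measurable

lemma borel_measurable_mollify [measurable]:
 assumes [measurable]: "u \<in> borel_measurable borel"
 shows "mollify \<eta> u \<in> borel_measurable borel"
 unfolding mollify_def by measurable

lemma line_avg_mono_add:
 assumes [measurable]: "G1 \<in> borel_measurable borel" "G2 \<in> borel_measurable borel"
  and le: "\<And>x. G x <= G1 x + G2 x"
 shows "line_avg \<eta> G x <= line_avg \<eta> G1 x + line_avg \<eta> G2 x"
proof -
 have "line_avg \<eta> G x <= (\<integral>\<^sup>+s. indicator {0..\<eta>} s * ((\<integral>\<^sup>+y. G1 (x + s *\<^sub>R y) + G2 (x + s *\<^sub>R y) \<partial>unif_ball)) \<partial>lborel)"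
  unfolding line_avg_def by (intro nn_integral_mono mult_left_mono le) auto
 also have "... = line_avg \<eta> G1 x + line_avg \<eta> G2 x"
  unfolding line_avg_def by (simp add: nn_integral_add distrib_left)
 finally show ?thesis .
qed

lemma nn_integral_line_avg:
 fixes G :: "'a::euclidean_space => ennreal"
 assumes [measurable]: "G \<in> borel_measurable borel" and \<eta>: "0 <= \<eta>"
 shows "(\<integral>\<^sup>+x. line_avg \<eta> G x \<partial>lborel) = ennreal \<eta> * (\<integral>\<^sup>+z. G z \<partial>lborel)"
proof -
 have "(\<integral>\<^sup>+x. line_avg \<eta> G x \<partial>lborel) = (\<integral>\<^sup>+s. \<integral>\<^sup>+x. indicator {0..\<eta>} s * (\<integral>\<^sup>+y. G (x + s *\<^sub>R y) \<partial>unif_ball) \<partial>lborel \<partial>lborel)"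
  unfolding line_avg_def by (rule lborel_pair.Fubini'[where f="\<lambda>s x. indicator {0..\<eta>} s * (\<integral>\<^sup>+y. G (x + s *\<^sub>R y) \<partial>unif_ball)"]) measurable
 also have "... = (\<integral>\<^sup>+s. indicator {0..\<eta>} s * (\<integral>\<^sup>+z. G z \<partial>lborel) \<partial>lborel)"
  by (simp add: nn_integral_cmult nn_integral_unif_ball_translate)
 also have "... = ennreal \<eta> * (\<integral>\<^sup>+z. G z \<partial>lborel)"
  using \<eta> by (simp add: nn_integral_multc)
 finally show ?thesis .
qed

lemma test_fun_increment:
 assumes "test_fun \<Omega> \<phi>" "0 <= \<eta>"
 shows "ennreal \<bar>\<phi> (x + \<eta> *\<^sub>R v) - \<phi> x\<bar> <= (\<integral>\<^sup>+s. indicator {0..\<eta>} s * ennreal (norm v * norm (grad \<phi> (x + s *\<^sub>R v))) \<partial>lborel)"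
proof -
 let ?f = "\<lambda>s. grad \<phi> (x + s *\<^sub>R v) \<bullet> v"
 have cont: "isCont ?f s" for s
  using continuous_on_grad[OF assms(1), of UNIV]
  by (intro continuous_intros isCont_o2[where f="\<lambda>s. x + s *\<^sub>R v" and g="grad \<phi>"]) (auto simp: continuous_on_eq_continuous_at)
 have "has_bochner_integral lborel (\<lambda>s. ?f s * indicator {0..\<eta>} s) (\<phi> (x + \<eta> *\<^sub>R v) - \<phi> (x + 0 *\<^sub>R v))"
  by (rule has_bochner_integral_FTC_Icc_real[OF assms(2) test_fun_line_deriv[OF assms(1)] cont])
 then have int: "integrable lborel (\<lambda>s. ?f s * indicator {0..\<eta>} s)"
   and eq: "(LINT s|lborel. ?f s * indicator {0..\<eta>} s) = \<phi> (x + \<eta> *\<^sub>R v) - \<phi> x"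
  by (auto simp: has_bochner_integral_iff)
 have "ennreal \<bar>\<phi> (x + \<eta> *\<^sub>R v) - \<phi> x\<bar> <= (\<integral>\<^sup>+s. ennreal (norm (?f s * indicator {0..\<eta>} s)) \<partial>lborel)"
  using integral_norm_bound_ennreal[OF int] by (simp only: eq real_norm_def)
 also have "... <= (\<integral>\<^sup>+s. indicator {0..\<eta>} s * ennreal (norm v * norm (grad \<phi> (x + s *\<^sub>R v))) \<partial>lborel)"
 proof (intro nn_integral_mono)
  fix s
  have "\<bar>?f s\<bar> <= norm v * norm (grad \<phi> (x + s *\<^sub>R v))" using Cauchy_Schwarz_ineq2 by (metis mult.commute)
  then show "ennreal (norm (?f s * indicator {0..\<eta>} s)) <= indicator {0..\<eta>} s * ennreal (norm v * norm (grad \<phi> (x + s *\<^sub>R v)))"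
   by (auto simp: indicator_def intro!: ennreal_leI)
 qed
 finally show ?thesis .
qed

lemma unif_ball_integrable:
 fixes u :: "'a::euclidean_space => real"
 assumes [measurable]: "u \<in> borel_measurable borel" and "(\<integral>\<^sup>+z. ennreal \<bar>u z\<bar> \<partial>lborel) < \<infinity>" "0 < \<eta>"
 shows "integrable unif_ball (\<lambda>y. u (x + \<eta> *\<^sub>R y))"
proof (rule integrableI_bounded)
 have "(\<integral>\<^sup>+y. ennreal (norm (u (x + \<eta> *\<^sub>R y))) \<partial>unif_ball) <= ennreal (ball_const TYPE('a) \<eta>) * (\<integral>\<^sup>+z. ennreal \<bar>u z\<bar> \<partial>lborel)"
  using nn_integral_unif_ball_le[of "\<lambda>z. ennreal \<bar>u z\<bar>" \<eta> x] assms(3) by simp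
 also have "... < \<infinity>" using assms(2) by (simp add: ennreal_mult_less_top)
 finally show "(\<integral>\<^sup>+y. ennreal (norm (u (x + \<eta> *\<^sub>R y))) \<partial>unif_ball) < \<infinity>" .
qed measurable

lemma mollify_diff_le:
 fixes u v :: "'a::euclidean_space => real"
 assumes [measurable]: "u \<in> borel_measurable borel" "v \<in> borel_measurable borel"
  and fin: "(\<integral>\<^sup>+z. ennreal \<bar>u z\<bar> \<partial>lborel) < \<infinity>" "(\<integral>\<^sup>+z. ennreal \<bar>v z\<bar> \<partial>lborel) < \<infinity>" and \<eta>: "0 < \<eta>"
 shows "ennreal \<bar>mollify \<eta> u x - mollify \<eta> v x\<bar> <= (\<integral>\<^sup>+y. ennreal \<bar>u (x + \<eta> *\<^sub>R y) - v (x + \<eta> *\<^sub>R y)\<bar> \<partial>unif_ball)"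
proof -
 have i: "integrable unif_ball (\<lambda>y. u (x + \<eta> *\<^sub>R y))" "integrable unif_ball (\<lambda>y. v (x + \<eta> *\<^sub>R y))"
  using fin \<eta> by (auto intro!: unif_ball_integrable)
 have "mollify \<eta> u x - mollify \<eta> v x = (LINT y|unif_ball. u (x + \<eta> *\<^sub>R y) - v (x + \<eta> *\<^sub>R y))"
  unfolding mollify_def using i by simp
 then show ?thesis using integral_norm_bound_ennreal[of unif_ball "\<lambda>y. u (x + \<eta> *\<^sub>R y) - v (x + \<eta> *\<^sub>R y)"] i by simp
qed

lemma test_fun_fin: assumes "test_fun \<Omega> \<phi>" 
 shows "(\<integral>\<^sup>+z. ennreal \<bar>\<phi> z\<bar> \<partial>lborel) < \<infinity>" "(\<integral>\<^sup>+z. ennreal (norm (grad \<phi> z)) \<partial>lborel) < \<infinity>"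
 using integrable_test[OF assms] by (auto simp: integrable_iff_bounded)

text \<open>\<phi>(x) minus its mean is the mean of \<phi>(x) - \<phi>(x + \<eta> y). Each
  difference is an integral along a ray, |y| <= 1 drops out, and Fubini moves the radial integral
  outside.\<close>

lemma test_fun_mollify:
 fixes \<phi> :: "'a::euclidean_space => real"
 assumes \<phi>: "test_fun \<Omega> \<phi>" and \<eta>: "0 < \<eta>"
 shows "ennreal \<bar>\<phi> x - mollify \<eta> \<phi> x\<bar> <= line_avg \<eta> (\<lambda>z. ennreal (norm (grad \<phi> z))) x"
proof -
 note [measurable] = borel_measurable_test[OF \<phi>]
 have i: "integrable unif_ball (\<lambda>y. \<phi> (x + \<eta> *\<^sub>R y))"
  by (intro unif_ball_integrable test_fun_fin[OF \<phi>] \<eta>) measurable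
 have eq: "\<phi> x - mollify \<eta> \<phi> x = (LINT y|unif_ball. \<phi> x - \<phi> (x + \<eta> *\<^sub>R y))"
  unfolding mollify_def using i by (simp add: measure_unif_ball)
 have "ennreal \<bar>\<phi> x - mollify \<eta> \<phi> x\<bar> <= (\<integral>\<^sup>+y. ennreal \<bar>\<phi> x - \<phi> (x + \<eta> *\<^sub>R y)\<bar> \<partial>unif_ball)"
  unfolding eq using integral_norm_bound_ennreal[of unif_ball "\<lambda>y. \<phi> x - \<phi> (x + \<eta> *\<^sub>R y)"] i by simp
 also have "... <= (\<integral>\<^sup>+y. \<integral>\<^sup>+s. indicator {0..\<eta>} s * ennreal (norm (grad \<phi> (x + s *\<^sub>R y))) \<partial>lborel \<partial>unif_ball)"
 proof (rule nn_integral_mono_AE, use AE_unif_ball in eventually_elim)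
  case (elim y)
  have "ennreal \<bar>\<phi> x - \<phi> (x + \<eta> *\<^sub>R y)\<bar> <= (\<integral>\<^sup>+s. indicator {0..\<eta>} s * ennreal (norm y * norm (grad \<phi> (x + s *\<^sub>R y))) \<partial>lborel)"
   using test_fun_increment[OF \<phi>, of \<eta> x y] \<eta> by (simp add: abs_minus_commute)
  also have "... <= (\<integral>\<^sup>+s. indicator {0..\<eta>} s * ennreal (norm (grad \<phi> (x + s *\<^sub>R y))) \<partial>lborel)"
   using elim by (intro nn_integral_mono mult_left_mono ennreal_leI mult_left_le_one_le) auto
  finally show ?case .
 qed
 also have "... = (\<integral>\<^sup>+s. \<integral>\<^sup>+y. indicator {0..\<eta>} s * ennreal (norm (grad \<phi> (x + s *\<^sub>R y))) \<partial>unif_ball \<partial>lborel)"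
  by (rule unif_lborel.Fubini'[symmetric, where f="\<lambda>y s. indicator {0..\<eta>} s * ennreal (norm (grad \<phi> (x + s *\<^sub>R y)))"]) measurable
 also have "... = line_avg \<eta> (\<lambda>z. ennreal (norm (grad \<phi> z))) x"
  unfolding line_avg_def by (simp add: nn_integral_cmult)
 finally show ?thesis .
qed

text \<open>The increment in the direction x' - x is integrated inside the mean. The ball mean of
  the gradient costs the factor \<open>ball_const\<close>, which is harmless because \<eta> stays
  fixed when equicontinuity is used.\<close>

lemma test_fun_mollify_lipschitz:
 fixes \<phi> :: "'a::euclidean_space => real"
 assumes \<phi>: "test_fun \<Omega> \<phi>" and \<eta>: "0 < \<eta>"
 shows "ennreal \<bar>mollify \<eta> \<phi> x' - mollify \<eta> \<phi> x\<bar> <= ennreal (norm (x' - x) * ball_const TYPE('a) \<eta>) * (\<integral>\<^sup>+z. ennreal (norm (grad \<phi> z)) \<partial>lborel)"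
proof -
 note [measurable] = borel_measurable_test[OF \<phi>]
 have i: "integrable unif_ball (\<lambda>y. \<phi> (x + \<eta> *\<^sub>R y))" for x
  by (intro unif_ball_integrable test_fun_fin[OF \<phi>] \<eta>) measurable
 let ?v = "x' - x" and ?B = "ball_const TYPE('a) \<eta>"
 have B: "?B >= 0" using \<eta> by (simp add: less_imp_le[OF measure_unit_ball_pos])
 have eq: "mollify \<eta> \<phi> x' - mollify \<eta> \<phi> x = (LINT y|unif_ball. \<phi> (x' + \<eta> *\<^sub>R y) - \<phi> (x + \<eta> *\<^sub>R y))"
  unfolding mollify_def using i[of x] i[of x'] by simp
 have "ennreal \<bar>mollify \<eta> \<phi> x' - mollify \<eta> \<phi> x\<bar> <= (\<integral>\<^sup>+y. ennreal \<bar>\<phi> (x' + \<eta> *\<^sub>R y) - \<phi> (x + \<eta> *\<^sub>R y)\<bar> \<partial>unif_ball)"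
  unfolding eq using integral_norm_bound_ennreal[of unif_ball "\<lambda>y. \<phi> (x' + \<eta> *\<^sub>R y) - \<phi> (x + \<eta> *\<^sub>R y)"] i[of x] i[of x'] by simp
 also have "... <= (\<integral>\<^sup>+y. \<integral>\<^sup>+s. indicator {0..1} s * ennreal (norm ?v * norm (grad \<phi> ((x + s *\<^sub>R ?v) + \<eta> *\<^sub>R y))) \<partial>lborel \<partial>unif_ball)"
 proof (intro nn_integral_mono)
  fix y :: 'a
  have e1: "(x + \<eta> *\<^sub>R y) + 1 *\<^sub>R ?v = x' + \<eta> *\<^sub>R y"
   and e2: "\<And>s. (x + \<eta> *\<^sub>R y) + s *\<^sub>R ?v = (x + s *\<^sub>R ?v) + \<eta> *\<^sub>R y" by auto
  from test_fun_increment[OF \<phi>, of 1 "x + \<eta> *\<^sub>R y" ?v, unfolded e1 e2]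
  show "ennreal \<bar>\<phi> (x' + \<eta> *\<^sub>R y) - \<phi> (x + \<eta> *\<^sub>R y)\<bar> <= (\<integral>\<^sup>+s. indicator {0..1} s * ennreal (norm ?v * norm (grad \<phi> ((x + s *\<^sub>R ?v) + \<eta> *\<^sub>R y))) \<partial>lborel)"
   by simp
 qed
 also have "... = (\<integral>\<^sup>+s. \<integral>\<^sup>+y. indicator {0..1} s * ennreal (norm ?v * norm (grad \<phi> ((x + s *\<^sub>R ?v) + \<eta> *\<^sub>R y))) \<partial>unif_ball \<partial>lborel)"
  by (rule unif_lborel.Fubini'[symmetric, where f="\<lambda>y s. indicator {0..1} s * ennreal (norm ?v * norm (grad \<phi> ((x + s *\<^sub>R ?v) + \<eta> *\<^sub>R y)))"]) measurable
 also have "... = (\<integral>\<^sup>+s. indicator {0..1::real} s * (ennreal (norm ?v) * (\<integral>\<^sup>+y. ennreal (norm (grad \<phi> ((x + s *\<^sub>R ?v) + \<eta> *\<^sub>R y))) \<partial>unif_ball)) \<partial>lborel)"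
  by (simp add: ennreal_mult nn_integral_cmult)
 also have "... <= (\<integral>\<^sup>+s. indicator {0..1::real} s * (ennreal (norm ?v) * (ennreal ?B * (\<integral>\<^sup>+z. ennreal (norm (grad \<phi> z)) \<partial>lborel))) \<partial>lborel)"
  using nn_integral_unif_ball_le[of "\<lambda>z. ennreal (norm (grad \<phi> z))" \<eta>] \<eta> by (intro nn_integral_mono mult_left_mono) auto
 also have "... = ennreal (norm ?v) * (ennreal ?B * (\<integral>\<^sup>+z. ennreal (norm (grad \<phi> z)) \<partial>lborel))"
  by (subst nn_integral_multc) auto
 finally have "ennreal \<bar>mollify \<eta> \<phi> x' - mollify \<eta> \<phi> x\<bar> <= ennreal (norm ?v) * (ennreal ?B * (\<integral>\<^sup>+z. ennreal (norm (grad \<phi> z)) \<partial>lborel))" .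
 moreover have "ennreal (norm ?v * ?B) = ennreal (norm ?v) * ennreal ?B" by (rule ennreal_mult) (use B in simp_all)
 ultimately show ?thesis by (simp only: mult.assoc)
qed

text \<open>Moving by 2R in a coordinate direction leaves the ball of radius R, hence \<Omega>, and
  there \<phi> vanishes. Integrating the gradient along that segment and then over x gives the
  constant 2R.\<close>

lemma test_fun_Poincare:
 fixes \<phi> :: "'a::euclidean_space => real"
 assumes \<phi>: "test_fun \<Omega> \<phi>" and R: "\<And>x. x \<in> \<Omega> ==> norm x < R" "0 < R"
 shows "(\<integral>\<^sup>+x. ennreal \<bar>\<phi> x\<bar> \<partial>lborel) <= ennreal (2 * R) * (\<integral>\<^sup>+z. ennreal (norm (grad \<phi> z)) \<partial>lborel)"
proof -
 note [measurable] = borel_measurable_test[OF \<phi>]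
 obtain b :: 'a where b: "b \<in> Basis" using nonempty_Basis by blast
 have "(\<integral>\<^sup>+x. ennreal \<bar>\<phi> x\<bar> \<partial>lborel) <= (\<integral>\<^sup>+x. \<integral>\<^sup>+s. indicator {0..2*R} s * ennreal (norm (grad \<phi> (x + s *\<^sub>R b))) \<partial>lborel \<partial>lborel)"
 proof (intro nn_integral_mono)
  fix x
  show "ennreal \<bar>\<phi> x\<bar> <= (\<integral>\<^sup>+s. indicator {0..2*R} s * ennreal (norm (grad \<phi> (x + s *\<^sub>R b))) \<partial>lborel)"
  proof (cases "x \<in> \<Omega>")
   case True
   have "norm ((2*R) *\<^sub>R b) <= norm (x + (2*R) *\<^sub>R b) + norm x" by (metis add.commute norm_triangle_sub add_diff_cancel_right' norm_minus_commute)
   then have "R < norm (x + (2*R) *\<^sub>R b)" using R(1)[OF True] R(2) b by simp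
   then have "x + (2*R) *\<^sub>R b \<notin> \<Omega>" using R(1) by fastforce
   then show ?thesis using test_fun_increment[OF \<phi>, of "2*R" x b] R b test_fun_outside(1)[OF \<phi>] by simp
  qed (simp add: test_fun_outside[OF \<phi>])
 qed
 also have "... = (\<integral>\<^sup>+s. \<integral>\<^sup>+x. indicator {0..2*R} s * ennreal (norm (grad \<phi> (x + s *\<^sub>R b))) \<partial>lborel \<partial>lborel)"
  by (rule lborel_pair.Fubini'[where f="\<lambda>s x. indicator {0..2*R} s * ennreal (norm (grad \<phi> (x + s *\<^sub>R b)))"]) measurable
 also have "... = (\<integral>\<^sup>+s. indicator {0..2*R} s * (\<integral>\<^sup>+z. ennreal (norm (grad \<phi> z)) \<partial>lborel) \<partial>lborel)"
 proof -
  have "(\<integral>\<^sup>+x. ennreal (norm (grad \<phi> (x + c))) \<partial>lborel) = (\<integral>\<^sup>+z. ennreal (norm (grad \<phi> z)) \<partial>lborel)" for c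
   using lborel_nn_integral_translate[of "\<lambda>z. ennreal (norm (grad \<phi> z))" c] by (simp add: add.commute)
  then show ?thesis by (simp add: nn_integral_cmult)
 qed
 also have "... = ennreal (2 * R) * (\<integral>\<^sup>+z. ennreal (norm (grad \<phi> z)) \<partial>lborel)"
  using R by (simp add: nn_integral_multc)
 finally show ?thesis .
qed

text \<open>Borel pairs on the whole space, approximated only in mean: the estimates for test
  functions pass to the limit here, before any exponent enters.\<close>

locale W11_pair =
 fixes \<Omega> :: "'a::euclidean_space set" and u :: "'a => real" and g :: "'a => 'a" and \<phi> :: "nat => 'a => real"
 assumes u_meas [measurable]: "u \<in> borel_measurable borel" and g_meas [measurable]: "g \<in> borel_measurable borel"
  and test: "\<And>k. test_fun \<Omega> (\<phi> k)"
  and lim_u: "(\<lambda>k. \<integral>\<^sup>+x. ennreal \<bar>\<phi> k x - u x\<bar> \<partial>lborel) \<longlonglongrightarrow> 0"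
  and lim_g: "(\<lambda>k. \<integral>\<^sup>+x. ennreal (norm (grad (\<phi> k) x - g x)) \<partial>lborel) \<longlonglongrightarrow> 0"
begin

lemma test_measurable [measurable]: "\<phi> k \<in> borel_measurable borel" "grad (\<phi> k) \<in> borel_measurable borel"
 using borel_measurable_test[OF test] by auto

lemma u_fin: "(\<integral>\<^sup>+z. ennreal \<bar>u z\<bar> \<partial>lborel) < \<infinity>"
proof -
 obtain k where k: "(\<integral>\<^sup>+x. ennreal \<bar>\<phi> k x - u x\<bar> \<partial>lborel) < 1"
  using order_tendstoD(2)[OF lim_u, of 1] by (auto simp: eventually_sequentially)
 have "(\<integral>\<^sup>+z. ennreal \<bar>u z\<bar> \<partial>lborel) <= (\<integral>\<^sup>+z. ennreal \<bar>\<phi> k z\<bar> + ennreal \<bar>\<phi> k z - u z\<bar> \<partial>lborel)"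
  by (intro nn_integral_mono) (auto simp: ennreal_plus[symmetric] simp del: ennreal_plus intro!: ennreal_leI)
 also have "... = (\<integral>\<^sup>+z. ennreal \<bar>\<phi> k z\<bar> \<partial>lborel) + (\<integral>\<^sup>+z. ennreal \<bar>\<phi> k z - u z\<bar> \<partial>lborel)"
  by (rule nn_integral_add) auto
 also have "... < \<infinity>" using test_fun_fin(1)[OF test, of k] k by (auto simp: less_top[symmetric])
 finally show ?thesis .
qed

lemma grad_le: "(\<integral>\<^sup>+z. ennreal (norm (grad (\<phi> k) z)) \<partial>lborel) <= (\<integral>\<^sup>+z. ennreal (norm (g z)) \<partial>lborel) + (\<integral>\<^sup>+z. ennreal (norm (grad (\<phi> k) z - g z)) \<partial>lborel)"
proof -
 have "(\<integral>\<^sup>+z. ennreal (norm (grad (\<phi> k) z)) \<partial>lborel) <= (\<integral>\<^sup>+z. ennreal (norm (g z)) + ennreal (norm (grad (\<phi> k) z - g z)) \<partial>lborel)"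
  by (intro nn_integral_mono) (auto simp: ennreal_plus[symmetric] simp del: ennreal_plus intro!: ennreal_leI norm_triangle_sub)
 also have "... = (\<integral>\<^sup>+z. ennreal (norm (g z)) \<partial>lborel) + (\<integral>\<^sup>+z. ennreal (norm (grad (\<phi> k) z - g z)) \<partial>lborel)"
  by (rule nn_integral_add) auto
 finally show ?thesis .
qed

lemma Poincare:
 assumes R: "\<And>x. x \<in> \<Omega> ==> norm x < R" "0 < R"
 shows "(\<integral>\<^sup>+z. ennreal \<bar>u z\<bar> \<partial>lborel) <= ennreal (2 * R) * (\<integral>\<^sup>+z. ennreal (norm (g z)) \<partial>lborel)"
proof -
 let ?a = "\<lambda>k. \<integral>\<^sup>+x. ennreal \<bar>\<phi> k x - u x\<bar> \<partial>lborel" and ?b = "\<lambda>k. \<integral>\<^sup>+x. ennreal (norm (grad (\<phi> k) x - g x)) \<partial>lborel"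
 let ?g = "\<integral>\<^sup>+z. ennreal (norm (g z)) \<partial>lborel"
 have "(\<integral>\<^sup>+z. ennreal \<bar>u z\<bar> \<partial>lborel) <= ennreal (2*R) * (?g + ?b k) + ?a k" for k
 proof -
  have "(\<integral>\<^sup>+z. ennreal \<bar>u z\<bar> \<partial>lborel) <= (\<integral>\<^sup>+z. ennreal \<bar>\<phi> k z\<bar> + ennreal \<bar>\<phi> k z - u z\<bar> \<partial>lborel)"
   by (intro nn_integral_mono) (auto simp: ennreal_plus[symmetric] simp del: ennreal_plus intro!: ennreal_leI)
  also have "... = (\<integral>\<^sup>+z. ennreal \<bar>\<phi> k z\<bar> \<partial>lborel) + ?a k"
   by (rule nn_integral_add) auto
  also have "... <= ennreal (2*R) * (\<integral>\<^sup>+z. ennreal (norm (grad (\<phi> k) z)) \<partial>lborel) + ?a k"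
   using R by (intro add_right_mono test_fun_Poincare[OF test]) auto
  also have "... <= ennreal (2*R) * (?g + ?b k) + ?a k"
   by (intro add_right_mono mult_left_mono grad_le) auto
  finally show ?thesis .
 qed
 moreover have "(\<lambda>k. ennreal (2*R) * (?g + ?b k) + ?a k) \<longlonglongrightarrow> ennreal (2*R) * (?g + 0) + 0"
  by (intro tendsto_add ennreal_tendsto_cmult tendsto_const lim_u lim_g) auto
 ultimately show ?thesis using LIMSEQ_le_const by fastforce
qed

text \<open>The inequality holds up to the error \<open>e k\<close> of the approximating test
  function, whose integral tends to 0. The truncated difference \<open>L x - T x\<close> therefore
  integrates to 0, and the pointwise statement follows almost everywhere.\<close>

lemma mollify_approx:
 assumes \<eta>: "0 < \<eta>"
 shows "AE x in lborel. ennreal \<bar>u x - mollify \<eta> u x\<bar> <= line_avg \<eta> (\<lambda>z. ennreal (norm (g z))) x"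
proof -
 let ?a = "\<lambda>k. \<integral>\<^sup>+x. ennreal \<bar>\<phi> k x - u x\<bar> \<partial>lborel" and ?b = "\<lambda>k. \<integral>\<^sup>+x. ennreal (norm (grad (\<phi> k) x - g x)) \<partial>lborel"
 define L where "L x = ennreal \<bar>u x - mollify \<eta> u x\<bar>" for x
 define T where "T = line_avg \<eta> (\<lambda>z. ennreal (norm (g z)))"
 define e where "e k x = (ennreal \<bar>\<phi> k x - u x\<bar> + (\<integral>\<^sup>+y. ennreal \<bar>\<phi> k (x + \<eta> *\<^sub>R y) - u (x + \<eta> *\<^sub>R y)\<bar> \<partial>unif_ball))
  + line_avg \<eta> (\<lambda>z. ennreal (norm (grad (\<phi> k) z - g z))) x" for k x
 have [measurable]: "L \<in> borel_measurable borel" "T \<in> borel_measurable borel" "e k \<in> borel_measurable borel" for k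
  unfolding L_def T_def e_def by measurable
 have le: "L x <= T x + e k x" for k x
 proof -
  have "L x <= ennreal (\<bar>\<phi> k x - u x\<bar> + \<bar>mollify \<eta> (\<phi> k) x - mollify \<eta> u x\<bar> + \<bar>\<phi> k x - mollify \<eta> (\<phi> k) x\<bar>)"
   unfolding L_def by (intro ennreal_leI) linarith
  also have "... = ennreal \<bar>\<phi> k x - u x\<bar> + ennreal \<bar>mollify \<eta> (\<phi> k) x - mollify \<eta> u x\<bar> + ennreal \<bar>\<phi> k x - mollify \<eta> (\<phi> k) x\<bar>"
   by simp
  also have "... <= ennreal \<bar>\<phi> k x - u x\<bar> + (\<integral>\<^sup>+y. ennreal \<bar>\<phi> k (x + \<eta> *\<^sub>R y) - u (x + \<eta> *\<^sub>R y)\<bar> \<partial>unif_ball)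
    + line_avg \<eta> (\<lambda>z. ennreal (norm (grad (\<phi> k) z))) x"
   by (intro add_mono order_refl mollify_diff_le test_fun_mollify[OF test \<eta>] test_fun_fin(1)[OF test] u_fin \<eta>) measurable
  also have "... <= ennreal \<bar>\<phi> k x - u x\<bar> + (\<integral>\<^sup>+y. ennreal \<bar>\<phi> k (x + \<eta> *\<^sub>R y) - u (x + \<eta> *\<^sub>R y)\<bar> \<partial>unif_ball)
    + (T x + line_avg \<eta> (\<lambda>z. ennreal (norm (grad (\<phi> k) z - g z))) x)"
   unfolding T_def
   by (intro add_left_mono line_avg_mono_add) (auto simp: ennreal_plus[symmetric] simp del: ennreal_plus intro!: ennreal_leI norm_triangle_sub)
  also have "... = T x + e k x" by (simp add: e_def add_ac)
  finally show ?thesis .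
 qed
 have int_e: "(\<integral>\<^sup>+x. e k x \<partial>lborel) = (?a k + ?a k) + ennreal \<eta> * ?b k" for k
 proof -
  have "(\<integral>\<^sup>+x. e k x \<partial>lborel) = (\<integral>\<^sup>+x. ennreal \<bar>\<phi> k x - u x\<bar> + (\<integral>\<^sup>+y. ennreal \<bar>\<phi> k (x + \<eta> *\<^sub>R y) - u (x + \<eta> *\<^sub>R y)\<bar> \<partial>unif_ball) \<partial>lborel)
   + (\<integral>\<^sup>+x. line_avg \<eta> (\<lambda>z. ennreal (norm (grad (\<phi> k) z - g z))) x \<partial>lborel)"
   unfolding e_def by (rule nn_integral_add) measurable
  also have "(\<integral>\<^sup>+x. line_avg \<eta> (\<lambda>z. ennreal (norm (grad (\<phi> k) z - g z))) x \<partial>lborel) = ennreal \<eta> * ?b k"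
   using \<eta> by (intro nn_integral_line_avg) auto
  also have "(\<integral>\<^sup>+x. ennreal \<bar>\<phi> k x - u x\<bar> + (\<integral>\<^sup>+y. ennreal \<bar>\<phi> k (x + \<eta> *\<^sub>R y) - u (x + \<eta> *\<^sub>R y)\<bar> \<partial>unif_ball) \<partial>lborel)
   = ?a k + (\<integral>\<^sup>+x. (\<integral>\<^sup>+y. ennreal \<bar>\<phi> k (x + \<eta> *\<^sub>R y) - u (x + \<eta> *\<^sub>R y)\<bar> \<partial>unif_ball) \<partial>lborel)"
   by (rule nn_integral_add) measurable
  also have "(\<integral>\<^sup>+x. (\<integral>\<^sup>+y. ennreal \<bar>\<phi> k (x + \<eta> *\<^sub>R y) - u (x + \<eta> *\<^sub>R y)\<bar> \<partial>unif_ball) \<partial>lborel) = ?a k"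
   by (rule nn_integral_unif_ball_translate) measurable
  finally show ?thesis .
 qed
 have "(\<integral>\<^sup>+x. L x - T x \<partial>lborel) <= (?a k + ?a k) + ennreal \<eta> * ?b k" for k
 proof -
  have "(\<integral>\<^sup>+x. L x - T x \<partial>lborel) <= (\<integral>\<^sup>+x. e k x \<partial>lborel)"
   using le[of _ k] by (intro nn_integral_mono) (simp add: ennreal_minus_le_iff L_def)
  then show ?thesis by (simp add: int_e)
 qed
 moreover have "(\<lambda>k. (?a k + ?a k) + ennreal \<eta> * ?b k) \<longlonglongrightarrow> (0 + 0) + ennreal \<eta> * 0"
  by (intro tendsto_add ennreal_tendsto_cmult lim_u lim_g) auto
 ultimately have "(\<integral>\<^sup>+x. L x - T x \<partial>lborel) <= 0" using LIMSEQ_le_const by fastforce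
 then have "(\<integral>\<^sup>+x. L x - T x \<partial>lborel) = 0" by simp
 then have "AE x in lborel. L x - T x = 0" by (subst (asm) nn_integral_0_iff_AE) auto
 then show ?thesis by eventually_elim (simp add: L_def T_def ennreal_minus_eq_0)
qed

lemma mollify_bound:
 assumes "0 < \<eta>"
 shows "ennreal \<bar>mollify \<eta> u x\<bar> <= ennreal (ball_const TYPE('a) \<eta>) * (\<integral>\<^sup>+z. ennreal \<bar>u z\<bar> \<partial>lborel)"
proof -
 have "ennreal \<bar>mollify \<eta> u x\<bar> <= (\<integral>\<^sup>+y. ennreal \<bar>u (x + \<eta> *\<^sub>R y)\<bar> \<partial>unif_ball)"
  unfolding mollify_def
  using integral_norm_bound_ennreal[OF unif_ball_integrable[OF u_meas u_fin assms], of x] by simp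
 also have "... <= ennreal (ball_const TYPE('a) \<eta>) * (\<integral>\<^sup>+z. ennreal \<bar>u z\<bar> \<partial>lborel)"
  by (rule nn_integral_unif_ball_le) (use assms in auto)
 finally show ?thesis .
qed

lemma mollify_lipschitz:
 assumes \<eta>: "0 < \<eta>"
 shows "ennreal \<bar>mollify \<eta> u x' - mollify \<eta> u x\<bar> <= ennreal (norm (x' - x) * ball_const TYPE('a) \<eta>) * (\<integral>\<^sup>+z. ennreal (norm (g z)) \<partial>lborel)"
proof -
 let ?a = "\<lambda>k. \<integral>\<^sup>+x. ennreal \<bar>\<phi> k x - u x\<bar> \<partial>lborel" and ?b = "\<lambda>k. \<integral>\<^sup>+x. ennreal (norm (grad (\<phi> k) x - g x)) \<partial>lborel"
 let ?g = "\<integral>\<^sup>+z. ennreal (norm (g z)) \<partial>lborel" and ?B = "ball_const TYPE('a) \<eta>"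
 have m: "ennreal \<bar>mollify \<eta> (\<phi> k) x - mollify \<eta> u x\<bar> <= ennreal ?B * ?a k" for k x
 proof -
  have "ennreal \<bar>mollify \<eta> (\<phi> k) x - mollify \<eta> u x\<bar> <= (\<integral>\<^sup>+y. ennreal \<bar>\<phi> k (x + \<eta> *\<^sub>R y) - u (x + \<eta> *\<^sub>R y)\<bar> \<partial>unif_ball)"
   by (intro mollify_diff_le test_fun_fin(1)[OF test] u_fin \<eta>) measurable
  also have "... <= ennreal ?B * ?a k" by (rule nn_integral_unif_ball_le[of "\<lambda>z. ennreal \<bar>\<phi> k z - u z\<bar>"]) (use \<eta> in auto)
  finally show ?thesis .
 qed
 have "ennreal \<bar>mollify \<eta> u x' - mollify \<eta> u x\<bar> <= ennreal (norm (x' - x) * ?B) * (?g + ?b k) + (ennreal ?B * ?a k + ennreal ?B * ?a k)" for k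
 proof -
  have "ennreal \<bar>mollify \<eta> u x' - mollify \<eta> u x\<bar> <= ennreal (\<bar>mollify \<eta> (\<phi> k) x' - mollify \<eta> (\<phi> k) x\<bar> + (\<bar>mollify \<eta> (\<phi> k) x' - mollify \<eta> u x'\<bar> + \<bar>mollify \<eta> (\<phi> k) x - mollify \<eta> u x\<bar>))"
   by (intro ennreal_leI) linarith
  also have "... = ennreal \<bar>mollify \<eta> (\<phi> k) x' - mollify \<eta> (\<phi> k) x\<bar> + (ennreal \<bar>mollify \<eta> (\<phi> k) x' - mollify \<eta> u x'\<bar> + ennreal \<bar>mollify \<eta> (\<phi> k) x - mollify \<eta> u x\<bar>)"
   by simp
  also have "... <= ennreal (norm (x' - x) * ?B) * (\<integral>\<^sup>+z. ennreal (norm (grad (\<phi> k) z)) \<partial>lborel) + (ennreal ?B * ?a k + ennreal ?B * ?a k)"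
   by (intro add_mono m test_fun_mollify_lipschitz[OF test \<eta>])
  also have "... <= ennreal (norm (x' - x) * ?B) * (?g + ?b k) + (ennreal ?B * ?a k + ennreal ?B * ?a k)"
   by (intro add_right_mono mult_left_mono grad_le) auto
  finally show ?thesis .
 qed
 moreover have "(\<lambda>k. ennreal (norm (x' - x) * ?B) * (?g + ?b k) + (ennreal ?B * ?a k + ennreal ?B * ?a k)) \<longlonglongrightarrow> ennreal (norm (x' - x) * ?B) * (?g + 0) + (ennreal ?B * 0 + ennreal ?B * 0)"
  by (intro tendsto_add ennreal_tendsto_cmult tendsto_const lim_u lim_g) auto
 ultimately show ?thesis using LIMSEQ_le_const by fastforce
qed

end

text \<open>In contrast to \<open>le_add_powr\<close> the exact power t^(1-p) is kept, because t is
  optimised later.\<close>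

lemma le_add_powr':
 fixes t d p :: real
 assumes "0 < t" "0 <= d" "1 <= p"
 shows "d <= t + t powr (1 - p) * d powr p"
proof (cases "d <= t")
 case True
 then show ?thesis by (simp add: add_increasing2)
next
 case False
 then have d: "d > 0" "d >= t" using assms by auto
 have "d = d powr (1 - p) * d powr p" using d by (simp add: powr_add[symmetric])
 also have "... <= t powr (1 - p) * d powr p" using assms d by (intro mult_right_mono powr_mono2') auto
 finally show ?thesis using assms by simp
qed

text \<open>A converse to Young's inequality: the hypothesis, available for all \<delta>, is used at
  \<delta> = (Z/\<mu>)^(1/\<alpha>), where \<delta> \<mu> and \<delta>^(1-\<alpha>) Z are
  equal.\<close>

lemma powr_optimize:
 fixes r \<mu> Z C \<alpha> :: real
 assumes r: "0 <= r" and \<mu>: "0 < \<mu>" and Z: "0 < Z" and C: "0 <= C" and \<alpha>: "1 <= \<alpha>"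
  and le: "\<And>\<delta>. 0 < \<delta> ==> r <= \<delta> * \<mu> + \<delta> powr (1 - \<alpha>) * C * Z"
 shows "r powr \<alpha> <= (1 + C) powr \<alpha> * \<mu> powr (\<alpha> - 1) * Z"
proof -
 define \<delta> where "\<delta> = (Z/\<mu>) powr (1/\<alpha>)"
 have \<delta>: "\<delta> > 0" "\<delta> powr \<alpha> = Z/\<mu>" using \<mu> Z \<alpha> by (auto simp: \<delta>_def powr_powr)
 have "\<delta> powr (1 - \<alpha>) = \<delta> / (Z/\<mu>)" using \<delta> by (simp add: powr_diff)
 then have "\<delta> powr (1 - \<alpha>) * C * Z = C * (\<delta> * \<mu>)" using \<mu> Z by simp
 then have "r <= \<delta> * \<mu> + C * (\<delta> * \<mu>)" using le[OF \<delta>(1)] by linarith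
 then have "r <= (1 + C) * (\<delta> * \<mu>)" by (simp add: distrib_right)
 then have "r powr \<alpha> <= ((1 + C) * (\<delta> * \<mu>)) powr \<alpha>" using r \<alpha> by (intro powr_mono2) auto
 also have "... = (1 + C) powr \<alpha> * (\<delta> powr \<alpha> * \<mu> powr \<alpha>)" using C \<delta> \<mu> by (simp add: powr_mult)
 also have "\<delta> powr \<alpha> * \<mu> powr \<alpha> = \<mu> powr (\<alpha> - 1) * Z" using \<mu> by (simp add: \<delta>(2) powr_diff)
 finally show ?thesis by (simp add: mult.assoc)
qed

lemma nn_integral_powr_from_0:
 assumes \<kappa>: "0 < \<kappa>" and \<eta>: "0 <= \<eta>"
 shows "(\<integral>\<^sup>+s. indicator {0..\<eta>} s * ennreal (s powr (\<kappa> - 1)) \<partial>lborel) = ennreal (\<eta> powr \<kappa> / \<kappa>)"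
proof -
 have "((\<lambda>s. s powr (\<kappa> - 1)) has_integral (\<eta> powr (\<kappa> - 1 + 1) / (\<kappa> - 1 + 1))) {0..\<eta>}"
  using \<kappa> \<eta> by (intro has_integral_powr_from_0) auto
 then have "((\<lambda>s. if s \<in> {0..\<eta>} then s powr (\<kappa> - 1) else 0) has_integral (\<eta> powr \<kappa> / \<kappa>)) UNIV"
  by (subst has_integral_restrict_UNIV) simp
 then have "(\<integral>\<^sup>+s. ennreal (if s \<in> {0..\<eta>} then s powr (\<kappa> - 1) else 0) \<partial>lborel) = ennreal (\<eta> powr \<kappa> / \<kappa>)"
  by (intro nn_integral_has_integral_lborel) auto
 moreover have "(\<integral>\<^sup>+s. ennreal (if s \<in> {0..\<eta>} then s powr (\<kappa> - 1) else 0) \<partial>lborel) = (\<integral>\<^sup>+s. indicator {0..\<eta>} s * ennreal (s powr (\<kappa> - 1)) \<partial>lborel)"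
  by (intro nn_integral_cong) (auto simp: indicator_def)
 ultimately show ?thesis by simp
qed

lemma nn_integral_linear:
 assumes "f \<in> borel_measurable M" "h \<in> borel_measurable M"
 shows "(\<integral>\<^sup>+x. c * f x + d * h x \<partial>M) = c * (\<integral>\<^sup>+x. f x \<partial>M) + d * (\<integral>\<^sup>+x. h x \<partial>M)"
 using assms by (simp add: nn_integral_add nn_integral_cmult)

subsection \<open>Subcritical embedding\<close>

text \<open>\<open>P\<close> is the exponent of the gradient, \<open>A\<close> that of the target
  space. Within distance \<open>\<eta>0\<close> the number q = \<open>P x - \<omega>\<close> is a
  lower bound for \<open>P\<close>. Divided by the dimension N and by \<open>A x\<close>, the
  assumption \<open>subcrit\<close> reads 1/q - 1/A <= (1 - \<kappa>)/N: the Sobolev condition with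
  margin \<open>\<kappa>\<close>.\<close>

locale subcritical =
 fixes \<Omega> :: "'a::euclidean_space set" and P A :: "'a => real" and R \<eta>0 \<omega> \<kappa> hi a0 :: real
 assumes \<Omega>_open: "open \<Omega>" and R: "0 < R" "\<And>x. x \<in> \<Omega> ==> norm x < R"
  and P_meas [measurable]: "P \<in> borel_measurable borel" and A_meas [measurable]: "A \<in> borel_measurable borel"
  and \<eta>0: "0 < \<eta>0" "\<eta>0 <= 1" and \<kappa>: "0 < \<kappa>" "\<kappa> < 1" and \<omega>: "0 <= \<omega>"
  and q1: "\<And>x. x \<in> \<Omega> ==> 1 <= P x - \<omega>" and P_close: "\<And>x z. x \<in> \<Omega> ==> z \<in> \<Omega> ==> norm (z - x) <= \<eta>0 ==> P x - \<omega> <= P z"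
  and A_hi: "\<And>x. x \<in> \<Omega> ==> A x <= hi" and qA: "\<And>x. x \<in> \<Omega> ==> P x - \<omega> <= A x"
  and a0: "1 < a0" "\<And>x. x \<in> \<Omega> ==> a0 <= A x"
  and subcrit: "\<And>x. x \<in> \<Omega> ==> real DIM('a) * (A x / (P x - \<omega>) - 1) <= (1 - \<kappa>) * A x"
begin

lemma \<Omega>_borel [measurable]: "\<Omega> \<in> sets borel" using \<Omega>_open by simp

abbreviation Amod :: "('a => real) => ennreal" where
 "Amod v \<equiv> \<integral>\<^sup>+x. indicator \<Omega> x * ennreal (\<bar>v x\<bar> powr A x) \<partial>lborel"

definition vol :: real where "vol = measure lborel \<Omega>"

lemma emeasure_\<Omega>: "emeasure lborel \<Omega> = ennreal vol" and vol_nonneg: "0 <= vol"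
proof -
 have "bounded \<Omega>" using R(2) by (auto simp: bounded_iff intro: less_imp_le)
 then show "emeasure lborel \<Omega> = ennreal vol"
  using emeasure_bounded_finite[of \<Omega>] by (auto simp: vol_def emeasure_eq_ennreal_measure less_top)
qed (simp add: vol_def)

text \<open>The factor \<open>2 powr hi\<close> stems from balancing at the constant exponent in
  \<open>ball_average_bound\<close>; the other factor bounds a power of the ball mean of a gradient
  whose modular is at most K.\<close>

definition Cst :: "real => real" where
 "Cst K = 2 powr hi * (1 + K / measure lborel (cball 0 1 :: 'a set)) powr hi"

text \<open>Bounds the \<open>A\<close>-modular of u minus its mean over balls of radius \<eta>, for
  gradients of modular at most K. The quotient \<eta>^\<kappa>/\<kappa> is the integral of
  s^(\<kappa>-1) over [0,\<eta>], so the bound tends to 0 with \<eta>.\<close>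

definition err :: "real => real => real" where
 "err K \<eta> = (1 + Cst K) powr hi * (\<eta> powr \<kappa> / \<kappa>) powr a0 * (vol + K)"

end

locale subcritical_pair = subcritical \<Omega> P A R \<eta>0 \<omega> \<kappa> hi a0 + W11_pair \<Omega> u g \<phi>
 for \<Omega> :: "'a::euclidean_space set" and P A R \<eta>0 \<omega> \<kappa> hi a0 u g \<phi> +
 fixes K :: real
 assumes g_outside: "\<And>x. x \<notin> \<Omega> ==> g x = 0" and K: "0 <= K"
  and g_mod: "(\<integral>\<^sup>+x. ennreal (norm (g x) powr P x) \<partial>lborel) <= ennreal K"
begin

lemma g_L1: "(\<integral>\<^sup>+z. ennreal (norm (g z)) \<partial>lborel) <= ennreal (vol + K)"
proof -
 have "(\<integral>\<^sup>+z. ennreal (norm (g z)) \<partial>lborel) <= (\<integral>\<^sup>+z. indicator \<Omega> z + ennreal (norm (g z) powr P z) \<partial>lborel)"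
 proof (intro nn_integral_mono)
  fix z
  show "ennreal (norm (g z)) <= indicator \<Omega> z + ennreal (norm (g z) powr P z)"
  proof (cases "z \<in> \<Omega>")
   case True
   then have "norm (g z) <= 1 + 1 powr (1 - P z) * norm (g z) powr P z"
    using q1[OF True] \<omega> by (intro le_add_powr') auto
   then show ?thesis using True by (simp add: ennreal_plus[symmetric] ennreal_1[symmetric] ennreal_leI del: ennreal_plus ennreal_1)
  qed (simp add: g_outside)
 qed
 also have "... = ennreal vol + (\<integral>\<^sup>+z. ennreal (norm (g z) powr P z) \<partial>lborel)"
  by (subst nn_integral_add) (auto simp: emeasure_\<Omega>)
 also have "... <= ennreal vol + ennreal K" by (intro add_left_mono g_mod)
 finally show ?thesis using vol_nonneg K by simp
qed

text \<open>The summand 1 absorbs the error in |g|^q <= 1 + |g|^P and makes m >= 1, so that its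
  powers can be compared.\<close>

definition m :: "real => 'a => ennreal" where
 "m s x = 1 + (\<integral>\<^sup>+y. ennreal (norm (g (x + s *\<^sub>R y)) powr P (x + s *\<^sub>R y)) \<partial>unif_ball)"

lemma m_measurable [measurable]: "(\<lambda>(s,x). m s x) \<in> borel_measurable (borel \<Otimes>\<^sub>M borel)"
 unfolding m_def by measurable

lemma m_measurable' [measurable]: "(\<lambda>s. m s x) \<in> borel_measurable borel" "(\<lambda>x. m s x) \<in> borel_measurable borel"
 unfolding m_def by measurable

lemma Cst_nonneg: "0 <= Cst K" by (simp add: Cst_def)

text \<open>The gain of integrability: averaging over a ball of radius \<open>s\<close> costs at most \<open>s\<^sup>-\<^sup>N\<close> in the
 supremum, and this loss is integrable in \<open>s\<close> exactly in the subcritical range.\<close>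

lemma ball_average_bound:
 assumes x: "x \<in> \<Omega>" and s: "0 < s" "s <= \<eta>0" and \<delta>: "0 < \<delta>"
 shows "(\<integral>\<^sup>+y. ennreal (norm (g (x + s *\<^sub>R y))) \<partial>unif_ball)
  <= ennreal (s powr (\<kappa> - 1)) * (ennreal \<delta> + ennreal (\<delta> powr (1 - A x) * Cst K) * m s x)"
proof -
 define v where "v = measure lborel (cball 0 1 :: 'a set)"
 define q where "q = P x - \<omega>"
 define \<alpha> where "\<alpha> = A x"
 define n where "n = real DIM('a)"
 define K1 where "K1 = 1 + K / v"
 have v: "0 < v" by (simp add: v_def measure_unit_ball_pos)
 have q: "1 <= q" "q <= \<alpha>" using q1[OF x] qA[OF x] by (auto simp: q_def \<alpha>_def)
 have \<alpha>: "1 < \<alpha>" "\<alpha> <= hi" using a0(1) a0(2)[OF x] A_hi[OF x] by (auto simp: \<alpha>_def)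
 have sub: "n * (\<alpha> / q - 1) <= (1 - \<kappa>) * \<alpha>" using subcrit[OF x] by (simp add: n_def \<alpha>_def q_def)
 have K1: "1 <= K1" using K v by (simp add: K1_def)
 have s1: "s <= 1" using s \<eta>0 by simp
 \<comment> \<open>The loss of averaging: a mean over a ball of radius s is at most a multiple of
   s^-n, and the summand 1 is at most s^-n because s <= 1.\<close>
 have m_le: "m s x <= ennreal (K1 * s powr (- n))"
 proof -
  have sn: "s ^ DIM('a) > 0" "s ^ DIM('a) <= 1" using s s1 by (auto intro: power_le_one)
  have "m s x <= 1 + ennreal (1 / (v * s ^ DIM('a))) * (\<integral>\<^sup>+z. ennreal (norm (g z) powr P z) \<partial>lborel)"
   unfolding m_def v_def using s by (intro add_left_mono nn_integral_unif_ball_le[of "\<lambda>z. ennreal (norm (g z) powr P z)"]) auto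
  also have "... <= 1 + ennreal (1 / (v * s ^ DIM('a))) * ennreal K"
   by (intro add_left_mono mult_left_mono g_mod) auto
  also have "... = ennreal (1 + K / (v * s ^ DIM('a)))"
   using K v sn by (simp add: ennreal_mult[symmetric])
  also have "... <= ennreal (K1 * s powr (- n))"
  proof (rule ennreal_leI)
   have "s powr (- n) = 1 / s ^ DIM('a)" using s by (simp add: n_def powr_minus powr_realpow inverse_eq_divide)
   then have "K1 * s powr (- n) = 1 / s ^ DIM('a) + K / (v * s ^ DIM('a))" by (simp add: K1_def add_divide_distrib)
   moreover have "1 <= 1 / s ^ DIM('a)" using sn by simp
   ultimately show "1 + K / (v * s ^ DIM('a)) <= K1 * s powr (- n)" by linarith
  qed
  finally show ?thesis .
 qed
 have m_ge: "1 <= m s x" by (simp add: m_def)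
 define mr where "mr = enn2real (m s x)"
 have m_eq: "m s x = ennreal mr" unfolding mr_def using m_le by (metis ennreal_enn2real ennreal_less_top le_less_trans)
 have mr: "1 <= mr" using m_ge by (simp add: m_eq)
 have mr_le: "mr <= K1 * s powr (- n)" using m_le mr K1 by (simp add: m_eq ennreal_le_iff2)
 let ?a = "\<integral>\<^sup>+y. ennreal (norm (g (x + s *\<^sub>R y))) \<partial>unif_ball"
 have a_le: "?a <= ennreal (t + t powr (1 - q) * mr)" if t: "0 < t" for t
 proof -
  have "?a <= (\<integral>\<^sup>+y. ennreal t + ennreal (t powr (1 - q)) * (1 + ennreal (norm (g (x + s *\<^sub>R y)) powr P (x + s *\<^sub>R y))) \<partial>unif_ball)"
  proof (rule nn_integral_mono_AE, use AE_unif_ball in eventually_elim)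
   case (elim y)
   define z where "z = x + s *\<^sub>R y"
   have "norm (g z) powr q <= 1 + norm (g z) powr P z"
   proof (cases "z \<in> \<Omega>")
    case True
    have "norm (s *\<^sub>R y) <= \<eta>0 * 1" using elim s by (simp del: mult_1_right) (intro mult_mono; simp)
    then have "q <= P z" using P_close[OF x True] by (simp add: z_def q_def)
    then show ?thesis
    proof (cases "norm (g z) <= 1")
     case True
     then have "norm (g z) powr q <= 1" using q by (intro powr_le1) auto
     then show ?thesis by (simp add: add_increasing2)
    next
     case False
     then have "norm (g z) powr q <= norm (g z) powr P z" using \<open>q <= P z\<close> by (intro powr_mono) auto
     then show ?thesis by simp
    qed
   qed (simp add: g_outside)
   then have "t powr (1 - q) * norm (g z) powr q <= t powr (1 - q) * (1 + norm (g z) powr P z)" by (intro mult_left_mono) auto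
   then have "norm (g z) <= t + t powr (1 - q) * (1 + norm (g z) powr P z)"
    using le_add_powr'[OF t _ q(1), of "norm (g z)"] by simp
   then have "ennreal (norm (g z)) <= ennreal (t + t powr (1 - q) * (1 + norm (g z) powr P z))" by (rule ennreal_leI)
   also have "... = ennreal t + ennreal (t powr (1 - q)) * (1 + ennreal (norm (g z) powr P z))"
    using t by (simp add: ennreal_plus ennreal_mult)
   finally show ?case by (simp add: z_def)
  qed
  also have "... = ennreal t + ennreal (t powr (1 - q)) * m s x"
   unfolding m_def by (simp add: nn_integral_add nn_integral_cmult emeasure_unif_ball)
  also have "... = ennreal (t + t powr (1 - q) * mr)" using t mr by (simp add: m_eq ennreal_mult ennreal_plus)
  finally show ?thesis .
 qed
 define ar where "ar = enn2real ?a"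
 have a_eq: "?a = ennreal ar" unfolding ar_def using a_le[of 1] by (metis ennreal_enn2real ennreal_less_top le_less_trans zero_less_one)
 have ar: "0 <= ar" by (simp add: ar_def)
 \<comment> \<open>The bound holds for all t and is optimised; with \<mu> = 1 this is Jensen's
   inequality for the constant exponent q, up to the factor 2^q.\<close>
 have "ar powr q <= (1 + 1) powr q * 1 powr (q - 1) * mr"
 proof (rule powr_optimize)
  show "ar <= t * 1 + t powr (1 - q) * 1 * mr" if t: "0 < t" for t
  proof -
   have "0 <= t + t powr (1 - q) * mr" using t mr by simp
   then show ?thesis using a_le[OF t] by (simp add: a_eq ennreal_le_iff)
  qed
 qed (use ar mr q in auto)
 then have arq: "ar powr q <= 2 powr q * mr" by simp
 have "ar powr \<alpha> = (ar powr q) powr (\<alpha> / q)" using q by (simp add: powr_powr)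
 also have "... <= (2 powr q * mr) powr (\<alpha> / q)" using arq q \<alpha> by (intro powr_mono2) auto
 also have "... = 2 powr \<alpha> * mr powr (\<alpha> / q)" using q mr by (simp add: powr_mult powr_powr)
 \<comment> \<open>One factor m is kept for the later integration over x; the remaining power
   \<alpha>/q - 1 is paid with the supremum bound \<open>mr_le\<close>.\<close>
 also have "mr powr (\<alpha> / q) = mr powr (\<alpha> / q - 1) * mr" using mr by (simp add: powr_diff)
 finally have ar1: "ar powr \<alpha> <= 2 powr \<alpha> * (mr powr (\<alpha> / q - 1) * mr)" .
 define \<beta> where "\<beta> = \<alpha> / q - 1"
 have \<beta>: "0 <= \<beta>" "\<beta> <= hi"
 proof -
  show "0 <= \<beta>" using q by (simp add: \<beta>_def)
  have "\<alpha> / q <= \<alpha>" using q \<alpha> by (simp add: divide_le_eq mult_le_cancel_left1)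
  then show "\<beta> <= hi" using \<alpha> by (simp add: \<beta>_def)
 qed
 \<comment> \<open>Normalised so that the weight s^(\<kappa>-1), integrable at 0, can be split off.
   In X^\<alpha> the powers of s add up to (1-\<kappa>) \<alpha> - n \<beta>, which is nonnegative
   by subcriticality, so they are bounded by 1.\<close>
 define X where "X = s powr (1 - \<kappa>) * ar"
 have X0: "0 <= X" using ar by (simp add: X_def)
 have "X powr \<alpha> = s powr ((1 - \<kappa>) * \<alpha>) * ar powr \<alpha>" using ar s by (simp add: X_def powr_mult powr_powr)
 also have "... <= s powr ((1 - \<kappa>) * \<alpha>) * (2 powr \<alpha> * (mr powr \<beta> * mr))"
  using ar1 by (intro mult_left_mono) (auto simp: \<beta>_def)
 also have "... <= s powr ((1 - \<kappa>) * \<alpha>) * (2 powr \<alpha> * ((K1 * s powr (- n)) powr \<beta> * mr))"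
  using mr mr_le \<beta> by (intro mult_left_mono mult_right_mono powr_mono2) auto
 also have "(K1 * s powr (- n)) powr \<beta> = K1 powr \<beta> * s powr (- (n * \<beta>))" using K1 s by (simp add: powr_mult powr_powr)
 also have "s powr ((1 - \<kappa>) * \<alpha>) * (2 powr \<alpha> * (K1 powr \<beta> * s powr (- (n * \<beta>)) * mr))
   = (s powr ((1 - \<kappa>) * \<alpha>) * s powr (- (n * \<beta>))) * (2 powr \<alpha> * K1 powr \<beta> * mr)" by (simp only: ac_simps)
 also have "s powr ((1 - \<kappa>) * \<alpha>) * s powr (- (n * \<beta>)) = s powr ((1 - \<kappa>) * \<alpha> - n * \<beta>)" using s by (simp add: powr_add[symmetric])
 also have "s powr ((1 - \<kappa>) * \<alpha> - n * \<beta>) * (2 powr \<alpha> * K1 powr \<beta> * mr) <= 1 * (2 powr hi * K1 powr hi * mr)"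
  using s s1 sub \<alpha> K1 \<beta> mr
  by (intro mult_mono powr_le1 powr_mono order_refl mult_nonneg_nonneg) (auto simp: \<beta>_def)
 finally have X\<alpha>: "X powr \<alpha> <= Cst K * mr" by (simp add: Cst_def K1_def v_def)
 have "X <= \<delta> + \<delta> powr (1 - \<alpha>) * X powr \<alpha>" using \<delta> X0 \<alpha> by (intro le_add_powr') auto
 also have "... <= \<delta> + \<delta> powr (1 - \<alpha>) * (Cst K * mr)" by (intro add_left_mono mult_left_mono X\<alpha>) auto
 finally have X: "X <= \<delta> + \<delta> powr (1 - \<alpha>) * Cst K * mr" by (simp add: mult.assoc)
 have "ar = s powr (\<kappa> - 1) * X" using s by (simp add: X_def mult.assoc[symmetric] powr_add[symmetric])
 also have "... <= s powr (\<kappa> - 1) * (\<delta> + \<delta> powr (1 - \<alpha>) * Cst K * mr)" by (intro mult_left_mono X) auto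
 finally have "?a <= ennreal (s powr (\<kappa> - 1) * (\<delta> + \<delta> powr (1 - \<alpha>) * Cst K * mr))" by (simp add: a_eq ennreal_leI)
 also have "... = ennreal (s powr (\<kappa> - 1)) * (ennreal \<delta> + ennreal (\<delta> powr (1 - \<alpha>) * Cst K) * ennreal mr)"
  using \<delta> mr Cst_nonneg by (simp add: ennreal_mult ennreal_plus)
 finally show ?thesis by (simp add: m_eq \<alpha>_def)
qed

text \<open>The ball estimate is integrated over the radii, \<delta> is optimised at each x
  separately, and Fubini with translation invariance bounds the integral of m over \<Omega> by vol +
  K.\<close>

lemma modular_mollify_error:
 assumes \<eta>: "0 < \<eta>" "\<eta> <= \<eta>0" and \<mu>1: "\<eta> powr \<kappa> / \<kappa> <= 1"
 shows "(Amod (\<lambda>x. u x - mollify \<eta> u x)) <= ennreal (err K \<eta>)"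
proof -
 define \<mu> where "\<mu> = \<eta> powr \<kappa> / \<kappa>"
 have \<mu>: "0 < \<mu>" "\<mu> <= 1" using \<eta> \<kappa> \<mu>1 by (auto simp: \<mu>_def)
 define Z where "Z x = (\<integral>\<^sup>+s. indicator {0..\<eta>} s * (ennreal (s powr (\<kappa> - 1)) * m s x) \<partial>lborel)" for x
 have [measurable]: "Z \<in> borel_measurable borel" unfolding Z_def m_def by measurable
 have \<mu>_int: "(\<integral>\<^sup>+s. indicator {0..\<eta>} s * ennreal (s powr (\<kappa> - 1)) \<partial>lborel) = ennreal \<mu>"
  unfolding \<mu>_def using \<kappa> \<eta> by (intro nn_integral_powr_from_0) auto
 \<comment> \<open>Optimising \<delta> requires Z > 0, which comes from m >= 1.\<close>
 have Z_ge: "ennreal \<mu> <= Z x" for x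
 proof -
  have "ennreal \<mu> = (\<integral>\<^sup>+s. indicator {0..\<eta>} s * (ennreal (s powr (\<kappa> - 1)) * 1) \<partial>lborel)" using \<mu>_int by simp
  also have "... <= Z x" unfolding Z_def by (intro nn_integral_mono mult_left_mono) (auto simp: m_def)
  finally show ?thesis .
 qed
 define c where "c = (1 + Cst K) powr hi * \<mu> powr (a0 - 1)"
 have c: "0 < c" using \<mu> Cst_nonneg by (auto simp: c_def add_pos_nonneg)
 have line: "line_avg \<eta> (\<lambda>z. ennreal (norm (g z))) x <= ennreal (\<delta> * \<mu>) + ennreal (\<delta> powr (1 - A x) * Cst K) * Z x"
  if x: "x \<in> \<Omega>" and \<delta>: "0 < \<delta>" for x \<delta>
 proof -
  have "line_avg \<eta> (\<lambda>z. ennreal (norm (g z))) x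
   <= (\<integral>\<^sup>+s. indicator {0..\<eta>} s * (ennreal (s powr (\<kappa> - 1)) * (ennreal \<delta> + ennreal (\<delta> powr (1 - A x) * Cst K) * m s x)) \<partial>lborel)"
   unfolding line_avg_def
  proof (rule nn_integral_mono_AE, use AE_lborel_singleton[of "0::real"] in eventually_elim)
   case (elim s)
   show ?case
   proof (cases "s \<in> {0..\<eta>}")
    case True
    then show ?thesis using ball_average_bound[OF x _ _ \<delta>, of s] elim \<eta> by simp
   qed simp
  qed
  also have "... = (\<integral>\<^sup>+s. ennreal \<delta> * (indicator {0..\<eta>} s * ennreal (s powr (\<kappa> - 1)))
     + ennreal (\<delta> powr (1 - A x) * Cst K) * (indicator {0..\<eta>} s * (ennreal (s powr (\<kappa> - 1)) * m s x)) \<partial>lborel)"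
   by (intro nn_integral_cong) (simp add: distrib_left ac_simps)
  also have "... = ennreal \<delta> * ennreal \<mu> + ennreal (\<delta> powr (1 - A x) * Cst K) * Z x"
   unfolding Z_def \<mu>_int[symmetric]
  proof (rule nn_integral_linear)
   show "(\<lambda>s. indicator {0..\<eta>} s * (ennreal (s powr (\<kappa> - 1)) * m s x)) \<in> borel_measurable lborel"
    using m_measurable'(1)[of x] by simp
  qed simp
  finally show ?thesis using \<delta> \<mu> by (simp add: ennreal_mult)
 qed
 have pt: "AE x in lborel. indicator \<Omega> x * ennreal (\<bar>u x - mollify \<eta> u x\<bar> powr A x) <= ennreal c * (indicator \<Omega> x * Z x)"
  using mollify_approx[OF \<eta>(1)]
 proof eventually_elim
  case (elim x)
  show ?case
  proof (cases "x \<in> \<Omega>")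
   case True
   show ?thesis
   proof (cases "Z x = top")
    case True
    then show ?thesis using c \<open>x \<in> \<Omega>\<close> by (simp add: ennreal_mult_top)
   next
    case False
    define zr where "zr = enn2real (Z x)"
    have Z_eq: "Z x = ennreal zr" using False by (simp add: zr_def less_top)
    have zr: "0 < zr" using Z_ge[of x] \<mu> by (simp add: Z_eq ennreal_le_iff2)
    define r where "r = \<bar>u x - mollify \<eta> u x\<bar>"
    have "r powr A x <= (1 + Cst K) powr A x * \<mu> powr (A x - 1) * zr"
    proof (rule powr_optimize)
     fix \<delta> :: real assume \<delta>: "0 < \<delta>"
     have "ennreal r <= ennreal (\<delta> * \<mu>) + ennreal (\<delta> powr (1 - A x) * Cst K) * ennreal zr"
      using elim line[OF \<open>x \<in> \<Omega>\<close> \<delta>] by (simp add: r_def Z_eq)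
     also have "... = ennreal (\<delta> * \<mu> + \<delta> powr (1 - A x) * Cst K * zr)"
      using \<delta> \<mu> zr Cst_nonneg by (simp add: ennreal_mult ennreal_plus)
     finally show "r <= \<delta> * \<mu> + \<delta> powr (1 - A x) * Cst K * zr"
      using \<delta> \<mu> zr Cst_nonneg by (subst (asm) ennreal_le_iff) auto
    qed (use a0(1) a0(2)[OF \<open>x \<in> \<Omega>\<close>] \<mu> zr Cst_nonneg in \<open>auto simp: r_def\<close>)
    also have "... <= c * zr"
     unfolding c_def using a0(1) a0(2)[OF \<open>x \<in> \<Omega>\<close>] A_hi[OF \<open>x \<in> \<Omega>\<close>] \<mu> zr Cst_nonneg
     by (intro mult_right_mono mult_mono powr_mono powr_mono') auto
    finally show ?thesis using \<open>x \<in> \<Omega>\<close> c zr by (simp add: Z_eq r_def ennreal_mult[symmetric] ennreal_leI)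
   qed
  qed simp
 qed
 have "(Amod (\<lambda>x. u x - mollify \<eta> u x)) <= (\<integral>\<^sup>+x. ennreal c * (indicator \<Omega> x * Z x) \<partial>lborel)"
  by (rule nn_integral_mono_AE[OF pt])
 also have "... = ennreal c * (\<integral>\<^sup>+x. indicator \<Omega> x * Z x \<partial>lborel)" by (rule nn_integral_cmult) measurable
 also have "(\<integral>\<^sup>+x. indicator \<Omega> x * Z x \<partial>lborel) = (\<integral>\<^sup>+x. \<integral>\<^sup>+s. indicator \<Omega> x * (indicator {0..\<eta>} s * (ennreal (s powr (\<kappa> - 1)) * m s x)) \<partial>lborel \<partial>lborel)"
  unfolding Z_def by (subst nn_integral_cmult) auto
 also have "... = (\<integral>\<^sup>+s. \<integral>\<^sup>+x. indicator \<Omega> x * (indicator {0..\<eta>} s * (ennreal (s powr (\<kappa> - 1)) * m s x)) \<partial>lborel \<partial>lborel)"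
  by (rule lborel_pair.Fubini'[where f="\<lambda>s x. indicator \<Omega> x * (indicator {0..\<eta>} s * (ennreal (s powr (\<kappa> - 1)) * m s x))"]) (unfold m_def, measurable)
 also have "... <= (\<integral>\<^sup>+s. (indicator {0..\<eta>} s * ennreal (s powr (\<kappa> - 1))) * ennreal (vol + K) \<partial>lborel)"
 proof (intro nn_integral_mono)
  fix s :: real
  have "(\<integral>\<^sup>+x. indicator \<Omega> x * m s x \<partial>lborel) <= (\<integral>\<^sup>+x. indicator \<Omega> x + (\<integral>\<^sup>+y. ennreal (norm (g (x + s *\<^sub>R y)) powr P (x + s *\<^sub>R y)) \<partial>unif_ball) \<partial>lborel)"
   unfolding m_def by (intro nn_integral_mono) (auto simp: indicator_def)
  also have "... = ennreal vol + (\<integral>\<^sup>+z. ennreal (norm (g z) powr P z) \<partial>lborel)"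
   using nn_integral_unif_ball_translate[of "\<lambda>z. ennreal (norm (g z) powr P z)" s]
   by (subst nn_integral_add) (auto simp: emeasure_\<Omega>)
  also have "... <= ennreal vol + ennreal K" by (intro add_left_mono g_mod)
  also have "... = ennreal (vol + K)" using vol_nonneg K by simp
  finally have le: "(\<integral>\<^sup>+x. indicator \<Omega> x * m s x \<partial>lborel) <= ennreal (vol + K)" .
  have "(\<integral>\<^sup>+x. indicator \<Omega> x * (indicator {0..\<eta>} s * (ennreal (s powr (\<kappa> - 1)) * m s x)) \<partial>lborel)
    = (\<integral>\<^sup>+x. (indicator {0..\<eta>} s * ennreal (s powr (\<kappa> - 1))) * (indicator \<Omega> x * m s x) \<partial>lborel)"
   by (intro nn_integral_cong) (simp add: ac_simps)
  also have "... = (indicator {0..\<eta>} s * ennreal (s powr (\<kappa> - 1))) * (\<integral>\<^sup>+x. indicator \<Omega> x * m s x \<partial>lborel)"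
   by (rule nn_integral_cmult) measurable
  also have "... <= (indicator {0..\<eta>} s * ennreal (s powr (\<kappa> - 1))) * ennreal (vol + K)" by (intro mult_left_mono le) auto
  finally show "(\<integral>\<^sup>+x. indicator \<Omega> x * (indicator {0..\<eta>} s * (ennreal (s powr (\<kappa> - 1)) * m s x)) \<partial>lborel) <= ..." .
 qed
 also have "(\<integral>\<^sup>+s. (indicator {0..\<eta>} s * ennreal (s powr (\<kappa> - 1))) * ennreal (vol + K) \<partial>lborel) = ennreal \<mu> * ennreal (vol + K)"
  by (subst nn_integral_multc) (auto simp: \<mu>_int)
 finally have "(Amod (\<lambda>x. u x - mollify \<eta> u x)) <= ennreal c * (ennreal \<mu> * ennreal (vol + K))"
  by (simp add: mult_left_mono)
 also have "... = ennreal (c * (\<mu> * (vol + K)))" using c \<mu> vol_nonneg K by (simp add: ennreal_mult[symmetric] del: ennreal_plus)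
 also have "c * (\<mu> * (vol + K)) = err K \<eta>"
  using \<mu> by (simp add: c_def err_def \<mu>_def[symmetric] powr_diff)
 finally show ?thesis .
qed

lemma mollify_bound_real:
 assumes \<eta>: "0 < \<eta>"
 shows "\<bar>mollify \<eta> u x\<bar> <= ball_const TYPE('a) \<eta> * (2 * R * (vol + K))"
proof -
 have B: "0 <= ball_const TYPE('a) \<eta>" using \<eta> by (simp add: less_imp_le[OF measure_unit_ball_pos])
 have "ennreal \<bar>mollify \<eta> u x\<bar> <= ennreal (ball_const TYPE('a) \<eta>) * (ennreal (2 * R) * ennreal (vol + K))"
  using mollify_bound[OF \<eta>] Poincare[OF R(2,1)] g_L1
  by (meson mult_left_mono order_trans zero_le)
 also have "... = ennreal (ball_const TYPE('a) \<eta> * (2 * R * (vol + K)))"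
  using B R vol_nonneg K by (subst (1 2) ennreal_mult) (auto intro!: mult_nonneg_nonneg)
 finally show ?thesis using B R vol_nonneg K by (subst (asm) ennreal_le_iff) (auto intro!: mult_nonneg_nonneg)
qed

lemma mollify_lipschitz_real:
 assumes \<eta>: "0 < \<eta>"
 shows "\<bar>mollify \<eta> u x' - mollify \<eta> u x\<bar> <= norm (x' - x) * (ball_const TYPE('a) \<eta> * (vol + K))"
proof -
 have B: "0 <= ball_const TYPE('a) \<eta>" using \<eta> by (simp add: less_imp_le[OF measure_unit_ball_pos])
 have "ennreal \<bar>mollify \<eta> u x' - mollify \<eta> u x\<bar> <= ennreal (norm (x' - x) * ball_const TYPE('a) \<eta>) * ennreal (vol + K)"
  using mollify_lipschitz[OF \<eta>] g_L1 by (meson mult_left_mono order_trans zero_le)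
 also have "... = ennreal (norm (x' - x) * (ball_const TYPE('a) \<eta> * (vol + K)))"
  using B vol_nonneg K by (subst ennreal_mult[symmetric]) (auto simp: mult.assoc intro!: mult_nonneg_nonneg)
 finally show ?thesis using B vol_nonneg K by (subst (asm) ennreal_le_iff) (auto intro!: mult_nonneg_nonneg)
qed

end

section \<open>Boundedness and compactness of the embedding\<close>

context subcritical
begin

lemma err_small:
 assumes K: "0 <= K" and \<epsilon>: "0 < \<epsilon>"
 obtains \<eta> where "0 < \<eta>" "\<eta> <= \<eta>0" "\<eta> powr \<kappa> / \<kappa> <= 1" "err K \<eta> <= \<epsilon>"
proof -
 define c where "c = (1 + Cst K) powr hi * (vol + K)"
 have c: "0 <= c" using vol_nonneg K by (simp add: c_def)
 define t where "t = min 1 (\<epsilon> / (c + 1))"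
 have t: "0 < t" "t <= 1" using \<epsilon> c by (auto simp: t_def)
 have "t * (c + 1) <= \<epsilon>" using c by (subst pos_le_divide_eq[symmetric]) (auto simp: t_def)
 then have tc: "t * c <= \<epsilon>" using t by (simp add: distrib_left)
 \<comment> \<open>This radius makes \<eta>^\<kappa>/\<kappa> <= t, and since t <= 1 < a0 the power
   a0 of that quotient is at most t as well.\<close>
 define \<eta> where "\<eta> = min \<eta>0 ((\<kappa> * t) powr (1/\<kappa>))"
 have \<eta>: "0 < \<eta>" "\<eta> <= \<eta>0" using \<eta>0 \<kappa> t by (auto simp: \<eta>_def)
 have "\<eta> powr \<kappa> <= ((\<kappa> * t) powr (1/\<kappa>)) powr \<kappa>" using \<eta> \<kappa> by (intro powr_mono2) (auto simp: \<eta>_def)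
 also have "... = \<kappa> * t" using \<kappa> t by (simp add: powr_powr)
 finally have \<mu>: "\<eta> powr \<kappa> / \<kappa> <= t" using \<kappa> by (simp add: pos_divide_le_eq mult.commute)
 have "(\<eta> powr \<kappa> / \<kappa>) powr a0 <= t powr a0" using \<mu> a0 \<eta> \<kappa> by (intro powr_mono2) auto
 also have "... <= t powr 1" using t a0 by (intro powr_mono') auto
 finally have "(\<eta> powr \<kappa> / \<kappa>) powr a0 <= t" using t by simp
 then have "(\<eta> powr \<kappa> / \<kappa>) powr a0 * c <= t * c" using c by (intro mult_right_mono)
 then have "err K \<eta> <= \<epsilon>" using tc by (simp add: err_def c_def ac_simps)
 then show thesis using that \<eta> \<mu> t by force
qed

text \<open>Hides the approximating sequence, so that bounds can be quantified over all pairs of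
  gradient modular at most K.\<close>

definition is_pair :: "real => ('a => real) => ('a => 'a) => bool" where
 "is_pair K u g \<longleftrightarrow> (\<exists>\<phi>. subcritical_pair \<Omega> P A R \<eta>0 \<omega> \<kappa> hi a0 u g \<phi> K)"

lemma is_pairD:
 assumes "is_pair K u g"
 shows "u \<in> borel_measurable borel" "g \<in> borel_measurable borel"
  "\<And>\<eta>. 0 < \<eta> ==> \<eta> <= \<eta>0 ==> \<eta> powr \<kappa> / \<kappa> <= 1 ==> (Amod (\<lambda>x. u x - mollify \<eta> u x)) <= ennreal (err K \<eta>)"
  "\<And>\<eta> x. 0 < \<eta> ==> \<bar>mollify \<eta> u x\<bar> <= ball_const TYPE('a) \<eta> * (2 * R * (vol + K))"
  "\<And>\<eta> x x'. 0 < \<eta> ==> \<bar>mollify \<eta> u x' - mollify \<eta> u x\<bar> <= norm (x' - x) * (ball_const TYPE('a) \<eta> * (vol + K))"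
proof -
 obtain \<phi> where "subcritical_pair \<Omega> P A R \<eta>0 \<omega> \<kappa> hi a0 u g \<phi> K" using assms by (auto simp: is_pair_def)
 then interpret p: subcritical_pair \<Omega> P A R \<eta>0 \<omega> \<kappa> hi a0 u g \<phi> K .
 show "u \<in> borel_measurable borel" "g \<in> borel_measurable borel" by measurable
 show "(Amod (\<lambda>x. u x - mollify \<eta> u x)) <= ennreal (err K \<eta>)"
  if "0 < \<eta>" "\<eta> <= \<eta>0" "\<eta> powr \<kappa> / \<kappa> <= 1" for \<eta> using p.modular_mollify_error that .
 show "\<bar>mollify \<eta> u x\<bar> <= ball_const TYPE('a) \<eta> * (2 * R * (vol + K))" if "0 < \<eta>" for \<eta> x
  using p.mollify_bound_real that .
 show "\<bar>mollify \<eta> u x' - mollify \<eta> u x\<bar> <= norm (x' - x) * (ball_const TYPE('a) \<eta> * (vol + K))" if "0 < \<eta>" for \<eta> x x'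
  using p.mollify_lipschitz_real that .
qed

lemma indicator_powr_add:
 assumes "\<bar>c\<bar> <= \<bar>a\<bar> + \<bar>b\<bar>"
 shows "indicator \<Omega> x * ennreal (\<bar>c\<bar> powr A x)
  <= ennreal (2 powr hi) * (indicator \<Omega> x * ennreal (\<bar>a\<bar> powr A x)) + ennreal (2 powr hi) * (indicator \<Omega> x * ennreal (\<bar>b\<bar> powr A x))"
proof (cases "x \<in> \<Omega>")
 case True
 have A: "0 <= A x" "A x <= hi" using a0(1) a0(2)[OF True] A_hi[OF True] by auto
 have "\<bar>c\<bar> powr A x <= (\<bar>a\<bar> + \<bar>b\<bar>) powr A x" using assms A by (intro powr_mono2) auto
 also have "... <= 2 powr A x * (\<bar>a\<bar> powr A x + \<bar>b\<bar> powr A x)" using A by (intro powr_add_le) auto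
 also have "... <= 2 powr hi * (\<bar>a\<bar> powr A x + \<bar>b\<bar> powr A x)" using A by (intro mult_right_mono powr_mono) auto
 finally show ?thesis using True
  by (simp add: ennreal_mult[symmetric] ennreal_plus[symmetric] distrib_left ennreal_leI del: ennreal_plus)
qed simp

lemma Amod_add:
 assumes [measurable]: "a \<in> borel_measurable borel" "b \<in> borel_measurable borel" and le: "\<And>x. \<bar>c x\<bar> <= \<bar>a x\<bar> + \<bar>b x\<bar>"
 shows "(Amod c) <= ennreal (2 powr hi) * (Amod a) + ennreal (2 powr hi) * (Amod b)"
proof -
 have "(Amod c) <= (\<integral>\<^sup>+x. ennreal (2 powr hi) * (indicator \<Omega> x * ennreal (\<bar>a x\<bar> powr A x)) + ennreal (2 powr hi) * (indicator \<Omega> x * ennreal (\<bar>b x\<bar> powr A x)) \<partial>lborel)"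
  by (intro nn_integral_mono indicator_powr_add le)
 also have "... = ennreal (2 powr hi) * (Amod a) + ennreal (2 powr hi) * (Amod b)"
  by (rule nn_integral_linear) measurable
 finally show ?thesis .
qed

lemma Amod_le_const:
 assumes "0 <= k" and d: "\<And>x. x \<in> \<Omega> ==> \<bar>d x\<bar> powr A x <= k"
 shows "(Amod d) <= ennreal (vol * k)"
proof -
 have "(Amod d) <= (\<integral>\<^sup>+x. ennreal k * indicator \<Omega> x \<partial>lborel)"
  by (intro nn_integral_mono) (auto simp: indicator_def ennreal_leI d)
 also have "... = ennreal (vol * k)"
  using vol_nonneg assms(1) by (subst nn_integral_cmult_indicator) (auto simp: emeasure_\<Omega> ennreal_mult mult.commute)
 finally show ?thesis .
qed

text \<open>One radius with error at most 1 is fixed. Then u is its mean over balls of that radius,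
  bounded uniformly through the Poincare inequality, plus a remainder of \<open>A\<close>-modular at
  most 1.\<close>

lemma Sobolev_bound:
 assumes K: "0 <= K"
 obtains C where "0 <= C" "\<And>u g. is_pair K u g ==> (Amod u) <= ennreal C"
proof -
 obtain \<eta> where \<eta>: "0 < \<eta>" "\<eta> <= \<eta>0" "\<eta> powr \<kappa> / \<kappa> <= 1" "err K \<eta> <= 1"
  by (rule err_small[OF K zero_less_one]) (rule that)
 define B where "B = max 1 (ball_const TYPE('a) \<eta> * (2 * R * (vol + K)))"
 define C where "C = 2 powr hi * 1 + 2 powr hi * (vol * B powr hi)"
 show thesis
 proof (rule that[of C])
  show "0 <= C" using vol_nonneg by (simp add: C_def)
  fix u g assume p: "is_pair K u g"
  note [measurable] = is_pairD(1,2)[OF p]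
  have "(Amod u) <= ennreal (2 powr hi) * (Amod (\<lambda>x. u x - mollify \<eta> u x)) + ennreal (2 powr hi) * (Amod (mollify \<eta> u))"
   by (rule Amod_add; (linarith | measurable))
  also have "... <= ennreal (2 powr hi) * ennreal 1 + ennreal (2 powr hi) * ennreal (vol * B powr hi)"
  proof (intro add_mono mult_left_mono Amod_le_const)
   show "(Amod (\<lambda>x. u x - mollify \<eta> u x)) <= ennreal 1"
    using is_pairD(3)[OF p \<eta>(1-3)] ennreal_leI[OF \<eta>(4)] by (rule order_trans)
   fix x assume x: "x \<in> \<Omega>"
   have "\<bar>mollify \<eta> u x\<bar> <= B" using is_pairD(4)[OF p \<eta>(1), of x] by (simp add: B_def)
   then have "\<bar>mollify \<eta> u x\<bar> powr A x <= B powr A x" using a0(1) a0(2)[OF x] by (intro powr_mono2) auto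
   also have "... <= B powr hi" using A_hi[OF x] by (intro powr_mono) (auto simp: B_def)
   finally show "\<bar>mollify \<eta> u x\<bar> powr A x <= B powr hi" .
  qed auto
  also have "... = ennreal C"
   using vol_nonneg by (simp add: C_def ennreal_mult ennreal_plus)
  finally show "(Amod u) <= ennreal C" .
 qed
qed

text \<open>Arzela--Ascoli in Cauchy form: finitely many points of the dense set D have \<rho>-balls
  covering the ball of radius R, and the common Lipschitz constant transports convergence at these
  points to all of \<Omega>.\<close>

lemma equicontinuous_uniform_Cauchy:
 fixes f :: "nat => 'a => real"
 assumes L: "0 <= L" "\<And>n x x'. \<bar>f n x' - f n x\<bar> <= norm (x' - x) * L"
  and D: "\<And>X. open X ==> X \<noteq> {} ==> \<exists>d\<in>D. d \<in> X" and conv: "\<And>d. d \<in> D ==> convergent (\<lambda>n. f n d)"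
  and e: "0 < e"
 shows "\<exists>n0. \<forall>m\<ge>n0. \<forall>n\<ge>n0. \<forall>x\<in>\<Omega>. \<bar>f m x - f n x\<bar> <= e"
proof -
 define \<rho> where "\<rho> = (e/3) / (L + 1)"
 have \<rho>: "0 < \<rho>" using e L by (simp add: \<rho>_def)
 have \<rho>L: "\<rho> * L <= e/3"
 proof -
  have c: "x / y * y = x" if "0 < y" for x y :: real using that by simp
  have "0 < L + 1" using L(1) by linarith
  from c[OF this, of "e/3"] have "\<rho> * (L + 1) = e/3" unfolding \<rho>_def .
  then show ?thesis using \<rho> by (simp add: distrib_left)
 qed
 have "cball 0 R \<subseteq> (\<Union>d\<in>D. ball d \<rho>)"
 proof
  fix x :: 'a
  obtain d where "d \<in> D" "d \<in> ball x \<rho>" using D[of "ball x \<rho>"] \<rho> by auto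
  then show "x \<in> (\<Union>d\<in>D. ball d \<rho>)" by (auto simp: dist_commute)
 qed
 then obtain F where F: "F \<subseteq> D" "finite F" "cball 0 R \<subseteq> (\<Union>d\<in>F. ball d \<rho>)"
  using compactE_image[OF compact_cball, of D "\<lambda>d. ball d \<rho>"] by (metis open_ball)
 have "\<forall>d\<in>F. \<exists>n0. \<forall>m\<ge>n0. \<forall>n\<ge>n0. \<bar>f m d - f n d\<bar> < e/3"
 proof
  fix d assume "d \<in> F"
  then have "Cauchy (\<lambda>n. f n d)" using F conv convergent_Cauchy by blast
  then show "\<exists>n0. \<forall>m\<ge>n0. \<forall>n\<ge>n0. \<bar>f m d - f n d\<bar> < e/3"
   unfolding Cauchy_def dist_real_def using e by (elim allE[of _ "e/3"]) simp
 qed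
 then obtain N where N: "\<And>d m n. d \<in> F ==> m >= N d ==> n >= N d ==> \<bar>f m d - f n d\<bar> < e/3" by metis
 define n0 where "n0 = (\<Sum>d\<in>F. N d)"
 have n0: "N d <= n0" if "d \<in> F" for d using member_le_sum[OF that, of N] F(2) by (simp add: n0_def)
 have "\<bar>f m x - f n x\<bar> <= e" if "m >= n0" "n >= n0" "x \<in> \<Omega>" for m n x
 proof -
  have "x \<in> cball 0 R" using R(2)[OF that(3)] by simp
  then obtain d where d: "d \<in> F" "norm (x - d) < \<rho>" using F(3) by (auto simp: dist_norm norm_minus_commute)
  have "norm (x - d) * L <= \<rho> * L" using d L by (intro mult_right_mono) auto
  then have "\<bar>f m x - f m d\<bar> <= e/3" "\<bar>f n x - f n d\<bar> <= e/3"
   using L(2)[of m x d] L(2)[of n x d] \<rho>L by linarith+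
  moreover have "\<bar>f m d - f n d\<bar> < e/3" using N[OF d(1)] n0[OF d(1)] that le_trans by blast
  ultimately show ?thesis by linarith
 qed
 then show ?thesis by blast
qed

text \<open>At a fixed scale the means are uniformly bounded and equicontinuous, and the remainders
  are uniformly small as the scale shrinks. One subsequence makes the means at all of countably many
  scales converge on a dense set.\<close>

lemma Rellich:
 fixes u :: "nat => 'a => real"
 assumes K: "0 <= K" and p: "\<And>n. is_pair K (u n) (g n)"
 obtains r where "strict_mono (r :: nat => nat)"
  "\<And>\<epsilon>. 0 < \<epsilon> ==> \<exists>n0. \<forall>m\<ge>n0. \<forall>n\<ge>n0. (Amod (\<lambda>x. u (r m) x - u (r n) x)) <= ennreal \<epsilon>"
proof -
 have [measurable]: "u n \<in> borel_measurable borel" for n using is_pairD(1)[OF p] .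
 have "\<exists>\<eta>. 0 < \<eta> \<and> \<eta> <= \<eta>0 \<and> \<eta> powr \<kappa> / \<kappa> <= 1 \<and> err K \<eta> <= inverse (real (Suc j))" for j
  by (rule err_small[OF K, of "inverse (real (Suc j))"]) auto
 then obtain \<eta> where \<eta>: "\<And>j. 0 < \<eta> j" "\<And>j. \<eta> j <= \<eta>0" "\<And>j. \<eta> j powr \<kappa> / \<kappa> <= 1"
  "\<And>j. err K (\<eta> j) <= inverse (real (Suc j))" by metis
 define B where "B j = ball_const TYPE('a) (\<eta> j) * (2 * R * (vol + K)) + 1" for j :: nat
 have B: "0 < B j" "\<bar>mollify (\<eta> j) (u n) x\<bar> <= B j" for j n x
 proof -
  show "\<bar>mollify (\<eta> j) (u n) x\<bar> <= B j" using is_pairD(4)[OF p[of n] \<eta>(1)[of j], of x] by (simp add: B_def)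
  have "0 <= ball_const TYPE('a) (\<eta> j) * (2 * R * (vol + K))"
   using \<eta>(1)[of j] R vol_nonneg K by (intro mult_nonneg_nonneg) (auto simp: less_imp_le[OF measure_unit_ball_pos] less_imp_le)
  then show "0 < B j" by (simp add: B_def)
 qed
 obtain D :: "'a set" where D: "countable D" "\<And>X. open X ==> X \<noteq> {} ==> \<exists>d\<in>D. d \<in> X"
  using countable_dense_exists by metis
 have count: "countable (UNIV \<times> D :: (nat \<times> 'a) set)" using D(1) by auto
 obtain r where r: "strict_mono (r :: nat => nat)"
  "\<And>z. z \<in> UNIV \<times> D ==> \<exists>l. (\<lambda>n. mollify (\<eta> (fst z)) (u (r n)) (snd z) / B (fst z)) \<longlonglongrightarrow> l"
 \<comment> \<open>Division by \<open>B\<close> gives the common bound 1, so that a single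
   extraction covers all indices (j, d).\<close>
 proof (rule function_convergent_subsequence[OF count, of "\<lambda>n z. mollify (\<eta> (fst z)) (u n) (snd z) / B (fst z)" 1])
  show "norm (mollify (\<eta> (fst z)) (u n) (snd z) / B (fst z)) <= 1" for n and z :: "nat \<times> 'a"
   using B by (simp add: abs_of_pos)
 qed (rule that)
 have conv: "convergent (\<lambda>n. mollify (\<eta> j) (u (r n)) d)" if "d \<in> D" for j d
 proof -
  have "convergent (\<lambda>n. mollify (\<eta> j) (u (r n)) d / B j)" using r(2)[of "(j, d)"] that by (auto simp: convergent_def)
  from convergent_mult[OF this convergent_const[of "B j"]] show ?thesis using B(1)[of j] by simp
 qed
 show thesis
 proof (rule that[OF r(1)])
  fix \<epsilon> :: real assume \<epsilon>: "0 < \<epsilon>"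
  \<comment> \<open>H is the quasi-triangle constant and is met twice. The two remainders together
    cost (H + H^2) t and the uniform difference of the means costs H^2 vol \<delta>; t and \<delta>
    keep each of these at most \<epsilon>/2.\<close>
  define H where "H = 2 powr hi"
  have H: "0 < H" by (simp add: H_def)
  obtain j where j: "(H + H * H) / (\<epsilon>/2) < real (Suc j)" using reals_Archimedean2 less_trans[OF _ lessI] of_nat_less_iff
   by (metis of_nat_Suc less_add_one order_less_trans)
  define t where "t = inverse (real (Suc j))"
  have "(H + H * H) < real (Suc j) * (\<epsilon>/2)" using j \<epsilon> by (simp only: pos_divide_less_eq half_gt_zero_iff)
  then have t: "0 < t" "(H + H * H) * t <= \<epsilon>/2" by (auto simp: t_def field_simps)
  define \<delta> where "\<delta> = min 1 (\<epsilon> / (2 * H * H * (vol + 1)))"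
  have den: "0 < 2 * H * H * (vol + 1)" using H vol_nonneg by (intro mult_pos_pos) auto
  have \<delta>: "0 < \<delta>" "\<delta> <= 1" using \<epsilon> den by (auto simp: \<delta>_def)
  have "\<delta> * (2 * H * H * (vol + 1)) <= \<epsilon>" using den by (subst pos_le_divide_eq[symmetric]) (auto simp: \<delta>_def)
  moreover have "\<delta> * (2 * H * H * vol) <= \<delta> * (2 * H * H * (vol + 1))" using \<delta> H by (intro mult_left_mono) auto
  ultimately have \<delta>2: "H * H * (vol * \<delta>) <= \<epsilon>/2" by (simp add: ac_simps)
  have "\<exists>n0. \<forall>m\<ge>n0. \<forall>n\<ge>n0. \<forall>x\<in>\<Omega>. \<bar>mollify (\<eta> j) (u (r m)) x - mollify (\<eta> j) (u (r n)) x\<bar> <= \<delta>"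
  proof (rule equicontinuous_uniform_Cauchy[OF _ is_pairD(5)[OF p \<eta>(1)] D(2) conv \<delta>(1)])
   show "0 <= ball_const TYPE('a) (\<eta> j) * (vol + K)"
    using \<eta>(1)[of j] vol_nonneg K by (intro mult_nonneg_nonneg) (auto simp: less_imp_le[OF measure_unit_ball_pos] less_imp_le)
  qed
  then obtain n0 where n0: "\<And>m n x. m >= n0 ==> n >= n0 ==> x \<in> \<Omega> ==> \<bar>mollify (\<eta> j) (u (r m)) x - mollify (\<eta> j) (u (r n)) x\<bar> <= \<delta>"
   by metis
  have "(Amod (\<lambda>x. u (r m) x - u (r n) x)) <= ennreal \<epsilon>" if mn: "m >= n0" "n >= n0" for m n
  proof -
   define a where "a x = u (r m) x - mollify (\<eta> j) (u (r m)) x" for x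
   define b where "b x = u (r n) x - mollify (\<eta> j) (u (r n)) x" for x
   define d where "d x = mollify (\<eta> j) (u (r m)) x - mollify (\<eta> j) (u (r n)) x" for x
   have [measurable]: "a \<in> borel_measurable borel" "b \<in> borel_measurable borel" "d \<in> borel_measurable borel"
    unfolding a_def b_def d_def by measurable
   have err: "err K (\<eta> j) <= t" using \<eta>(4)[of j] by (simp add: t_def)
   have Ia: "(Amod a) <= ennreal t"
    unfolding a_def using is_pairD(3)[OF p \<eta>(1-3)] ennreal_leI[OF err] by (rule order_trans)
   have Ib: "(Amod b) <= ennreal t"
    unfolding b_def using is_pairD(3)[OF p \<eta>(1-3)] ennreal_leI[OF err] by (rule order_trans)
   have Id: "(Amod d) <= ennreal (vol * \<delta>)"
   proof (rule Amod_le_const)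
    fix x assume x: "x \<in> \<Omega>"
    have "\<bar>d x\<bar> <= \<delta>" unfolding d_def by (intro n0 mn x)
    then have "\<bar>d x\<bar> powr A x <= \<delta> powr A x" using a0(1) a0(2)[OF x] by (intro powr_mono2) auto
    also have "... <= \<delta> powr 1" using a0(1) a0(2)[OF x] \<delta> by (intro powr_mono') auto
    finally show "\<bar>d x\<bar> powr A x <= \<delta>" using \<delta> by simp
   qed (use \<delta> in simp)
   have "(Amod (\<lambda>x. u (r m) x - u (r n) x)) <= ennreal H * (Amod a) + ennreal H * (Amod (\<lambda>x. d x - b x))"
    unfolding H_def a_def b_def d_def by (rule Amod_add; (linarith | measurable))
   also have "(Amod (\<lambda>x. d x - b x)) <= ennreal H * (Amod d) + ennreal H * (Amod b)"
    unfolding H_def by (rule Amod_add; (linarith | measurable))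
   finally have "(Amod (\<lambda>x. u (r m) x - u (r n) x)) <= ennreal H * (Amod a) + ennreal H * (ennreal H * (Amod d) + ennreal H * (Amod b))"
    by (simp add: add_left_mono mult_left_mono)
   also have "... <= ennreal H * ennreal t + ennreal H * (ennreal H * ennreal (vol * \<delta>) + ennreal H * ennreal t)"
    by (intro add_mono mult_left_mono Ia Ib Id) auto
   also have "... = ennreal (H * t + H * (H * (vol * \<delta>) + H * t))"
    using H t vol_nonneg \<delta> by (simp add: ennreal_mult ennreal_plus)
   also have "... <= ennreal \<epsilon>" using t(2) \<delta>2 by (intro ennreal_leI) (simp add: algebra_simps)
   finally show ?thesis .
  qed
  then show "\<exists>n0. \<forall>m\<ge>n0. \<forall>n\<ge>n0. (Amod (\<lambda>x. u (r m) x - u (r n) x)) <= ennreal \<epsilon>" by blast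
 qed
qed

end

subsection \<open>Sobolev functions as pairs\<close>

definition tpair :: "('a::euclidean_space => real) => 'a => real \<times> 'a" where
 "tpair \<phi> x = (\<phi> x, grad \<phi> x)"

lemma norm_prod_bounds:
 fixes w :: "real \<times> 'a::euclidean_space"
 shows "\<bar>fst w\<bar> <= norm w" "norm (snd w) <= norm w" "norm w <= \<bar>fst w\<bar> + norm (snd w)"
 using norm_fst_le[of "fst w" "snd w"] norm_snd_le[of "snd w" "fst w"] norm_Pair_le[of "fst w" "snd w"] by auto

locale var_dom =
 fixes \<Omega> :: "'a::euclidean_space set" and p :: "'a => real" and lo hi :: real
 assumes \<Omega>_open: "open \<Omega>" and \<Omega>_bounded: "bounded \<Omega>" and p_cont: "continuous_on \<Omega> p"
  and p_bounds: "x \<in> \<Omega> ==> lo <= p x" "x \<in> \<Omega> ==> p x <= hi" and lohi': "1 < lo" "lo <= hi"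
begin

lemma \<Omega>_sets [simp, intro]: "\<Omega> \<in> sets lebesgue" "\<Omega> \<in> sets borel" using \<Omega>_open by auto

lemma emeasure_finite: "emeasure lebesgue \<Omega> < \<infinity>"
 using emeasure_bounded_finite[OF \<Omega>_bounded] \<Omega>_sets by simp

end

sublocale var_dom \<subseteq> var_exponent "lebesgue_on \<Omega>" p lo hi
proof -
 have "finite_measure (lebesgue_on \<Omega>)"
  by (rule finite_measureI) (use emeasure_finite in \<open>simp add: emeasure_restrict_space\<close>)
 moreover have "var_exponent_axioms (lebesgue_on \<Omega>) p lo hi"
  using p_bounds lohi' p_cont by unfold_locales (auto intro: continuous_imp_measurable_on_sets_lebesgue)
 ultimately show "var_exponent (lebesgue_on \<Omega>) p lo hi" by (rule var_exponent.intro)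
qed

context var_dom
begin

abbreviation \<mu> :: "'a measure" where "\<mu> \<equiv> lebesgue_on \<Omega>"

lemma tpair_measurable: "test_fun \<Omega> \<phi> ==> tpair \<phi> \<in> borel_measurable \<mu>"
 unfolding tpair_def[abs_def] by (intro borel_measurable_Pair borel_measurable_test_on)

lemma pmod_bounded_finite:
 fixes w :: "'a => 'v::euclidean_space"
 assumes "w \<in> borel_measurable \<mu>" and B: "\<And>x. norm (w x) <= B"
 shows "pmod \<mu> p w < \<infinity>"
proof -
 have "pmod \<mu> p w <= (\<integral>\<^sup>+x. ennreal (max 1 B powr hi) \<partial>\<mu>)"
  unfolding pmod_def
 proof (intro nn_integral_mono ennreal_leI)
  fix x assume x: "x \<in> space \<mu>"
  have "norm (w x) powr p x <= max 1 B powr p x" using B[of x] p_range[OF x] lo by (intro powr_mono2) auto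
  also have "... <= max 1 B powr hi" using p_range[OF x] by (intro powr_mono) auto
  finally show "norm (w x) powr p x <= max 1 B powr hi" .
 qed
 also have "... < \<infinity>" using emeasure_finite by (simp add: emeasure_restrict_space ennreal_mult_less_top)
 finally show ?thesis .
qed

lemma pmod_tpair_finite: assumes "test_fun \<Omega> \<phi>" shows "pmod \<mu> p (tpair \<phi>) < \<infinity>"
proof -
 obtain B where B: "0 < B" "\<And>x. \<bar>\<phi> x\<bar> <= B" "\<And>x. norm (grad \<phi> x) <= B" by (rule test_fun_bounded[OF assms]) (rule that)
 have "norm (tpair \<phi> x) <= B + B" for x
  using norm_prod_bounds(3)[of "tpair \<phi> x"] B(2,3)[of x] by (simp add: tpair_def)
 then show ?thesis by (rule pmod_bounded_finite[OF tpair_measurable[OF assms]])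
qed

text \<open>The closure of the test pairs in the modular of the whole pair, function and gradient
  together. Because the exponent is bounded this is the closure in the Luxemburg norm;
  \<open>W0_imp_W01p\<close> and \<open>W01p_imp_W0\<close> translate.\<close>

definition W0 :: "('a => real \<times> 'a) => bool" where
 "W0 w \<longleftrightarrow> w \<in> borel_measurable \<mu> \<and> (\<forall>e>0. \<exists>\<phi>. test_fun \<Omega> \<phi> \<and> pmod \<mu> p (\<lambda>x. tpair \<phi> x - w x) <= ennreal e)"

lemma W0_measurable: "W0 w ==> w \<in> borel_measurable \<mu>" by (simp add: W0_def)

lemma W0_approx:
 assumes "W0 w" "0 < e" obtains \<phi> where "test_fun \<Omega> \<phi>" "pmod \<mu> p (\<lambda>x. tpair \<phi> x - w x) <= ennreal e"
 using assms by (auto simp: W0_def)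

lemma half_eps: assumes "0 < e" shows "0 < e / (2 * 2 powr hi)" 
 "ennreal (2 powr hi) * (ennreal (e / (2 * 2 powr hi)) + ennreal (e / (2 * 2 powr hi))) = ennreal e"
 using assms by (auto simp: ennreal_plus[symmetric] ennreal_mult[symmetric] simp del: ennreal_plus)

lemma W0_finite: assumes "W0 w" shows "pmod \<mu> p w < \<infinity>"
proof -
 obtain \<phi> where \<phi>: "test_fun \<Omega> \<phi>" "pmod \<mu> p (\<lambda>x. tpair \<phi> x - w x) <= ennreal 1" by (rule W0_approx[OF assms zero_less_one]) (rule that)
 have [measurable]: "w \<in> borel_measurable \<mu>" "tpair \<phi> \<in> borel_measurable \<mu>" using W0_measurable[OF assms] tpair_measurable[OF \<phi>(1)] by auto
 have "pmod \<mu> p w = pmod \<mu> p (\<lambda>x. tpair \<phi> x - (tpair \<phi> x - w x))" by simp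
 also have "... <= ennreal (2 powr hi) * (pmod \<mu> p (tpair \<phi>) + pmod \<mu> p (\<lambda>x. tpair \<phi> x - w x))" by (intro pmod_diff) measurable
 also have "... < \<infinity>" using pmod_tpair_finite[OF \<phi>(1)] \<phi>(2) by (auto simp: ennreal_mult_less_top le_less_trans)
 finally show ?thesis .
qed

lemma W0_zero: "W0 (\<lambda>_. 0)"
proof -
 have "pmod \<mu> p (\<lambda>x. tpair (\<lambda>_. 0) x - 0) = 0" by (simp add: tpair_def grad_const pmod_def zero_prod_def[symmetric])
 then show ?thesis unfolding W0_def using test_fun_zero by fastforce
qed

lemma W0_add: assumes "W0 v" "W0 w" shows "W0 (\<lambda>x. v x + w x)"
 unfolding W0_def
proof (intro conjI allI impI)
 note [measurable] = W0_measurable[OF assms(1)] W0_measurable[OF assms(2)]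
 show "(\<lambda>x. v x + w x) \<in> borel_measurable \<mu>" by measurable
 fix e :: real assume e: "0 < e"
 obtain \<phi> where \<phi>: "test_fun \<Omega> \<phi>" "pmod \<mu> p (\<lambda>x. tpair \<phi> x - v x) <= ennreal (e / (2 * 2 powr hi))" by (rule W0_approx[OF assms(1) half_eps(1)[OF e]]) (rule that)
 obtain \<psi> where \<psi>: "test_fun \<Omega> \<psi>" "pmod \<mu> p (\<lambda>x. tpair \<psi> x - w x) <= ennreal (e / (2 * 2 powr hi))" by (rule W0_approx[OF assms(2) half_eps(1)[OF e]]) (rule that)
 note [measurable] = tpair_measurable[OF \<phi>(1)] tpair_measurable[OF \<psi>(1)]
 have "(\<lambda>x. tpair (\<lambda>x. \<phi> x + \<psi> x) x - (v x + w x)) = (\<lambda>x. (tpair \<phi> x - v x) + (tpair \<psi> x - w x))"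
  by (auto simp: fun_eq_iff tpair_def grad_add[OF \<phi>(1) \<psi>(1)] prod_eq_iff)
 then have "pmod \<mu> p (\<lambda>x. tpair (\<lambda>x. \<phi> x + \<psi> x) x - (v x + w x)) <= ennreal (2 powr hi) * (pmod \<mu> p (\<lambda>x. tpair \<phi> x - v x) + pmod \<mu> p (\<lambda>x. tpair \<psi> x - w x))"
  by (simp only:) (intro pmod_add; measurable)
 also have "... <= ennreal (2 powr hi) * (ennreal (e / (2 * 2 powr hi)) + ennreal (e / (2 * 2 powr hi)))"
  by (intro mult_left_mono add_mono \<phi> \<psi>) auto
 finally have "pmod \<mu> p (\<lambda>x. tpair (\<lambda>x. \<phi> x + \<psi> x) x - (v x + w x)) <= ennreal e" by (simp only: half_eps(2)[OF e])
 then show "\<exists>\<phi>. test_fun \<Omega> \<phi> \<and> pmod \<mu> p (\<lambda>x. tpair \<phi> x - (v x + w x)) <= ennreal e"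
  using test_fun_add[OF \<phi>(1) \<psi>(1)] by blast
qed

lemma W0_scale: assumes "W0 w" shows "W0 (\<lambda>x. c *\<^sub>R w x)"
 unfolding W0_def
proof (intro conjI allI impI)
 note [measurable] = W0_measurable[OF assms]
 show "(\<lambda>x. c *\<^sub>R w x) \<in> borel_measurable \<mu>" by measurable
 fix e :: real assume e: "0 < e"
 define k where "k = max (\<bar>c\<bar> powr lo) (\<bar>c\<bar> powr hi) + 1"
 have k: "0 < k" "max (\<bar>c\<bar> powr lo) (\<bar>c\<bar> powr hi) <= k" by (auto simp: k_def add_nonneg_pos le_max_iff_disj)
 obtain \<phi> where \<phi>: "test_fun \<Omega> \<phi>" "pmod \<mu> p (\<lambda>x. tpair \<phi> x - w x) <= ennreal (e / k)" by (rule W0_approx[OF assms, of "e/k"]) (use e k in \<open>auto intro: that\<close>)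
 note [measurable] = tpair_measurable[OF \<phi>(1)]
 have "(\<lambda>x. tpair (\<lambda>x. c * \<phi> x) x - c *\<^sub>R w x) = (\<lambda>x. c *\<^sub>R (tpair \<phi> x - w x))"
  by (auto simp: fun_eq_iff tpair_def grad_cmult[OF \<phi>(1)] prod_eq_iff algebra_simps)
 then have "pmod \<mu> p (\<lambda>x. tpair (\<lambda>x. c * \<phi> x) x - c *\<^sub>R w x) <= ennreal (max (\<bar>c\<bar> powr lo) (\<bar>c\<bar> powr hi)) * pmod \<mu> p (\<lambda>x. tpair \<phi> x - w x)"
  by (simp only:) (intro pmod_scale; measurable)
 also have "... <= ennreal k * ennreal (e / k)" by (intro mult_mono ennreal_leI k \<phi>) auto
 also have "... = ennreal e" using k e by (simp add: ennreal_mult[symmetric])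
 finally show "\<exists>\<phi>. test_fun \<Omega> \<phi> \<and> pmod \<mu> p (\<lambda>x. tpair \<phi> x - c *\<^sub>R w x) <= ennreal e"
  using test_fun_cmult[OF \<phi>(1)] by blast
qed

lemma W0_closed:
 assumes [measurable]: "w \<in> borel_measurable \<mu>" and close: "\<And>e. 0 < e ==> \<exists>v. W0 v \<and> pmod \<mu> p (\<lambda>x. v x - w x) <= ennreal e"
 shows "W0 w"
 unfolding W0_def
proof (intro conjI allI impI)
 fix e :: real assume e: "0 < e"
 obtain v where v: "W0 v" "pmod \<mu> p (\<lambda>x. v x - w x) <= ennreal (e / (2 * 2 powr hi))" using close[OF half_eps(1)[OF e]] by blast
 obtain \<phi> where \<phi>: "test_fun \<Omega> \<phi>" "pmod \<mu> p (\<lambda>x. tpair \<phi> x - v x) <= ennreal (e / (2 * 2 powr hi))" by (rule W0_approx[OF v(1) half_eps(1)[OF e]]) (rule that)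
 note [measurable] = tpair_measurable[OF \<phi>(1)] W0_measurable[OF v(1)]
 have "pmod \<mu> p (\<lambda>x. tpair \<phi> x - w x) = pmod \<mu> p (\<lambda>x. (tpair \<phi> x - v x) + (v x - w x))" by simp
 also have "... <= ennreal (2 powr hi) * (pmod \<mu> p (\<lambda>x. tpair \<phi> x - v x) + pmod \<mu> p (\<lambda>x. v x - w x))" by (intro pmod_add) measurable
 also have "... <= ennreal (2 powr hi) * (ennreal (e / (2 * 2 powr hi)) + ennreal (e / (2 * 2 powr hi)))"
  by (intro mult_left_mono add_mono \<phi> v) auto
 finally have "pmod \<mu> p (\<lambda>x. tpair \<phi> x - w x) <= ennreal e" by (simp only: half_eps(2)[OF e])
 then show "\<exists>\<phi>. test_fun \<Omega> \<phi> \<and> pmod \<mu> p (\<lambda>x. tpair \<phi> x - w x) <= ennreal e" using \<phi> by blast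
qed (rule assms)

text \<open>By \<open>le_add_powr\<close> the norm is at most t plus a multiple, depending on t, of
  its p-th power; t is fixed first against the finite measure of \<Omega>.\<close>

lemma pmod_tendsto_L1:
 fixes w :: "nat => 'a => 'v::euclidean_space"
 assumes [measurable]: "\<And>k. w k \<in> borel_measurable \<mu>" and lim: "(\<lambda>k. pmod \<mu> p (w k)) \<longlonglongrightarrow> 0"
 shows "(\<lambda>k. \<integral>\<^sup>+x. ennreal (norm (w k x)) \<partial>\<mu>) \<longlonglongrightarrow> 0"
proof (rule tendsto_zero_ennreal)
 fix e :: real assume e: "0 < e"
 define V where "V = measure \<mu> \<Omega>"
 have V: "emeasure \<mu> \<Omega> = ennreal V" "0 <= V" using emeasure_eq_measure[of \<Omega>] by (auto simp: V_def)
 define t where "t = min 1 (e / (2 * (V + 1)))"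
 have t: "0 < t" "t <= 1" using e V by (auto simp: t_def)
 have "t * (2 * (V + 1)) <= e" using V by (subst pos_le_divide_eq[symmetric]) (auto simp: t_def)
 then have tV: "t * V < e/2" using t by (simp add: algebra_simps)
 define b where "b = (1/t) powr hi"
 have "(\<lambda>k. ennreal b * pmod \<mu> p (w k)) \<longlonglongrightarrow> ennreal b * 0" using lim by (intro ennreal_tendsto_cmult) auto
 from order_tendstoD(2)[OF this, of "ennreal (e/2)"] e
 have "\<forall>\<^sub>F k in sequentially. ennreal b * pmod \<mu> p (w k) < ennreal (e/2)" by simp
 then show "\<forall>\<^sub>F k in sequentially. (\<integral>\<^sup>+x. ennreal (norm (w k x)) \<partial>\<mu>) < ennreal e"
 proof eventually_elim
  case (elim k)
  have "(\<integral>\<^sup>+x. ennreal (norm (w k x)) \<partial>\<mu>) <= (\<integral>\<^sup>+x. ennreal t * 1 + ennreal b * ennreal (norm (w k x) powr p x) \<partial>\<mu>)"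
  proof (intro nn_integral_mono)
   fix x assume "x \<in> space \<mu>"
   then have "norm (w k x) <= t + b * norm (w k x) powr p x" unfolding b_def using t p_range[of x] lo by (intro le_add_powr) auto
   then show "ennreal (norm (w k x)) <= ennreal t * 1 + ennreal b * ennreal (norm (w k x) powr p x)"
    using t by (simp add: b_def ennreal_mult[symmetric] ennreal_plus[symmetric] ennreal_leI del: ennreal_plus)
  qed
  also have "... = ennreal t * (\<integral>\<^sup>+x. 1 \<partial>\<mu>) + ennreal b * pmod \<mu> p (w k)"
   unfolding pmod_def by (rule nn_integral_linear) measurable
  also have "(\<integral>\<^sup>+x. 1 \<partial>\<mu>) = ennreal V" using V by simp
  also have "ennreal t * ennreal V + ennreal b * pmod \<mu> p (w k) < ennreal (e/2) + ennreal (e/2)"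
   using elim tV t V by (intro add_strict_mono) (auto simp: ennreal_mult[symmetric] ennreal_less_iff)
  also have "... = ennreal e" using e by (simp add: ennreal_plus[symmetric] del: ennreal_plus)
  finally show ?case .
 qed
qed

lemma W0_sequence:
 assumes "W0 w"
 obtains \<phi> where "\<And>k. test_fun \<Omega> (\<phi> k)" "(\<lambda>k. pmod \<mu> p (\<lambda>x. tpair (\<phi> k) x - w x)) \<longlonglongrightarrow> 0"
  "(\<lambda>k. \<integral>\<^sup>+x. ennreal (norm (tpair (\<phi> k) x - w x)) \<partial>\<mu>) \<longlonglongrightarrow> 0"
proof -
 have "\<forall>k. \<exists>\<phi>. test_fun \<Omega> \<phi> \<and> pmod \<mu> p (\<lambda>x. tpair \<phi> x - w x) <= ennreal (inverse (real (Suc k)))"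
  using assms unfolding W0_def by auto
 then obtain \<phi> where \<phi>: "\<And>k. test_fun \<Omega> (\<phi> k)" "\<And>k. pmod \<mu> p (\<lambda>x. tpair (\<phi> k) x - w x) <= ennreal (inverse (real (Suc k)))" by metis
 have inv: "(\<lambda>k. ennreal (inverse (real (Suc k)))) \<longlonglongrightarrow> ennreal 0" by (intro tendsto_ennrealI LIMSEQ_inverse_real_of_nat)
 have lim: "(\<lambda>k. pmod \<mu> p (\<lambda>x. tpair (\<phi> k) x - w x)) \<longlonglongrightarrow> 0"
 proof (rule tendsto_sandwich[OF _ _ tendsto_const])
  show "\<forall>\<^sub>F k in sequentially. pmod \<mu> p (\<lambda>x. tpair (\<phi> k) x - w x) <= ennreal (inverse (real (Suc k)))"
   by (intro always_eventually allI \<phi>(2))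
  show "(\<lambda>k. ennreal (inverse (real (Suc k)))) \<longlonglongrightarrow> 0" using inv by simp
 qed simp
 have "(\<lambda>k. \<integral>\<^sup>+x. ennreal (norm (tpair (\<phi> k) x - w x)) \<partial>\<mu>) \<longlonglongrightarrow> 0"
  by (intro pmod_tendsto_L1[OF _ lim] borel_measurable_diff tpair_measurable \<phi> W0_measurable[OF assms])
 from that[OF \<phi>(1) lim this] show thesis .
qed

lemma pmod_finite_integrable:
 fixes w :: "'a => 'v::euclidean_space"
 assumes [measurable]: "w \<in> borel_measurable \<mu>" and fin: "pmod \<mu> p w < \<infinity>"
 shows "integrable \<mu> w"
proof (rule Bochner_Integration.integrable_bound)
 show "integrable \<mu> (\<lambda>x. 1 + 1 * norm (w x) powr p x)" using fin pmod_finite_iff[of w] by (auto intro!: Bochner_Integration.integrable_add)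
 show "AE x in \<mu>. norm (w x) <= norm (1 + 1 * norm (w x) powr p x)"
 proof (intro AE_I2)
  fix x assume "x \<in> space \<mu>"
  then show "norm (w x) <= norm (1 + 1 * norm (w x) powr p x)" using p_range[of x] lo le_add_powr[of 1 "norm (w x)" "p x" hi] by simp
 qed
qed measurable

lemma W0_integrable: assumes "W0 w" shows "integrable \<mu> (\<lambda>x. fst (w x))" "integrable \<mu> (\<lambda>x. snd (w x))"
 using pmod_finite_integrable[OF W0_measurable[OF assms] W0_finite[OF assms]] by (auto intro: integrable_fst integrable_snd)

lemma tpair_integrable: assumes "test_fun \<Omega> \<phi>" shows "integrable \<mu> \<phi>" "integrable \<mu> (grad \<phi>)"
proof -
 have "integrable \<mu> (tpair \<phi>)" by (rule pmod_finite_integrable[OF tpair_measurable[OF assms] pmod_tpair_finite[OF assms]])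
 from integrable_fst[OF this] integrable_snd[OF this] show "integrable \<mu> \<phi>" "integrable \<mu> (grad \<phi>)" by (auto simp: tpair_def)
qed

lemma L1_components:
 assumes "(\<lambda>k. \<integral>\<^sup>+x. ennreal (norm (tpair (\<phi> k) x - w x)) \<partial>\<mu>) \<longlonglongrightarrow> 0"
 shows "(\<lambda>k. \<integral>\<^sup>+x. ennreal \<bar>\<phi> k x - fst (w x)\<bar> \<partial>\<mu>) \<longlonglongrightarrow> 0"
  "(\<lambda>k. \<integral>\<^sup>+x. ennreal (norm (grad (\<phi> k) x - snd (w x))) \<partial>\<mu>) \<longlonglongrightarrow> 0"
proof -
 have "\<bar>\<phi> k x - fst (w x)\<bar> <= norm (tpair (\<phi> k) x - w x)" "norm (grad (\<phi> k) x - snd (w x)) <= norm (tpair (\<phi> k) x - w x)" for k x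
  using norm_prod_bounds(1,2)[of "tpair (\<phi> k) x - w x"] by (simp_all add: tpair_def)
 then show "(\<lambda>k. \<integral>\<^sup>+x. ennreal \<bar>\<phi> k x - fst (w x)\<bar> \<partial>\<mu>) \<longlonglongrightarrow> 0"
  "(\<lambda>k. \<integral>\<^sup>+x. ennreal (norm (grad (\<phi> k) x - snd (w x))) \<partial>\<mu>) \<longlonglongrightarrow> 0"
  by (intro tendsto_sandwich[OF _ _ tendsto_const assms] always_eventually allI nn_integral_mono ennreal_leI; simp)+
qed

lemma W0_weak_grad: assumes "W0 w" shows "weak_grad \<Omega> (\<lambda>x. fst (w x)) (\<lambda>x. snd (w x))"
proof -
 obtain \<phi> where \<phi>: "\<And>k. test_fun \<Omega> (\<phi> k)" "(\<lambda>k. pmod \<mu> p (\<lambda>x. tpair (\<phi> k) x - w x)) \<longlonglongrightarrow> 0"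
  "(\<lambda>k. \<integral>\<^sup>+x. ennreal (norm (tpair (\<phi> k) x - w x)) \<partial>\<mu>) \<longlonglongrightarrow> 0" by (rule W0_sequence[OF assms]) (rule that)
 show ?thesis
  by (rule weak_grad_of_approx[OF \<Omega>_open W0_integrable[OF assms] \<phi>(1) tpair_integrable[OF \<phi>(1)] L1_components[OF \<phi>(3)]])
qed

section \<open>Luxemburg norm and modular\<close>

lemma modular_eq: "modular \<Omega> p u = pmod \<mu> p u"
 by (simp add: modular_def pmod_def)

lemma modular_scaled: "modular \<Omega> p (\<lambda>x. u x / c) = pmod \<mu> p (\<lambda>x. inverse c *\<^sub>R u x)"
 by (simp add: modular_eq divide_inverse mult.commute)

lemma lux_set_nonempty:
 assumes [measurable]: "(u :: 'a => real) \<in> borel_measurable \<mu>" and fin: "pmod \<mu> p u < \<infinity>"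
 shows "\<exists>c>0. pmod \<mu> p (\<lambda>x. inverse c *\<^sub>R u x) <= 1"
proof -
 define k where "k = enn2real (pmod \<mu> p u)"
 have k: "pmod \<mu> p u = ennreal k" "0 <= k" using fin by (auto simp: k_def less_top)
 define c where "c = max 1 k"
 have c: "1 <= c" "k <= c" by (auto simp: c_def)
 have "pmod \<mu> p (\<lambda>x. inverse c *\<^sub>R u x) <= ennreal (inverse c powr lo) * pmod \<mu> p u"
  using c by (intro pmod_scale_le) (auto simp: field_simps)
 also have "... <= ennreal (inverse c powr 1) * ennreal c"
  using c lo k by (intro mult_mono ennreal_leI powr_mono') (auto simp: field_simps)
 also have "... = 1" using c by (simp add: ennreal_mult[symmetric])
 finally show ?thesis using c by (intro exI[of _ c]) auto
qed

text \<open>The exponent is bounded by hi, so scaling changes the modular by a finite factor, and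
  finiteness at one scale is finiteness at scale 1.\<close>

lemma Lp_var_iff: "Lp_var \<Omega> p u \<longleftrightarrow> u \<in> borel_measurable \<mu> \<and> pmod \<mu> p u < \<infinity>"
proof
 assume u: "Lp_var \<Omega> p u"
 then obtain c where c: "c > 0" "pmod \<mu> p (\<lambda>x. inverse c *\<^sub>R u x) < \<infinity>" and [measurable]: "u \<in> borel_measurable \<mu>"
  by (auto simp: Lp_var_def modular_scaled)
 have "pmod \<mu> p u = pmod \<mu> p (\<lambda>x. c *\<^sub>R (inverse c *\<^sub>R u x))" using c by (simp add: mult.assoc[symmetric])
 also have "... <= ennreal (max (\<bar>c\<bar> powr lo) (\<bar>c\<bar> powr hi)) * pmod \<mu> p (\<lambda>x. inverse c *\<^sub>R u x)" by (intro pmod_scale) measurable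
 also have "... < \<infinity>" using c by (simp add: ennreal_mult_less_top)
 finally show "u \<in> borel_measurable \<mu> \<and> pmod \<mu> p u < \<infinity>" by simp
next
 assume "u \<in> borel_measurable \<mu> \<and> pmod \<mu> p u < \<infinity>"
 then show "Lp_var \<Omega> p u" by (auto simp: Lp_var_def modular_eq intro!: exI[of _ 1])
qed

lemma lux_norm_nonneg:
 assumes "(u :: 'a => real) \<in> borel_measurable \<mu>" "pmod \<mu> p u < \<infinity>" shows "0 <= lux_norm \<Omega> p u"
 unfolding lux_norm_def modular_scaled using lux_set_nonempty[OF assms] by (intro cInf_greatest) auto

text \<open>Some scale d < c has modular at most 1, and scaling back by d <= 1 costs the factor d^lo
  <= d.\<close>

lemma pmod_le_of_lux_norm:
 assumes [measurable]: "(u :: 'a => real) \<in> borel_measurable \<mu>" and fin: "pmod \<mu> p u < \<infinity>" and lux: "lux_norm \<Omega> p u < c" and c: "c <= 1"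
 shows "pmod \<mu> p u <= ennreal c"
proof -
 have "{c. 0 < c \<and> pmod \<mu> p (\<lambda>x. inverse c *\<^sub>R u x) <= 1} \<noteq> {}" using lux_set_nonempty[OF assms(1) fin] by auto
 from cInf_lessD[OF this] lux obtain d where d: "0 < d" "pmod \<mu> p (\<lambda>x. inverse d *\<^sub>R u x) <= 1" "d < c"
  unfolding lux_norm_def modular_scaled by auto
 have "pmod \<mu> p u = pmod \<mu> p (\<lambda>x. d *\<^sub>R (inverse d *\<^sub>R u x))" using d by (simp add: mult.assoc[symmetric])
 also have "... <= ennreal (d powr lo) * pmod \<mu> p (\<lambda>x. inverse d *\<^sub>R u x)" using d c by (intro pmod_scale_le) auto
 also have "... <= ennreal (d powr 1) * 1" using d c lo by (intro mult_mono ennreal_leI powr_mono') auto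
 also have "... <= ennreal c" using d by (simp add: ennreal_leI)
 finally show ?thesis .
qed

text \<open>Scaling by 1/e >= 1 costs at most e^-hi, so e itself is admissible in the
  infimum.\<close>

lemma lux_norm_le_of_pmod:
 assumes [measurable]: "(u :: 'a => real) \<in> borel_measurable \<mu>" and e: "0 < e" "e <= 1" and le: "pmod \<mu> p u <= ennreal (e powr hi)"
 shows "lux_norm \<Omega> p u <= e"
 unfolding lux_norm_def modular_scaled
proof (rule cInf_lower)
 have "\<bar>inverse e\<bar> powr lo <= \<bar>inverse e\<bar> powr hi" using e lohi by (intro powr_mono) (auto simp: field_simps)
 then have "pmod \<mu> p (\<lambda>x. inverse e *\<^sub>R u x) <= ennreal (inverse e powr hi) * pmod \<mu> p u"
  using pmod_scale[of u "inverse e"] e by (simp add: max_absorb2)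
 also have "... <= ennreal (inverse e powr hi) * ennreal (e powr hi)" by (intro mult_left_mono le) auto
 also have "... = 1" using e by (simp add: ennreal_mult[symmetric] powr_mult[symmetric])
 finally show "e \<in> {c. 0 < c \<and> pmod \<mu> p (\<lambda>x. inverse c *\<^sub>R u x) <= 1}" using e by simp
qed (rule bdd_belowI[of _ 0], auto)

lemma W0_imp_W01p: assumes "W0 w" shows "W01p \<Omega> p (\<lambda>x. fst (w x))"
proof -
 have wm [measurable]: "w \<in> borel_measurable \<mu>" by (rule W0_measurable[OF assms])
 have comp: "pmod \<mu> p (\<lambda>x. fst (v x)) <= pmod \<mu> p v" "pmod \<mu> p (\<lambda>x. norm (snd (v x))) <= pmod \<mu> p v" for v :: "'a => real \<times> 'a"
  by (intro pmod_mono AE_I2; simp add: norm_prod_bounds)+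
 obtain \<phi> where \<phi>: "\<And>k. test_fun \<Omega> (\<phi> k)" "(\<lambda>k. pmod \<mu> p (\<lambda>x. tpair (\<phi> k) x - w x)) \<longlonglongrightarrow> 0"
  "(\<lambda>k. \<integral>\<^sup>+x. ennreal (norm (tpair (\<phi> k) x - w x)) \<partial>\<mu>) \<longlonglongrightarrow> 0" by (rule W0_sequence[OF assms]) (rule that)
 note [measurable] = tpair_measurable[OF \<phi>(1)]
 have fs: "fst (tpair (\<phi> k) x - w x) = \<phi> k x - fst (w x)" "snd (tpair (\<phi> k) x - w x) = grad (\<phi> k) x - snd (w x)" for k x
  by (simp_all add: tpair_def)
 have fin: "pmod \<mu> p (\<lambda>x. tpair (\<phi> k) x - w x) < \<infinity>" for k
  using pmod_diff[of "tpair (\<phi> k)" w] pmod_tpair_finite[OF \<phi>(1), of k] W0_finite[OF assms]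
  by (auto simp: ennreal_mult_less_top intro: le_less_trans)
 have m1: "(\<lambda>x. \<phi> k x - fst (w x)) \<in> borel_measurable \<mu>" and m2: "(\<lambda>x. norm (grad (\<phi> k) x - snd (w x))) \<in> borel_measurable \<mu>" for k
 proof -
  have [measurable]: "(\<lambda>x. fst (w x)) \<in> borel_measurable \<mu>" "(\<lambda>x. snd (w x)) \<in> borel_measurable \<mu>"
   using W0_integrable[OF assms] by auto
  note [measurable] = borel_measurable_test_on[OF \<phi>(1), of k \<Omega>]
  show "(\<lambda>x. \<phi> k x - fst (w x)) \<in> borel_measurable \<mu>" "(\<lambda>x. norm (grad (\<phi> k) x - snd (w x))) \<in> borel_measurable \<mu>"
   by measurable
 qed
 show ?thesis
  unfolding W01p_def
 proof (intro exI[of _ "\<lambda>x. snd (w x)"] exI[of _ \<phi>] conjI allI \<phi>(1))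
  show "W1p_grad \<Omega> p (\<lambda>x. fst (w x)) (\<lambda>x. snd (w x))"
   unfolding W1p_grad_def Lp_var_iff using W0_weak_grad[OF assms] comp[of w] W0_finite[OF assms]
    borel_measurable_integrable[OF W0_integrable(1)[OF assms]] borel_measurable_integrable[OF W0_integrable(2)[OF assms]]
   by (auto intro: le_less_trans)
  show "(\<lambda>k. lux_norm \<Omega> p (\<lambda>x. \<phi> k x - fst (w x)) + lux_norm \<Omega> p (\<lambda>x. norm (grad (\<phi> k) x - snd (w x)))) \<longlonglongrightarrow> 0"
  proof (rule LIMSEQ_I)
   fix e :: real assume e: "0 < e"
   define d where "d = min 1 (e/3)"
   have d: "0 < d" "d <= 1" "d + d < e" using e by (auto simp: d_def)
   have "\<forall>\<^sub>F k in sequentially. pmod \<mu> p (\<lambda>x. tpair (\<phi> k) x - w x) < ennreal (d powr hi)"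
    using order_tendstoD(2)[OF \<phi>(2), of "ennreal (d powr hi)"] d by simp
   then obtain k0 where k0: "\<And>k. k >= k0 ==> pmod \<mu> p (\<lambda>x. tpair (\<phi> k) x - w x) < ennreal (d powr hi)" by (auto simp: eventually_sequentially)
   have "norm (lux_norm \<Omega> p (\<lambda>x. \<phi> k x - fst (w x)) + lux_norm \<Omega> p (\<lambda>x. norm (grad (\<phi> k) x - snd (w x))) - 0) < e" if k: "k >= k0" for k
   proof -
    have c: "pmod \<mu> p (\<lambda>x. \<phi> k x - fst (w x)) <= pmod \<mu> p (\<lambda>x. tpair (\<phi> k) x - w x)" "pmod \<mu> p (\<lambda>x. norm (grad (\<phi> k) x - snd (w x))) <= pmod \<mu> p (\<lambda>x. tpair (\<phi> k) x - w x)"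
     using comp[of "\<lambda>x. tpair (\<phi> k) x - w x"] by (simp_all only: fs)
    have "lux_norm \<Omega> p (\<lambda>x. \<phi> k x - fst (w x)) <= d" "lux_norm \<Omega> p (\<lambda>x. norm (grad (\<phi> k) x - snd (w x))) <= d"
     using c k0[OF k] d by (intro lux_norm_le_of_pmod m1 m2; simp)+
    moreover have "0 <= lux_norm \<Omega> p (\<lambda>x. \<phi> k x - fst (w x))" "0 <= lux_norm \<Omega> p (\<lambda>x. norm (grad (\<phi> k) x - snd (w x)))"
     using c fin[of k] by (intro lux_norm_nonneg m1 m2; auto intro: le_less_trans)+
    ultimately show ?thesis using d by simp
   qed
   then show "\<exists>k0. \<forall>k\<ge>k0. norm (lux_norm \<Omega> p (\<lambda>x. \<phi> k x - fst (w x)) + lux_norm \<Omega> p (\<lambda>x. norm (grad (\<phi> k) x - snd (w x))) - 0) < e" by blast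
  qed
 qed
qed

text \<open>The first component of the pair is u itself and not a version of it, so no null set has
  to be tracked for the function.\<close>

lemma W01p_imp_W0:
 assumes "W01p \<Omega> p u"
 obtains g where "W0 (\<lambda>x. (u x, g x))" "weak_grad \<Omega> u g"
proof -
 obtain g \<phi> where g: "W1p_grad \<Omega> p u g" and \<phi>: "\<And>k. test_fun \<Omega> (\<phi> k)"
  and lim: "(\<lambda>k. lux_norm \<Omega> p (\<lambda>x. \<phi> k x - u x) + lux_norm \<Omega> p (\<lambda>x. norm (grad (\<phi> k) x - g x))) \<longlonglongrightarrow> 0"
  using assms unfolding W01p_def by blast
 have [measurable]: "u \<in> borel_measurable \<mu>" "g \<in> borel_measurable \<mu>" using g by (auto simp: W1p_grad_def Lp_var_def)
 note [measurable] = borel_measurable_test_on(1)[OF \<phi>, of _ \<Omega>] borel_measurable_test_on(2)[OF \<phi>, of _ \<Omega>]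
 have finu: "pmod \<mu> p u < \<infinity>" and fing: "pmod \<mu> p (\<lambda>x. norm (g x)) < \<infinity>" using g by (auto simp: W1p_grad_def Lp_var_iff)
 have t: "pmod \<mu> p (\<phi> k) < \<infinity>" "pmod \<mu> p (\<lambda>x. norm (grad (\<phi> k) x)) < \<infinity>" for k
 proof -
  obtain B where B: "0 < B" "\<And>x. \<bar>\<phi> k x\<bar> <= B" "\<And>x. norm (grad (\<phi> k) x) <= B" by (rule test_fun_bounded[OF \<phi>]) (rule that)
  show "pmod \<mu> p (\<phi> k) < \<infinity>" by (rule pmod_bounded_finite[of _ B]) (use B in auto)
  show "pmod \<mu> p (\<lambda>x. norm (grad (\<phi> k) x)) < \<infinity>" by (rule pmod_bounded_finite[of _ B]) (use B in auto)
 qed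
 have f1: "pmod \<mu> p (\<lambda>x. \<phi> k x - u x) < \<infinity>" for k
  using pmod_diff[of "\<phi> k" u] t(1)[of k] finu by (auto simp: ennreal_mult_less_top intro: le_less_trans)
 have pn: "pmod \<mu> p (\<lambda>x. norm (v x)) = pmod \<mu> p v" for v :: "'a => 'a" by (simp add: pmod_def)
 have f2: "pmod \<mu> p (\<lambda>x. norm (grad (\<phi> k) x - g x)) < \<infinity>" for k
  using pmod_diff[of "grad (\<phi> k)" g] t(2)[of k] fing unfolding pn by (auto simp: ennreal_mult_less_top intro: le_less_trans)
 have "W0 (\<lambda>x. (u x, g x))"
  unfolding W0_def
 proof (intro conjI allI impI)
  show "(\<lambda>x. (u x, g x)) \<in> borel_measurable \<mu>" by measurable
  fix e :: real assume e: "0 < e"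
  define c where "c = min 1 (e / (2 * 2 powr hi))"
  have c: "0 < c" "c <= 1" "c <= e / (2 * 2 powr hi)" using e by (auto simp: c_def)
  have "\<forall>\<^sub>F k in sequentially. lux_norm \<Omega> p (\<lambda>x. \<phi> k x - u x) + lux_norm \<Omega> p (\<lambda>x. norm (grad (\<phi> k) x - g x)) < c"
   using order_tendstoD(2)[OF lim c(1)] .
  then obtain k where k: "lux_norm \<Omega> p (\<lambda>x. \<phi> k x - u x) + lux_norm \<Omega> p (\<lambda>x. norm (grad (\<phi> k) x - g x)) < c" by (auto simp: eventually_sequentially)
  have n: "0 <= lux_norm \<Omega> p (\<lambda>x. \<phi> k x - u x)" "0 <= lux_norm \<Omega> p (\<lambda>x. norm (grad (\<phi> k) x - g x))"
   by (intro lux_norm_nonneg f1 f2; measurable)+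
  have k1: "pmod \<mu> p (\<lambda>x. \<phi> k x - u x) <= ennreal c" by (rule pmod_le_of_lux_norm[OF _ f1]) (use k n c in auto)
  have k2: "pmod \<mu> p (\<lambda>x. norm (grad (\<phi> k) x - g x)) <= ennreal c" by (rule pmod_le_of_lux_norm[OF _ f2]) (use k n c in auto)
  have "pmod \<mu> p (\<lambda>x. tpair (\<phi> k) x - (u x, g x)) = pmod \<mu> p (\<lambda>x. (\<phi> k x - u x, 0 :: 'a) + (0, grad (\<phi> k) x - g x))"
   by (simp add: tpair_def)
  also have "... <= ennreal (2 powr hi) * (pmod \<mu> p (\<lambda>x. (\<phi> k x - u x, 0 :: 'a)) + pmod \<mu> p (\<lambda>x. (0 :: real, grad (\<phi> k) x - g x)))"
   by (intro pmod_add) measurable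
  also have "pmod \<mu> p (\<lambda>x. (\<phi> k x - u x, 0 :: 'a)) = pmod \<mu> p (\<lambda>x. \<phi> k x - u x)" by (simp add: pmod_def norm_Pair)
  also have "pmod \<mu> p (\<lambda>x. (0 :: real, grad (\<phi> k) x - g x)) = pmod \<mu> p (\<lambda>x. norm (grad (\<phi> k) x - g x))" by (simp add: pmod_def norm_Pair)
  also have "ennreal (2 powr hi) * (pmod \<mu> p (\<lambda>x. \<phi> k x - u x) + pmod \<mu> p (\<lambda>x. norm (grad (\<phi> k) x - g x))) 
    <= ennreal (2 powr hi) * (ennreal (e / (2 * 2 powr hi)) + ennreal (e / (2 * 2 powr hi)))"
   using k1 k2 ennreal_leI[OF c(3)] by (intro mult_left_mono add_mono) (auto intro: order_trans)
  finally have "pmod \<mu> p (\<lambda>x. tpair (\<phi> k) x - (u x, g x)) <= ennreal e" by (simp only: half_eps(2)[OF e])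
  then show "\<exists>\<phi>. test_fun \<Omega> \<phi> \<and> pmod \<mu> p (\<lambda>x. tpair \<phi> x - (u x, g x)) <= ennreal e" using \<phi> by blast
 qed
 moreover have "weak_grad \<Omega> u g" using g by (simp add: W1p_grad_def)
 ultimately show thesis by (rule that)
qed

end

section \<open>The gauge of a convex modular\<close>

instantiation "fun" :: (type, real_vector) real_vector
begin
definition "scaleR c f = (\<lambda>x. c *\<^sub>R f x)"
instance
 by standard (auto simp: scaleR_fun_def fun_eq_iff algebra_simps)
end

lemma scaleR_fun_apply [simp]: "(c *\<^sub>R f) x = c *\<^sub>R f x"
 by (simp add: scaleR_fun_def)

text \<open>\<open>lo\<close> and \<open>hi\<close> are the extreme rates at which the modular
  shrinks under contraction; they yield the comparison of gauge and modular on both sides of 1. The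
  gauge is only a seminorm, as the modular may vanish at nonzero vectors.\<close>

locale convex_modular =
 fixes E :: "'v::real_vector set" and \<rho> :: "'v => real" and lo hi :: real
 assumes E: "subspace E"
  and conv: "[|v \<in> E; w \<in> E; 0 <= t; t <= 1|] ==> \<rho> ((1-t) *\<^sub>R v + t *\<^sub>R w) <= (1-t) * \<rho> v + t * \<rho> w"
  and nonneg: "v \<in> E ==> 0 <= \<rho> v"
  and neg: "v \<in> E ==> \<rho> (- v) = \<rho> v"
  and upper: "[|v \<in> E; 0 < c; c <= 1|] ==> \<rho> (c *\<^sub>R v) <= c powr lo * \<rho> v"
  and lower: "[|v \<in> E; 0 < c; c <= 1|] ==> c powr hi * \<rho> v <= \<rho> (c *\<^sub>R v)"
  and lo: "1 < lo" "lo <= hi"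
begin

definition gset :: "'v => real set" where
 "gset v = {c. 0 < c \<and> \<rho> (inverse c *\<^sub>R v) <= 1}"

definition gauge :: "'v => real" where
 "gauge v = Inf (gset v)"

lemma scaleE: "v \<in> E ==> c *\<^sub>R v \<in> E"
 using E by (simp add: subspace_scale)

lemma gset_nonempty: assumes "v \<in> E" shows "gset v \<noteq> {}"
proof -
 define c where "c = max 1 (\<rho> v)"
 have c: "c >= 1" "\<rho> v <= c" by (auto simp: c_def)
 have "\<rho> (inverse c *\<^sub>R v) <= inverse c powr lo * \<rho> v"
  using c by (intro upper assms) (auto simp: field_simps)
 also have "inverse c powr lo <= inverse c powr 1"
  using c lo by (intro powr_mono') (auto simp: field_simps)
 then have "inverse c powr lo * \<rho> v <= inverse c * c"
  using c nonneg[OF assms] by (intro mult_mono) auto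
 finally have "c \<in> gset v" using c by (auto simp: gset_def)
 then show ?thesis by auto
qed

lemma gset_bdd: "bdd_below (gset v)"
 by (rule bdd_belowI[of _ 0]) (auto simp: gset_def)

lemma gset_up: assumes "v \<in> E" "c \<in> gset v" "c <= d" shows "d \<in> gset v"
proof -
 have c: "c > 0" "\<rho> (inverse c *\<^sub>R v) <= 1" using assms by (auto simp: gset_def)
 have "\<rho> ((c/d) *\<^sub>R (inverse c *\<^sub>R v)) <= (c/d) powr lo * \<rho> (inverse c *\<^sub>R v)"
  using c assms by (intro upper scaleE) (auto simp: field_simps)
 also have "... <= 1 * 1"
  using c assms lo nonneg[OF scaleE] by (intro mult_mono powr_le1) (auto simp: field_simps)
 finally show ?thesis using c assms by (auto simp: gset_def field_simps)
qed

lemma gauge_lessD: assumes "v \<in> E" "gauge v < c" shows "c \<in> gset v"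
proof -
 obtain d where "d \<in> gset v" "d < c"
  using cInf_lessD[OF gset_nonempty] assms unfolding gauge_def by blast
 then show ?thesis using gset_up assms by force
qed

lemma gauge_le: "c \<in> gset v ==> gauge v <= c"
 unfolding gauge_def by (intro cInf_lower gset_bdd)

lemma gauge_nonneg: "v \<in> E ==> 0 <= gauge v"
 unfolding gauge_def by (intro cInf_greatest gset_nonempty) (auto simp: gset_def)

lemma gauge_triangle: assumes "v \<in> E" "w \<in> E" shows "gauge (v + w) <= gauge v + gauge w"
proof (rule field_le_epsilon)
 fix e :: real assume e: "e > 0"
 define a b where "a = gauge v + e/2" and "b = gauge w + e/2"
 have ab: "a > 0" "b > 0" using gauge_nonneg assms e by (auto simp: a_def b_def add_nonneg_pos)
 have "a \<in> gset v" "b \<in> gset w" using assms e by (auto intro!: gauge_lessD simp: a_def b_def)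
 then have 1: "\<rho> (inverse a *\<^sub>R v) <= 1" "\<rho> (inverse b *\<^sub>R w) <= 1" by (auto simp: gset_def)
 \<comment> \<open>The scaled sum is a convex combination of v/a and w/b, both of modular at most
   1.\<close>
 have eq: "inverse (a + b) *\<^sub>R (v + w) = (1 - b/(a+b)) *\<^sub>R (inverse a *\<^sub>R v) + (b/(a+b)) *\<^sub>R (inverse b *\<^sub>R w)"
 proof -
  have "1 - b/(a+b) = a/(a+b)" using ab by (simp add: field_simps)
  then show ?thesis using ab by (simp add: scaleR_add_right divide_simps)
 qed
 have "\<rho> (inverse (a + b) *\<^sub>R (v + w)) <= (1 - b/(a+b)) * \<rho> (inverse a *\<^sub>R v) + (b/(a+b)) * \<rho> (inverse b *\<^sub>R w)"
  unfolding eq using ab assms by (intro conv scaleE) (auto simp: field_simps)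
 also have "... <= (1 - b/(a+b)) * 1 + (b/(a+b)) * 1"
  using 1 ab by (intro add_mono mult_left_mono) (auto simp: field_simps)
 finally have "a + b \<in> gset (v + w)" using ab by (auto simp: gset_def)
 then have "gauge (v + w) <= a + b" by (rule gauge_le)
 then show "gauge (v + w) <= gauge v + gauge w + e" by (simp add: a_def b_def)
qed

lemma rho_zero: "\<rho> 0 = 0"
proof -
 have z: "0 \<in> E" using E by (simp add: subspace_0)
 have "\<rho> ((1/2) *\<^sub>R 0) <= (1/2) powr lo * \<rho> 0" by (rule upper) (auto simp: z)
 then have "\<rho> 0 * (1 - (1/2) powr lo) <= 0" by (simp add: algebra_simps)
 moreover have "(1/2) powr lo < (1::real)"
  using lo powr_less_mono'[of "1/2" 0 lo] by simp
 ultimately show ?thesis using nonneg[OF z] by (auto simp: mult_le_0_iff)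
qed

lemma gauge_zero: "gauge 0 = 0"
proof -
 have "gset 0 = {0<..}" by (auto simp: gset_def rho_zero)
 then show ?thesis by (simp add: gauge_def cInf_greaterThan)
qed

lemma gauge_scale_le: assumes "v \<in> E" "c > 0" shows "gauge (c *\<^sub>R v) <= c * gauge v"
proof (rule field_le_epsilon)
 fix e :: real assume e: "e > 0"
 have "gauge v + e/c \<in> gset v" using assms e by (intro gauge_lessD) auto
 moreover have "inverse (c * (gauge v + e/c)) *\<^sub>R (c *\<^sub>R v) = inverse (gauge v + e/c) *\<^sub>R v"
  using assms by simp
 ultimately have "c * (gauge v + e/c) \<in> gset (c *\<^sub>R v)" 
  unfolding gset_def mem_Collect_eq using assms by (simp only:) simp
 from gauge_le[OF this] show "gauge (c *\<^sub>R v) <= c * gauge v + e" using assms by (simp add: distrib_left)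
qed

lemma gauge_neg: "v \<in> E ==> gauge (- v) = gauge v"
 using neg[OF scaleE] by (simp add: gauge_def gset_def)

lemma gauge_scale: assumes "v \<in> E" shows "gauge (c *\<^sub>R v) = \<bar>c\<bar> * gauge v"
proof -
 have pos: "gauge (c *\<^sub>R v) = c * gauge v" if "c > 0" for c
  using gauge_scale_le[OF scaleE[OF assms], of "inverse c" c] gauge_scale_le[OF assms that] that
  by (simp add: field_simps)
 consider "c > 0" | "c = 0" | "c < 0" by linarith
 then show ?thesis
 proof cases
  case 3
  then have "gauge (c *\<^sub>R v) = gauge (- ((-c) *\<^sub>R v))" by simp
  also have "... = gauge ((-c) *\<^sub>R v)" by (rule gauge_neg) (simp add: scaleE assms subspace_neg E)
  finally show ?thesis using pos[of "-c"] 3 by simp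
 qed (auto simp: pos gauge_zero)
qed

lemma rho_le_powr_hi: assumes "v \<in> E" "gauge v < c" "c >= 1" shows "\<rho> v <= c powr hi"
proof -
 have "\<rho> (inverse c *\<^sub>R v) <= 1" using gauge_lessD[OF assms(1,2)] by (auto simp: gset_def)
 moreover have "inverse c powr hi * \<rho> v <= \<rho> (inverse c *\<^sub>R v)"
  using assms by (intro lower) (auto simp: field_simps)
 ultimately have "inverse c powr hi * \<rho> v <= 1" by linarith
 then have "\<rho> v / (c powr hi) <= 1" using assms by (simp add: inverse_eq_divide powr_divide)
 then show ?thesis using assms by (simp add: field_simps)
qed

lemma rho_le_powr_lo: assumes "v \<in> E" "gauge v < c" "c <= 1" shows "\<rho> v <= c powr lo"
proof -
 have c: "c > 0" using gauge_nonneg assms by (meson le_less_trans)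
 have "\<rho> (inverse c *\<^sub>R v) <= 1" using gauge_lessD[OF assms(1,2)] by (auto simp: gset_def)
 moreover have "\<rho> (c *\<^sub>R (inverse c *\<^sub>R v)) <= c powr lo * \<rho> (inverse c *\<^sub>R v)"
  using assms c by (intro upper scaleE) auto
 ultimately show ?thesis using c by simp (smt (verit) mult_left_le powr_gt_zero)
qed

lemma gauge_le_powr: assumes "v \<in> E" "0 < c" "c <= 1" "\<rho> v <= c powr hi" shows "gauge v <= c"
proof -
 have "c powr hi * \<rho> (inverse c *\<^sub>R v) <= \<rho> (c *\<^sub>R (inverse c *\<^sub>R v))"
  using assms by (intro lower scaleE) auto
 moreover have "\<rho> (c *\<^sub>R (inverse c *\<^sub>R v)) = \<rho> v" using assms by simp
 ultimately have "c powr hi * \<rho> (inverse c *\<^sub>R v) <= c powr hi * 1" using assms(4) by linarith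
 then have "\<rho> (inverse c *\<^sub>R v) <= 1" using assms by (subst (asm) mult_le_cancel_left_pos) auto
 then show ?thesis using assms by (intro gauge_le) (auto simp: gset_def)
qed

lemma rho_ge_powr_hi: assumes "v \<in> E" "0 < c" "c < gauge v" "c <= 1" shows "c powr hi <= \<rho> v"
 using gauge_le_powr[of v c] assms by (meson leI le_less_trans less_le_not_le linear)

lemma rho_ge_powr_lo: assumes "v \<in> E" "1 <= c" "c < gauge v" shows "c powr lo <= \<rho> v"
proof -
 have "c \<notin> gset v" using gauge_le[of c v] assms by linarith
 then have 1: "1 < \<rho> (inverse c *\<^sub>R v)" using assms by (auto simp: gset_def)
 have "\<rho> (inverse c *\<^sub>R v) <= inverse c powr lo * \<rho> v"
  using assms by (intro upper) (auto simp: field_simps)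
 then have "1 < inverse c powr lo * \<rho> v" using 1 by linarith
 then have "1 < \<rho> v / (c powr lo)" using assms by (simp add: inverse_eq_divide powr_divide)
 then show ?thesis using assms by (simp add: field_simps)
qed

end

text \<open>Integer translates form a piecewise linear partition of unity, used to interpolate
  descent directions between the nodes of a path.\<close>

definition hat :: "real => real" where "hat x = max 0 (1 - \<bar>x\<bar>)"

lemma hat_nonneg: "0 <= hat x" and hat_pos_iff: "0 < hat x \<longleftrightarrow> \<bar>x\<bar> < 1"
 and hat_lipschitz: "\<bar>hat x - hat y\<bar> <= \<bar>x - y\<bar>"
 by (auto simp: hat_def)

lemma sum_hat: "0 <= x ==> x <= real m ==> (\<Sum>i\<le>m. hat (x - real i)) = 1"
proof (induction m)
 case 0 then show ?case by (simp add: hat_def)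
next
 case (Suc m)
 show ?case
 proof (cases "x <= real m")
  case True
  then have "hat (x - real (Suc m)) = 0" by (auto simp: hat_def)
  with Suc True show ?thesis by simp
 next
  case False
  have "(\<Sum>i<m. hat (x - real i)) = 0"
   using False by (intro sum.neutral) (auto simp: hat_def)
  then have "(\<Sum>i\<le>m. hat (x - real i)) = hat (x - real m)"
   by (simp add: lessThan_Suc_atMost[symmetric])
  then show ?thesis using False Suc by (simp add: hat_def)
 qed
qed

subsection \<open>The mountain pass argument\<close>

text \<open>Only directional derivatives are assumed, bounded and uniformly continuous on bounded
  sets in the dual seminorm; no limit of a sequence in E is taken in this locale.\<close>

locale seminormed_functional =
 fixes E :: "'v::real_vector set" and N :: "'v => real"
  and J :: "'v => real" and D :: "'v => 'v => real"
 assumes E: "subspace E"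
  and N_triangle: "[|v \<in> E; w \<in> E|] ==> N (v + w) <= N v + N w"
  and N_scale: "v \<in> E ==> N (c *\<^sub>R v) = \<bar>c\<bar> * N v"
  and D_add: "[|u \<in> E; v \<in> E; w \<in> E|] ==> D u (v + w) = D u v + D u w"
  and D_scale: "[|u \<in> E; v \<in> E|] ==> D u (c *\<^sub>R v) = c * D u v"
  and J_deriv: "[|u \<in> E; v \<in> E|] ==>
   ((\<lambda>s. J (u + s *\<^sub>R v)) has_real_derivative D (u + s *\<^sub>R v) v) (at s)"
  and D_ucont: "0 < e ==> \<exists>d>0. \<forall>u\<in>E. \<forall>v\<in>E. N u <= R --> N v <= R --> N (u - v) < d -->
   (\<forall>w\<in>E. N w <= 1 --> \<bar>D u w - D v w\<bar> <= e)"
  and D_bounded: "\<exists>B. \<forall>u\<in>E. N u <= R --> (\<forall>w\<in>E. N w <= 1 --> \<bar>D u w\<bar> <= B)"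
begin

lemma add_in: "v \<in> E ==> w \<in> E ==> v + w \<in> E" and scale_in: "v \<in> E ==> c *\<^sub>R v \<in> E"
 and diff_in: "v \<in> E ==> w \<in> E ==> v - w \<in> E" and zero_in: "0 \<in> E"
 and sum_in: "(\<And>i. i \<in> A ==> g i \<in> E) ==> sum g A \<in> E"
 using E by (auto simp: subspace_add subspace_scale subspace_diff subspace_0 intro: subspace_sum)

lemma N_zero [simp]: "N 0 = 0"
 using N_scale[OF zero_in, of 0] by simp

lemma N_nonneg: "v \<in> E ==> 0 <= N v"
 using N_triangle[of v "(-1) *\<^sub>R v"] N_scale[of v "-1"] scale_in[of v "-1"] by simp

lemma N_minus: "v \<in> E ==> w \<in> E ==> N (v - w) = N (w - v)"
 using N_scale[OF diff_in, of v w "-1"] by simp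

lemma N_sum: "(\<And>i. i \<in> A ==> g i \<in> E) ==> N (sum g A) <= (\<Sum>i\<in>A. N (g i))"
proof (induction A rule: infinite_finite_induct)
 case (insert x F)
 then have "N (g x + sum g F) <= N (g x) + N (sum g F)" by (intro N_triangle sum_in) auto
 with insert show ?case by auto
qed auto

lemma D_sum: "u \<in> E ==> (\<And>i. i \<in> A ==> g i \<in> E) ==> D u (sum g A) = (\<Sum>i\<in>A. D u (g i))"
proof (induction A rule: infinite_finite_induct)
 case (insert x F)
 then have "D u (g x + sum g F) = D u (g x) + D u (sum g F)" by (intro D_add sum_in) auto
 with insert show ?case by auto
qed (use D_scale[OF _ zero_in, of u 0] in auto)

lemma D_le_N:
 assumes u: "u \<in> E" "v \<in> E" and B: "\<forall>w\<in>E. N w <= 1 --> \<bar>D u w\<bar> <= B"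
 shows "\<bar>D u v\<bar> <= B * N v"
proof (rule field_le_epsilon)
 fix e :: real assume e: "e > 0"
 have B0: "B >= 0" using B zero_in by fastforce
 \<comment> \<open>N v may be 0, so v is normalised by a slightly larger positive number; the slack
   e/(B+1), multiplied by B, stays below e.\<close>
 define c where "c = N v + e / (B + 1)"
 have c: "c > 0" "N v <= c" using N_nonneg[OF u(2)] e B0 by (auto simp: c_def add_nonneg_pos)
 have "N (inverse c *\<^sub>R v) <= 1" using c N_scale[OF u(2)] by (simp add: field_simps)
 then have "\<bar>D u (inverse c *\<^sub>R v)\<bar> <= B" using B u scale_in by blast
 then have "\<bar>D u v\<bar> <= B * c" using c D_scale[OF u] by (simp add: abs_mult field_simps)
 also have "... <= B * N v + e" using B0 e by (simp add: c_def field_simps)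
 finally show "\<bar>D u v\<bar> <= B * N v + e" .
qed

lemma mean_value:
 assumes "u \<in> E" "v \<in> E" "0 < h"
 obtains s where "0 < s" "s < h" "J (u + h *\<^sub>R v) - J u = h * D (u + s *\<^sub>R v) v"
 using MVT2[of 0 h "\<lambda>s. J (u + s *\<^sub>R v)" "\<lambda>s. D (u + s *\<^sub>R v) v"] J_deriv assms by auto

lemma J_lipschitz:
 assumes B: "\<forall>u\<in>E. N u <= R --> (\<forall>w\<in>E. N w <= 1 --> \<bar>D u w\<bar> <= B)"
  and u: "u \<in> E" "v \<in> E" "N u + N v <= R"
 shows "\<bar>J (u + v) - J u\<bar> <= B * N v"
proof -
 obtain s where s: "0 < s" "s < 1" "J (u + 1 *\<^sub>R v) - J u = 1 * D (u + s *\<^sub>R v) v"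
  using mean_value[OF u(1,2), of 1] by auto
 have "N (u + s *\<^sub>R v) <= N u + s * N v" using N_triangle[of u "s *\<^sub>R v"] N_scale[of v s] u scale_in s by auto
 also have "... <= N u + N v" using s N_nonneg[OF u(2)] by (simp add: mult_left_le_one_le)
 finally have "N (u + s *\<^sub>R v) <= R" using u by linarith
 then have "\<bar>D (u + s *\<^sub>R v) v\<bar> <= B * N v" using u B by (intro D_le_N) (auto intro: add_in scale_in)
 then show ?thesis using s by simp
qed

text \<open>Whenever the derivative is bounded away from \<open>0\<close> on the relevant levels, every path can be
 lowered by a fixed amount while moving it by at most \<open>h\<close>.\<close>

lemma descent_step:
 assumes h: "0 < h" "h <= 1" "2 * h <= d" "8 * h * B <= a" and "0 < a"
  and B: "\<forall>u\<in>E. N u <= R --> (\<forall>w\<in>E. N w <= 1 --> \<bar>D u w\<bar> <= B)"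
  and d: "\<forall>u\<in>E. \<forall>v\<in>E. N u <= R --> N v <= R --> N (u - v) < d -->
   (\<forall>w\<in>E. N w <= 1 --> \<bar>D u w - D v w\<bar> <= \<epsilon>/4)" and \<epsilon>: "0 < \<epsilon>"
  and desc: "\<And>u. [|u \<in> E; a/2 <= J u; J u <= K|] ==> \<exists>w\<in>E. N w <= 1 \<and> D u w < - \<epsilon>"
  and \<gamma>E: "\<And>t. \<gamma> t \<in> E" and lip: "\<And>s t. s \<in> {0..1} ==> t \<in> {0..1} ==> N (\<gamma> s - \<gamma> t) <= L * \<bar>s - t\<bar>"
  and \<gamma>K: "\<And>t. t \<in> {0..1} ==> J (\<gamma> t) <= K" and \<gamma>R: "\<And>t. t \<in> {0..1} ==> N (\<gamma> t) + h <= R"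
  and J0: "J (\<gamma> 0) < a/2" "J (\<gamma> 1) < a/2"
 obtains \<gamma>' L' where "\<And>t. \<gamma>' t \<in> E"
  "\<And>s t. s \<in> {0..1} ==> t \<in> {0..1} ==> N (\<gamma>' s - \<gamma>' t) <= L' * \<bar>s - t\<bar>"
  "\<And>t. t \<in> {0..1} ==> N (\<gamma>' t) <= N (\<gamma> t) + h"
  "\<And>t. t \<in> {0..1} ==> J (\<gamma>' t) <= max (3*a/4) (J (\<gamma> t) - h * \<epsilon> / 2)"
  "\<gamma>' 0 = \<gamma> 0" "\<gamma>' 1 = \<gamma> 1"
proof -
 have B0: "B >= 0"
 proof -
  have "N (\<gamma> 0) <= R" using \<gamma>R[of 0] h by simp
  then have "\<bar>D (\<gamma> 0) 0\<bar> <= B" using B \<gamma>E[of 0] zero_in by simp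
  then show ?thesis by linarith
 qed
 \<comment> \<open>A descent direction at points in the relevant range of levels and 0 elsewhere;
   the latter also keeps the end points of the path fixed, since J is below a/2 there.\<close>
 define W where "W u = (if a/2 <= J u \<and> J u <= K then SOME w. w \<in> E \<and> N w <= 1 \<and> D u w < - \<epsilon> else 0)" for u
 have W: "W u \<in> E \<and> N (W u) <= 1 \<and> (a/2 <= J u \<and> J u <= K --> D u (W u) < - \<epsilon>)" if "u \<in> E" for u
 proof (cases "a/2 <= J u \<and> J u <= K")
  case True
  then have "\<exists>w. w \<in> E \<and> N w <= 1 \<and> D u w < - \<epsilon>" using desc that by blast
  from someI_ex[OF this] show ?thesis using True by (simp add: W_def)
 qed (auto simp: W_def zero_in)
 \<comment> \<open>A mesh so fine that points of the path within one mesh width are at most h apart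
   in N.\<close>
 obtain m0 where m0: "L / h < real m0" using reals_Archimedean2 by blast
 define m where "m = Suc m0"
 have m: "m > 0" "L / real m <= h"
  using m0 h by (auto simp: m_def field_simps) 
 define w where "w i = W (\<gamma> (real i / real m))" for i
 have wE: "w i \<in> E" and wN: "N (w i) <= 1" for i using W[OF \<gamma>E] by (auto simp: w_def)
 define V where "V t = (\<Sum>i\<le>m. hat (real m * t - real i) *\<^sub>R w i)" for t
 have VE: "V t \<in> E" for t unfolding V_def by (intro sum_in scale_in wE)
 have hat1: "(\<Sum>i\<le>m. hat (real m * t - real i)) = 1" if "t \<in> {0..1}" for t
  using that m by (intro sum_hat) (auto simp: mult_left_le)
 have VN: "N (V t) <= 1" if "t \<in> {0..1}" for t
 proof -
  have "N (V t) <= (\<Sum>i\<le>m. N (hat (real m * t - real i) *\<^sub>R w i))"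
   unfolding V_def by (intro N_sum scale_in wE)
  also have "... = (\<Sum>i\<le>m. hat (real m * t - real i) * N (w i))"
   by (simp add: N_scale[OF wE] hat_nonneg)
  also have "... <= (\<Sum>i\<le>m. hat (real m * t - real i) * 1)"
   by (intro sum_mono mult_left_mono wN hat_nonneg)
  finally show ?thesis using hat1[OF that] by simp
 qed
 define \<gamma>' where "\<gamma>' t = \<gamma> t + h *\<^sub>R V t" for t
 have near: "\<bar>t - real i / real m\<bar> <= 1 / real m" if "0 < hat (real m * t - real i)" for t i
 proof -
  have "\<bar>real m * (t - real i / real m)\<bar> < 1" using that m by (simp add: hat_pos_iff right_diff_distrib)
  then have "real m * \<bar>t - real i / real m\<bar> < 1" by (simp only: abs_mult abs_of_nat)
  then have "\<bar>t - real i / real m\<bar> < 1 / real m" using m by (subst pos_less_divide_eq) (auto simp: mult.commute)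
  then show ?thesis by simp
 qed
 show thesis
 proof
  show "\<gamma>' t \<in> E" for t unfolding \<gamma>'_def by (intro add_in scale_in VE \<gamma>E)
  show "N (\<gamma>' t) <= N (\<gamma> t) + h" if "t \<in> {0..1}" for t
  proof -
   have "N (\<gamma>' t) <= N (\<gamma> t) + h * N (V t)" unfolding \<gamma>'_def
    using N_triangle[OF \<gamma>E scale_in[OF VE]] N_scale[OF VE] h by (metis abs_of_pos)
   then show ?thesis using VN[OF that] h mult_left_le[of "N (V t)" h] by linarith
  qed
  define L' where "L' = L + h * (real m * real (Suc m))"
  show "N (\<gamma>' s - \<gamma>' t) <= L' * \<bar>s - t\<bar>" if st: "s \<in> {0..1}" "t \<in> {0..1}" for s t
  proof -
   have "V s - V t = (\<Sum>i\<le>m. (hat (real m * s - real i) - hat (real m * t - real i)) *\<^sub>R w i)"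
    by (simp add: V_def sum_subtractf scaleR_left_diff_distrib)
   then have "N (V s - V t) <= (\<Sum>i\<le>m. N ((hat (real m * s - real i) - hat (real m * t - real i)) *\<^sub>R w i))"
    by (auto intro!: N_sum scale_in wE)
   also have "... <= (\<Sum>i\<le>m. real m * \<bar>s - t\<bar>)"
   proof (rule sum_mono)
    fix i
    have "\<bar>hat (real m * s - real i) - hat (real m * t - real i)\<bar> <= \<bar>(real m * s - real i) - (real m * t - real i)\<bar>"
     by (rule hat_lipschitz)
    also have "(real m * s - real i) - (real m * t - real i) = real m * (s - t)" by (simp add: algebra_simps)
    finally have "\<bar>hat (real m * s - real i) - hat (real m * t - real i)\<bar> <= real m * \<bar>s - t\<bar>" by (simp add: abs_mult)
    then have "\<bar>hat (real m * s - real i) - hat (real m * t - real i)\<bar> * N (w i) <= real m * \<bar>s - t\<bar> * 1"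
     using wN[of i] N_nonneg[OF wE, of i] by (intro mult_mono) auto
    then show "N ((hat (real m * s - real i) - hat (real m * t - real i)) *\<^sub>R w i) <= real m * \<bar>s - t\<bar>"
     by (simp add: N_scale[OF wE])
   qed
   also have "... = real m * real (Suc m) * \<bar>s - t\<bar>" by simp
   finally have V: "N (V s - V t) <= real m * real (Suc m) * \<bar>s - t\<bar>" .
   have eq: "\<gamma>' s - \<gamma>' t = (\<gamma> s - \<gamma> t) + h *\<^sub>R (V s - V t)" by (simp add: \<gamma>'_def algebra_simps)
   have "N (\<gamma>' s - \<gamma>' t) <= N (\<gamma> s - \<gamma> t) + h * N (V s - V t)"
    unfolding eq using N_triangle[OF diff_in scale_in[OF diff_in]] N_scale[OF diff_in] \<gamma>E VE h
    by (metis abs_of_pos)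
   also have "... <= L * \<bar>s - t\<bar> + h * (real m * real (Suc m) * \<bar>s - t\<bar>)"
    using V h by (intro add_mono lip[OF st] mult_left_mono) auto
   finally show ?thesis by (simp add: L'_def algebra_simps)
  qed
  show "\<gamma>' 0 = \<gamma> 0"
  proof -
   have "V 0 = (\<Sum>i\<le>m. if i = 0 then w 0 else 0)"
    unfolding V_def by (intro sum.cong) (auto simp: hat_def)
   also have "... = w 0" by simp
   also have "w 0 = 0" using J0 by (auto simp: w_def W_def)
   finally show ?thesis by (simp add: \<gamma>'_def)
  qed
  show "\<gamma>' 1 = \<gamma> 1"
  proof -
   have "V 1 = (\<Sum>i\<le>m. if i = m then w m else 0)"
    unfolding V_def by (intro sum.cong) (auto simp: hat_def)
   also have "... = w m" by simp
   also have "w m = 0" using J0 m by (auto simp: w_def W_def)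
   finally show ?thesis by (simp add: \<gamma>'_def)
  qed
  show "J (\<gamma>' t) <= max (3*a/4) (J (\<gamma> t) - h * \<epsilon> / 2)" if t: "t \<in> {0..1}" for t
  proof -
   define I where "I = {i. i <= m \<and> 0 < hat (real m * t - real i)}"
   have ti: "real i / real m \<in> {0..1}" if "i \<in> I" for i using that m by (auto simp: I_def)
   have close: "N (\<gamma> t - \<gamma> (real i / real m)) <= h" if "i \<in> I" for i
   proof (cases "L >= 0")
    case True
    have "N (\<gamma> t - \<gamma> (real i / real m)) <= L * \<bar>t - real i / real m\<bar>" using lip t ti that by blast
    also have "... <= L * (1 / real m)" using near that True by (intro mult_left_mono) (auto simp: I_def)
    finally show ?thesis using m by simp
   next
    case False
    have "N (\<gamma> t - \<gamma> (real i / real m)) <= L * \<bar>t - real i / real m\<bar>" using lip t ti that by blast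
    also have "... <= 0" using False by (simp add: mult_nonpos_nonneg)
    finally show ?thesis using h by simp
   qed
   show ?thesis
   proof (cases "\<exists>i\<in>I. J (\<gamma> (real i / real m)) < a/2")
    \<comment> \<open>One low node near t suffices: J is below a/2 at the node, and two
      displacements of length at most h cost 2 B h <= a/4.\<close>
    case True
    then obtain i where i: "i \<in> I" "J (\<gamma> (real i / real m)) < a/2" by blast
    define y where "y = \<gamma> (real i / real m)"
    have yE: "y \<in> E" by (simp add: y_def \<gamma>E)
    have "J (\<gamma> t) <= J y + B * h"
    proof -
     have "\<bar>J (\<gamma> t + (y - \<gamma> t)) - J (\<gamma> t)\<bar> <= B * N (y - \<gamma> t)"
     proof (rule J_lipschitz[OF B])
      show "N (\<gamma> t) + N (y - \<gamma> t) <= R" using close[OF i(1)] \<gamma>R[OF t] N_minus[OF yE \<gamma>E, of t] by (simp add: y_def)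
     qed (auto simp: yE \<gamma>E diff_in)
     moreover have "B * N (y - \<gamma> t) <= B * h"
      using close[OF i(1)] B0 N_minus[OF yE \<gamma>E, of t] by (simp add: y_def mult_left_mono)
     ultimately show ?thesis by simp
    qed
    moreover have "J (\<gamma>' t) <= J (\<gamma> t) + B * h"
    proof -
     have NV: "N (h *\<^sub>R V t) <= h" using VN[OF t] h N_scale[OF VE, of h t] by simp
     have "\<bar>J (\<gamma> t + h *\<^sub>R V t) - J (\<gamma> t)\<bar> <= B * N (h *\<^sub>R V t)"
      using NV \<gamma>R[OF t] by (intro J_lipschitz[OF B]) (auto simp: \<gamma>E VE scale_in)
     also have "... <= B * h" using NV B0 by (intro mult_left_mono)
     finally show ?thesis by (simp add: \<gamma>'_def)
    qed
    moreover have "8 * (B * h) <= a" using h by (simp add: mult.commute mult.left_commute)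
    ultimately have "J (\<gamma>' t) <= 3*a/4" using i y_def by simp
    then show ?thesis by simp
   next
    \<comment> \<open>Every node active at t now carries a descent direction. By uniform continuity
      each of them still decreases J at the intermediate point z, and so does their convex
      combination \<open>V t\<close>.\<close>
    case False
    obtain s where s: "0 < s" "s < h" and eq: "J (\<gamma> t + h *\<^sub>R V t) - J (\<gamma> t) = h * D (\<gamma> t + s *\<^sub>R V t) (V t)"
     using mean_value[OF \<gamma>E VE h(1)] by blast
    define z where "z = \<gamma> t + s *\<^sub>R V t"
    have zE: "z \<in> E" by (simp add: z_def add_in \<gamma>E VE scale_in)
    have Ns: "N (s *\<^sub>R V t) < h" 
     using N_scale[OF VE, of s t] VN[OF t] s N_nonneg[OF VE, of t]
     by simp (meson le_less_trans mult_left_le less_imp_le)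
    have zR: "N z <= R" using N_triangle[OF \<gamma>E scale_in[OF VE], of t s t] Ns \<gamma>R[OF t] by (simp add: z_def)
    have Dz: "hat (real m * t - real i) * D z (w i) <= hat (real m * t - real i) * (- \<epsilon>/2)" if "i <= m" for i
    proof (cases "i \<in> I")
     case True
     define y where "y = \<gamma> (real i / real m)"
     have yE: "y \<in> E" by (simp add: y_def \<gamma>E)
     have "z - y = (\<gamma> t - y) + s *\<^sub>R V t" by (simp add: z_def)
     then have "N (z - y) <= N (\<gamma> t - y) + N (s *\<^sub>R V t)"
      using N_triangle[OF diff_in scale_in] \<gamma>E yE VE by metis
     then have "N (z - y) < d" using Ns close[OF True] h by (simp add: y_def)
     moreover have "N y <= R" using \<gamma>R[OF ti[OF True]] h by (simp add: y_def)
     ultimately have "\<bar>D z (w i) - D y (w i)\<bar> <= \<epsilon>/4" using d zE yE zR wE wN by blast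
     moreover have "D y (w i) < - \<epsilon>"
      using W[OF \<gamma>E, of "real i / real m"] False True \<gamma>K[OF ti[OF True]] by (force simp: w_def y_def not_less)
     ultimately have "D z (w i) <= - \<epsilon>/2" using \<epsilon> by linarith
     then show ?thesis by (intro mult_left_mono hat_nonneg)
    next
     case False
     then have "hat (real m * t - real i) = 0" using that hat_nonneg[of "real m * t - real i"] by (auto simp: I_def)
     then show ?thesis by simp
    qed
    have "D z (V t) = (\<Sum>i\<le>m. hat (real m * t - real i) * D z (w i))"
     unfolding V_def by (subst D_sum) (auto simp: zE wE scale_in D_scale)
    also have "... <= (\<Sum>i\<le>m. hat (real m * t - real i) * (- \<epsilon>/2))"
     by (intro sum_mono Dz) auto
    also have "... = (\<Sum>i\<le>m. hat (real m * t - real i)) * (- \<epsilon>/2)" by (rule sum_distrib_right[symmetric])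
    also have "... = - \<epsilon>/2" using hat1[OF t] by simp
    finally have "h * D z (V t) <= h * (- \<epsilon>/2)" using h by (intro mult_left_mono) auto
    then show ?thesis using eq by (simp add: \<gamma>'_def z_def)
   qed
  qed
 qed
qed

text \<open>Without an almost critical point every u with a/2 <= J u <= K admits descent, and the
  segment from 0 to e can be deformed until J is at most 3a/4 on it. But every path from 0 to e
  crosses the sphere, where J >= a.\<close>

lemma almost_critical_point:
 assumes "0 < a" "0 < r" and sphere: "\<And>u. u \<in> E ==> N u = r ==> a <= J u"
  and J0: "J 0 <= 0" and e: "e \<in> E" "r < N e" "J e <= 0"
  and K: "\<And>t. t \<in> {0..1} ==> J (t *\<^sub>R e) <= K" and \<epsilon>: "0 < \<epsilon>"
 obtains u where "u \<in> E" "a/2 <= J u" "J u <= K" "\<And>w. w \<in> E ==> N w <= 1 ==> \<bar>D u w\<bar> <= \<epsilon>"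
proof (rule ccontr)
 assume contr: "\<not> thesis"
 note main = that
 have desc: "\<exists>w\<in>E. N w <= 1 \<and> D u w < - \<epsilon>" if u: "u \<in> E" "a/2 <= J u" "J u <= K" for u
 proof -
  obtain w where w: "w \<in> E" "N w <= 1" "\<not> \<bar>D u w\<bar> <= \<epsilon>" using contr u main by blast
  show ?thesis
  proof (cases "D u w < 0")
   case True then show ?thesis using w by (intro bexI[of _ w]) auto
  next
   case False then show ?thesis using w D_scale[OF u(1) w(1), of "-1"] N_scale[OF w(1), of "-1"] scale_in[OF w(1), of "-1"]
    by (intro bexI[of _ "(-1) *\<^sub>R w"]) auto
  qed
 qed
 \<comment> \<open>The Lipschitz bound makes N continuous along the path, so the intermediate value
   theorem yields a point of seminorm r.\<close>
 have crossing: "\<exists>t\<in>{0..1}. a <= J (\<gamma> t)"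
  if g: "\<And>t. \<gamma> t \<in> E" "\<And>s t. s \<in> {0..1} ==> t \<in> {0..1} ==> N (\<gamma> s - \<gamma> t) <= L * \<bar>s - t\<bar>"
   "\<gamma> 0 = 0" "\<gamma> 1 = e" for \<gamma> L
 proof -
  have "\<bar>N (\<gamma> s) - N (\<gamma> t)\<bar> <= L * \<bar>s - t\<bar>" if "s \<in> {0..1}" "t \<in> {0..1}" for s t
   using N_triangle[of "\<gamma> s - \<gamma> t" "\<gamma> t"] N_triangle[of "\<gamma> t - \<gamma> s" "\<gamma> s"] N_minus[of "\<gamma> s" "\<gamma> t"] g diff_in that
   by (fastforce)
  moreover have "L * \<bar>s - t\<bar> <= max L 0 * \<bar>s - t\<bar>" for s t by (intro mult_right_mono) auto
  ultimately have "(max L 0)-lipschitz_on {0..1} (\<lambda>t. N (\<gamma> t))"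
   by (intro lipschitz_onI) (unfold dist_real_def, blast intro: order_trans, simp)
  then have "continuous_on {0..1} (\<lambda>t. N (\<gamma> t))" by (rule lipschitz_on_continuous_on)
  then obtain t where "t \<in> {0..1}" "N (\<gamma> t) = r"
   using IVT'[of "\<lambda>t. N (\<gamma> t)" 0 r 1] g e \<open>0 < r\<close> by auto
  then show ?thesis using sphere[OF g(1)] by blast
 qed
 have lin: "N (s *\<^sub>R e - t *\<^sub>R e) <= N e * \<bar>s - t\<bar>" for s t
  using N_scale[OF e(1), of "s - t"] by (simp add: scaleR_left_diff_distrib mult.commute)
 obtain t where "t \<in> {0..1}" "a <= J (t *\<^sub>R e)"
  using crossing[of "\<lambda>t. t *\<^sub>R e", OF _ lin] e scale_in by auto
 then have aK: "a <= K" using K by fastforce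
 \<comment> \<open>The radius is fixed before the step length: all deformations together move the
   path by at most n h <= 2 K/\<epsilon> + 1, whatever h is. Then B and d are chosen for R, and h
   for both of them.\<close>
 define R where "R = N e + 2 * K / \<epsilon> + 2"
 obtain B where B: "\<forall>u\<in>E. N u <= R --> (\<forall>w\<in>E. N w <= 1 --> \<bar>D u w\<bar> <= B)" using D_bounded by blast
 obtain d where d0: "d > 0" and d: "\<forall>u\<in>E. \<forall>v\<in>E. N u <= R --> N v <= R --> N (u - v) < d -->
   (\<forall>w\<in>E. N w <= 1 --> \<bar>D u w - D v w\<bar> <= \<epsilon>/4)" using D_ucont[of "\<epsilon>/4" R] \<epsilon> by auto
 define h where "h = min 1 (min (d/2) (a / (8 * (\<bar>B\<bar> + 1))))"
 have h: "0 < h" "h <= 1" "2 * h <= d" using d0 \<open>0 < a\<close> by (auto simp: h_def)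
 have "h * (8 * (\<bar>B\<bar> + 1)) <= a"
  using \<open>0 < a\<close> by (subst pos_le_divide_eq[symmetric]) (auto simp: h_def)
 moreover have "h * (8 * B) <= h * (8 * (\<bar>B\<bar> + 1))" using h by (intro mult_left_mono) auto
 ultimately have hB: "8 * h * B <= a" by (simp add: mult.commute mult.left_commute)
 have paths: "real n * h <= 2 * K / \<epsilon> + 1 ==> \<exists>\<gamma> L. (\<forall>t. \<gamma> t \<in> E) \<and>
   (\<forall>s\<in>{0..1}. \<forall>t\<in>{0..1}. N (\<gamma> s - \<gamma> t) <= L * \<bar>s - t\<bar>) \<and> \<gamma> 0 = 0 \<and> \<gamma> 1 = e \<and>
   (\<forall>t\<in>{0..1}. N (\<gamma> t) <= N e + real n * h) \<and> (\<forall>t\<in>{0..1}. J (\<gamma> t) <= max (3*a/4) (K - real n * h * \<epsilon> / 2))" for n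
 proof (induction n)
  case 0
  show ?case
  proof (intro exI[of _ "\<lambda>t. t *\<^sub>R e"] exI[of _ "N e"] conjI ballI allI lin)
   show "N (t *\<^sub>R e) <= N e + real 0 * h" if "t \<in> {0..1}" for t
    using that N_scale[OF e(1)] N_nonneg[OF e(1)] by (auto simp: mult_left_le_one_le)
  qed (use e scale_in K in \<open>auto simp: le_max_iff_disj\<close>)
 next
  case (Suc n)
  then have "real n * h <= 2 * K / \<epsilon> + 1" using h by (auto simp: algebra_simps)
  with Suc.IH obtain \<gamma> L where g: "\<And>t. \<gamma> t \<in> E"
   "\<And>s t. s \<in> {0..1} ==> t \<in> {0..1} ==> N (\<gamma> s - \<gamma> t) <= L * \<bar>s - t\<bar>" "\<gamma> 0 = 0" "\<gamma> 1 = e"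
   "\<And>t. t \<in> {0..1} ==> N (\<gamma> t) <= N e + real n * h"
   "\<And>t. t \<in> {0..1} ==> J (\<gamma> t) <= max (3*a/4) (K - real n * h * \<epsilon> / 2)" by metis
  have "J (\<gamma> t) <= K" if "t \<in> {0..1}" for t
  proof -
   have "real n * h * \<epsilon> / 2 >= 0" using h \<epsilon> by simp
   then show ?thesis using g(6)[OF that] aK \<open>0 < a\<close> by linarith
  qed
  note gK = this
  have gR: "N (\<gamma> t) + h <= R" if "t \<in> {0..1}" for t
   using g(5)[OF that] Suc.prems by (simp add: R_def algebra_simps)
  have g01: "J (\<gamma> 0) < a/2" "J (\<gamma> 1) < a/2" using g J0 e \<open>0 < a\<close> by auto
  obtain \<gamma>' L' where g': "\<And>t. \<gamma>' t \<in> E"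
   "\<And>s t. s \<in> {0..1} ==> t \<in> {0..1} ==> N (\<gamma>' s - \<gamma>' t) <= L' * \<bar>s - t\<bar>"
   "\<And>t. t \<in> {0..1} ==> N (\<gamma>' t) <= N (\<gamma> t) + h"
   "\<And>t. t \<in> {0..1} ==> J (\<gamma>' t) <= max (3*a/4) (J (\<gamma> t) - h * \<epsilon> / 2)"
   "\<gamma>' 0 = \<gamma> 0" "\<gamma>' 1 = \<gamma> 1"
   by (rule descent_step[where \<gamma>=\<gamma> and L=L and K=K, OF h hB \<open>0 < a\<close> B d \<epsilon> _ _ _ _ _ g01])
    (use desc g(1,2) gK gR in blast)+
  have "J (\<gamma>' t) <= max (3*a/4) (K - real (Suc n) * h * \<epsilon> / 2)" if "t \<in> {0..1}" for t
  proof -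
   have "h * \<epsilon> >= 0" using h \<epsilon> by simp
   moreover have "K - real (Suc n) * h * \<epsilon> / 2 = (K - real n * h * \<epsilon> / 2) - h * \<epsilon> / 2" by (simp add: algebra_simps add_divide_distrib)
   ultimately show ?thesis using g'(4)[OF that] g(6)[OF that] by linarith
  qed
  moreover have "N (\<gamma>' t) <= N e + real (Suc n) * h" if "t \<in> {0..1}" for t
   using g'(3)[OF that] g(5)[OF that] by (simp add: algebra_simps)
  ultimately show ?case using g g' by (intro exI[of _ \<gamma>'] exI[of _ L']) auto
 qed
 \<comment> \<open>With this number of steps the total decrease n h \<epsilon>/2 is at least
   K.\<close>
 define n where "n = nat \<lceil>2 * K / (h * \<epsilon>)\<rceil>"
 have pos: "2 * K / (h * \<epsilon>) >= 0" using aK \<open>0 < a\<close> h \<epsilon> by simp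
 have n1: "2 * K / (h * \<epsilon>) <= real n" by (simp add: n_def real_nat_ceiling_ge)
 have "real n <= 2 * K / (h * \<epsilon>) + 1" using pos unfolding n_def by linarith
 then have "real n * h <= (2 * K / (h * \<epsilon>) + 1) * h" using h by (intro mult_right_mono) auto
 also have "... = 2 * K / \<epsilon> + h" using h \<epsilon> by (simp add: field_simps)
 finally have "real n * h <= 2 * K / \<epsilon> + 1" using h by linarith
 from paths[OF this] obtain \<gamma> L where g: "\<And>t. \<gamma> t \<in> E"
   "\<And>s t. s \<in> {0..1} ==> t \<in> {0..1} ==> N (\<gamma> s - \<gamma> t) <= L * \<bar>s - t\<bar>" "\<gamma> 0 = 0" "\<gamma> 1 = e"
   "\<And>t. t \<in> {0..1} ==> J (\<gamma> t) <= max (3*a/4) (K - real n * h * \<epsilon> / 2)" by metis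
 obtain t where t: "t \<in> {0..1}" "a <= J (\<gamma> t)" using crossing[OF g(1-4)] by auto
 have "2 * K <= real n * (h * \<epsilon>)" using n1 h \<epsilon> by (subst (asm) pos_divide_le_eq) auto
 then have "K - real n * h * \<epsilon> / 2 <= 0" by (simp add: mult.assoc)
 then show False using g(5)[OF t(1)] t(2) \<open>0 < a\<close> by linarith
qed

end

text \<open>Measurable functions on \<Omega> are exchanged for Borel functions on the whole space
  vanishing outside \<Omega>, so that translations, means over balls and Fubini for
  \<open>lborel\<close> become available.\<close>

lemma lebesgue_on_borel_version_real:
 fixes w :: "'a::euclidean_space => real"
 assumes "w \<in> borel_measurable (lebesgue_on \<Omega>)" and \<Omega>: "\<Omega> \<in> sets borel"
 obtains v where "v \<in> borel_measurable borel" "\<And>x. x \<notin> \<Omega> ==> v x = 0" "AE x in lebesgue_on \<Omega>. w x = v x"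
proof -
 have "(\<lambda>x. indicator \<Omega> x *\<^sub>R w x) \<in> borel_measurable lebesgue"
  using assms by (subst borel_measurable_restrict_space_iff[symmetric]) auto
 then obtain g where g: "g \<in> borel_measurable lborel" "AE x in lborel. indicator \<Omega> x *\<^sub>R w x = g x"
  using completion_ex_borel_measurable_real by blast
 show thesis
 proof (rule that[of "\<lambda>x. indicator \<Omega> x * g x"])
  have [measurable]: "g \<in> borel_measurable borel" using g by simp
  show "(\<lambda>x. indicator \<Omega> x * g x) \<in> borel_measurable borel" using \<Omega> by measurable
  have "AE x in lebesgue. indicator \<Omega> x *\<^sub>R w x = g x" by (rule AE_completion[OF g(2)])
  then have "AE x in lebesgue. x \<in> \<Omega> --> w x = indicator \<Omega> x * g x" by eventually_elim (auto simp: indicator_def)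
  then show "AE x in lebesgue_on \<Omega>. w x = indicator \<Omega> x * g x" using \<Omega> by (subst AE_restrict_space_iff) auto
 qed simp
qed

lemma lebesgue_on_borel_version:
 fixes w :: "'a::euclidean_space => 'v::euclidean_space"
 assumes w: "w \<in> borel_measurable (lebesgue_on \<Omega>)" and \<Omega>: "\<Omega> \<in> sets borel"
 obtains v where "v \<in> borel_measurable borel" "\<And>x. x \<notin> \<Omega> ==> v x = 0" "AE x in lebesgue_on \<Omega>. w x = v x"
proof -
 have "\<exists>v. v \<in> borel_measurable borel \<and> (\<forall>x. x \<notin> \<Omega> --> v x = 0) \<and> (AE x in lebesgue_on \<Omega>. w x \<bullet> i = v x)" for i
 proof -
  have "(\<lambda>x. w x \<bullet> i) \<in> borel_measurable (lebesgue_on \<Omega>)" using w by measurable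
  then show ?thesis by (rule lebesgue_on_borel_version_real[OF _ \<Omega>]) blast
 qed
 then obtain v where v: "\<And>i. v i \<in> borel_measurable borel" "\<And>i x. x \<notin> \<Omega> ==> v i x = 0" "\<And>i. AE x in lebesgue_on \<Omega>. w x \<bullet> i = v i x"
  by metis
 show thesis
 proof (rule that[of "\<lambda>x. \<Sum>i\<in>Basis. v i x *\<^sub>R i"])
  show "(\<lambda>x. \<Sum>i\<in>Basis. v i x *\<^sub>R i) \<in> borel_measurable borel"
   using v(1) by (intro borel_measurable_sum borel_measurable_scaleR) auto
  have "AE x in lebesgue_on \<Omega>. \<forall>i\<in>Basis. w x \<bullet> i = v i x"
   by (intro AE_ball_countable[THEN iffD2] ballI v(3)) (simp add: countable_finite)
  then show "AE x in lebesgue_on \<Omega>. w x = (\<Sum>i\<in>Basis. v i x *\<^sub>R i)"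
  proof eventually_elim
   case (elim x)
   then show ?case using euclidean_representation[of "w x"] by (metis (no_types, lifting) sum.cong)
  qed
 qed (simp add: v)
qed

lemma nn_integral_lebesgue_on_eq:
 fixes h :: "'a::euclidean_space => ennreal"
 assumes "\<Omega> \<in> sets borel" and [measurable]: "h \<in> borel_measurable borel"
 shows "(\<integral>\<^sup>+x. h x \<partial>lebesgue_on \<Omega>) = (\<integral>\<^sup>+x. indicator \<Omega> x * h x \<partial>lborel)"
proof -
 have "(\<integral>\<^sup>+x. h x \<partial>lebesgue_on \<Omega>) = (\<integral>\<^sup>+x. h x * indicator \<Omega> x \<partial>lebesgue)"
  using assms(1) by (intro nn_integral_restrict_space) auto
 also have "... = (\<integral>\<^sup>+x. h x * indicator \<Omega> x \<partial>lborel)" by (rule nn_integral_completion)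
 finally show ?thesis by (simp add: mult.commute)
qed

subsection \<open>The energy functional\<close>

text \<open>\<open>lo\<close> and \<open>hi\<close> bound all three exponents. \<open>pp\<close>
  bounds both gradient exponents and stays below \<open>a0\<close>, the lower bound of the target
  exponent; this is the form in which the minimum of \<alpha> exceeding the maximum of p_M is
  used.\<close>

locale energy_space = d1: var_dom \<Omega> p1 lo hi + d2: var_dom \<Omega> p2 lo hi + dA: var_dom \<Omega> \<alpha> lo hi +
  sub: subcritical \<Omega> P A R \<eta>0 \<omega> \<kappa> hi a0
 for \<Omega> :: "'a::euclidean_space set" and p1 p2 \<alpha> P A lo hi R \<eta>0 \<omega> \<kappa> a0 +
 fixes pp :: real
 assumes P_eq: "\<And>x. x \<in> \<Omega> ==> P x = max (p1 x) (p2 x)" and A_eq: "\<And>x. x \<in> \<Omega> ==> A x = \<alpha> x"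
  and pp: "\<And>x. x \<in> \<Omega> ==> p1 x <= pp" "\<And>x. x \<in> \<Omega> ==> p2 x <= pp" "lo <= pp" "pp <= hi" "pp < a0"
begin

abbreviation M where "M \<equiv> lebesgue_on \<Omega>"

text \<open>The approximating test functions may differ for the two exponents; the shared second
  component encodes that both gradients are the same.\<close>

definition E :: "('a => real \<times> 'a) set" where "E = {w. d1.W0 w \<and> d2.W0 w}"

lemma E_subspace: "subspace E"
proof -
 have z: "(0 :: 'a => real \<times> 'a) = (\<lambda>_. 0)" by (simp add: zero_fun_def)
 have a: "v + w = (\<lambda>x. v x + w x)" for v w :: "'a => real \<times> 'a" by (simp add: plus_fun_def)
 have s: "c *\<^sub>R w = (\<lambda>x. c *\<^sub>R w x)" for c and w :: "'a => real \<times> 'a" by (simp add: scaleR_fun_def)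
 show ?thesis unfolding subspace_def E_def z a s
  by (auto intro: d1.W0_zero d2.W0_zero d1.W0_add d2.W0_add d1.W0_scale d2.W0_scale)
qed

lemma E_measurable: "w \<in> E ==> w \<in> borel_measurable M"
 by (simp add: E_def d1.W0_measurable)

lemma E_measurable': assumes "w \<in> E" shows "(\<lambda>x. fst (w x)) \<in> borel_measurable M" "(\<lambda>x. snd (w x)) \<in> borel_measurable M"
 using d1.W0_integrable[of w] assms by (auto simp: E_def)

lemma pmod_snd_finite:
 assumes "w \<in> E" shows "pmod M p1 (\<lambda>x. snd (w x)) < \<infinity>" "pmod M p2 (\<lambda>x. snd (w x)) < \<infinity>"
proof -
 have "pmod M p1 (\<lambda>x. snd (w x)) <= pmod M p1 w" by (intro d1.pmod_mono AE_I2) (simp add: norm_prod_bounds)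
 then show "pmod M p1 (\<lambda>x. snd (w x)) < \<infinity>" using d1.W0_finite[of w] assms by (auto simp: E_def)
 have "pmod M p2 (\<lambda>x. snd (w x)) <= pmod M p2 w" by (intro d2.pmod_mono AE_I2) (simp add: norm_prod_bounds)
 then show "pmod M p2 (\<lambda>x. snd (w x)) < \<infinity>" using d2.W0_finite[of w] assms by (auto simp: E_def)
qed

lemma integrable_snd_powr:
 assumes "w \<in> E"
 shows "integrable M (\<lambda>x. norm (snd (w x)) powr p1 x)" "integrable M (\<lambda>x. norm (snd (w x)) powr p2 x)"
 using pmod_snd_finite[OF assms] d1.pmod_finite_iff[OF E_measurable'(2)[OF assms]] d2.pmod_finite_iff[OF E_measurable'(2)[OF assms]] by auto

text \<open>Only the gradient enters; the function part is recovered through \<open>Sobolev\<close>.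
  The sum over both exponents dominates the modular for max(p1, p2).\<close>

definition \<rho> :: "('a => real \<times> 'a) => real" where
 "\<rho> w = (LINT x|M. norm (snd (w x)) powr p1 x + norm (snd (w x)) powr p2 x)"

lemma \<rho>_nonneg: "0 <= \<rho> w"
 unfolding \<rho>_def by (intro integral_nonneg_AE) auto

lemma ennreal_\<rho>: assumes "w \<in> E" shows "ennreal (\<rho> w) = pmod M p1 (\<lambda>x. snd (w x)) + pmod M p2 (\<lambda>x. snd (w x))"
proof -
 note i = integrable_snd_powr[OF assms]
 have "\<rho> w = (LINT x|M. norm (snd (w x)) powr p1 x) + (LINT x|M. norm (snd (w x)) powr p2 x)"
  unfolding \<rho>_def using i by simp
 then show ?thesis using d1.pmod_eq_integral[OF i(1)] d2.pmod_eq_integral[OF i(2)]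
  by (simp add: ennreal_plus integral_nonneg_AE)
qed

lemma \<rho>_mono_integral:
 assumes "v \<in> E" "w \<in> E" and "\<And>x. x \<in> \<Omega> ==> norm (snd (v x)) powr p1 x + norm (snd (v x)) powr p2 x <= c * (norm (snd (w x)) powr p1 x + norm (snd (w x)) powr p2 x)"
 shows "\<rho> v <= c * \<rho> w"
proof -
 have "\<rho> v <= (LINT x|M. c * (norm (snd (w x)) powr p1 x + norm (snd (w x)) powr p2 x))"
  unfolding \<rho>_def using integrable_snd_powr[OF assms(1)] integrable_snd_powr[OF assms(2)] assms(3)
  by (intro integral_mono) auto
 then show ?thesis by (simp add: \<rho>_def)
qed

text \<open>The upper growth rate supplied is \<open>pp\<close> and not \<open>hi\<close>: on a
  small sphere of radius c the modular is then at least of order c^pp, which beats the order c^a0 of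
  the superlinear term.\<close>

sublocale cm: convex_modular E \<rho> lo pp
proof
 show "subspace E" by (rule E_subspace)
 show "1 < lo" by (rule d1.lo) show "lo <= pp" by (rule pp)
 fix v assume v: "v \<in> E"
 show "0 <= \<rho> v" by (rule \<rho>_nonneg)
 show "\<rho> (- v) = \<rho> v" by (simp add: \<rho>_def)
 {
  fix c :: real assume c: "0 < c" "c <= 1"
  have cv: "c *\<^sub>R v \<in> E" using E_subspace v by (simp add: subspace_scale)
  have b: "c powr q <= c powr lo" "c powr pp <= c powr q" if "lo <= q" "q <= pp" for q using c that by (auto intro!: powr_mono')
  show "\<rho> (c *\<^sub>R v) <= c powr lo * \<rho> v"
  proof (rule \<rho>_mono_integral[OF cv v])
   fix x assume x: "x \<in> \<Omega>"
   show "norm (snd ((c *\<^sub>R v) x)) powr p1 x + norm (snd ((c *\<^sub>R v) x)) powr p2 x <= c powr lo * (norm (snd (v x)) powr p1 x + norm (snd (v x)) powr p2 x)"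
    using c b(1)[of "p1 x"] b(1)[of "p2 x"] d1.p_bounds[OF x] d2.p_bounds[OF x] pp(1,2)[OF x]
    by (simp add: powr_mult distrib_left add_mono mult_right_mono)
  qed
  have "\<rho> v <= inverse (c powr pp) * \<rho> (c *\<^sub>R v)"
  proof (rule \<rho>_mono_integral[OF v cv])
   fix x assume x: "x \<in> \<Omega>"
   have "c powr pp * (norm (snd (v x)) powr p1 x + norm (snd (v x)) powr p2 x) <= norm (snd ((c *\<^sub>R v) x)) powr p1 x + norm (snd ((c *\<^sub>R v) x)) powr p2 x"
    using c b(2)[of "p1 x"] b(2)[of "p2 x"] d1.p_bounds[OF x] d2.p_bounds[OF x] pp(1,2)[OF x]
    by (simp add: powr_mult distrib_left add_mono mult_right_mono)
   from mult_left_mono[OF this, of "inverse (c powr pp)"]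
   show "norm (snd (v x)) powr p1 x + norm (snd (v x)) powr p2 x <= inverse (c powr pp) * (norm (snd ((c *\<^sub>R v) x)) powr p1 x + norm (snd ((c *\<^sub>R v) x)) powr p2 x)"
    using c by (simp add: mult.assoc[symmetric])
  qed
  from mult_left_mono[OF this, of "c powr pp"] show "c powr pp * \<rho> v <= \<rho> (c *\<^sub>R v)"
   using c by (simp add: mult.assoc[symmetric])
 }
 fix w and t :: real assume w: "w \<in> E" and t: "0 <= t" "t <= 1"
 have vw: "(1 - t) *\<^sub>R v + t *\<^sub>R w \<in> E" using E_subspace v w by (simp add: subspace_scale subspace_add)
 have "\<rho> ((1 - t) *\<^sub>R v + t *\<^sub>R w) <= (LINT x|M. (1 - t) * (norm (snd (v x)) powr p1 x + norm (snd (v x)) powr p2 x) + t * (norm (snd (w x)) powr p1 x + norm (snd (w x)) powr p2 x))"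
  unfolding \<rho>_def
 proof (intro integral_mono)
  show "integrable M (\<lambda>x. norm (snd (((1 - t) *\<^sub>R v + t *\<^sub>R w) x)) powr p1 x + norm (snd (((1 - t) *\<^sub>R v + t *\<^sub>R w) x)) powr p2 x)"
   using integrable_snd_powr[OF vw] by simp
  show "integrable M (\<lambda>x. (1 - t) * (norm (snd (v x)) powr p1 x + norm (snd (v x)) powr p2 x) + t * (norm (snd (w x)) powr p1 x + norm (snd (w x)) powr p2 x))"
   using integrable_snd_powr[OF v] integrable_snd_powr[OF w] by simp
  fix x assume "x \<in> space M"
  then have x: "x \<in> \<Omega>" by simp
  have "norm ((1 - t) *\<^sub>R snd (v x) + t *\<^sub>R snd (w x)) powr p1 x <= (1 - t) * norm (snd (v x)) powr p1 x + t * norm (snd (w x)) powr p1 x"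
   "norm ((1 - t) *\<^sub>R snd (v x) + t *\<^sub>R snd (w x)) powr p2 x <= (1 - t) * norm (snd (v x)) powr p2 x + t * norm (snd (w x)) powr p2 x"
   using d1.p_bounds(1)[OF x] d2.p_bounds(1)[OF x] d1.lo t by (intro norm_convex_powr; simp)+
  then show "norm (snd (((1 - t) *\<^sub>R v + t *\<^sub>R w) x)) powr p1 x + norm (snd (((1 - t) *\<^sub>R v + t *\<^sub>R w) x)) powr p2 x
   <= (1 - t) * (norm (snd (v x)) powr p1 x + norm (snd (v x)) powr p2 x) + t * (norm (snd (w x)) powr p1 x + norm (snd (w x)) powr p2 x)"
   by (simp add: distrib_left)
 qed
 also have "... = (1 - t) * \<rho> v + t * \<rho> w"
  unfolding \<rho>_def using integrable_snd_powr[OF v] integrable_snd_powr[OF w] by simp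
 finally show "\<rho> ((1 - t) *\<^sub>R v + t *\<^sub>R w) <= (1 - t) * \<rho> v + t * \<rho> w" .
qed

text \<open>The pair is replaced by a Borel version vanishing outside \<Omega>. Convergence in mean
  comes from the first exponent alone, and |g|^max(p1,p2) <= |g|^p1 + |g|^p2 turns the bound on
  \<rho> into one on the \<open>P\<close>-modular.\<close>

lemma E_is_pair:
 assumes w: "w \<in> E" and K: "0 <= K" "\<rho> w <= K"
 obtains u g where "sub.is_pair K u g" "AE x in M. fst (w x) = u x"
proof -
 obtain v where v: "v \<in> borel_measurable borel" "\<And>x. x \<notin> \<Omega> ==> v x = 0" "AE x in M. w x = v x"
  using lebesgue_on_borel_version[OF E_measurable[OF w]] d1.\<Omega>_sets by blast
 have [measurable]: "(\<lambda>x. fst (v x)) \<in> borel_measurable borel" "(\<lambda>x. snd (v x)) \<in> borel_measurable borel"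
  by (rule measurable_compose[OF v(1)], rule borel_measurable_continuous_onI, intro continuous_intros)+
 have W: "d1.W0 w" using w by (simp add: E_def)
 obtain \<phi> where \<phi>: "\<And>k. test_fun \<Omega> (\<phi> k)" "(\<lambda>k. pmod M p1 (\<lambda>x. tpair (\<phi> k) x - w x)) \<longlonglongrightarrow> 0"
  "(\<lambda>k. \<integral>\<^sup>+x. ennreal (norm (tpair (\<phi> k) x - w x)) \<partial>M) \<longlonglongrightarrow> 0" by (rule d1.W0_sequence[OF W]) (rule that)
 note [measurable] = borel_measurable_test[OF \<phi>(1)]
 have "subcritical_pair \<Omega> P A R \<eta>0 \<omega> \<kappa> hi a0 (\<lambda>x. fst (v x)) (\<lambda>x. snd (v x)) \<phi> K"
 proof
  show "(\<lambda>x. fst (v x)) \<in> borel_measurable borel" "(\<lambda>x. snd (v x)) \<in> borel_measurable borel" by measurable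
  show "test_fun \<Omega> (\<phi> k)" for k by (rule \<phi>)
  have "(\<integral>\<^sup>+x. ennreal \<bar>\<phi> k x - fst (v x)\<bar> \<partial>lborel) = (\<integral>\<^sup>+x. ennreal \<bar>\<phi> k x - fst (w x)\<bar> \<partial>M)" for k
  proof -
   have "(\<integral>\<^sup>+x. ennreal \<bar>\<phi> k x - fst (v x)\<bar> \<partial>lborel) = (\<integral>\<^sup>+x. indicator \<Omega> x * ennreal \<bar>\<phi> k x - fst (v x)\<bar> \<partial>lborel)"
    by (intro nn_integral_cong) (auto simp: indicator_def v(2) test_fun_outside[OF \<phi>(1)])
   also have "... = (\<integral>\<^sup>+x. ennreal \<bar>\<phi> k x - fst (v x)\<bar> \<partial>M)" by (rule nn_integral_lebesgue_on_eq[symmetric]) auto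
   also have "... = (\<integral>\<^sup>+x. ennreal \<bar>\<phi> k x - fst (w x)\<bar> \<partial>M)"
    by (rule nn_integral_cong_AE) (use v(3) in \<open>eventually_elim, simp\<close>)
   finally show ?thesis .
  qed
  then show "(\<lambda>k. \<integral>\<^sup>+x. ennreal \<bar>\<phi> k x - fst (v x)\<bar> \<partial>lborel) \<longlonglongrightarrow> 0" using d1.L1_components(1)[OF \<phi>(3)] by simp
  have "(\<integral>\<^sup>+x. ennreal (norm (grad (\<phi> k) x - snd (v x))) \<partial>lborel) = (\<integral>\<^sup>+x. ennreal (norm (grad (\<phi> k) x - snd (w x))) \<partial>M)" for k
  proof -
   have "(\<integral>\<^sup>+x. ennreal (norm (grad (\<phi> k) x - snd (v x))) \<partial>lborel) = (\<integral>\<^sup>+x. indicator \<Omega> x * ennreal (norm (grad (\<phi> k) x - snd (v x))) \<partial>lborel)"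
    by (intro nn_integral_cong) (auto simp: indicator_def v(2) test_fun_outside[OF \<phi>(1)])
   also have "... = (\<integral>\<^sup>+x. ennreal (norm (grad (\<phi> k) x - snd (v x))) \<partial>M)" by (rule nn_integral_lebesgue_on_eq[symmetric]) auto
   also have "... = (\<integral>\<^sup>+x. ennreal (norm (grad (\<phi> k) x - snd (w x))) \<partial>M)"
    by (rule nn_integral_cong_AE) (use v(3) in \<open>eventually_elim, simp\<close>)
   finally show ?thesis .
  qed
  then show "(\<lambda>k. \<integral>\<^sup>+x. ennreal (norm (grad (\<phi> k) x - snd (v x))) \<partial>lborel) \<longlonglongrightarrow> 0" using d1.L1_components(2)[OF \<phi>(3)] by simp
  show "snd (v x) = 0" if "x \<notin> \<Omega>" for x using v(2)[OF that] by simp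
  show "0 <= K" by (rule K)
  have "(\<integral>\<^sup>+x. ennreal (norm (snd (v x)) powr P x) \<partial>lborel) = (\<integral>\<^sup>+x. indicator \<Omega> x * ennreal (norm (snd (v x)) powr P x) \<partial>lborel)"
   by (intro nn_integral_cong) (auto simp: indicator_def v(2))
  also have "... = (\<integral>\<^sup>+x. ennreal (norm (snd (v x)) powr P x) \<partial>M)" by (rule nn_integral_lebesgue_on_eq[symmetric]) auto
  also have "... = (\<integral>\<^sup>+x. ennreal (norm (snd (w x)) powr P x) \<partial>M)"
   by (rule nn_integral_cong_AE) (use v(3) in \<open>eventually_elim, simp\<close>)
  also have "... <= (\<integral>\<^sup>+x. ennreal (norm (snd (w x)) powr p1 x) + ennreal (norm (snd (w x)) powr p2 x) \<partial>M)"
   by (intro nn_integral_mono) (auto simp: P_eq max_def)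
  also have "... = pmod M p1 (\<lambda>x. snd (w x)) + pmod M p2 (\<lambda>x. snd (w x))"
   unfolding pmod_def using borel_measurable_integrable[OF integrable_snd_powr(1)[OF w]] borel_measurable_integrable[OF integrable_snd_powr(2)[OF w]]
   by (intro nn_integral_add) auto
  also have "... <= ennreal K" using K by (simp add: ennreal_\<rho>[OF w, symmetric] ennreal_leI)
  finally show "(\<integral>\<^sup>+x. ennreal (norm (snd (v x)) powr P x) \<partial>lborel) <= ennreal K" .
 qed
 then have "sub.is_pair K (\<lambda>x. fst (v x)) (\<lambda>x. snd (v x))" unfolding sub.is_pair_def by blast
 moreover have "AE x in M. fst (w x) = fst (v x)" using v(3) by eventually_elim simp
 ultimately show thesis by (rule that)
qed

lemma pmod_A_eq:
 assumes [measurable]: "u \<in> borel_measurable borel" and w: "AE x in M. w x = u x"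
 shows "pmod M \<alpha> w = (sub.Amod u)"
proof -
 have "pmod M \<alpha> w = pmod M \<alpha> u" by (rule pmod_cong_AE) (use w in \<open>eventually_elim, simp\<close>)
 also have "... = (\<integral>\<^sup>+x. ennreal (\<bar>u x\<bar> powr A x) \<partial>M)" unfolding pmod_def by (intro nn_integral_cong) (simp add: A_eq)
 also have "... = (sub.Amod u)" by (rule nn_integral_lebesgue_on_eq) auto
 finally show ?thesis .
qed

abbreviation pmodA :: "('a => real \<times> 'a) => ennreal" where "pmodA w \<equiv> pmod M \<alpha> (\<lambda>x. fst (w x))"

lemma Sobolev:
 assumes K: "0 <= K"
 obtains C where "0 <= C" "\<And>w. w \<in> E ==> \<rho> w <= K ==> pmodA w <= ennreal C"
proof -
 obtain C where C: "0 <= C" "\<And>u g. sub.is_pair K u g ==> (sub.Amod u) <= ennreal C"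
  by (rule sub.Sobolev_bound[OF K]) (rule that)
 have "pmodA w <= ennreal C" if w: "w \<in> E" "\<rho> w <= K" for w
 proof -
  obtain u g where u: "sub.is_pair K u g" "AE x in M. fst (w x) = u x" by (rule E_is_pair[OF w(1) K w(2)]) (rule that)
  show ?thesis using pmod_A_eq[OF sub.is_pairD(1)[OF u(1)] u(2)] C(2)[OF u(1)] by simp
 qed
 then show thesis using C(1) that by blast
qed

lemma Rellich_E:
 assumes K: "0 <= K" and w: "\<And>n. w n \<in> E" "\<And>n. \<rho> (w n) <= K"
 obtains r where "strict_mono (r :: nat => nat)"
  "\<And>\<epsilon>. 0 < \<epsilon> ==> \<exists>n0. \<forall>m\<ge>n0. \<forall>n\<ge>n0. pmod M \<alpha> (\<lambda>x. fst (w (r m) x) - fst (w (r n) x)) <= ennreal \<epsilon>"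
proof -
 have "\<exists>u g. sub.is_pair K u g \<and> (AE x in M. fst (w n x) = u x)" for n
  by (rule E_is_pair[OF w(1) K w(2), of n]) blast
 then obtain u g where u: "\<And>n. sub.is_pair K (u n) (g n)" "\<And>n. AE x in M. fst (w n x) = u n x" by metis
 obtain r where r: "strict_mono (r :: nat => nat)"
  "\<And>\<epsilon>. 0 < \<epsilon> ==> \<exists>n0. \<forall>m\<ge>n0. \<forall>n\<ge>n0. (sub.Amod (\<lambda>x. u (r m) x - u (r n) x)) <= ennreal \<epsilon>"
  by (rule sub.Rellich[OF K u(1)]) (rule that)
 have [measurable]: "u n \<in> borel_measurable borel" for n by (rule sub.is_pairD(1)[OF u(1)])
 have "pmod M \<alpha> (\<lambda>x. fst (w m x) - fst (w n x)) = (sub.Amod (\<lambda>x. u m x - u n x))" for m n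
 proof (rule pmod_A_eq)
  show "AE x in M. fst (w m x) - fst (w n x) = u m x - u n x" using u(2)[of m] u(2)[of n] by eventually_elim simp
 qed measurable
 then show thesis using r by (intro that[of r]) auto
qed

end

section \<open>Primitives, growth bounds and the energy density\<close>

lemma primitive_deriv:
 assumes "continuous_on UNIV (f x)"
 shows "((\<lambda>t. primitive f x t) has_real_derivative f x t) (at t)"
proof -
 \<comment> \<open>The interval contains 0 and has t in its interior, so that the derivative within
   it is a full derivative at t.\<close>
 let ?a = "- \<bar>t\<bar> - 1" and ?b = "\<bar>t\<bar> + 1"
 have "((\<lambda>u. LBINT y=0..u. f x y) has_vector_derivative f x t) (at t within {?a..?b})"
  using interval_integral_FTC2[of ?a 0 ?b "f x" t] continuous_on_subset[OF assms] by (auto simp: zero_ereal_def)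
 moreover have "at t within {?a..?b} = at t" by (rule at_within_Icc_at) auto
 ultimately show ?thesis
  by (simp add: primitive_def has_real_derivative_iff_has_vector_derivative)
qed

lemma primitive_0 [simp]: "primitive f x 0 = 0"
 by (simp add: primitive_def flip: zero_ereal_def)

lemma primitive_bound:
 assumes "continuous_on UNIV (f x)" and B: "\<And>s. \<bar>s\<bar> <= \<bar>t\<bar> ==> \<bar>f x s\<bar> <= B"
 shows "\<bar>primitive f x t\<bar> <= B * \<bar>t\<bar>"
proof -
 have "((\<lambda>s. primitive f x (s * t)) has_real_derivative f x (s * t) * t) (at s)" for s
  by (rule DERIV_chain2[OF primitive_deriv[of f x, OF assms(1)]]) (auto intro!: derivative_eq_intros)
 then obtain s where s: "0 < s" "s < 1" "primitive f x (1 * t) - primitive f x (0 * t) = (1 - 0) * (f x (s * t) * t)"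
  using MVT2[of 0 1 "\<lambda>s. primitive f x (s * t)" "\<lambda>s. f x (s * t) * t"] by auto
 have "\<bar>s * t\<bar> <= \<bar>t\<bar>" using s by (simp add: abs_mult mult_left_le_one_le)
 then have "\<bar>f x (s * t)\<bar> * \<bar>t\<bar> <= B * \<bar>t\<bar>" by (intro mult_right_mono B) auto
 then show ?thesis using s by (simp add: abs_mult)
qed

text \<open>For fixed t the primitive is a measurable parameter integral and for fixed x it is
  differentiable, so it is again a Caratheodory function.\<close>

lemma primitive_joint_measurable:
 assumes f: "case_prod f \<in> borel_measurable (M \<Otimes>\<^sub>M borel)" and cont: "\<And>x. x \<in> space M ==> continuous_on UNIV (f x)"
 shows "case_prod (primitive f) \<in> borel_measurable (M \<Otimes>\<^sub>M borel)"
proof (rule caratheodory_joint_measurable)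
 have f': "case_prod f \<in> borel_measurable (M \<Otimes>\<^sub>M lborel)" using f by simp
 have "(\<lambda>x. LINT s|lborel. indicator S s *\<^sub>R f x s) \<in> borel_measurable M" if "S \<in> sets borel" for S :: "real set"
 proof (rule lborel.borel_measurable_lebesgue_integral)
  show "(\<lambda>(x, s). indicator S s *\<^sub>R f x s) \<in> borel_measurable (M \<Otimes>\<^sub>M lborel)"
   unfolding case_prod_unfold using that f'[unfolded case_prod_unfold]
   by (intro borel_measurable_scaleR measurable_compose[OF measurable_snd]) auto
 qed
 then show "(\<lambda>x. primitive f x t) \<in> borel_measurable M" for t
  unfolding primitive_def interval_lebesgue_integral_def set_lebesgue_integral_def
  by (cases "0 <= ereal t") (simp_all only: if_True if_False, auto intro!: borel_measurable_uminus simp del: einterval_eq)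
 show "continuous_on UNIV (primitive f x)" if "x \<in> space M" for x
  using primitive_deriv[of f x, OF cont[OF that]] by (intro continuous_at_imp_continuous_on ballI DERIV_isCont)
qed

lemma abs_pvec_inner_le:
 fixes a b :: "'v::real_inner"
 assumes "1 < p" shows "\<bar>pvec p a \<bullet> b\<bar> <= norm a powr p + norm b powr p"
proof -
 have "\<bar>pvec p a \<bullet> b\<bar> <= norm a powr (p-1) * norm b" using Cauchy_Schwarz_ineq2[of "pvec p a" b] by (simp add: norm_pvec)
 also have "... <= max (norm a) (norm b) powr (p-1) * max (norm a) (norm b)"
  using assms by (intro mult_mono powr_mono2) (auto simp: le_max_iff_disj)
 also have "... = max (norm a) (norm b) powr p"
 proof (cases "max (norm a) (norm b) = 0")
  case False
  then have "0 < max (norm a) (norm b)" by (auto simp: less_max_iff_disj max_def)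
  then show ?thesis using powr_add[of "max (norm a) (norm b)" "p-1" 1] by simp
 qed simp
 also have "... <= norm a powr p + norm b powr p" by (auto simp: max_def)
 finally show ?thesis .
qed

lemma powr_mult_le_add:
 fixes s t p :: real
 assumes "1 < p" "0 <= s" "0 <= t" shows "t powr (p-1) * s <= t powr p + s powr p"
 using abs_pvec_inner_le[OF assms(1), of t s] assms by (simp add: pvec_def) (metis (no_types, lifting) abs_of_nonneg mult_nonneg_nonneg norm_pvec powr_ge_zero pvec_def real_norm_def real_scaleR_def)

text \<open>Here f is continuous in t at every point of \<Omega>; the exceptional null set of a
  Caratheodory function is removed before the locale is instantiated.\<close>

locale energy = energy_space \<Omega> p1 p2 \<alpha> P A lo hi R \<eta>0 \<omega> \<kappa> a0 pp
 for \<Omega> :: "'a::euclidean_space set" and p1 p2 \<alpha> P A lo hi R \<eta>0 \<omega> \<kappa> a0 pp +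
 fixes f :: "'a => real => real" and C :: real
 assumes f_meas: "case_prod f \<in> borel_measurable (lebesgue_on \<Omega> \<Otimes>\<^sub>M borel)"
  and f_cont: "\<And>x. x \<in> \<Omega> ==> continuous_on UNIV (f x)"
  and growth: "\<And>x t. x \<in> \<Omega> ==> \<bar>f x t\<bar> <= C * (1 + \<bar>t\<bar> powr (\<alpha> x - 1))" and C: "1 <= C"
begin

definition F :: "'a => real => real" where "F = primitive f"

lemma f_comp: assumes "u \<in> borel_measurable M" shows "(\<lambda>x. f x (u x)) \<in> borel_measurable M"
 using measurable_compose[OF measurable_Pair[OF measurable_ident_sets[OF refl] assms] f_meas] by simp

lemma F_comp: assumes "u \<in> borel_measurable M" shows "(\<lambda>x. F x (u x)) \<in> borel_measurable M"
proof -
 have "case_prod F \<in> borel_measurable (M \<Otimes>\<^sub>M borel)" unfolding F_def by (rule primitive_joint_measurable[OF f_meas]) (simp add: f_cont)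
 from measurable_compose[OF measurable_Pair[OF measurable_ident_sets[OF refl] assms] this] show ?thesis by simp
qed

lemma ranges:
 assumes "x \<in> \<Omega>"
 shows "1 < p1 x" "1 < p2 x" "1 < \<alpha> x" "p1 x <= hi" "p2 x <= hi" "\<alpha> x <= hi" "lo <= p1 x" "lo <= p2 x" "lo <= \<alpha> x" "pp < \<alpha> x"
 using d1.p_bounds[OF assms] d2.p_bounds[OF assms] dA.p_bounds[OF assms] d1.lo sub.a0(2)[OF assms] A_eq[OF assms] pp by auto

lemma lo1: "1 < lo" and hi1: "1 < hi" and pp1: "1 < pp" using d1.lo pp by auto

lemma F_bound: assumes "x \<in> \<Omega>" shows "\<bar>F x t\<bar> <= C * (\<bar>t\<bar> + \<bar>t\<bar> powr \<alpha> x)"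
proof -
 have "\<bar>F x t\<bar> <= (C * (1 + \<bar>t\<bar> powr (\<alpha> x - 1))) * \<bar>t\<bar>"
  unfolding F_def
 proof (rule primitive_bound[of f x, OF f_cont[OF assms]])
  fix s assume "\<bar>s\<bar> <= \<bar>t\<bar>"
  then have "C * (1 + \<bar>s\<bar> powr (\<alpha> x - 1)) <= C * (1 + \<bar>t\<bar> powr (\<alpha> x - 1))"
   using C ranges(3)[OF assms] by (intro mult_left_mono add_left_mono powr_mono2) auto
  then show "\<bar>f x s\<bar> <= C * (1 + \<bar>t\<bar> powr (\<alpha> x - 1))" using growth[OF assms, of s] by linarith
 qed
 also have "... = C * (\<bar>t\<bar> + \<bar>t\<bar> powr (\<alpha> x - 1) * \<bar>t\<bar>)" by (simp add: algebra_simps)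
 also have "\<bar>t\<bar> powr (\<alpha> x - 1) * \<bar>t\<bar> = \<bar>t\<bar> powr \<alpha> x"
  by (cases "t = 0") (use powr_add[of "\<bar>t\<bar>" "\<alpha> x - 1" 1] in auto)
 finally show ?thesis .
qed

lemma le_one_powr: "0 <= t ==> 1 <= q ==> t <= 1 + t powr q" for t q :: real
 using le_add_powr'[of 1 t q] by simp

definition Ld :: "'a => real \<times> 'a => real" where
 "Ld x W = norm (snd W) powr p1 x / p1 x + norm (snd W) powr p2 x / p2 x - F x (fst W)"

definition dL :: "'a => real \<times> 'a => real \<times> 'a => real" where
 "dL x W V = pvec (p1 x) (snd W) \<bullet> snd V + pvec (p2 x) (snd W) \<bullet> snd V - f x (fst W) * fst V"

text \<open>A common majorant for the energy density and its derivative; the constant 1 pays for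
  terms linear in the function.\<close>

definition \<Phi> :: "'a => real \<times> 'a => real" where
 "\<Phi> x W = 1 + norm (snd W) powr p1 x + norm (snd W) powr p2 x + \<bar>fst W\<bar> powr \<alpha> x"

lemma f_mult_le: assumes x: "x \<in> \<Omega>" shows "\<bar>f x t * s\<bar> <= 2 * C * (1 + \<bar>t\<bar> powr \<alpha> x + \<bar>s\<bar> powr \<alpha> x)"
proof -
 have "\<bar>f x t * s\<bar> <= C * (1 + \<bar>t\<bar> powr (\<alpha> x - 1)) * \<bar>s\<bar>"
  unfolding abs_mult by (intro mult_right_mono growth[OF x]) auto
 also have "... = C * (\<bar>s\<bar> + \<bar>t\<bar> powr (\<alpha> x - 1) * \<bar>s\<bar>)" by (simp add: algebra_simps)
 also have "... <= C * ((1 + \<bar>s\<bar> powr \<alpha> x) + (\<bar>t\<bar> powr \<alpha> x + \<bar>s\<bar> powr \<alpha> x))"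
  using C ranges(3)[OF x] by (intro mult_left_mono add_mono le_one_powr powr_mult_le_add) auto
 also have "... <= C * (2 * (1 + \<bar>t\<bar> powr \<alpha> x + \<bar>s\<bar> powr \<alpha> x))" using C by (intro mult_left_mono) auto
 finally show ?thesis by (simp only: mult.assoc mult.left_commute)
qed

lemma dL_bound: assumes x: "x \<in> \<Omega>" shows "\<bar>dL x W V\<bar> <= 2 * C * (\<Phi> x W + \<Phi> x V)"
proof -
 have 1: "\<bar>pvec (p1 x) (snd W) \<bullet> snd V\<bar> <= norm (snd W) powr p1 x + norm (snd V) powr p1 x"
  "\<bar>pvec (p2 x) (snd W) \<bullet> snd V\<bar> <= norm (snd W) powr p2 x + norm (snd V) powr p2 x"
  using ranges[OF x] by (auto intro!: abs_pvec_inner_le)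
 define T where "T = norm (snd W) powr p1 x + norm (snd V) powr p1 x + norm (snd W) powr p2 x + norm (snd V) powr p2 x"
 have T: "0 <= T" by (simp add: T_def)
 have "\<bar>dL x W V\<bar> <= T + 2 * C * (1 + \<bar>fst W\<bar> powr \<alpha> x + \<bar>fst V\<bar> powr \<alpha> x)"
  using 1 f_mult_le[OF x, of "fst W" "fst V"] unfolding dL_def T_def by linarith
 also have "T <= 2 * C * T" using T C by (simp add: mult_le_cancel_right1)
 also have "2 * C * T + 2 * C * (1 + \<bar>fst W\<bar> powr \<alpha> x + \<bar>fst V\<bar> powr \<alpha> x) = 2 * C * (T + (1 + \<bar>fst W\<bar> powr \<alpha> x + \<bar>fst V\<bar> powr \<alpha> x))" by (simp add: distrib_left)
 also have "... <= 2 * C * (\<Phi> x W + \<Phi> x V)" using C by (intro mult_left_mono) (auto simp: T_def \<Phi>_def)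
 finally show ?thesis by simp
qed

lemma Ld_bound: assumes x: "x \<in> \<Omega>" shows "\<bar>Ld x W\<bar> <= 2 * C * \<Phi> x W"
proof -
 have d: "norm (snd W) powr q / q <= norm (snd W) powr q" if "1 < q" for q using that by (simp add: divide_le_eq mult_le_cancel_left1)
 have "\<bar>F x (fst W)\<bar> <= C * (\<bar>fst W\<bar> + \<bar>fst W\<bar> powr \<alpha> x)" by (rule F_bound[OF x])
 also have "... <= C * (1 + \<bar>fst W\<bar> powr \<alpha> x + \<bar>fst W\<bar> powr \<alpha> x)"
  using C ranges(3)[OF x] by (intro mult_left_mono add_right_mono le_one_powr) auto
 finally have F: "\<bar>F x (fst W)\<bar> <= C * (1 + 2 * \<bar>fst W\<bar> powr \<alpha> x)" by (simp only: mult_2 add.assoc)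
 have g: "norm (snd W) powr p1 x / p1 x <= norm (snd W) powr p1 x" "norm (snd W) powr p2 x / p2 x <= norm (snd W) powr p2 x"
  "0 <= norm (snd W) powr p1 x / p1 x" "0 <= norm (snd W) powr p2 x / p2 x"
  using d ranges[OF x] by auto
 define T where "T = norm (snd W) powr p1 x + norm (snd W) powr p2 x"
 have T: "T <= C * T" using C mult_right_mono[of 1 C T] by (simp add: T_def)
 have "\<bar>Ld x W\<bar> <= T + C * (1 + 2 * \<bar>fst W\<bar> powr \<alpha> x)" using F g unfolding Ld_def T_def by linarith
 also have "... <= C * T + C * (1 + 2 * \<bar>fst W\<bar> powr \<alpha> x)" using T by simp
 also have "... = C * (T + 1 + 2 * \<bar>fst W\<bar> powr \<alpha> x)" by (simp add: algebra_simps)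
 also have "... <= C * (2 * \<Phi> x W)" using C by (intro mult_left_mono) (auto simp: \<Phi>_def T_def)
 finally show ?thesis by (simp only: mult.assoc mult.left_commute)
qed

text \<open>A majorant along the line W + s V that is uniform for |s| <= S, as differentiation under
  the integral demands.\<close>

lemma \<Phi>_add_scale:
 assumes x: "x \<in> \<Omega>" and s: "\<bar>s\<bar> <= S" "1 <= S"
 shows "\<Phi> x (W + s *\<^sub>R V) <= 2 powr hi * (\<Phi> x W + S powr hi * \<Phi> x V)"
proof -
 have H: "(1::real) <= 2 powr hi" "1 <= S powr hi" using hi1 s by (auto intro!: ge_one_powr_ge_zero)
 have "norm (a + s *\<^sub>R b) powr q <= 2 powr hi * (norm a powr q + S powr hi * norm b powr q)" if q: "1 < q" "q <= hi" for a b :: "'v::real_normed_vector" and q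
 proof -
  have "norm (a + s *\<^sub>R b) powr q <= 2 powr hi * (norm a powr q + norm (s *\<^sub>R b) powr q)" using q by (intro norm_add_powr_le) auto
  also have "norm (s *\<^sub>R b) powr q = \<bar>s\<bar> powr q * norm b powr q" by (simp add: powr_mult)
  also have "\<bar>s\<bar> powr q * norm b powr q <= S powr hi * norm b powr q"
   using s q powr_mono2[of q "\<bar>s\<bar>" S] powr_mono[of q hi S] by (intro mult_right_mono) auto
  finally show ?thesis by (simp add: mult_left_mono)
 qed
 note b = this[OF ranges(1,4)[OF x], of "snd W" "snd V"] this[OF ranges(2,5)[OF x], of "snd W" "snd V"] this[OF ranges(3,6)[OF x], of "fst W" "fst V"]
 have one: "1 <= 2 powr hi * (1 + S powr hi * 1)" using H mult_mono[of 1 "2 powr hi" 1 "1 + S powr hi * 1"] by simp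
 have "\<Phi> x (W + s *\<^sub>R V) <= 2 powr hi * (1 + S powr hi * 1) + 2 powr hi * (norm (snd W) powr p1 x + S powr hi * norm (snd V) powr p1 x)
   + 2 powr hi * (norm (snd W) powr p2 x + S powr hi * norm (snd V) powr p2 x) + 2 powr hi * (\<bar>fst W\<bar> powr \<alpha> x + S powr hi * \<bar>fst V\<bar> powr \<alpha> x)"
  unfolding \<Phi>_def using b one by simp
 also have "... = 2 powr hi * (\<Phi> x W + S powr hi * \<Phi> x V)" by (simp add: \<Phi>_def algebra_simps)
 finally show ?thesis .
qed

lemma dL_deriv: assumes x: "x \<in> \<Omega>"
 shows "((\<lambda>s. Ld x (W + s *\<^sub>R V)) has_real_derivative dL x (W + s *\<^sub>R V) V) (at s)"
proof -
 have "((\<lambda>s. F x (fst W + s * fst V)) has_real_derivative f x (fst W + s * fst V) * fst V) (at s)"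
  unfolding F_def by (rule DERIV_chain2[OF primitive_deriv[of f x, OF f_cont[OF x]]]) (auto intro!: derivative_eq_intros)
 then show ?thesis
  unfolding Ld_def dL_def using DERIV_norm_powr[OF ranges(1)[OF x], of "snd W" "snd V" s] DERIV_norm_powr[OF ranges(2)[OF x], of "snd W" "snd V" s]
  by (auto intro!: DERIV_diff DERIV_add)
qed

lemma pmod_fst_finite: assumes "w \<in> E" shows "pmodA w < \<infinity>"
proof -
 obtain C where "0 <= C" "\<And>v. v \<in> E ==> \<rho> v <= \<rho> w ==> pmodA v <= ennreal C"
  by (rule Sobolev[OF \<rho>_nonneg, of w]) (rule that)
 from this(2)[OF assms order_refl] have "pmodA w <= ennreal C" .
 then show ?thesis by (rule le_less_trans) simp
qed

lemma integrable_fst_powr: assumes "w \<in> E" shows "integrable M (\<lambda>x. \<bar>fst (w x)\<bar> powr \<alpha> x)"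
 using pmod_fst_finite[OF assms] dA.pmod_finite_iff[OF E_measurable'(1)[OF assms]] by simp

lemma integrable_\<Phi>: assumes "w \<in> E" shows "integrable M (\<lambda>x. \<Phi> x (w x))"
 unfolding \<Phi>_def using integrable_snd_powr[OF assms] integrable_fst_powr[OF assms] by simp

lemma measurable_parts:
 assumes "w \<in> E" "v \<in> E"
 shows "(\<lambda>x. pvec (p1 x) (snd (w x)) \<bullet> snd (v x)) \<in> borel_measurable M"
  "(\<lambda>x. pvec (p2 x) (snd (w x)) \<bullet> snd (v x)) \<in> borel_measurable M"
  "(\<lambda>x. f x (fst (w x)) * fst (v x)) \<in> borel_measurable M"
proof -
 note [measurable] = E_measurable'[OF assms(1)] E_measurable'[OF assms(2)] d1.p_measurable d2.p_measurable f_comp[OF E_measurable'(1)[OF assms(1)]]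
 show "(\<lambda>x. pvec (p1 x) (snd (w x)) \<bullet> snd (v x)) \<in> borel_measurable M"
  "(\<lambda>x. pvec (p2 x) (snd (w x)) \<bullet> snd (v x)) \<in> borel_measurable M" unfolding pvec_def by measurable
 show "(\<lambda>x. f x (fst (w x)) * fst (v x)) \<in> borel_measurable M" by measurable
qed

lemma integrable_parts:
 assumes w: "w \<in> E" and v: "v \<in> E"
 shows "integrable M (\<lambda>x. pvec (p1 x) (snd (w x)) \<bullet> snd (v x))"
  "integrable M (\<lambda>x. pvec (p2 x) (snd (w x)) \<bullet> snd (v x))"
  "integrable M (\<lambda>x. f x (fst (w x)) * fst (v x))"
proof -
 note m = measurable_parts[OF assms]
 show "integrable M (\<lambda>x. pvec (p1 x) (snd (w x)) \<bullet> snd (v x))"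
  using abs_pvec_inner_le[OF ranges(1)] integrable_snd_powr[OF w] integrable_snd_powr[OF v]
  by (intro Bochner_Integration.integrable_bound[OF _ m(1), of "\<lambda>x. norm (snd (w x)) powr p1 x + norm (snd (v x)) powr p1 x"]) (auto intro!: AE_I2)
 show "integrable M (\<lambda>x. pvec (p2 x) (snd (w x)) \<bullet> snd (v x))"
  using abs_pvec_inner_le[OF ranges(2)] integrable_snd_powr[OF w] integrable_snd_powr[OF v]
  by (intro Bochner_Integration.integrable_bound[OF _ m(2), of "\<lambda>x. norm (snd (w x)) powr p2 x + norm (snd (v x)) powr p2 x"]) (auto intro!: AE_I2)
 show "integrable M (\<lambda>x. f x (fst (w x)) * fst (v x))"
 proof (rule Bochner_Integration.integrable_bound[OF _ m(3), of "\<lambda>x. 2 * C * (1 + \<bar>fst (w x)\<bar> powr \<alpha> x + \<bar>fst (v x)\<bar> powr \<alpha> x)"])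
  show "integrable M (\<lambda>x. 2 * C * (1 + \<bar>fst (w x)\<bar> powr \<alpha> x + \<bar>fst (v x)\<bar> powr \<alpha> x))"
   using integrable_fst_powr[OF w] integrable_fst_powr[OF v] by simp
  show "AE x in M. norm (f x (fst (w x)) * fst (v x)) <= norm (2 * C * (1 + \<bar>fst (w x)\<bar> powr \<alpha> x + \<bar>fst (v x)\<bar> powr \<alpha> x))"
  proof (intro AE_I2)
   fix x assume "x \<in> space M"
   then have "\<bar>f x (fst (w x)) * fst (v x)\<bar> <= 2 * C * (1 + \<bar>fst (w x)\<bar> powr \<alpha> x + \<bar>fst (v x)\<bar> powr \<alpha> x)" by (intro f_mult_le) simp
   then show "norm (f x (fst (w x)) * fst (v x)) <= norm (2 * C * (1 + \<bar>fst (w x)\<bar> powr \<alpha> x + \<bar>fst (v x)\<bar> powr \<alpha> x))" by simp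
  qed
 qed
qed

lemma integrable_dL: assumes "w \<in> E" "v \<in> E" shows "integrable M (\<lambda>x. dL x (w x) (v x))"
 unfolding dL_def using integrable_parts[OF assms] by simp

lemma integrable_Ld: assumes w: "w \<in> E" shows "integrable M (\<lambda>x. Ld x (w x))"
proof (rule Bochner_Integration.integrable_bound[of _ "\<lambda>x. 2 * C * \<Phi> x (w x)"])
 show "integrable M (\<lambda>x. 2 * C * \<Phi> x (w x))" using integrable_\<Phi>[OF w] by simp
 note [measurable] = E_measurable'[OF w] d1.p_measurable d2.p_measurable F_comp[OF E_measurable'(1)[OF w]]
 show "(\<lambda>x. Ld x (w x)) \<in> borel_measurable M" unfolding Ld_def by measurable
 show "AE x in M. norm (Ld x (w x)) <= norm (2 * C * \<Phi> x (w x))"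
 proof (intro AE_I2)
  fix x assume "x \<in> space M"
  then have "\<bar>Ld x (w x)\<bar> <= 2 * C * \<Phi> x (w x)" by (intro Ld_bound) simp
  then show "norm (Ld x (w x)) <= norm (2 * C * \<Phi> x (w x))" by simp
 qed
qed

definition J :: "('a => real \<times> 'a) => real" where "J w = (LINT x|M. Ld x (w x))"
definition D :: "('a => real \<times> 'a) => ('a => real \<times> 'a) => real" where "D w v = (LINT x|M. dL x (w x) (v x))"

lemma D_parts: assumes "w \<in> E" "v \<in> E"
 shows "D w v = (LINT x|M. pvec (p1 x) (snd (w x)) \<bullet> snd (v x)) + (LINT x|M. pvec (p2 x) (snd (w x)) \<bullet> snd (v x)) - (LINT x|M. f x (fst (w x)) * fst (v x))"
 unfolding D_def dL_def using integrable_parts[OF assms] by simp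

abbreviation N where "N \<equiv> cm.gauge"

lemma \<rho>_le: assumes "w \<in> E" "N w <= r" "0 <= r" shows "\<rho> w <= (r + 1) powr pp"
 by (rule cm.rho_le_powr_hi[OF assms(1)]) (use assms in auto)

lemma \<Phi>_integral_bound:
 obtains B where "0 <= B" "\<And>w. w \<in> E ==> N w <= r ==> (LINT x|M. \<Phi> x (w x)) <= B"
proof -
 define K where "K = (\<bar>r\<bar> + 1) powr pp"
 obtain C1 where C1: "0 <= C1" "\<And>w. w \<in> E ==> \<rho> w <= K ==> pmodA w <= ennreal C1"
  by (rule Sobolev[of K]) (auto simp: K_def intro: that)
 show thesis
 proof (rule that[of "measure M \<Omega> + K + C1"])
  show "0 <= measure M \<Omega> + K + C1" using C1 by (simp add: K_def)
  fix w assume w: "w \<in> E" "N w <= r"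
  have r: "\<rho> w <= K" unfolding K_def by (rule \<rho>_le) (use w in auto)
  have "ennreal (LINT x|M. \<bar>fst (w x)\<bar> powr \<alpha> x) <= ennreal C1"
   using C1(2)[OF w(1) r] dA.pmod_eq_integral[of "\<lambda>x. fst (w x)"] integrable_fst_powr[OF w(1)] by simp
  then have "(LINT x|M. \<bar>fst (w x)\<bar> powr \<alpha> x) <= C1" using C1 by (simp add: ennreal_le_iff)
  moreover have "(LINT x|M. \<Phi> x (w x)) = measure M \<Omega> + \<rho> w + (LINT x|M. \<bar>fst (w x)\<bar> powr \<alpha> x)"
   unfolding \<Phi>_def \<rho>_def using integrable_snd_powr[OF w(1)] integrable_fst_powr[OF w(1)] by simp
  ultimately show "(LINT x|M. \<Phi> x (w x)) <= measure M \<Omega> + K + C1" using r by simp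
 qed
qed

text \<open>If w has gauge below c, then w/c has modular at most 1; the embedding at this fixed
  level, followed by scaling back with c, produces the power c^lo.\<close>

lemma pmod_fst_small:
 obtains C1 where "0 <= C1" "\<And>w c. w \<in> E ==> N w < c ==> c <= 1 ==> pmodA w <= ennreal (c powr lo * C1)"
proof -
 obtain C1 where C1: "0 <= C1" "\<And>w. w \<in> E ==> \<rho> w <= 1 ==> pmodA w <= ennreal C1"
  by (rule Sobolev[of 1]) (auto intro: that)
 show thesis
 proof (rule that[OF C1(1)])
  fix w c assume w: "w \<in> E" "N w < c" "c <= 1"
  have c: "0 < c" using cm.gauge_nonneg[OF w(1)] w by linarith
  have w': "inverse c *\<^sub>R w \<in> E" using w by (simp add: cm.scaleE)
  have "\<rho> (inverse c *\<^sub>R w) <= 1" using cm.gauge_lessD[OF w(1,2)] by (simp add: cm.gset_def)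
  then have le: "pmodA (inverse c *\<^sub>R w) <= ennreal C1" by (rule C1(2)[OF w'])
  have "pmodA w = pmod M \<alpha> (\<lambda>x. c *\<^sub>R fst ((inverse c *\<^sub>R w) x))" using c by (simp add: mult.assoc[symmetric])
  also have "... <= ennreal (c powr lo) * pmodA (inverse c *\<^sub>R w)"
   using c w by (intro dA.pmod_scale_le E_measurable'(1)[OF w']) auto
  also have "... <= ennreal (c powr lo) * ennreal C1" by (intro mult_left_mono le) auto
  also have "... = ennreal (c powr lo * C1)" using C1 by (simp add: ennreal_mult)
  finally show "pmodA w <= ennreal (c powr lo * C1)" .
 qed
qed

abbreviation pdiff :: "('a => real \<times> 'a) => ('a => real \<times> 'a) => ('a => real \<times> 'a) => 'a => real" where
 "pdiff u v w x \<equiv> \<bar>(pvec (p1 x) (snd (u x)) - pvec (p1 x) (snd (v x))) \<bullet> snd (w x)\<bar> + \<bar>(pvec (p2 x) (snd (u x)) - pvec (p2 x) (snd (v x))) \<bullet> snd (w x)\<bar>"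

abbreviation fint :: "('a => real \<times> 'a) => ('a => real \<times> 'a) => real" where
 "fint u w \<equiv> LINT x|M. f x (fst (u x)) * fst (w x)"

text \<open>\<open>pvec_uniformly_continuous\<close> is integrated. Its \<epsilon> part meets three
  modulars bounded by K, hence the denominator 6 (K + 1); the rest is C1 times the modular of u -
  v.\<close>

lemma A_ucont:
 assumes e: "0 < e" and K: "0 <= K"
 obtains d where "0 < d" "\<And>u v w. u \<in> E ==> v \<in> E ==> w \<in> E ==> \<rho> u <= K ==> \<rho> v <= K ==> \<rho> w <= K ==> \<rho> (u - v) <= d ==>
  (LINT x|M. pdiff u v w x) <= e"
proof -
 define \<epsilon> where "\<epsilon> = e / (6 * (K + 1))"
 have \<epsilon>: "0 < \<epsilon>" using e K by (simp add: \<epsilon>_def)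
 obtain C1 where C1: "0 <= C1" "\<And>p (a::'a) b v. p \<in> {lo..hi} ==>
  \<bar>(pvec p a - pvec p b) \<bullet> v\<bar> <= \<epsilon> * (norm a powr p + norm b powr p + norm v powr p) + C1 * norm (a - b) powr p"
  by (rule pvec_uniformly_continuous[OF lo1 \<epsilon>, of hi]) (rule that)
 define d where "d = e / (2 * (C1 + 1))"
 have d: "0 < d" using e C1 by (simp add: d_def)
 have C1d: "C1 * d <= e/2"
 proof -
  have "C1 * d <= (C1 + 1) * d" using d by (intro mult_right_mono) auto
  also have "... = e/2" using C1(1) by (simp add: d_def field_simps)
  finally show ?thesis .
 qed
 have \<epsilon>K: "\<epsilon> * (3 * K) <= e/2"
 proof -
  have "\<epsilon> * (3 * K) <= \<epsilon> * (3 * (K + 1))" using \<epsilon> by (intro mult_left_mono) auto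
  also have "... = e/2" using K by (simp add: \<epsilon>_def field_simps)
  finally show ?thesis .
 qed
 show thesis
 proof (rule that[OF d])
  fix u v w assume u: "u \<in> E" and v: "v \<in> E" and w: "w \<in> E" and K': "\<rho> u <= K" "\<rho> v <= K" "\<rho> w <= K" "\<rho> (u - v) <= d"
  have uv: "u - v \<in> E" using E_subspace u v by (rule subspace_diff)
  let ?n = "\<lambda>w x. norm (snd (w x)) powr p1 x + norm (snd (w x)) powr p2 x"
  have i: "integrable M (?n w)" if "w \<in> E" for w using integrable_snd_powr[OF that] by simp
  have i0: "integrable M (\<lambda>x. pdiff u v w x)"
   unfolding inner_diff_left using integrable_parts[OF u w] integrable_parts[OF v w] by simp
  have "(LINT x|M. pdiff u v w x)
   <= (LINT x|M. \<epsilon> * (?n u x + ?n v x + ?n w x) + C1 * ?n (u - v) x)"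
  proof (rule integral_mono[OF i0])
   show "integrable M (\<lambda>x. \<epsilon> * (?n u x + ?n v x + ?n w x) + C1 * ?n (u - v) x)"
    using i[OF u] i[OF v] i[OF w] i[OF uv] by simp
   fix x assume "x \<in> space M"
   then have x: "x \<in> \<Omega>" by simp
   show "pdiff u v w x <= \<epsilon> * (?n u x + ?n v x + ?n w x) + C1 * ?n (u - v) x"
    using C1(2)[of "p1 x" "snd (u x)" "snd (v x)" "snd (w x)"] C1(2)[of "p2 x" "snd (u x)" "snd (v x)" "snd (w x)"] ranges[OF x]
    by (simp add: algebra_simps)
  qed
  also have "... = \<epsilon> * (\<rho> u + \<rho> v + \<rho> w) + C1 * \<rho> (u - v)"
   unfolding \<rho>_def using i[OF u] i[OF v] i[OF w] i[OF uv] by (simp del: fun_diff_def)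
  also have "... <= \<epsilon> * (3 * K) + C1 * d"
   using K' \<epsilon> C1 by (intro add_mono mult_left_mono) auto
  also have "... <= e" using \<epsilon>K C1d by simp
  finally show "(LINT x|M. pdiff u v w x) <= e" .
 qed
qed

end

context energy begin

section \<open>Uniform continuity and boundedness of the derivative\<close>

lemma Rellich_limit:
 assumes K: "0 <= K" and w: "\<And>n. w n \<in> E" "\<And>n. \<rho> (w n) <= K"
 obtains s u where "strict_mono (s :: nat => nat)" "u \<in> borel_measurable M" "pmod M \<alpha> u < \<infinity>"
  "AE x in M. (\<lambda>n. fst (w (s n) x)) \<longlonglongrightarrow> u x" "(\<lambda>n. pmod M \<alpha> (\<lambda>x. fst (w (s n) x) - u x)) \<longlonglongrightarrow> 0"
proof -
 obtain r where r: "strict_mono (r :: nat => nat)"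
  "\<And>\<epsilon>. 0 < \<epsilon> ==> \<exists>n0. \<forall>m\<ge>n0. \<forall>n\<ge>n0. pmod M \<alpha> (\<lambda>x. fst (w (r m) x) - fst (w (r n) x)) <= ennreal \<epsilon>"
  by (rule Rellich_E[OF K w]) (rule that)
 have m: "(\<lambda>x. fst (w n x)) \<in> borel_measurable M" for n by (rule E_measurable'(1)[OF w(1)])
 obtain s u where s: "strict_mono (s :: nat => nat)" "u \<in> borel_measurable M"
  "AE x in M. (\<lambda>k. fst (w (r (s k)) x)) \<longlonglongrightarrow> u x" "(\<lambda>n. pmod M \<alpha> (\<lambda>x. fst (w (r n) x) - u x)) \<longlonglongrightarrow> 0"
  by (rule dA.pmod_complete[of "\<lambda>n x. fst (w (r n) x)", OF m r(2)]) (assumption, rule that)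
 show thesis
 proof (rule that[of "r \<circ> s" u])
  show "strict_mono (r \<circ> s)" by (rule strict_mono_o[OF r(1) s(1)])
  show "u \<in> borel_measurable M" by fact
  show "AE x in M. (\<lambda>n. fst (w ((r \<circ> s) n) x)) \<longlonglongrightarrow> u x" using s(3) by simp
  show "(\<lambda>n. pmod M \<alpha> (\<lambda>x. fst (w ((r \<circ> s) n) x) - u x)) \<longlonglongrightarrow> 0"
   using LIMSEQ_subseq_LIMSEQ[OF s(4) s(1)] by (simp add: comp_def)
  obtain n where n: "pmod M \<alpha> (\<lambda>x. fst (w (r n) x) - u x) < 1"
   using order_tendstoD(2)[OF s(4), of 1] by (auto simp: eventually_sequentially)
  have "pmod M \<alpha> u = pmod M \<alpha> (\<lambda>x. fst (w (r n) x) - (fst (w (r n) x) - u x))" by simp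
  also have "... <= ennreal (2 powr hi) * (pmodA (w (r n)) + pmod M \<alpha> (\<lambda>x. fst (w (r n) x) - u x))"
   by (rule dA.pmod_diff) (use m s(2) in measurable)
  also have "... < \<infinity>" using pmod_fst_finite[OF w(1), of "r n"] n
   by (auto simp: ennreal_mult_less_top less_top intro: order.strict_trans)
  finally show "pmod M \<alpha> u < \<infinity>" .
 qed
qed

text \<open>Both integrals are compared with a third function u' instead of with each other, which
  is the form in which \<open>Nemytskii_tendsto\<close> applies.\<close>

lemma abs_integral_f_diff_le:
 assumes u: "u \<in> E" and v: "v \<in> E" and w: "w \<in> E" and [measurable]: "u' \<in> borel_measurable M"
 shows "ennreal \<bar>fint u w - fint v w\<bar>
  <= (\<integral>\<^sup>+x. ennreal (\<bar>f x (fst (u x)) - f x (u' x)\<bar> * \<bar>fst (w x)\<bar>) \<partial>M) + (\<integral>\<^sup>+x. ennreal (\<bar>f x (fst (v x)) - f x (u' x)\<bar> * \<bar>fst (w x)\<bar>) \<partial>M)"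
proof -
 note [measurable] = f_comp[OF E_measurable'(1)[OF u]] f_comp[OF E_measurable'(1)[OF v]] E_measurable'(1)[OF w] f_comp[OF assms(4)]
 note i = integrable_parts(3)[OF u w] integrable_parts(3)[OF v w]
 have "ennreal \<bar>fint u w - fint v w\<bar>
  = ennreal (norm (LINT x|M. f x (fst (u x)) * fst (w x) - f x (fst (v x)) * fst (w x)))"
  using i by simp
 also have "... <= (\<integral>\<^sup>+x. ennreal (norm (f x (fst (u x)) * fst (w x) - f x (fst (v x)) * fst (w x))) \<partial>M)"
  using i by (intro integral_norm_bound_ennreal) simp
 also have "... <= (\<integral>\<^sup>+x. ennreal (\<bar>f x (fst (u x)) - f x (u' x)\<bar> * \<bar>fst (w x)\<bar>) + ennreal (\<bar>f x (fst (v x)) - f x (u' x)\<bar> * \<bar>fst (w x)\<bar>) \<partial>M)"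
 proof (intro nn_integral_mono)
  fix x
  have "\<bar>f x (fst (u x)) * fst (w x) - f x (fst (v x)) * fst (w x)\<bar> = \<bar>f x (fst (u x)) - f x (fst (v x))\<bar> * \<bar>fst (w x)\<bar>"
   by (simp add: abs_mult[symmetric] algebra_simps)
  also have "... <= (\<bar>f x (fst (u x)) - f x (u' x)\<bar> + \<bar>f x (fst (v x)) - f x (u' x)\<bar>) * \<bar>fst (w x)\<bar>" by (intro mult_right_mono) auto
  finally show "ennreal (norm (f x (fst (u x)) * fst (w x) - f x (fst (v x)) * fst (w x))) <= ennreal (\<bar>f x (fst (u x)) - f x (u' x)\<bar> * \<bar>fst (w x)\<bar>) + ennreal (\<bar>f x (fst (v x)) - f x (u' x)\<bar> * \<bar>fst (w x)\<bar>)"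
   by (simp add: ennreal_plus[symmetric] distrib_right ennreal_leI del: ennreal_plus)
 qed
 also have "... = (\<integral>\<^sup>+x. ennreal (\<bar>f x (fst (u x)) - f x (u' x)\<bar> * \<bar>fst (w x)\<bar>) \<partial>M) + (\<integral>\<^sup>+x. ennreal (\<bar>f x (fst (v x)) - f x (u' x)\<bar> * \<bar>fst (w x)\<bar>) \<partial>M)"
  by (rule nn_integral_add) measurable
 finally show ?thesis .
qed

text \<open>The lower order term is uniformly continuous on bounded sets because the embedding is
  compact: in a counterexample sequence u n and v n have, along a subsequence, one common limit, and
  the superposition operator is continuous there.\<close>

lemma B_ucont:
 assumes e: "0 < e"
 shows "\<exists>d>0. \<forall>u\<in>E. \<forall>v\<in>E. \<forall>w\<in>E. N u <= r --> N v <= r --> N w <= 1 --> N (u - v) < d -->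
  \<bar>fint u w - fint v w\<bar> <= e"
proof (rule ccontr)
 assume contr: "\<not> ?thesis"
 have "\<exists>u v w. u \<in> E \<and> v \<in> E \<and> w \<in> E \<and> N u <= r \<and> N v <= r \<and> N w <= 1 \<and> N (u - v) < d \<and> e < \<bar>fint u w - fint v w\<bar>" if "0 < d" for d
 proof (rule ccontr)
  assume no: "\<not> ?thesis"
  have "\<forall>u\<in>E. \<forall>v\<in>E. \<forall>w\<in>E. N u <= r --> N v <= r --> N w <= 1 --> N (u - v) < d --> \<bar>fint u w - fint v w\<bar> <= e"
  proof (intro ballI impI)
   fix u v w assume "u \<in> E" "v \<in> E" "w \<in> E" "N u <= r" "N v <= r" "N w <= 1" "N (u - v) < d"
   then show "\<bar>fint u w - fint v w\<bar> <= e" using no by (meson not_le)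
  qed
  then show False using contr that by blast
 qed
 then have "\<forall>n. \<exists>u v w. u \<in> E \<and> v \<in> E \<and> w \<in> E \<and> N u <= r \<and> N v <= r \<and> N w <= 1 \<and> N (u - v) < inverse (real (Suc n)) \<and> e < \<bar>fint u w - fint v w\<bar>" by simp
 then obtain u v w where H: "\<And>n. u n \<in> E \<and> v n \<in> E \<and> w n \<in> E \<and> N (u n) <= r \<and> N (v n) <= r \<and> N (w n) <= 1 \<and> N (u n - v n) < inverse (real (Suc n)) \<and> e < \<bar>fint (u n) (w n) - fint (v n) (w n)\<bar>"
  unfolding choice_iff by blast
 have uE: "u n \<in> E" and vE: "v n \<in> E" and wE: "w n \<in> E" and uN: "N (u n) <= r" and wN: "N (w n) <= 1"
  and d: "N (u n - v n) < inverse (real (Suc n))" and gt: "e < \<bar>fint (u n) (w n) - fint (v n) (w n)\<bar>" for n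
  using H[of n] by auto
 note [measurable] = E_measurable'(1)[OF uE] E_measurable'(1)[OF vE] E_measurable'(1)[OF wE]
 have r0: "0 <= r" using cm.gauge_nonneg[OF uE[of 0]] uN[of 0] by linarith
 define K where "K = (r + 1) powr pp"
 have uK: "\<rho> (u n) <= K" for n unfolding K_def by (rule \<rho>_le[OF uE uN r0])
 obtain s u' where s: "strict_mono (s :: nat => nat)" "u' \<in> borel_measurable M" "pmod M \<alpha> u' < \<infinity>"
  "AE x in M. (\<lambda>n. fst (u (s n) x)) \<longlonglongrightarrow> u' x" "(\<lambda>n. pmod M \<alpha> (\<lambda>x. fst (u (s n) x) - u' x)) \<longlonglongrightarrow> 0"
  by (rule Rellich_limit[of K u, OF _ uE uK]) (simp add: K_def, rule that)
 note [measurable] = s(2)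
 obtain C1 where C1: "0 <= C1" "\<And>w c. w \<in> E ==> N w < c ==> c <= 1 ==> pmodA w <= ennreal (c powr lo * C1)"
  by (rule pmod_fst_small) (rule that)
 have uv: "pmod M \<alpha> (\<lambda>x. fst (u n x) - fst (v n x)) <= ennreal (inverse (real (Suc n)) powr lo * C1)" for n
  using C1(2)[OF subspace_diff[OF E_subspace uE vE] d, of n] by (simp add: inverse_le_1_iff)
 have "(\<lambda>n. inverse (real (Suc n)) powr lo * C1) \<longlonglongrightarrow> 0 powr lo * C1"
  using lo1 by (intro tendsto_intros LIMSEQ_inverse_real_of_nat) auto
 then have "(\<lambda>n. ennreal (inverse (real (Suc n)) powr lo * C1)) \<longlonglongrightarrow> 0" using tendsto_ennrealI by fastforce
 from LIMSEQ_subseq_LIMSEQ[OF this s(1)] have lim1: "(\<lambda>n. ennreal (inverse (real (Suc (s n))) powr lo * C1)) \<longlonglongrightarrow> 0" by (simp add: comp_def)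
 have vlim: "(\<lambda>n. pmod M \<alpha> (\<lambda>x. fst (v (s n) x) - u' x)) \<longlonglongrightarrow> 0"
 proof (rule tendsto_sandwich[OF _ _ tendsto_const])
  show "(\<lambda>n. ennreal (2 powr hi) * (pmod M \<alpha> (\<lambda>x. fst (u (s n) x) - u' x) + ennreal (inverse (real (Suc (s n))) powr lo * C1))) \<longlonglongrightarrow> 0"
   using ennreal_tendsto_cmult[OF _ tendsto_add[OF s(5) lim1], of "ennreal (2 powr hi)"] by simp
  show "\<forall>\<^sub>F n in sequentially. pmod M \<alpha> (\<lambda>x. fst (v (s n) x) - u' x) <= ennreal (2 powr hi) * (pmod M \<alpha> (\<lambda>x. fst (u (s n) x) - u' x) + ennreal (inverse (real (Suc (s n))) powr lo * C1))"
  proof (intro always_eventually allI)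
   fix n
   have "pmod M \<alpha> (\<lambda>x. fst (v (s n) x) - u' x) = pmod M \<alpha> (\<lambda>x. (fst (u (s n) x) - u' x) - (fst (u (s n) x) - fst (v (s n) x)))" by simp
   also have "... <= ennreal (2 powr hi) * (pmod M \<alpha> (\<lambda>x. fst (u (s n) x) - u' x) + pmod M \<alpha> (\<lambda>x. fst (u (s n) x) - fst (v (s n) x)))"
    by (rule dA.pmod_diff) measurable
   also have "... <= ennreal (2 powr hi) * (pmod M \<alpha> (\<lambda>x. fst (u (s n) x) - u' x) + ennreal (inverse (real (Suc (s n))) powr lo * C1))"
    by (intro mult_left_mono add_left_mono uv) auto
   finally show "pmod M \<alpha> (\<lambda>x. fst (v (s n) x) - u' x) <= ennreal (2 powr hi) * (pmod M \<alpha> (\<lambda>x. fst (u (s n) x) - u' x) + ennreal (inverse (real (Suc (s n))) powr lo * C1))" .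
  qed
 qed auto
 \<comment> \<open>The first extraction gives almost everywhere convergence only for the u n; a
   second one provides it for the v n.\<close>
 obtain t where t: "strict_mono (t :: nat => nat)" "AE x in M. (\<lambda>k. fst (v (s (t k)) x)) \<longlonglongrightarrow> u' x"
  by (rule dA.pmod_tendsto_AE_subseq[of "\<lambda>n x. fst (v (s n) x)" u', OF E_measurable'(1)[OF vE] s(2) vlim]) (rule that)
 have wK: "\<rho> (w n) <= (1 + 1) powr pp" for n by (rule \<rho>_le[OF wE wN]) simp
 obtain B where B: "0 <= B" "\<And>v. v \<in> E ==> \<rho> v <= (1 + 1) powr pp ==> pmodA v <= ennreal B"
  by (rule Sobolev[of "(1 + 1) powr pp"]) (simp, rule that)
 have growth': "\<bar>f x t\<bar> <= C * (1 + \<bar>t\<bar> powr (\<alpha> x - 1))" and cont': "continuous_on UNIV (f x)" if "x \<in> space M" for x t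
  using growth[of x t] f_cont[of x] that by simp_all
 have 1: "(\<lambda>n. \<integral>\<^sup>+x. ennreal (\<bar>f x (fst (u (s (t n)) x)) - f x (u' x)\<bar> * \<bar>fst (w (s (t n)) x)\<bar>) \<partial>M) \<longlonglongrightarrow> 0"
 proof (rule dA.Nemytskii_tendsto[OF f_meas cont' growth' C])
  show "(\<lambda>n. pmod M \<alpha> (\<lambda>x. fst (u (s (t n)) x) - u' x)) \<longlonglongrightarrow> 0" using LIMSEQ_subseq_LIMSEQ[OF s(5) t(1)] by (simp add: comp_def)
  show "AE x in M. (\<lambda>n. fst (u (s (t n)) x)) \<longlonglongrightarrow> u' x"
   using s(4) by eventually_elim (drule LIMSEQ_subseq_LIMSEQ[OF _ t(1)], simp add: comp_def)
  show "pmod M \<alpha> (\<lambda>x. fst (w (s (t n)) x)) <= ennreal B" for n by (rule B(2)[OF wE wK])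
 qed (use B s in \<open>simp_all\<close>)
 have 2: "(\<lambda>n. \<integral>\<^sup>+x. ennreal (\<bar>f x (fst (v (s (t n)) x)) - f x (u' x)\<bar> * \<bar>fst (w (s (t n)) x)\<bar>) \<partial>M) \<longlonglongrightarrow> 0"
 proof (rule dA.Nemytskii_tendsto[OF f_meas cont' growth' C])
  show "(\<lambda>n. pmod M \<alpha> (\<lambda>x. fst (v (s (t n)) x) - u' x)) \<longlonglongrightarrow> 0" using LIMSEQ_subseq_LIMSEQ[OF vlim t(1)] by (simp add: comp_def)
  show "AE x in M. (\<lambda>n. fst (v (s (t n)) x)) \<longlonglongrightarrow> u' x" by (rule t(2))
  show "pmod M \<alpha> (\<lambda>x. fst (w (s (t n)) x)) <= ennreal B" for n by (rule B(2)[OF wE wK])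
 qed (use B s in \<open>simp_all\<close>)
 have "\<forall>\<^sub>F n in sequentially. (\<integral>\<^sup>+x. ennreal (\<bar>f x (fst (u (s (t n)) x)) - f x (u' x)\<bar> * \<bar>fst (w (s (t n)) x)\<bar>) \<partial>M) + (\<integral>\<^sup>+x. ennreal (\<bar>f x (fst (v (s (t n)) x)) - f x (u' x)\<bar> * \<bar>fst (w (s (t n)) x)\<bar>) \<partial>M) < ennreal e"
  by (rule order_tendstoD(2)[OF tendsto_add[OF 1 2]]) (simp add: e)
 then obtain n where "(\<integral>\<^sup>+x. ennreal (\<bar>f x (fst (u (s (t n)) x)) - f x (u' x)\<bar> * \<bar>fst (w (s (t n)) x)\<bar>) \<partial>M) + (\<integral>\<^sup>+x. ennreal (\<bar>f x (fst (v (s (t n)) x)) - f x (u' x)\<bar> * \<bar>fst (w (s (t n)) x)\<bar>) \<partial>M) < ennreal e"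
  by (auto simp: eventually_sequentially)
 with abs_integral_f_diff_le[OF uE vE wE s(2), of "s (t n)" "s (t n)" "s (t n)"]
 have "ennreal \<bar>fint (u (s (t n))) (w (s (t n))) - fint (v (s (t n))) (w (s (t n)))\<bar> < ennreal e" by (rule le_less_trans)
 then show False using gt[of "s (t n)"] by (simp add: ennreal_less_iff)
qed

lemma D_ucont:
 assumes e: "0 < e"
 shows "\<exists>d>0. \<forall>u\<in>E. \<forall>v\<in>E. N u <= r --> N v <= r --> N (u - v) < d --> (\<forall>w\<in>E. N w <= 1 --> \<bar>D u w - D v w\<bar> <= e)"
proof -
 define K where "K = (\<bar>r\<bar> + 2) powr pp"
 have K: "0 <= K" by (simp add: K_def)
 obtain d1 where d1: "0 < d1" "\<And>u v w. u \<in> E ==> v \<in> E ==> w \<in> E ==> \<rho> u <= K ==> \<rho> v <= K ==> \<rho> w <= K ==> \<rho> (u - v) <= d1 ==>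
  (LINT x|M. pdiff u v w x) <= e/2"
  by (rule A_ucont[of "e/2" K]) (use e K in simp, rule K, rule that)
 obtain d2 where d2: "0 < d2" "\<forall>u\<in>E. \<forall>v\<in>E. \<forall>w\<in>E. N u <= r --> N v <= r --> N w <= 1 --> N (u - v) < d2 -->
  \<bar>fint u w - fint v w\<bar> <= e/2"
  using B_ucont[of "e/2" r] e by auto
 \<comment> \<open>Converts the threshold d1 for the modular into one for the gauge: a gauge below c
   <= 1 means a modular of at most c^lo <= d1.\<close>
 define c where "c = min 1 (d1 powr (1/lo))"
 have c: "0 < c" "c <= 1" using d1 by (auto simp: c_def)
 have "c powr lo <= (d1 powr (1/lo)) powr lo" using c lo1 by (intro powr_mono2) (auto simp: c_def)
 also have "... = d1" using d1 lo1 by (simp add: powr_powr)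
 finally have cd: "c powr lo <= d1" .
 show ?thesis
 proof (intro exI[of _ "min c d2"] conjI ballI impI)
  show "0 < min c d2" using c d2 by simp
  fix u v w assume u: "u \<in> E" "N u <= r" and v: "v \<in> E" "N v <= r" and w: "w \<in> E" "N w <= 1" and uv: "N (u - v) < min c d2"
  have bd: "\<rho> w <= K" if "w \<in> E" "N w <= \<bar>r\<bar> + 1" for w
   using cm.rho_le_powr_hi[OF that(1), of "\<bar>r\<bar> + 2"] that by (simp add: K_def)
  have "\<rho> (u - v) <= c powr lo" using uv c by (intro cm.rho_le_powr_lo subspace_diff E_subspace u v) auto
  then have 1: "(LINT x|M. pdiff u v w x) <= e/2"
   using u v w cd by (intro d1(2) bd) auto
  have 2: "\<bar>fint u w - fint v w\<bar> <= e/2"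
   using d2(2) u v w uv by auto
  note i = integrable_parts[OF u(1) w(1)] integrable_parts[OF v(1) w(1)]
  have "D u w - D v w = (LINT x|M. (pvec (p1 x) (snd (u x)) - pvec (p1 x) (snd (v x))) \<bullet> snd (w x) + (pvec (p2 x) (snd (u x)) - pvec (p2 x) (snd (v x))) \<bullet> snd (w x))
   - (fint u w - fint v w)"
   unfolding D_parts[OF u(1) w(1)] D_parts[OF v(1) w(1)] inner_diff_left using i by simp
  moreover have "\<bar>LINT x|M. (pvec (p1 x) (snd (u x)) - pvec (p1 x) (snd (v x))) \<bullet> snd (w x) + (pvec (p2 x) (snd (u x)) - pvec (p2 x) (snd (v x))) \<bullet> snd (w x)\<bar>
   <= (LINT x|M. pdiff u v w x)"
   using i by (intro integral_abs_bound_integral) (auto simp: inner_diff_left)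
  ultimately show "\<bar>D u w - D v w\<bar> <= e" using 1 2 by linarith
 qed
qed

lemma J_deriv: assumes u: "u \<in> E" and v: "v \<in> E"
 shows "((\<lambda>s. J (u + s *\<^sub>R v)) has_real_derivative D (u + s0 *\<^sub>R v) v) (at s0)"
proof -
 have i: "u + s *\<^sub>R v \<in> E" for s using E_subspace u v by (simp add: subspace_add subspace_scale)
 define S where "S = \<bar>s0\<bar> + 1"
 have "((\<lambda>s. LINT x|M. Ld x (u x + s *\<^sub>R v x)) has_real_derivative (LINT x|M. dL x (u x + s0 *\<^sub>R v x) (v x))) (at s0)"
 proof (rule DERIV_integral[where G = "\<lambda>x. 2 * C * (2 powr hi * (\<Phi> x (u x) + S powr hi * \<Phi> x (v x)) + \<Phi> x (v x))"])
  show "integrable M (\<lambda>x. Ld x (u x + s *\<^sub>R v x))" for s using integrable_Ld[OF i[of s]] by (simp add: scaleR_fun_apply)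
  show "(\<lambda>x. dL x (u x + s0 *\<^sub>R v x) (v x)) \<in> borel_measurable M"
   using borel_measurable_integrable[OF integrable_dL[OF i[of s0] v]] by (simp add: scaleR_fun_apply)
  show "integrable M (\<lambda>x. 2 * C * (2 powr hi * (\<Phi> x (u x) + S powr hi * \<Phi> x (v x)) + \<Phi> x (v x)))"
   using integrable_\<Phi>[OF u] integrable_\<Phi>[OF v] by simp
  fix x s assume "x \<in> space M"
  then have x: "x \<in> \<Omega>" by simp
  show "((\<lambda>s. Ld x (u x + s *\<^sub>R v x)) has_real_derivative dL x (u x + s *\<^sub>R v x) (v x)) (at s)" by (rule dL_deriv[OF x])
  assume s: "\<bar>s - s0\<bar> <= 1"
  have "\<bar>dL x (u x + s *\<^sub>R v x) (v x)\<bar> <= 2 * C * (\<Phi> x (u x + s *\<^sub>R v x) + \<Phi> x (v x))" by (rule dL_bound[OF x])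
  also have "... <= 2 * C * (2 powr hi * (\<Phi> x (u x) + S powr hi * \<Phi> x (v x)) + \<Phi> x (v x))"
   using C s by (intro mult_left_mono add_right_mono \<Phi>_add_scale[OF x]) (auto simp: S_def)
  finally show "\<bar>dL x (u x + s *\<^sub>R v x) (v x)\<bar> <= 2 * C * (2 powr hi * (\<Phi> x (u x) + S powr hi * \<Phi> x (v x)) + \<Phi> x (v x))" .
 qed
 then show ?thesis by (simp add: J_def D_def scaleR_fun_apply)
qed

lemma D_bounded: "\<exists>B. \<forall>u\<in>E. N u <= r --> (\<forall>w\<in>E. N w <= 1 --> \<bar>D u w\<bar> <= B)"
proof -
 obtain B where B: "0 <= B" "\<And>w. w \<in> E ==> N w <= max r 1 ==> (LINT x|M. \<Phi> x (w x)) <= B"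
  by (rule \<Phi>_integral_bound[of "max r 1"]) (rule that)
 have "\<bar>D u w\<bar> <= 2 * C * (B + B)" if u: "u \<in> E" "N u <= r" and w: "w \<in> E" "N w <= 1" for u w
 proof -
  have i: "integrable M (\<lambda>x. 2 * C * (\<Phi> x (u x) + \<Phi> x (w x)))" using integrable_\<Phi>[OF u(1)] integrable_\<Phi>[OF w(1)] by simp
  have "\<bar>D u w\<bar> <= (LINT x|M. 2 * C * (\<Phi> x (u x) + \<Phi> x (w x)))"
   unfolding D_def by (intro integral_abs_bound_integral integrable_dL u w i) (simp add: dL_bound)
  also have "... = 2 * C * ((LINT x|M. \<Phi> x (u x)) + (LINT x|M. \<Phi> x (w x)))" using integrable_\<Phi>[OF u(1)] integrable_\<Phi>[OF w(1)] by simp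
  also have "... <= 2 * C * (B + B)" using C B(2)[OF u(1)] B(2)[OF w(1)] u w by (intro mult_left_mono add_mono) auto
  finally show ?thesis .
 qed
 then show ?thesis by blast
qed

sublocale sf: seminormed_functional E N J D
proof
 show "subspace E" by (rule E_subspace)
 show "N (v + w) <= N v + N w" if "v \<in> E" "w \<in> E" for v w by (rule cm.gauge_triangle[OF that])
 show "N (c *\<^sub>R v) = \<bar>c\<bar> * N v" if "v \<in> E" for c v by (rule cm.gauge_scale[OF that])
 show "D u (v + w) = D u v + D u w" if "u \<in> E" "v \<in> E" "w \<in> E" for u v w
 proof -
  have "dL x U (V + W) = dL x U V + dL x U W" for x U V W by (simp add: dL_def inner_add_right algebra_simps)
  then show ?thesis unfolding D_def using integrable_dL that by simp
 qed
 show "D u (c *\<^sub>R v) = c * D u v" if "u \<in> E" "v \<in> E" for u c v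
 proof -
  have "dL x U (c *\<^sub>R V) = c * dL x U V" for x U V by (simp add: dL_def algebra_simps)
  then show ?thesis unfolding D_def by (simp add: scaleR_fun_apply)
 qed
 show "((\<lambda>s. J (u + s *\<^sub>R v)) has_real_derivative D (u + s *\<^sub>R v) v) (at s)" if "u \<in> E" "v \<in> E" for u v s
  by (rule J_deriv[OF that])
 show "\<exists>d>0. \<forall>u\<in>E. \<forall>v\<in>E. N u <= r --> N v <= r --> N (u - v) < d --> (\<forall>w\<in>E. N w <= 1 --> \<bar>D u w - D v w\<bar> <= e)" if "0 < e" for e r
  by (rule D_ucont[OF that])
 show "\<exists>B. \<forall>u\<in>E. N u <= r --> (\<forall>w\<in>E. N w <= 1 --> \<bar>D u w\<bar> <= B)" for r by (rule D_bounded)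
qed

end

subsection \<open>Palais--Smale condition and mountain pass geometry\<close>

text \<open>\<open>G\<close> is the set of full measure on which the original nonlinearity is
  continuous in t. Elsewhere f will be replaced by 0, so the strict positivity of the primitive can
  be asked only on \<open>G\<close>. The condition at the origin includes t = 0.\<close>

locale superlinear = energy \<Omega> p1 p2 \<alpha> P A lo hi R \<eta>0 \<omega> \<kappa> a0 pp f C
 for \<Omega> :: "'a::euclidean_space set" and p1 p2 \<alpha> P A lo hi R \<eta>0 \<omega> \<kappa> a0 pp f C +
 fixes G :: "'a set" and T \<theta> :: real
 assumes G: "AE x in lebesgue_on \<Omega>. x \<in> G" and T: "0 < T" and \<theta>: "pp < \<theta>"
  and AR: "\<And>x t. x \<in> \<Omega> ==> x \<in> G ==> T <= \<bar>t\<bar> ==> 0 < \<theta> * primitive f x t \<and> \<theta> * primitive f x t <= t * f x t"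
  and f_origin: "\<And>\<epsilon>. 0 < \<epsilon> ==> \<exists>\<delta>>0. \<forall>x\<in>\<Omega>. \<forall>t. \<bar>t\<bar> < \<delta> --> \<bar>f x t\<bar> <= \<epsilon> * \<bar>t\<bar> powr (pp - 1)"
  and \<Omega>_nonempty: "\<Omega> \<noteq> {}"
begin

lemma f_mult_self: assumes x: "x \<in> \<Omega>" shows "\<bar>t * f x t\<bar> <= C * (\<bar>t\<bar> + \<bar>t\<bar> powr \<alpha> x)"
proof -
 have "\<bar>t * f x t\<bar> <= \<bar>t\<bar> * (C * (1 + \<bar>t\<bar> powr (\<alpha> x - 1)))"
  unfolding abs_mult by (intro mult_left_mono growth[OF x]) auto
 also have "... = C * (\<bar>t\<bar> + \<bar>t\<bar> powr (\<alpha> x - 1) * \<bar>t\<bar>)" by (simp add: algebra_simps)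
 also have "\<bar>t\<bar> powr (\<alpha> x - 1) * \<bar>t\<bar> = \<bar>t\<bar> powr \<alpha> x"
  by (cases "t = 0") (use powr_add[of "\<bar>t\<bar>" "\<alpha> x - 1" 1] in auto)
 finally show ?thesis .
qed

text \<open>Twice a bound, from the growth condition, for F and t f on |t| <= max 1 T; it measures
  by how much the superlinearity inequality may fail for small t.\<close>

definition defect :: real where "defect = 4 * C * max 1 T powr hi"

lemma defect_nonneg: "0 <= defect" using C by (simp add: defect_def)

lemma small_growth: assumes x: "x \<in> \<Omega>" and t: "\<bar>t\<bar> <= max 1 T" shows "C * (\<bar>t\<bar> + \<bar>t\<bar> powr \<alpha> x) <= defect / 2"
proof -
 let ?S = "max 1 T"
 have "\<bar>t\<bar> powr \<alpha> x <= ?S powr \<alpha> x" using t ranges[OF x] by (intro powr_mono2) auto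
 also have "... <= ?S powr hi" using ranges[OF x] by (intro powr_mono) auto
 finally have 1: "\<bar>t\<bar> powr \<alpha> x <= ?S powr hi" .
 have "?S powr 1 <= ?S powr hi" using hi1 by (intro powr_mono) auto
 with order_trans[OF t, of "?S powr hi"] have "\<bar>t\<bar> <= ?S powr hi" by simp
 then have "C * (\<bar>t\<bar> + \<bar>t\<bar> powr \<alpha> x) <= C * (?S powr hi + ?S powr hi)" using 1 C by (intro mult_left_mono) auto
 then show ?thesis by (simp add: defect_def)
qed

lemma \<theta>1: "1 < \<theta>" using pp1 \<theta> by linarith

lemma AR_defect: assumes x: "x \<in> \<Omega>" "x \<in> G" shows "F x t - t * f x t / \<theta> <= defect"
proof (cases "T <= \<bar>t\<bar>")
 case True
 then have "F x t <= t * f x t / \<theta>" using AR[OF x True] \<theta>1 by (simp add: F_def field_simps)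
 then show ?thesis using defect_nonneg by linarith
next
 case False
 then have b: "C * (\<bar>t\<bar> + \<bar>t\<bar> powr \<alpha> x) <= defect / 2" by (intro small_growth x) auto
 have "\<bar>t * f x t / \<theta>\<bar> <= \<bar>t * f x t\<bar>" using \<theta>1 by (simp add: abs_divide divide_le_eq mult_le_cancel_left1)
 also have "... <= defect / 2" by (rule order_trans[OF f_mult_self[OF x(1)] b])
 finally have "\<bar>t * f x t / \<theta>\<bar> <= defect / 2" .
 moreover have "\<bar>F x t\<bar> <= defect / 2" by (rule order_trans[OF F_bound[OF x(1)] b])
 ultimately show ?thesis unfolding abs_le_iff by linarith
qed

text \<open>Subtracting D w w / \<theta> leaves each gradient term with a coefficient of at least
  1/pp - 1/\<theta>, while the terms in f combine to F - t f/\<theta>, bounded above by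
  \<open>defect\<close> almost everywhere.\<close>

lemma J_AR: assumes w: "w \<in> E" shows "(1/pp - 1/\<theta>) * \<rho> w - defect * measure M \<Omega> <= J w - D w w / \<theta>"
proof -
 let ?n = "\<lambda>x. norm (snd (w x)) powr p1 x + norm (snd (w x)) powr p2 x"
 have i: "integrable M ?n" using integrable_snd_powr[OF w] by simp
 have "(1/pp - 1/\<theta>) * \<rho> w - defect * measure M \<Omega> = (LINT x|M. (1/pp - 1/\<theta>) * ?n x - defect)"
  unfolding \<rho>_def using i by simp
 also have "... <= (LINT x|M. Ld x (w x) - dL x (w x) (w x) / \<theta>)"
 proof (rule integral_mono_AE)
  show "integrable M (\<lambda>x. (1/pp - 1/\<theta>) * ?n x - defect)" using i by simp
  show "integrable M (\<lambda>x. Ld x (w x) - dL x (w x) (w x) / \<theta>)" using integrable_Ld[OF w] integrable_dL[OF w w] by simp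
  show "AE x in M. (1/pp - 1/\<theta>) * ?n x - defect <= Ld x (w x) - dL x (w x) (w x) / \<theta>"
   using G AE_space
  proof eventually_elim
   case (elim x)
   then have x: "x \<in> \<Omega>" "x \<in> G" by auto
   have q: "norm (snd (w x)) powr p / pp <= norm (snd (w x)) powr p / p" if "1 < p" "p <= pp" for p
    using that by (intro divide_left_mono) auto
   show ?case using AR_defect[OF x, of "fst (w x)"] q[of "p1 x"] q[of "p2 x"] ranges[OF x(1)] pp(1,2)[OF x(1)]
    unfolding Ld_def dL_def pvec_self by (simp add: add_divide_distrib diff_divide_distrib algebra_simps)
  qed
 qed
 also have "... = J w - D w w / \<theta>" unfolding J_def D_def using integrable_Ld[OF w] integrable_dL[OF w w] by simp
 finally show ?thesis .
qed

text \<open>With N w = 2c the preceding estimate gives c1 \<rho> <= K' + 2c, whereas \<rho> >= c^lo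
  for c >= 1. Since lo > 1 this bounds c^(lo-1) by (K' + 2)/c1, and \<open>B\<close> is the
  corresponding root.\<close>

lemma ps_bounded:
 obtains B where "0 <= B" "\<And>w. w \<in> E ==> J w <= K ==> \<forall>v\<in>E. N v <= 1 --> \<bar>D w v\<bar> <= 1 ==> N w <= B"
proof -
 define c1 where "c1 = 1/pp - 1/\<theta>"
 have c1: "0 < c1" using \<theta> pp1 by (simp add: c1_def frac_less2)
 define K' where "K' = \<bar>K\<bar> + defect * measure M \<Omega>"
 have K': "0 <= K'" using defect_nonneg by (simp add: K'_def)
 define B where "B = ((K' + 2) / c1) powr (1/(lo-1))"
 show thesis
 proof (rule that[of "2 + 2 * B"])
  show "0 <= 2 + 2 * B" by (simp add: B_def)
  fix w assume w: "w \<in> E" "J w <= K" and D: "\<forall>v\<in>E. N v <= 1 --> \<bar>D w v\<bar> <= 1"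
  show "N w <= 2 + 2 * B"
  proof (cases "N w <= 2")
   case False
   define c where "c = N w / 2"
   have c: "1 <= c" "c < N w" using False by (auto simp: c_def)
   have "\<bar>D w w\<bar> <= 1 * N w" by (rule sf.D_le_N[OF w(1) w(1) D])
   then have "\<bar>D w w / \<theta>\<bar> <= N w" using \<theta>1 by (simp add: abs_divide divide_le_eq) (smt (verit) cm.gauge_nonneg mult_le_cancel_left1 w(1))
   then have 1: "c1 * \<rho> w <= K' + 2 * c" using J_AR[OF w(1)] w(2) unfolding c1_def K'_def c_def by linarith
   have "c powr (lo-1) * c = c powr lo" using c powr_add[of c "lo-1" 1] by simp
   also have "... <= \<rho> w" by (rule cm.rho_ge_powr_lo[OF w(1) c])
   also have "... <= (K' + 2 * c) / c1" using 1 c1 by (simp add: field_simps)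
   also have "... <= (K' * c + 2 * c) / c1" using c1 c K' by (intro divide_right_mono add_right_mono) (auto simp: mult_le_cancel_left1)
   also have "... = (K' + 2) / c1 * c" by (simp add: algebra_simps add_divide_distrib)
   finally have "c powr (lo-1) <= (K' + 2) / c1" by (rule mult_right_le_imp_le) (use c in simp)
   then have "(c powr (lo-1)) powr (1/(lo-1)) <= B" unfolding B_def using lo1 by (intro powr_mono2) auto
   then have "c <= B" using lo1 c by (simp add: powr_powr)
   then show ?thesis by (simp add: c_def)
  qed (simp add: B_def add_increasing2)
 qed
qed

lemma integral_fst_le:
 assumes w: "w \<in> E" and le: "pmodA w <= ennreal d" and d: "0 <= d"
 shows "(LINT x|M. \<bar>fst (w x)\<bar> powr \<alpha> x) <= d"
 using le d dA.pmod_eq_integral[of "\<lambda>x. fst (w x)"] integrable_fst_powr[OF w] by (simp add: ennreal_le_iff)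

text \<open>Writing |s| = \<eta> z puts the small factor on the part in t; the price is a power of
  1/\<eta> in front of |s|^\<alpha>, uniform because \<alpha> <= hi.\<close>

lemma f_Young:
 assumes x: "x \<in> \<Omega>" and \<eta>: "0 < \<eta>" "\<eta> <= 1"
 shows "\<bar>f x t * s\<bar> <= C * (\<eta> * (1 + \<bar>t\<bar> powr \<alpha> x) + 2 * (1/\<eta>) powr hi * \<bar>s\<bar> powr \<alpha> x)"
proof -
 define z where "z = \<bar>s\<bar> / \<eta>"
 have z: "0 <= z" "\<bar>s\<bar> = \<eta> * z" using \<eta> by (auto simp: z_def)
 have "\<eta> * z powr \<alpha> x <= 1 * (\<bar>s\<bar> powr \<alpha> x * (1/\<eta>) powr \<alpha> x)"
  using \<eta> by (intro mult_mono) (auto simp: z_def powr_divide)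
 also have "... <= 1 * (\<bar>s\<bar> powr \<alpha> x * (1/\<eta>) powr hi)"
  using \<eta> ranges[OF x] by (intro mult_left_mono powr_mono) auto
 finally have zz: "\<eta> * z powr \<alpha> x <= (1/\<eta>) powr hi * \<bar>s\<bar> powr \<alpha> x" by (simp add: mult.commute)
 have "\<bar>f x t * s\<bar> <= C * (1 + \<bar>t\<bar> powr (\<alpha> x - 1)) * (\<eta> * z)"
  unfolding abs_mult z(2)[symmetric] by (intro mult_right_mono growth[OF x]) auto
 also have "... = C * (\<eta> * (z + \<bar>t\<bar> powr (\<alpha> x - 1) * z))" by (simp add: algebra_simps)
 also have "... <= C * (\<eta> * ((1 + z powr \<alpha> x) + (\<bar>t\<bar> powr \<alpha> x + z powr \<alpha> x)))"
  using C \<eta> z ranges(3)[OF x] by (intro mult_left_mono add_mono le_one_powr powr_mult_le_add) auto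
 also have "... = C * (\<eta> * (1 + \<bar>t\<bar> powr \<alpha> x) + 2 * (\<eta> * z powr \<alpha> x))" by (simp add: algebra_simps)
 also have "... <= C * (\<eta> * (1 + \<bar>t\<bar> powr \<alpha> x) + 2 * ((1/\<eta>) powr hi * \<bar>s\<bar> powr \<alpha> x))"
  using C zz by (intro mult_left_mono add_left_mono) auto
 finally show ?thesis by (simp only: mult.assoc)
qed

text \<open>In \<open>f_Young\<close>, first \<eta> is chosen against the bound for u, then d
  against the constant this produces. Smallness of the function part of w in the \<alpha>-modular is
  enough, which is exactly what the compact embedding delivers.\<close>

lemma f_small:
 assumes e: "0 < e" and K: "0 <= K"
 obtains d where "0 < d" "\<And>u w. u \<in> E ==> w \<in> E ==> \<rho> u <= K ==> pmodA w <= ennreal d ==>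
  \<bar>fint u w\<bar> <= e"
proof -
 obtain B where B: "0 <= B" "\<And>w. w \<in> E ==> \<rho> w <= K ==> pmodA w <= ennreal B"
  by (rule Sobolev[OF K]) (rule that)
 define V where "V = measure M \<Omega> + B + 1"
 have V: "0 < V" using B by (simp add: V_def add_nonneg_pos)
 define \<eta> where "\<eta> = min 1 (e / (2 * C * V))"
 have \<eta>: "0 < \<eta>" "\<eta> <= 1" using e C V by (auto simp: \<eta>_def)
 have "C * (\<eta> * V) <= C * (e / (2 * C * V) * V)" using C V e by (intro mult_left_mono mult_mono) (auto simp: \<eta>_def)
 also have "... = e/2" using C V by simp
 finally have 1: "C * (\<eta> * V) <= e/2" .
 define H where "H = (1/\<eta>) powr hi"
 have H: "0 < H" using \<eta> by (simp add: H_def)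
 define d where "d = e / (4 * C * H)"
 have d: "0 < d" "C * (2 * H * d) = e/2" using e C H by (auto simp: d_def field_simps)
 show thesis
 proof (rule that[OF d(1)])
  fix u w assume u: "u \<in> E" "\<rho> u <= K" and w: "w \<in> E" "pmodA w <= ennreal d"
  note i = integrable_fst_powr[OF u(1)] integrable_fst_powr[OF w(1)]
  have "\<bar>fint u w\<bar> <= (LINT x|M. C * (\<eta> * (1 + \<bar>fst (u x)\<bar> powr \<alpha> x) + 2 * H * \<bar>fst (w x)\<bar> powr \<alpha> x))"
   unfolding H_def using i by (intro integral_abs_bound_integral integrable_parts u w) (auto intro!: f_Young \<eta>)
  also have "... = C * (\<eta> * (measure M \<Omega> + (LINT x|M. \<bar>fst (u x)\<bar> powr \<alpha> x)) + 2 * H * (LINT x|M. \<bar>fst (w x)\<bar> powr \<alpha> x))"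
   using i by simp
  also have "... <= C * (\<eta> * V + 2 * H * d)"
  proof -
   have "measure M \<Omega> + (LINT x|M. \<bar>fst (u x)\<bar> powr \<alpha> x) <= V" using integral_fst_le[OF u(1) B(2)[OF u] B(1)] by (simp add: V_def)
   moreover have "(LINT x|M. \<bar>fst (w x)\<bar> powr \<alpha> x) <= d" using integral_fst_le[OF w] d by simp
   ultimately show ?thesis using C \<eta> H by (intro mult_left_mono[of _ _ C] add_mono mult_left_mono) auto
  qed
  also have "... <= e" using 1 d(2) by (simp add: distrib_left)
  finally show "\<bar>fint u w\<bar> <= e" .
 qed
qed

text \<open>The monotone gradient pairing equals the difference of the derivatives tested with u - v
  plus the difference of the lower order terms. These four quantities are each at most c, so the
  pairing is at most 4c, and uniform monotonicity converts this into a bound for \<rho>(u -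
  v).\<close>

lemma strong_monotone:
 assumes e: "0 < e" and K: "0 <= K"
 obtains d where "0 < d" "\<And>u v. u \<in> E ==> v \<in> E ==> \<rho> u <= K ==> \<rho> v <= K ==> \<bar>D u (u - v)\<bar> <= d ==> \<bar>D v (u - v)\<bar> <= d ==>
  pmodA (u - v) <= ennreal d ==> \<rho> (u - v) <= e"
proof -
 define \<epsilon> where "\<epsilon> = e / (4 * (K + 1))"
 have \<epsilon>: "0 < \<epsilon>" using e K by (simp add: \<epsilon>_def)
 have "\<epsilon> * (2 * K) <= \<epsilon> * (2 * (K + 1))" using \<epsilon> by (intro mult_left_mono) auto
 also have "... = e/2" using K by (simp add: \<epsilon>_def field_simps)
 finally have \<epsilon>K: "\<epsilon> * (2 * K) <= e/2" .
 obtain C1 where C1: "0 <= C1" "\<And>p (a::'a) b. p \<in> {lo..hi} ==>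
  norm (a - b) powr p <= \<epsilon> * (norm a powr p + norm b powr p) + C1 * ((pvec p a - pvec p b) \<bullet> (a - b))"
  by (rule pvec_uniformly_monotone[OF lo1 \<epsilon>, of hi]) (rule that)
 define c where "c = e / (8 * (C1 + 1))"
 have c: "0 < c" using e C1 by (simp add: c_def)
 have "C1 * (4 * c) <= (C1 + 1) * (4 * c)" using c by (intro mult_right_mono) auto
 also have "... = e/2" using C1(1) by (simp add: c_def field_simps)
 finally have C1c: "C1 * (4 * c) <= e/2" .
 obtain d where d: "0 < d" "\<And>u w. u \<in> E ==> w \<in> E ==> \<rho> u <= K ==> pmodA w <= ennreal d ==>
  \<bar>fint u w\<bar> <= c"
  by (rule f_small[OF c K]) (rule that)
 show thesis
 proof (rule that[of "min c d"])
  show "0 < min c d" using c d by simp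
  fix u v assume u: "u \<in> E" "\<rho> u <= K" and v: "v \<in> E" "\<rho> v <= K" and D: "\<bar>D u (u - v)\<bar> <= min c d" "\<bar>D v (u - v)\<bar> <= min c d"
   and small: "pmodA (u - v) <= ennreal (min c d)"
  define z where "z = u - v"
  have z: "z \<in> E" unfolding z_def using E_subspace u v by (intro subspace_diff) auto
  have "pmodA z <= ennreal d" unfolding z_def by (rule order_trans[OF small]) (simp add: ennreal_leI)
  then have f: "\<bar>fint u z\<bar> <= c" "\<bar>fint v z\<bar> <= c"
   using d(2) u v z by auto
  note i = integrable_parts[OF u(1) z] integrable_parts[OF v(1) z]
  define A where "A x = (pvec (p1 x) (snd (u x)) - pvec (p1 x) (snd (v x))) \<bullet> snd (z x) + (pvec (p2 x) (snd (u x)) - pvec (p2 x) (snd (v x))) \<bullet> snd (z x)" for x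
  have iA: "integrable M A" unfolding A_def inner_diff_left using i by simp
  have "(LINT x|M. A x) = D u z - D v z + fint u z - fint v z"
   unfolding D_parts[OF u(1) z] D_parts[OF v(1) z] A_def inner_diff_left using i by simp
  then have A4: "(LINT x|M. A x) <= 4 * c" using f D unfolding z_def by linarith
  let ?n = "\<lambda>w x. norm (snd (w x)) powr p1 x + norm (snd (w x)) powr p2 x"
  have j: "integrable M (?n w)" if "w \<in> E" for w using integrable_snd_powr[OF that] by simp
  have "\<rho> z <= (LINT x|M. \<epsilon> * (?n u x + ?n v x) + C1 * A x)"
   unfolding \<rho>_def
  proof (rule integral_mono[OF j[OF z]])
   show "integrable M (\<lambda>x. \<epsilon> * (?n u x + ?n v x) + C1 * A x)" using j[OF u(1)] j[OF v(1)] iA by simp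
   fix x assume "x \<in> space M"
   then have x: "x \<in> \<Omega>" by simp
   show "?n z x <= \<epsilon> * (?n u x + ?n v x) + C1 * A x"
    using C1(2)[of "p1 x" "snd (u x)" "snd (v x)"] C1(2)[of "p2 x" "snd (u x)" "snd (v x)"] ranges[OF x]
    by (simp add: A_def z_def distrib_left)
  qed
  also have "... = \<epsilon> * (\<rho> u + \<rho> v) + C1 * (LINT x|M. A x)" unfolding \<rho>_def using j[OF u(1)] j[OF v(1)] iA by simp
  also have "... <= \<epsilon> * (2 * K) + C1 * (4 * c)" using u v \<epsilon> C1 A4 by (intro add_mono mult_left_mono) auto
  also have "... <= e" using \<epsilon>K C1c by simp
  finally show "\<rho> (u - v) <= e" by (simp add: z_def)
 qed
qed

end

context superlinear begin

section \<open>Completeness and the Palais--Smale condition\<close>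

lemma pmod_le_scaled_\<alpha>:
 fixes s :: "'a => real"
 assumes q: "\<And>x. x \<in> \<Omega> ==> 1 <= q x \<and> q x <= \<alpha> x" and \<eta>: "0 < \<eta>" "\<eta> <= 1" and [measurable]: "s \<in> borel_measurable M"
 shows "pmod M q s <= ennreal (\<eta> * measure M \<Omega>) + ennreal ((1/\<eta>) powr hi) * pmod M \<alpha> s"
proof -
 note [measurable] = dA.p_measurable
 have "pmod M q s <= (\<integral>\<^sup>+x. ennreal \<eta> + ennreal ((1/\<eta>) powr hi) * ennreal (norm (s x) powr \<alpha> x) \<partial>M)"
  unfolding pmod_def
 proof (intro nn_integral_mono)
  fix x assume "x \<in> space M"
  then have x: "x \<in> \<Omega>" by simp
  have "\<bar>s x\<bar> powr q x <= \<eta> + (1/\<eta>) powr hi * \<bar>s x\<bar> powr \<alpha> x"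
  \<comment> \<open>Below \<eta> <= 1 a power of exponent q >= 1 is at most \<eta>. Above, division
    by \<eta> brings the base to at least 1, where raising the exponent from q to \<alpha> only
    increases the power.\<close>
  proof (cases "\<bar>s x\<bar> <= \<eta>")
   case True
   then have "\<bar>s x\<bar> powr q x <= \<eta> powr q x" using q[OF x] by (intro powr_mono2) auto
   also have "... <= \<eta> powr 1" using q[OF x] \<eta> by (intro powr_mono') auto
   finally show ?thesis using \<eta> by (simp add: add_increasing2)
  next
   case False
   define z where "z = \<bar>s x\<bar> / \<eta>"
   have z: "1 <= z" "\<bar>s x\<bar> = \<eta> * z" using False \<eta> by (auto simp: z_def)
   have "\<bar>s x\<bar> powr q x = \<eta> powr q x * z powr q x" using z \<eta> by (simp add: powr_mult)
   also have "... <= 1 * z powr \<alpha> x" using q[OF x] \<eta> z by (intro mult_mono powr_mono powr_le1) auto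
   also have "... = (1/\<eta>) powr \<alpha> x * \<bar>s x\<bar> powr \<alpha> x" using \<eta> by (simp add: z_def powr_divide)
   also have "... <= (1/\<eta>) powr hi * \<bar>s x\<bar> powr \<alpha> x" using \<eta> ranges[OF x] by (intro mult_right_mono powr_mono) auto
   finally show ?thesis using \<eta> by linarith
  qed
  then show "ennreal (norm (s x) powr q x) <= ennreal \<eta> + ennreal ((1/\<eta>) powr hi) * ennreal (norm (s x) powr \<alpha> x)"
   using \<eta> by (simp add: ennreal_mult[symmetric] ennreal_plus[symmetric] ennreal_leI del: ennreal_plus)
 qed
 also have "... = ennreal \<eta> * emeasure M (space M) + ennreal ((1/\<eta>) powr hi) * pmod M \<alpha> s"
  unfolding pmod_def by (simp add: nn_integral_add nn_integral_cmult)
 also have "ennreal \<eta> * emeasure M (space M) = ennreal (\<eta> * measure M \<Omega>)"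
  using \<eta> d1.emeasure_eq_measure[of "space M"] by (simp add: ennreal_mult)
 finally show ?thesis .
qed

text \<open>Membership in the closure is measured by the q-modular of the whole pair. Its gradient
  part is controlled by \<rho>, its function part by the \<alpha>-modular up to a constant of size
  \<eta>; each of the three errors takes e/3.\<close>

lemma pmod_small:
 assumes q: "var_dom \<Omega> q lo hi" and q\<alpha>: "\<And>x. x \<in> \<Omega> ==> q x <= \<alpha> x" and e: "0 < e"
  and q\<rho>: "\<And>z. z \<in> E ==> pmod M q (\<lambda>x. snd (z x)) <= ennreal (\<rho> z)"
 obtains d where "0 < d" "\<And>z. z \<in> E ==> \<rho> z <= d ==> pmodA z <= ennreal d ==> pmod M q z <= ennreal e"
proof -
 interpret q: var_dom \<Omega> q lo hi by (rule q)
 define H where "H = (2::real) powr hi"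
 have H: "0 < H" by (simp add: H_def)
 define W where "W = measure M \<Omega> + 1"
 have W: "0 < W" "measure M \<Omega> <= W" by (simp_all add: W_def add_nonneg_pos)
 define \<eta> where "\<eta> = min 1 (e / (3 * H * W))"
 have \<eta>: "0 < \<eta>" "\<eta> <= 1" using e H W by (auto simp: \<eta>_def)
 have "H * (\<eta> * measure M \<Omega>) <= H * (e / (3 * H * W) * W)"
  using H e W by (intro mult_left_mono mult_mono) (auto simp: \<eta>_def)
 also have "... = e / 3" using H W by simp
 finally have 1: "H * (\<eta> * measure M \<Omega>) <= e / 3" .
 define L where "L = (1/\<eta>) powr hi"
 have L: "0 < L" using \<eta> by (simp add: L_def)
 define d where "d = min (e / (3 * H)) (e / (3 * H * L))"
 have d: "0 < d" "H * d <= e / 3" "H * (L * d) <= e / 3"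
 proof -
  show "0 < d" using e H L by (simp add: d_def)
  have "H * d <= H * (e / (3 * H))" using H by (intro mult_left_mono) (auto simp: d_def)
  then show "H * d <= e / 3" using H by simp
  have "H * (L * d) <= H * (L * (e / (3 * H * L)))" using H L by (intro mult_left_mono) (auto simp: d_def)
  then show "H * (L * d) <= e / 3" using H L by simp
 qed
 show thesis
 proof (rule that[OF d(1)])
  fix z assume z: "z \<in> E" "\<rho> z <= d" "pmodA z <= ennreal d"
  note [measurable] = E_measurable'[OF z(1)]
  have qx: "1 <= q x \<and> q x <= \<alpha> x" if "x \<in> \<Omega>" for x using q.p_bounds[OF that] lo1 q\<alpha>[OF that] by auto
  have "pmod M q z = pmod M q (\<lambda>x. (fst (z x), 0) + (0, snd (z x)))" by simp
  also have "... <= ennreal H * (pmod M q (\<lambda>x. (fst (z x), 0::'a)) + pmod M q (\<lambda>x. (0::real, snd (z x))))"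
   unfolding H_def by (rule q.pmod_add) measurable
  also have "pmod M q (\<lambda>x. (fst (z x), 0::'a)) = pmod M q (\<lambda>x. fst (z x))" by (simp add: pmod_def norm_Pair)
  also have "pmod M q (\<lambda>x. (0::real, snd (z x))) = pmod M q (\<lambda>x. snd (z x))" by (simp add: pmod_def norm_Pair)
  also have "ennreal H * (pmod M q (\<lambda>x. fst (z x)) + pmod M q (\<lambda>x. snd (z x))) <= ennreal H * ((ennreal (\<eta> * measure M \<Omega>) + ennreal L * ennreal d) + ennreal d)"
  proof (intro mult_left_mono add_mono)
   have "pmod M q (\<lambda>x. fst (z x)) <= ennreal (\<eta> * measure M \<Omega>) + ennreal L * pmodA z"
    unfolding L_def by (rule pmod_le_scaled_\<alpha>[OF qx \<eta>]) measurable
   also have "... <= ennreal (\<eta> * measure M \<Omega>) + ennreal L * ennreal d" by (intro add_left_mono mult_left_mono z(3)) simp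
   finally show "pmod M q (\<lambda>x. fst (z x)) <= ennreal (\<eta> * measure M \<Omega>) + ennreal L * ennreal d" .
   show "pmod M q (\<lambda>x. snd (z x)) <= ennreal d" by (rule order_trans[OF q\<rho>[OF z(1)] ennreal_leI[OF z(2)]])
  qed simp
  also have "... = ennreal (H * (\<eta> * measure M \<Omega>) + H * (L * d) + H * d)"
   using \<eta> L d H by (simp add: ennreal_mult[symmetric] ennreal_plus[symmetric] distrib_left del: ennreal_plus)
  also have "... <= ennreal e" using 1 d by (intro ennreal_leI) linarith
  finally show "pmod M q z <= ennreal e" .
 qed
qed

lemma pmod_snd_le_\<rho>:
 assumes "z \<in> E" shows "pmod M p1 (\<lambda>x. snd (z x)) <= ennreal (\<rho> z)" "pmod M p2 (\<lambda>x. snd (z x)) <= ennreal (\<rho> z)"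
 unfolding ennreal_\<rho>[OF assms] by (simp_all add: add_increasing2 add_increasing)

text \<open>The limit is constructed for the first exponent. Its almost everywhere convergent
  subsequence identifies the same function as limit for the second, so a single pair lies in both
  closures.\<close>

lemma E_complete:
 assumes w: "\<And>n. w n \<in> E"
  and C\<rho>: "\<And>e. 0 < e ==> \<exists>n0. \<forall>m\<ge>n0. \<forall>n\<ge>n0. \<rho> (w m - w n) <= e"
  and C\<alpha>: "\<And>e. 0 < e ==> \<exists>n0. \<forall>m\<ge>n0. \<forall>n\<ge>n0. pmodA (w m - w n) <= ennreal e"
 obtains w' where "w' \<in> E" "(\<lambda>n. N (w n - w')) \<longlonglongrightarrow> 0"
proof -
 have wd: "w m - w n \<in> E" for m n using E_subspace w by (intro subspace_diff)
 have Cq: "\<exists>n0. \<forall>m\<ge>n0. \<forall>n\<ge>n0. pmod M q (\<lambda>x. w m x - w n x) <= ennreal e"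
  if q: "var_dom \<Omega> q lo hi" "\<And>x. x \<in> \<Omega> ==> q x <= \<alpha> x" "0 < e" "\<And>z. z \<in> E ==> pmod M q (\<lambda>x. snd (z x)) <= ennreal (\<rho> z)" for q e
 proof -
  obtain d where d: "0 < d" "\<And>z. z \<in> E ==> \<rho> z <= d ==> pmodA z <= ennreal d ==> pmod M q z <= ennreal e"
   by (rule pmod_small[OF q]) (assumption+, rule that)
  obtain n1 where n1: "\<forall>m\<ge>n1. \<forall>n\<ge>n1. \<rho> (w m - w n) <= d" using C\<rho>[OF d(1)] by blast
  obtain n2 where n2: "\<forall>m\<ge>n2. \<forall>n\<ge>n2. pmodA (w m - w n) <= ennreal d" using C\<alpha>[OF d(1)] by blast
  have "pmod M q (w m - w n) <= ennreal e" if "max n1 n2 <= m" "max n1 n2 <= n" for m n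
   using that n1 n2 by (intro d(2) wd) auto
  then show ?thesis by (intro exI[of _ "max n1 n2"]) (simp add: fun_diff_def)
 qed
 have wm: "w n \<in> borel_measurable M" for n by (rule E_measurable[OF w])
 have c1: "\<exists>n0. \<forall>m\<ge>n0. \<forall>n\<ge>n0. pmod M p1 (\<lambda>x. w m x - w n x) <= ennreal e" if "0 < e" for e
  by (rule Cq[OF d1.var_dom_axioms _ that pmod_snd_le_\<rho>(1)]) (use ranges pp in force)+
 have c2: "\<exists>n0. \<forall>m\<ge>n0. \<forall>n\<ge>n0. pmod M p2 (\<lambda>x. w m x - w n x) <= ennreal e" if "0 < e" for e
  by (rule Cq[OF d2.var_dom_axioms _ that pmod_snd_le_\<rho>(2)]) (use ranges pp in force)+
 obtain r w' where r: "strict_mono (r :: nat => nat)" "w' \<in> borel_measurable M"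
  "AE x in M. (\<lambda>k. w (r k) x) \<longlonglongrightarrow> w' x" "(\<lambda>n. pmod M p1 (\<lambda>x. w n x - w' x)) \<longlonglongrightarrow> 0"
  by (rule d1.pmod_complete[of w, OF wm c1]) (assumption, rule that)
 have l2: "(\<lambda>n. pmod M p2 (\<lambda>x. w n x - w' x)) \<longlonglongrightarrow> 0"
  by (rule d2.pmod_tendsto_of_AE_subseq[OF wm r(2) c2 r(1,3)])
 have "d1.W0 w'"
 proof (rule d1.W0_closed[OF r(2)])
  fix e :: real assume "0 < e"
  then obtain n where "pmod M p1 (\<lambda>x. w n x - w' x) < ennreal e" using order_tendstoD(2)[OF r(4), of "ennreal e"] by (auto simp: eventually_sequentially)
  then show "\<exists>v. d1.W0 v \<and> pmod M p1 (\<lambda>x. v x - w' x) <= ennreal e" using w[of n] by (intro exI[of _ "w n"]) (simp add: E_def)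
 qed
 moreover have "d2.W0 w'"
 proof (rule d2.W0_closed[OF r(2)])
  fix e :: real assume "0 < e"
  then obtain n where "pmod M p2 (\<lambda>x. w n x - w' x) < ennreal e" using order_tendstoD(2)[OF l2, of "ennreal e"] by (auto simp: eventually_sequentially)
  then show "\<exists>v. d2.W0 v \<and> pmod M p2 (\<lambda>x. v x - w' x) <= ennreal e" using w[of n] by (intro exI[of _ "w n"]) (simp add: E_def)
 qed
 ultimately have w': "w' \<in> E" by (simp add: E_def)
 have zE: "w n - w' \<in> E" for n using E_subspace w w' by (intro subspace_diff)
 have "(\<lambda>n. N (w n - w')) \<longlonglongrightarrow> 0"
 proof (rule LIMSEQ_I)
  fix c0 :: real assume c0: "0 < c0"
  define c where "c = min 1 (c0/2)"
  have c: "0 < c" "c <= 1" "c < c0" using c0 by (auto simp: c_def)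
  have "\<forall>\<^sub>F n in sequentially. pmod M p1 (\<lambda>x. w n x - w' x) + pmod M p2 (\<lambda>x. w n x - w' x) < ennreal (c powr pp)"
   by (rule order_tendstoD(2)[OF tendsto_add[OF r(4) l2]]) (use c in simp)
  then obtain n0 where n0: "\<And>n. n0 <= n ==> pmod M p1 (\<lambda>x. w n x - w' x) + pmod M p2 (\<lambda>x. w n x - w' x) < ennreal (c powr pp)"
   by (auto simp: eventually_sequentially)
  have "norm (N (w n - w') - 0) < c0" if "n0 <= n" for n
  proof -
   have "ennreal (\<rho> (w n - w')) <= pmod M p1 (\<lambda>x. w n x - w' x) + pmod M p2 (\<lambda>x. w n x - w' x)"
    unfolding ennreal_\<rho>[OF zE] unfolding fun_diff_def by (intro add_mono d1.pmod_mono d2.pmod_mono AE_I2 norm_prod_bounds(2))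
   then have "ennreal (\<rho> (w n - w')) <= ennreal (c powr pp)" by (rule order_trans[OF _ less_imp_le[OF n0[OF that]]])
   then have "N (w n - w') <= c" using c by (intro cm.gauge_le_powr zE) (auto simp: ennreal_le_iff)
   then show ?thesis using cm.gauge_nonneg[OF zE[of n]] c by simp
  qed
  then show "\<exists>n0. \<forall>n\<ge>n0. norm (N (w n - w') - 0) < c0" by blast
 qed
 with w' show thesis by (rule that)
qed

text \<open>The sequence is bounded, so along a subsequence the function parts are Cauchy in the
  \<alpha>-modular; smallness of the derivatives and \<open>strong_monotone\<close> then make the
  gradients Cauchy. Convergence is strong, and J and D pass to the limit by continuity.\<close>

lemma Palais_Smale:
 assumes w: "\<And>n. w n \<in> E" and J: "\<And>n. a <= J (w n)" "\<And>n. J (w n) <= K"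
  and D: "\<And>n v. v \<in> E ==> N v <= 1 ==> \<bar>D (w n) v\<bar> <= inverse (real (Suc n))"
 obtains w' where "w' \<in> E" "a <= J w'" "\<And>v. v \<in> E ==> D w' v = 0"
proof -
 obtain B where B: "0 <= B" "\<And>w. w \<in> E ==> J w <= K ==> \<forall>v\<in>E. N v <= 1 --> \<bar>D w v\<bar> <= 1 ==> N w <= B"
  by (rule ps_bounded[of K]) (rule that)
 have NB: "N (w n) <= B" for n
 proof (rule B(2)[OF w J(2)], intro ballI impI)
  fix v assume "v \<in> E" "N v <= 1"
  from D[OF this, of n] show "\<bar>D (w n) v\<bar> <= 1" by (rule order_trans) (simp add: inverse_le_1_iff)
 qed
 define K' where "K' = (B + 1) powr pp"
 have K': "0 <= K'" by (simp add: K'_def)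
 have \<rho>K: "\<rho> (w n) <= K'" for n unfolding K'_def by (rule \<rho>_le[OF w NB B(1)])
 obtain s where s: "strict_mono (s :: nat => nat)"
  "\<And>\<epsilon>. 0 < \<epsilon> ==> \<exists>n0. \<forall>m\<ge>n0. \<forall>n\<ge>n0. pmod M \<alpha> (\<lambda>x. fst (w (s m) x) - fst (w (s n) x)) <= ennreal \<epsilon>"
  by (rule Rellich_E[OF K' w \<rho>K]) (rule that)
 define u where "u n = w (s n)" for n
 have uE: "u n \<in> E" and uB: "N (u n) <= B" and u\<rho>: "\<rho> (u n) <= K'" for n by (simp_all add: u_def w NB \<rho>K)
 have ud: "u m - u n \<in> E" for m n using E_subspace uE by (intro subspace_diff)
 have Du: "\<bar>D (u n) v\<bar> <= inverse (real (Suc n)) * N v" if "v \<in> E" for n v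
 proof -
  have "\<bar>D (u n) v\<bar> <= inverse (real (Suc (s n))) * N v"
   by (rule sf.D_le_N[OF uE that]) (use D[of _ "s n"] in \<open>auto simp: u_def\<close>)
  also have "... <= inverse (real (Suc n)) * N v"
   using seq_suble[OF s(1), of n] cm.gauge_nonneg[OF that] by (intro mult_right_mono le_imp_inverse_le) auto
  finally show ?thesis .
 qed
 have C\<alpha>: "\<exists>n0. \<forall>m\<ge>n0. \<forall>n\<ge>n0. pmodA (u m - u n) <= ennreal e" if "0 < e" for e
  using s(2)[OF that] by (simp add: u_def)
 have C\<rho>: "\<exists>n0. \<forall>m\<ge>n0. \<forall>n\<ge>n0. \<rho> (u m - u n) <= e" if e: "0 < e" for e
 proof -
  obtain d where d: "0 < d" "\<And>u v. u \<in> E ==> v \<in> E ==> \<rho> u <= K' ==> \<rho> v <= K' ==> \<bar>D u (u - v)\<bar> <= d ==> \<bar>D v (u - v)\<bar> <= d ==>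
   pmodA (u - v) <= ennreal d ==> \<rho> (u - v) <= e"
   by (rule strong_monotone[OF e K']) (rule that)
  obtain n1 where n1: "\<forall>m\<ge>n1. \<forall>n\<ge>n1. pmodA (u m - u n) <= ennreal d" using C\<alpha>[OF d(1)] by blast
  have dB: "0 < d / (2 * B + 1)" using d B by simp
  obtain n2 where n2: "inverse (real (Suc n2)) < d / (2 * B + 1)" using reals_Archimedean[OF dB] by blast
  have Dd: "\<bar>D (u k) (u m - u n)\<bar> <= d" if "n2 <= k" for k m n
  proof -
   have "N (u m - u n) = N (u m + (-1) *\<^sub>R u n)" by (simp add: scaleR_minus1_left)
   also have "... <= N (u m) + N ((-1) *\<^sub>R u n)" by (rule cm.gauge_triangle[OF uE cm.scaleE[OF uE]])
   also have "... <= 2 * B + 1" using uB[of m] uB[of n] cm.gauge_scale[OF uE, of "-1" n] by simp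
   finally have NN: "N (u m - u n) <= 2 * B + 1" .
   have "inverse (real (Suc k)) <= inverse (real (Suc n2))" using that by (intro le_imp_inverse_le) auto
   then have "inverse (real (Suc k)) <= d / (2 * B + 1)" using n2 by linarith
   then have "inverse (real (Suc k)) * N (u m - u n) <= d / (2 * B + 1) * (2 * B + 1)"
    using NN dB cm.gauge_nonneg[OF ud[of m n]] by (intro mult_mono) auto
   also have "... = d" using B by simp
   finally show ?thesis using Du[OF ud, of k m n] by linarith
  qed
  have "\<rho> (u m - u n) <= e" if "max n1 n2 <= m" "max n1 n2 <= n" for m n
   using that n1 by (intro d(2) uE u\<rho> Dd) auto
  then show ?thesis by blast
 qed
 obtain w' where w': "w' \<in> E" "(\<lambda>n. N (u n - w')) \<longlonglongrightarrow> 0"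
  by (rule E_complete[of u, OF uE C\<rho> C\<alpha> that])
 have dE: "u n - w' \<in> E" "w' - u n \<in> E" for n using E_subspace uE w' by (auto intro: subspace_diff)
 have Nsym: "N (w' - u n) = N (u n - w')" for n by (rule sf.N_minus[OF w'(1) uE])
 show thesis
 proof (rule that[OF w'(1)])
  obtain B1 where B1: "\<forall>u\<in>E. N u <= B + 1 --> (\<forall>w\<in>E. N w <= 1 --> \<bar>D u w\<bar> <= B1)" using D_bounded[of "B + 1"] by blast
  have "\<forall>\<^sub>F n in sequentially. N (u n - w') < 1" by (rule order_tendstoD(2)[OF w'(2)]) simp
  then have "\<forall>\<^sub>F n in sequentially. a - B1 * N (u n - w') <= J w'"
  proof eventually_elim
   case (elim n)
   have "\<bar>J (u n + (w' - u n)) - J (u n)\<bar> <= B1 * N (w' - u n)"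
    by (rule sf.J_lipschitz[OF B1 uE dE(2)]) (use uB[of n] Nsym[of n] elim in linarith)
   then show ?case using J(1)[of "s n"] Nsym[of n] by (simp add: u_def)
  qed
  moreover have "(\<lambda>n. a - B1 * N (u n - w')) \<longlonglongrightarrow> a - B1 * 0" by (intro tendsto_intros w')
  ultimately show "a <= J w'" using tendsto_upperbound[of "\<lambda>n. a - B1 * N (u n - w')" "a - B1 * 0" sequentially "J w'"] by simp
  have NB': "N w' <= B + 1"
  proof -
   obtain n where "N (u n - w') < 1" using order_tendstoD(2)[OF w'(2), of 1] by (auto simp: eventually_sequentially)
   then show ?thesis using sf.N_triangle[OF uE dE(2), of n n] uB[of n] Nsym[of n] by simp
  qed
  have small: "\<bar>D w' v\<bar> <= 0" if v: "v \<in> E" "N v <= 1" for v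
  proof (rule field_le_epsilon)
   fix e :: real assume e: "0 < e"
   obtain d where d: "0 < d" "\<forall>u\<in>E. \<forall>v\<in>E. N u <= B + 1 --> N v <= B + 1 --> N (u - v) < d --> (\<forall>w\<in>E. N w <= 1 --> \<bar>D u w - D v w\<bar> <= e/2)"
    using D_ucont[of "e/2" "B + 1"] e by auto
   have "\<forall>\<^sub>F n in sequentially. N (u n - w') < d" by (rule order_tendstoD(2)[OF w'(2) d(1)])
   moreover have "\<forall>\<^sub>F n in sequentially. inverse (real (Suc n)) < e/2" by (rule order_tendstoD(2)[OF LIMSEQ_inverse_real_of_nat]) (use e in simp)
   ultimately have "\<forall>\<^sub>F n in sequentially. \<bar>D w' v\<bar> <= 0 + e"
   proof eventually_elim
    case (elim n)
    have "N (u n) <= B + 1" using uB[of n] by linarith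
    then have "\<bar>D (u n) v - D w' v\<bar> <= e/2" using d(2) uE w'(1) NB' elim(1) v by blast
    moreover have "\<bar>D (u n) v\<bar> <= inverse (real (Suc n)) * 1"
     by (rule order_trans[OF Du[OF v(1)]], rule mult_left_mono[OF v(2)]) simp
    ultimately show ?case using elim(2) by linarith
   qed
   then show "\<bar>D w' v\<bar> <= 0 + e" by (auto simp: eventually_sequentially)
  qed
  fix v assume v: "v \<in> E"
  have "\<bar>D w' v\<bar> <= 0 * N v" by (rule sf.D_le_N[OF w'(1) v]) (use small in blast)
  then show "D w' v = 0" by simp
 qed
qed

end

section \<open>Mountain pass geometry\<close>

lemma powr_le_one_add:
 fixes t p q :: real
 assumes "0 <= t" "0 <= p" "p <= q" shows "t powr p <= 1 + t powr q"
proof (cases "t <= 1")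
 case True
 then have "t powr p <= 1" using assms by (intro powr_le1) auto
 then show ?thesis by (simp add: add_increasing2)
next
 case False
 then have "t powr p <= t powr q" using assms by (intro powr_mono) auto
 then show ?thesis by simp
qed

context superlinear begin

text \<open>Near 0 the small order condition on f is integrated. For |t| >= d the growth bound is
  absorbed into |t|^\<alpha>: as |t|/d >= 1, the linear term is at most (1/d)^hi
  |t|^\<alpha>.\<close>

lemma F_origin:
 assumes \<epsilon>: "0 < \<epsilon>"
 obtains L where "0 <= L" "\<And>x t. x \<in> \<Omega> ==> \<bar>F x t\<bar> <= \<epsilon> * \<bar>t\<bar> powr pp + L * \<bar>t\<bar> powr \<alpha> x"
proof -
 obtain \<delta> where \<delta>: "0 < \<delta>" "\<And>x t. x \<in> \<Omega> ==> \<bar>t\<bar> < \<delta> ==> \<bar>f x t\<bar> <= \<epsilon> * \<bar>t\<bar> powr (pp - 1)"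
  using f_origin[OF \<epsilon>] by blast
 define d where "d = min 1 \<delta>"
 have d: "0 < d" "d <= 1" "d <= \<delta>" using \<delta> by (auto simp: d_def)
 define H where "H = (1/d) powr hi"
 have H: "1 <= H" unfolding H_def using d hi1 by (intro ge_one_powr_ge_zero) auto
 show thesis
 proof (rule that[of "2 * C * H"])
  show "0 <= 2 * C * H" using C H by simp
  fix x t assume x: "x \<in> \<Omega>"
  show "\<bar>F x t\<bar> <= \<epsilon> * \<bar>t\<bar> powr pp + 2 * C * H * \<bar>t\<bar> powr \<alpha> x"
  proof (cases "\<bar>t\<bar> < d")
   case True
   have "\<bar>F x t\<bar> <= (\<epsilon> * \<bar>t\<bar> powr (pp - 1)) * \<bar>t\<bar>"
    unfolding F_def
   proof (rule primitive_bound[of f x, OF f_cont[OF x]])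
    fix s assume s: "\<bar>s\<bar> <= \<bar>t\<bar>"
    have "\<bar>f x s\<bar> <= \<epsilon> * \<bar>s\<bar> powr (pp - 1)" using s True d by (intro \<delta>(2)[OF x]) auto
    also have "... <= \<epsilon> * \<bar>t\<bar> powr (pp - 1)" using s \<epsilon> pp1 by (intro mult_left_mono powr_mono2) auto
    finally show "\<bar>f x s\<bar> <= \<epsilon> * \<bar>t\<bar> powr (pp - 1)" .
   qed
   also have "... = \<epsilon> * \<bar>t\<bar> powr pp" using powr_add[of "\<bar>t\<bar>" "pp - 1" 1] by (cases "t = 0") auto
   finally show ?thesis using C H by (simp add: add_increasing2)
  next
   case False
   define z where "z = \<bar>t\<bar> / d"
   have z: "1 <= z" "\<bar>t\<bar> = d * z" using False d by (auto simp: z_def)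
   have "\<bar>t\<bar> <= z powr 1" using z d by (simp add: mult_left_le_one_le)
   also have "... <= z powr \<alpha> x" using z ranges[OF x] by (intro powr_mono) auto
   also have "... = (1/d) powr \<alpha> x * \<bar>t\<bar> powr \<alpha> x" using d by (simp add: z_def powr_divide)
   also have "... <= H * \<bar>t\<bar> powr \<alpha> x" unfolding H_def using d ranges[OF x] by (intro mult_right_mono powr_mono) auto
   finally have 1: "\<bar>t\<bar> <= H * \<bar>t\<bar> powr \<alpha> x" .
   have 2: "1 * \<bar>t\<bar> powr \<alpha> x <= H * \<bar>t\<bar> powr \<alpha> x" using H by (intro mult_right_mono) auto
   have "\<bar>F x t\<bar> <= C * (\<bar>t\<bar> + \<bar>t\<bar> powr \<alpha> x)" by (rule F_bound[OF x])
   also have "... <= C * (H * \<bar>t\<bar> powr \<alpha> x + H * \<bar>t\<bar> powr \<alpha> x)" using 1 2 C by (intro mult_left_mono) auto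
   also have "... = 2 * C * H * \<bar>t\<bar> powr \<alpha> x" by simp
   finally show ?thesis using \<epsilon> by (simp add: add_increasing)
  qed
 qed
qed

text \<open>With N w = c/2 the rescaled v = w/c has modular at most 1. The gradient part of J is at
  least q c^pp, the \<epsilon> part of F costs at most a quarter of this, and the other part, of
  order c^a0, another quarter once c^(a0-pp) <= k.\<close>

lemma sphere:
 obtains r a where "0 < r" "0 < a" "\<And>w. w \<in> E ==> N w = r ==> a <= J w"
proof -
 obtain S where S: "0 <= S" "\<And>v. v \<in> E ==> \<rho> v <= 1 ==> pmodA v <= ennreal S"
  by (rule Sobolev[of 1]) (simp, rule that)
 \<comment> \<open>The lower bound for the modular requires a number strictly below N w = c/2; c/4
   is taken, hence the 1/4.\<close>
 define q where "q = (1/4) powr pp / pp"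
 have q: "0 < q" using pp1 by (simp add: q_def)
 define V where "V = measure M \<Omega> + S + 1"
 have V: "0 < V" using S by (simp add: V_def add_nonneg_pos)
 define \<epsilon> where "\<epsilon> = q / (4 * V)"
 have \<epsilon>: "0 < \<epsilon>" "\<epsilon> * V = q / 4" using q V by (auto simp: \<epsilon>_def)
 obtain L where L: "0 <= L" "\<And>x t. x \<in> \<Omega> ==> \<bar>F x t\<bar> <= \<epsilon> * \<bar>t\<bar> powr pp + L * \<bar>t\<bar> powr \<alpha> x"
  by (rule F_origin[OF \<epsilon>(1)]) (rule that)
 have ap: "0 < a0 - pp" using pp by simp
 define k where "k = q / (4 * (L * S + 1))"
 have k: "0 < k" using q L S by (simp add: k_def add_nonneg_pos)
 have LSk: "L * S * k <= q / 4"
 proof -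
  have "L * S * k <= (L * S + 1) * k" using k by (intro mult_right_mono) auto
  also have "... = q / 4" using mult_nonneg_nonneg[OF L(1) S(1)] by (simp add: k_def field_simps)
  finally show ?thesis .
 qed
 define c where "c = min 1 (k powr (1 / (a0 - pp)))"
 have c: "0 < c" "c <= 1" using k by (auto simp: c_def)
 have "c powr (a0 - pp) <= (k powr (1 / (a0 - pp))) powr (a0 - pp)" using c ap by (intro powr_mono2) (auto simp: c_def)
 also have "... = k" using k ap by (simp add: powr_powr)
 finally have ck: "c powr (a0 - pp) <= k" .
 have ca0: "c powr a0 = c powr pp * c powr (a0 - pp)" by (simp add: powr_add[symmetric])
 show thesis
 proof (rule that[of "c / 2" "c powr pp * (q / 2)"])
  show "0 < c / 2" "0 < c powr pp * (q / 2)" using c q by auto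
  fix w assume w: "w \<in> E" "N w = c / 2"
  define v where "v = inverse c *\<^sub>R w"
  have v: "v \<in> E" "\<rho> v <= 1" using cm.gauge_lessD[OF w(1), of c] w c by (auto simp: v_def cm.gset_def cm.scaleE)
  have wv: "fst (w x) = c * fst (v x)" for x using c by (simp add: v_def scaleR_fun_apply)
  define I where "I = (LINT x|M. \<bar>fst (v x)\<bar> powr \<alpha> x)"
  have I: "I <= S" unfolding I_def by (rule integral_fst_le[OF v(1) S(2)[OF v] S(1)])
  let ?n = "\<lambda>x. norm (snd (w x)) powr p1 x + norm (snd (w x)) powr p2 x"
  have i: "integrable M ?n" "integrable M (\<lambda>x. \<bar>fst (v x)\<bar> powr \<alpha> x)" using integrable_snd_powr[OF w(1)] integrable_fst_powr[OF v(1)] by simp_all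
  have "(c/4) powr pp <= \<rho> w" using w c by (intro cm.rho_ge_powr_hi) auto
  then have "(c/4) powr pp / pp <= \<rho> w / pp" using pp1 by (intro divide_right_mono) auto
  moreover have "(c/4) powr pp / pp = c powr pp * q" using c by (simp add: q_def powr_divide)
  ultimately have 1: "c powr pp * q <= \<rho> w / pp" by simp
  have "\<rho> w / pp - (c powr pp * (\<epsilon> * (measure M \<Omega> + I)) + c powr a0 * (L * I)) =
   (LINT x|M. ?n x / pp - (c powr pp * (\<epsilon> * (1 + \<bar>fst (v x)\<bar> powr \<alpha> x)) + c powr a0 * (L * \<bar>fst (v x)\<bar> powr \<alpha> x)))"
   unfolding \<rho>_def I_def using i by simp
  also have "... <= J w"
   unfolding J_def
  proof (rule integral_mono[OF _ integrable_Ld[OF w(1)]])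
   show "integrable M (\<lambda>x. ?n x / pp - (c powr pp * (\<epsilon> * (1 + \<bar>fst (v x)\<bar> powr \<alpha> x)) + c powr a0 * (L * \<bar>fst (v x)\<bar> powr \<alpha> x)))"
    using i by simp
   fix x assume "x \<in> space M"
   then have x: "x \<in> \<Omega>" by simp
   have a0x: "a0 <= \<alpha> x" using sub.a0(2)[OF x] A_eq[OF x] by simp
   have g: "norm (snd (w x)) powr p / pp <= norm (snd (w x)) powr p / p" if "1 < p" "p <= pp" for p
    using that by (intro divide_left_mono) auto
   have "\<bar>fst (w x)\<bar> powr pp = c powr pp * \<bar>fst (v x)\<bar> powr pp" using c by (simp add: wv abs_mult powr_mult)
   also have "... <= c powr pp * (1 + \<bar>fst (v x)\<bar> powr \<alpha> x)"
    using ranges[OF x] pp1 by (intro mult_left_mono powr_le_one_add) auto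
   finally have "\<epsilon> * \<bar>fst (w x)\<bar> powr pp <= \<epsilon> * (c powr pp * (1 + \<bar>fst (v x)\<bar> powr \<alpha> x))" using \<epsilon> by (intro mult_left_mono) auto
   moreover have "\<bar>fst (w x)\<bar> powr \<alpha> x <= c powr a0 * \<bar>fst (v x)\<bar> powr \<alpha> x"
    using c a0x by (simp add: wv abs_mult powr_mult mult_right_mono powr_mono')
   then have "L * \<bar>fst (w x)\<bar> powr \<alpha> x <= L * (c powr a0 * \<bar>fst (v x)\<bar> powr \<alpha> x)" using L by (intro mult_left_mono) auto
   ultimately have "F x (fst (w x)) <= c powr pp * (\<epsilon> * (1 + \<bar>fst (v x)\<bar> powr \<alpha> x)) + c powr a0 * (L * \<bar>fst (v x)\<bar> powr \<alpha> x)"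
    using L(2)[OF x, of "fst (w x)"] by (simp add: mult.left_commute abs_le_iff)
   then show "?n x / pp - (c powr pp * (\<epsilon> * (1 + \<bar>fst (v x)\<bar> powr \<alpha> x)) + c powr a0 * (L * \<bar>fst (v x)\<bar> powr \<alpha> x)) <= Ld x (w x)"
    unfolding Ld_def add_divide_distrib using g[of "p1 x"] g[of "p2 x"] ranges[OF x] pp(1,2)[OF x] by linarith
  qed
  finally have 2: "\<rho> w / pp - (c powr pp * (\<epsilon> * (measure M \<Omega> + I)) + c powr a0 * (L * I)) <= J w" .
  have "c powr pp * (\<epsilon> * (measure M \<Omega> + I)) <= c powr pp * (q / 4)"
  proof (rule mult_left_mono)
   have "\<epsilon> * (measure M \<Omega> + I) <= \<epsilon> * V" using I \<epsilon> by (intro mult_left_mono) (auto simp: V_def)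
   then show "\<epsilon> * (measure M \<Omega> + I) <= q / 4" using \<epsilon> by simp
  qed simp
  moreover have "c powr a0 * (L * I) <= c powr pp * (q / 4)"
  proof -
   have "c powr (a0 - pp) * (L * I) <= c powr (a0 - pp) * (L * S)" using I L by (intro mult_left_mono) auto
   also have "... <= k * (L * S)" using ck L S by (intro mult_right_mono) auto
   also have "... <= q / 4" using LSk by (simp add: mult.commute)
   finally show ?thesis unfolding ca0 mult.assoc by (intro mult_left_mono) auto
  qed
  ultimately show "c powr pp * (q / 2) <= J w" using 1 2 by (simp add: algebra_simps)
 qed
qed

text \<open>For t >= T superlinearity says that F(t) t^-\<theta> has nonnegative derivative, so F(s)
  >= F(T) (s/T)^\<theta>. For s < T everything is bounded through the growth condition, and
  \<open>defect\<close> compensates.\<close>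

lemma F_lower:
 assumes x: "x \<in> \<Omega>" "x \<in> G" and s: "0 <= s"
 shows "F x T / T powr \<theta> * s powr \<theta> - defect <= F x s"
proof (cases "T <= s")
 case True
 have "F x T * T powr - \<theta> <= F x s * s powr - \<theta>"
 proof (rule DERIV_nonneg_imp_nondecreasing[OF True])
  fix t assume t: "T <= t" "t <= s"
  have t0: "0 < t" using t T by linarith
  have "((\<lambda>t. F x t * t powr - \<theta>) has_real_derivative f x t * t powr - \<theta> + (- \<theta> * t powr (- \<theta> - 1)) * F x t) (at t)"
   unfolding F_def by (rule DERIV_mult[OF primitive_deriv[of f x, OF f_cont[OF x(1)]] has_real_derivative_powr[OF t0]])
  moreover have "f x t * t powr - \<theta> + (- \<theta> * t powr (- \<theta> - 1)) * F x t = t powr (- \<theta> - 1) * (t * f x t - \<theta> * F x t)"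
   using t0 powr_add[of t "- \<theta> - 1" 1] by (simp add: algebra_simps)
  moreover have "0 <= t powr (- \<theta> - 1) * (t * f x t - \<theta> * F x t)"
   using AR[OF x, of t] t t0 by (intro mult_nonneg_nonneg) (auto simp: F_def)
  ultimately show "\<exists>y. ((\<lambda>t. F x t * t powr - \<theta>) has_real_derivative y) (at t) \<and> 0 <= y" by metis
 qed
 then have "F x T * T powr - \<theta> * s powr \<theta> <= F x s * s powr - \<theta> * s powr \<theta>" by (intro mult_right_mono) auto
 also have "... = F x s" using True T by (simp add: mult.assoc powr_add[symmetric])
 finally show ?thesis using defect_nonneg by (simp add: powr_minus_divide)
next
 case False
 have sm: "\<bar>F x t\<bar> <= defect / 2" if "\<bar>t\<bar> <= T" for t
  by (rule order_trans[OF F_bound[OF x(1)] small_growth[OF x(1)]]) (use that in auto)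
 have "0 < F x T" using AR[OF x, of T] T \<theta>1 by (simp add: F_def zero_less_mult_iff)
 have "F x T / T powr \<theta> * s powr \<theta> <= F x T / T powr \<theta> * T powr \<theta>"
  using False s \<theta>1 \<open>0 < F x T\<close> by (intro mult_left_mono powr_mono2) auto
 also have "... = F x T" using T by simp
 finally show ?thesis using sm[of T] sm[of s] s False T unfolding abs_le_iff by auto
qed

lemma tpair_in_E: assumes "test_fun \<Omega> \<phi>" shows "tpair \<phi> \<in> E"
proof -
 have "d1.W0 (tpair \<phi>)" unfolding d1.W0_def using assms d1.tpair_measurable[OF assms] by (auto simp: pmod_def intro!: exI[of _ \<phi>])
 moreover have "d2.W0 (tpair \<phi>)" unfolding d2.W0_def using assms d1.tpair_measurable[OF assms] by (auto simp: pmod_def intro!: exI[of _ \<phi>])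
 ultimately show ?thesis by (simp add: E_def)
qed

lemma bump_exists:
 obtains \<phi> where "test_fun \<Omega> \<phi>" "\<And>x. 0 <= \<phi> x" "\<And>x. \<phi> x <= 1" "\<not> (AE x in M. \<phi> x = 0)"
proof -
 obtain x where "x \<in> \<Omega>" using \<Omega>_nonempty by blast
 then obtain a b where ab: "cbox a b \<subseteq> \<Omega>" "x \<in> box a b" using open_contains_cbox[OF d1.\<Omega>_open] by metis
 have "\<not> (AE x in M. bump a b 0 x = 0)"
 proof
  assume "AE x in M. bump a b 0 x = 0"
  then have "AE x in lebesgue. x \<in> \<Omega> --> bump a b 0 x = 0" using d1.\<Omega>_open by (simp add: AE_restrict_space_iff)
  then have "AE x in lebesgue. x \<notin> box a b"
  proof eventually_elim
   case (elim x)
   then show ?case using bump_pos_iff[of a b 0 x] ab(1) box_subset_cbox[of a b] by auto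
  qed
  then have "negligible (box a b)" by (subst (asm) AE_iff_null_sets[symmetric]) (auto simp: negligible_iff_null_sets)
  then show False using ab(2) by (auto simp: negligible_interval)
 qed
 then show thesis using test_fun_bump[OF ab(1)] bump_bounds by (intro that[of "bump a b 0"]) auto
qed

text \<open>The seminorm sees only the gradient; the embedding at scale c, with c tending to 0,
  forces the function part to vanish.\<close>

lemma N_zero_imp: assumes w: "w \<in> E" "N w = 0" shows "AE x in M. fst (w x) = 0"
proof (rule dA.pmod_zero_AE)
 show "(\<lambda>x. fst (w x)) \<in> borel_measurable M" by (rule E_measurable'(1)[OF w(1)])
 obtain C1 where C1: "0 <= C1" "\<And>w c. w \<in> E ==> N w < c ==> c <= 1 ==> pmodA w <= ennreal (c powr lo * C1)"
  by (rule pmod_fst_small) (rule that)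
 have "(\<lambda>n. inverse (real (Suc n)) powr lo * C1) \<longlonglongrightarrow> 0 powr lo * C1"
  using lo1 by (intro tendsto_intros LIMSEQ_inverse_real_of_nat) auto
 then have "(\<lambda>n. ennreal (inverse (real (Suc n)) powr lo * C1)) \<longlonglongrightarrow> 0" using tendsto_ennrealI by fastforce
 then have "pmodA w <= 0"
  by (rule LIMSEQ_le_const) (intro exI[of _ 0] allI impI C1(2) w, simp_all add: w inverse_le_1_iff)
 then show "pmodA w = 0" by simp
qed

text \<open>Along the ray through a nonnegative bump, J is at most s^pp \<rho> - s^\<theta> I plus a
  constant, with I > 0, and \<theta> > pp makes this nonpositive for large s. Nonnegativity of the
  bump keeps \<open>F_lower\<close> applicable at s \<phi>(x).\<close>

lemma far_point:
 obtains e where "e \<in> E" "r < N e" "J e <= 0"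
proof -
 obtain \<phi> where \<phi>: "test_fun \<Omega> \<phi>" "\<And>x. 0 <= \<phi> x" "\<And>x. \<phi> x <= 1" "\<not> (AE x in M. \<phi> x = 0)"
  by (rule bump_exists) (rule that)
 define w where "w = tpair \<phi>"
 have w: "w \<in> E" unfolding w_def by (rule tpair_in_E[OF \<phi>(1)])
 have fw: "fst (w x) = \<phi> x" for x by (simp add: w_def tpair_def)
 have Npos: "0 < N w" using N_zero_imp[OF w] \<phi>(4) cm.gauge_nonneg[OF w] by (auto simp: fw less_le)
 define h where "h x = F x T / T powr \<theta> * \<phi> x powr \<theta>" for x
 have FT: "0 < F x T" if "x \<in> \<Omega>" "x \<in> G" for x using AR[OF that, of T] T \<theta>1 by (simp add: F_def zero_less_mult_iff)
 have AEG: "AE x in M. x \<in> \<Omega> \<and> x \<in> G" using G AE_space by eventually_elim auto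
 have hm: "h \<in> borel_measurable M"
 proof -
  note [measurable] = F_comp[of "\<lambda>_. T"] borel_measurable_test_on(1)[OF \<phi>(1)]
  show ?thesis unfolding h_def by measurable
 qed
 have hi: "integrable M h"
 proof (rule d1.integrable_const_bound[OF _ hm])
  show "AE x in M. norm (h x) <= (defect / 2) / T powr \<theta> * 1"
   using AEG
  proof eventually_elim
   case (elim x)
   have "\<bar>F x T\<bar> <= defect / 2" by (rule order_trans[OF F_bound small_growth]) (use elim T in auto)
   then have "\<bar>F x T\<bar> / T powr \<theta> <= (defect / 2) / T powr \<theta>" by (rule divide_right_mono) simp
   moreover have "\<phi> x powr \<theta> <= 1" using \<phi>(2,3)[of x] \<theta>1 by (intro powr_le1) auto
   ultimately show ?case unfolding h_def norm_mult using defect_nonneg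
    by (intro mult_mono) (auto simp: abs_divide)
  qed
 qed
 define I where "I = (LINT x|M. h x)"
 have hnn: "AE x in M. 0 <= h x" using AEG by eventually_elim (use FT in \<open>auto simp: h_def less_imp_le\<close>)
 have I: "0 < I"
 proof -
  have "I \<noteq> 0"
  proof
   assume "I = 0"
   then have "AE x in M. h x = 0" unfolding I_def using integral_nonneg_eq_0_iff_AE[OF hi hnn] by simp
   then have "AE x in M. \<phi> x = 0" using AEG
   proof eventually_elim
    case (elim x)
    then show ?case using FT[of x] T by (auto simp: h_def)
   qed
   then show False using \<phi>(4) by simp
  qed
  moreover have "0 <= I" unfolding I_def by (rule integral_nonneg_AE[OF hnn])
  ultimately show ?thesis by simp
 qed
 let ?n = "\<lambda>x. norm (snd (w x)) powr p1 x + norm (snd (w x)) powr p2 x"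
 have i: "integrable M ?n" using integrable_snd_powr[OF w] by simp
 have up: "J (s *\<^sub>R w) <= s powr pp * \<rho> w - s powr \<theta> * I + defect * measure M \<Omega>" if s: "1 <= s" for s
 proof -
  have "J (s *\<^sub>R w) <= (LINT x|M. s powr pp * ?n x - s powr \<theta> * h x + defect)"
   unfolding J_def
  proof (rule integral_mono_AE[OF integrable_Ld[OF cm.scaleE[OF w]]])
   show "integrable M (\<lambda>x. s powr pp * ?n x - s powr \<theta> * h x + defect)" using i hi by simp
   show "AE x in M. Ld x ((s *\<^sub>R w) x) <= s powr pp * ?n x - s powr \<theta> * h x + defect"
    using AEG
   proof eventually_elim
    case (elim x)
    then have x: "x \<in> \<Omega>" "x \<in> G" by auto
    have g: "norm (s *\<^sub>R snd (w x)) powr p / p <= s powr pp * norm (snd (w x)) powr p" if "1 < p" "p <= pp" for p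
    proof -
     have "norm (s *\<^sub>R snd (w x)) powr p / p <= norm (s *\<^sub>R snd (w x)) powr p" using that by (simp add: divide_le_eq mult_le_cancel_left1)
     also have "... = s powr p * norm (snd (w x)) powr p" using s by (simp add: powr_mult)
     also have "... <= s powr pp * norm (snd (w x)) powr p" using s that by (intro mult_right_mono powr_mono) auto
     finally show ?thesis .
    qed
    have "F x T / T powr \<theta> * (s * \<phi> x) powr \<theta> - defect <= F x (s * \<phi> x)" using s \<phi>(2) by (intro F_lower x) auto
    moreover have "F x T / T powr \<theta> * (s * \<phi> x) powr \<theta> = s powr \<theta> * h x" using s \<phi>(2) by (simp add: h_def powr_mult)
    ultimately show ?case
     using g[of "p1 x"] g[of "p2 x"] ranges[OF x(1)] pp(1,2)[OF x(1)]
     by (simp add: Ld_def scaleR_fun_apply fw distrib_left)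
   qed
  qed
  also have "... = s powr pp * \<rho> w - s powr \<theta> * I + defect * measure M \<Omega>" unfolding \<rho>_def I_def using i hi by simp
  finally show ?thesis .
 qed
 define d where "d = \<rho> w + defect * measure M \<Omega>"
 have d: "0 <= d" using \<rho>_nonneg defect_nonneg by (simp add: d_def)
 \<comment> \<open>Three requirements: s >= 1 for the upper bound on J, seminorm beyond r, and
   s^(\<theta>-pp) I >= d.\<close>
 define s where "s = Max {1, \<bar>r\<bar> / N w + 1, (d / I) powr (1 / (\<theta> - pp))}"
 have s: "1 <= s" "\<bar>r\<bar> / N w + 1 <= s" "(d / I) powr (1 / (\<theta> - pp)) <= s" by (simp_all add: s_def)
 show thesis
 proof (rule that[of "s *\<^sub>R w"])
  show "s *\<^sub>R w \<in> E" by (rule cm.scaleE[OF w])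
  have "\<bar>r\<bar> < (\<bar>r\<bar> / N w + 1) * N w" using Npos by (simp add: field_simps)
  also have "... <= s * N w" using s Npos by (intro mult_right_mono) auto
  finally show "r < N (s *\<^sub>R w)" using cm.gauge_scale[OF w, of s] s by simp
  have "d / I = ((d / I) powr (1 / (\<theta> - pp))) powr (\<theta> - pp)" using \<theta> d I by (simp add: powr_powr)
  also have "... <= s powr (\<theta> - pp)" using s \<theta> by (intro powr_mono2) auto
  finally have "d <= s powr (\<theta> - pp) * I" using I by (simp add: field_simps)
  then have "s powr pp * d <= s powr pp * (s powr (\<theta> - pp) * I)" by (intro mult_left_mono) auto
  also have "... = s powr \<theta> * I" by (simp add: mult.assoc[symmetric] powr_add[symmetric])
  finally have 1: "s powr pp * d <= s powr \<theta> * I" .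
  have "1 * (defect * measure M \<Omega>) <= s powr pp * (defect * measure M \<Omega>)"
   using s pp1 defect_nonneg by (intro mult_right_mono ge_one_powr_ge_zero) auto
  then show "J (s *\<^sub>R w) <= 0" using up[OF s(1)] 1 by (simp add: d_def distrib_left)
 qed
qed

text \<open>If the function part vanished almost everywhere, so would its weak gradient by
  uniqueness, and J w would be 0.\<close>

lemma nontrivial:
 assumes w: "w \<in> E" "0 < J w" shows "\<not> (AE x in M. fst (w x) = 0)"
proof
 assume z: "AE x in M. fst (w x) = 0"
 have "weak_grad \<Omega> (\<lambda>x. fst (w x)) (\<lambda>x. snd (w x))" using w by (intro d1.W0_weak_grad) (simp add: E_def)
 then have "AE x in M. snd (w x) = 0" by (rule weak_grad_unique[OF d1.\<Omega>_open _ weak_grad_zero[OF d1.\<Omega>_open z]])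
 with z have "AE x in M. Ld x (w x) = 0"
  by eventually_elim (simp add: Ld_def F_def)
 then have "J w = 0" unfolding J_def by (rule integral_eq_zero_AE)
 then show False using w by simp
qed

text \<open>The majorant \<Phi> bounds J along the segment to the far point, which fixes the upper
  level. Almost critical points for the accuracies 1/(n+1) feed \<open>Palais_Smale\<close>, and the
  limit keeps J >= a/2 > 0.\<close>

theorem nontrivial_critical_point:
 obtains w where "w \<in> E" "\<not> (AE x in M. fst (w x) = 0)" "\<And>v. v \<in> E ==> D w v = 0"
proof -
 obtain r a where ra: "0 < r" "0 < a" "\<And>w. w \<in> E ==> N w = r ==> a <= J w" by (rule sphere) (rule that)
 obtain e where e: "e \<in> E" "r < N e" "J e <= 0" by (rule far_point) (rule that)
 obtain B where B: "0 <= B" "\<And>w. w \<in> E ==> N w <= N e ==> (LINT x|M. \<Phi> x (w x)) <= B"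
  by (rule \<Phi>_integral_bound) (rule that)
 have K: "J (t *\<^sub>R e) <= 2 * C * B" if t: "t \<in> {0..1}" for t
 proof -
  have tE: "t *\<^sub>R e \<in> E" by (rule cm.scaleE[OF e(1)])
  have "N (t *\<^sub>R e) <= N e" using cm.gauge_scale[OF e(1), of t] t cm.gauge_nonneg[OF e(1)] by (simp add: mult_left_le_one_le)
  then have b: "(LINT x|M. \<Phi> x ((t *\<^sub>R e) x)) <= B" by (rule B(2)[OF tE])
  have "J (t *\<^sub>R e) <= (LINT x|M. 2 * C * \<Phi> x ((t *\<^sub>R e) x))"
   unfolding J_def
  proof (rule integral_mono[OF integrable_Ld[OF tE]])
   show "integrable M (\<lambda>x. 2 * C * \<Phi> x ((t *\<^sub>R e) x))" by (intro integrable_mult_right integrable_\<Phi>[OF tE])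
   show "Ld x ((t *\<^sub>R e) x) <= 2 * C * \<Phi> x ((t *\<^sub>R e) x)" if "x \<in> space M" for x
    using Ld_bound[of x "(t *\<^sub>R e) x"] that by simp
  qed
  also have "... = 2 * C * (LINT x|M. \<Phi> x ((t *\<^sub>R e) x))" by simp
  also have "... <= 2 * C * B" using b C by (intro mult_left_mono) auto
  finally show ?thesis .
 qed
 have J0: "J 0 <= 0" by (simp add: J_def Ld_def F_def)
 have "\<exists>u. u \<in> E \<and> a/2 <= J u \<and> J u <= 2 * C * B \<and> (\<forall>w. w \<in> E --> N w <= 1 --> \<bar>D u w\<bar> <= inverse (real (Suc n)))" for n
 proof -
  obtain u where "u \<in> E" "a/2 <= J u" "J u <= 2 * C * B" "\<And>w. w \<in> E ==> N w <= 1 ==> \<bar>D u w\<bar> <= inverse (real (Suc n))"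
   by (rule sf.almost_critical_point[OF ra(2,1,3) J0 e K, of "inverse (real (Suc n))"]) (assumption+, simp, rule that)
  then show ?thesis by blast
 qed
 then obtain u where u: "\<And>n. u n \<in> E \<and> a/2 <= J (u n) \<and> J (u n) <= 2 * C * B \<and> (\<forall>w. w \<in> E --> N w <= 1 --> \<bar>D (u n) w\<bar> <= inverse (real (Suc n)))"
  by metis
 obtain w where w: "w \<in> E" "a/2 <= J w" "\<And>v. v \<in> E ==> D w v = 0"
  by (rule Palais_Smale[of u "a/2" "2 * C * B"]) (use u in simp, use u in simp, use u in simp, use u in simp, rule that)
 have "\<not> (AE x in M. fst (w x) = 0)" using w ra by (intro nontrivial) auto
 with w(1) show thesis using w(3) by (rule that)
qed

end

subsection \<open>Existence of a nontrivial weak solution\<close>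

text \<open>Lebesgue measure is complete, so a change on a null set preserves measurability.\<close>

lemma borel_measurable_lebesgue_on_AE:
 fixes u v :: "'a::euclidean_space => 'b::euclidean_space"
 assumes \<Omega>: "\<Omega> \<in> sets lebesgue" and u: "u \<in> borel_measurable (lebesgue_on \<Omega>)" and eq: "AE x in lebesgue_on \<Omega>. u x = v x"
 shows "v \<in> borel_measurable (lebesgue_on \<Omega>)"
proof -
 have "AE x in lebesgue. x \<in> \<Omega> --> u x = v x" using eq \<Omega> by (simp add: AE_restrict_space_iff)
 then have "AE x in lebesgue. (if x \<in> \<Omega> then u x else 0) = (if x \<in> \<Omega> then v x else 0)" by eventually_elim auto
 then have "(\<lambda>x. if x \<in> \<Omega> then v x else 0) \<in> borel_measurable lebesgue"
  by (rule borel_measurable_AE[rotated]) (rule iffD2[OF borel_measurable_if[OF \<Omega>] u])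
 then show ?thesis by (simp add: borel_measurable_if[OF \<Omega>])
qed

lemma integral_lebesgue_on_cong_AE:
 fixes u v :: "'a::euclidean_space => real"
 assumes "\<Omega> \<in> sets lebesgue" "u \<in> borel_measurable (lebesgue_on \<Omega>)" "AE x in lebesgue_on \<Omega>. u x = v x"
 shows "(LINT x|(lebesgue_on \<Omega>). u x) = (LINT x|(lebesgue_on \<Omega>). v x)"
 by (rule integral_cong_AE[OF assms(2) borel_measurable_lebesgue_on_AE[OF assms] assms(3)])

lemma (in var_dom) W0_cong_AE:
 assumes w: "W0 w" and w': "w' \<in> borel_measurable \<mu>" and eq: "AE x in \<mu>. w x = w' x"
 shows "W0 w'"
proof (rule W0_closed[OF w'])
 fix e :: real assume "0 < e"
 have "pmod \<mu> p (\<lambda>x. w x - w' x) = pmod \<mu> p (\<lambda>_. 0 :: real \<times> 'a)" by (rule pmod_cong_AE) (use eq in \<open>auto\<close>)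
 then show "\<exists>v. W0 v \<and> pmod \<mu> p (\<lambda>x. v x - w' x) <= ennreal e" using w by (intro exI[of _ w]) (simp add: pmod_def)
qed

text \<open>Membership in X supplies one gradient per exponent; uniqueness of weak gradients merges
  them into a single pair and identifies its second component with the given h.\<close>

lemma (in energy_space) X_space_in_E:
 assumes X: "X_space \<Omega> p1 p2 v" and h: "weak_grad \<Omega> v h"
 obtains w where "w \<in> E" "\<And>x. fst (w x) = v x" "AE x in M. snd (w x) = h x"
proof -
 obtain g1 where g1: "d1.W0 (\<lambda>x. (v x, g1 x))" "weak_grad \<Omega> v g1"
  by (rule d1.W01p_imp_W0[of v]) (use X in \<open>simp add: X_space_def\<close>, rule that)
 obtain g2 where g2: "d2.W0 (\<lambda>x. (v x, g2 x))" "weak_grad \<Omega> v g2"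
  by (rule d2.W01p_imp_W0[of v]) (use X in \<open>simp add: X_space_def\<close>, rule that)
 have "AE x in M. g2 x = g1 x" by (rule weak_grad_unique[OF d1.\<Omega>_open g2(2) g1(2)])
 then have "AE x in M. (v x, g2 x) = (v x, g1 x)" by eventually_elim simp
 then have "d2.W0 (\<lambda>x. (v x, g1 x))" by (rule d2.W0_cong_AE[OF g2(1) d1.W0_measurable[OF g1(1)]])
 with g1 have "(\<lambda>x. (v x, g1 x)) \<in> E" by (simp add: E_def)
 moreover have "AE x in M. g1 x = h x" by (rule weak_grad_unique[OF d1.\<Omega>_open g1(2) h])
 ultimately show thesis by (intro that[of "\<lambda>x. (v x, g1 x)"]) auto
qed

section \<open>Choice of the parameters\<close>

lemma C_plus_bounds:
 assumes \<Omega>: "bounded \<Omega>" "\<Omega> \<noteq> {}" and h: "C_plus \<Omega> h"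
 shows "1 < inf_exp \<Omega> h" "\<And>x. x \<in> closure \<Omega> ==> inf_exp \<Omega> h <= h x" "\<And>x. x \<in> closure \<Omega> ==> h x <= sup_exp \<Omega> h"
proof -
 have c: "compact (closure \<Omega>)" "closure \<Omega> \<noteq> {}" "continuous_on (closure \<Omega>) h" using \<Omega> h by (auto simp: compact_closure C_plus_def)
 have b: "bdd_below (h ` closure \<Omega>)" "bdd_above (h ` closure \<Omega>)"
  using compact_imp_bounded[OF compact_continuous_image[OF c(3,1)]] by (auto intro: bounded_imp_bdd_below bounded_imp_bdd_above)
 obtain x0 where x0: "x0 \<in> closure \<Omega>" "\<And>x. x \<in> closure \<Omega> ==> h x0 <= h x" using continuous_attains_inf[OF c] by blast
 have "1 < h x0" using h x0 by (simp add: C_plus_def)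
 also have "h x0 <= inf_exp \<Omega> h" unfolding inf_exp_def using c(2) x0 by (intro cInf_greatest) auto
 finally show "1 < inf_exp \<Omega> h" .
 show "inf_exp \<Omega> h <= h x" "h x <= sup_exp \<Omega> h" if "x \<in> closure \<Omega>" for x
  unfolding inf_exp_def sup_exp_def using b that by (auto intro: cInf_lower cSup_upper)
qed

text \<open>For p < n the condition a < n p/(n - p) is multiplied out; for p >= n the inequality
  holds for every a, because n (a/p) <= a.\<close>

lemma subcritical_iff:
 fixes a p n :: real
 assumes "1 < p" "1 < a" "0 < n" and sub: "ereal a < (if p < n then ereal (n * p / (n - p)) else \<infinity>)"
 shows "n * (a / p - 1) < a"
proof (cases "p < n")
 case True
 then have "a * (n - p) < n * p" using sub by (simp add: pos_less_divide_eq)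
 then have "n * a - n * p < a * p" by (simp add: algebra_simps)
 then have "(n * a - n * p) / p < a" using assms by (simp add: divide_less_eq)
 then show ?thesis using assms by (simp add: diff_divide_distrib right_diff_distrib)
next
 case False
 then have "n * (a / p) <= p * (a / p)" using assms by (intro mult_right_mono) auto
 then show ?thesis using assms by (simp add: right_diff_distrib)
qed

text \<open>The margin g is continuous and positive on the compact closure, hence at least some g0 >
  0. Lowering the exponent by \<open>\<omega>\<close> and reserving \<open>\<kappa>\<close> consume
  at most g0/2 each, and uniform continuity of q turns \<open>\<omega>\<close> into a
  radius.\<close>

lemma subcritical_parameters:
 fixes \<Omega> :: "'a::euclidean_space set" and q a :: "'a => real"
 assumes \<Omega>: "bounded \<Omega>" "\<Omega> \<noteq> {}" and q: "C_plus \<Omega> q" and a: "C_plus \<Omega> a"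
  and sub: "\<forall>x\<in>closure \<Omega>. ereal (a x) < crit_exp DIM('a) (q x)"
 obtains \<omega> \<kappa> \<eta> where "0 <= \<omega>" "0 < \<kappa>" "\<kappa> < 1" "0 < \<eta>" "\<eta> <= 1" "\<And>x. x \<in> closure \<Omega> ==> 1 <= q x - \<omega>"
  "\<And>x z. x \<in> closure \<Omega> ==> z \<in> closure \<Omega> ==> norm (z - x) <= \<eta> ==> q x - \<omega> <= q z"
  "\<And>x. x \<in> closure \<Omega> ==> real DIM('a) * (a x / (q x - \<omega>) - 1) <= (1 - \<kappa>) * a x"
proof -
 let ?n = "real DIM('a)"
 have n: "0 < ?n" by simp
 note qb = C_plus_bounds[OF \<Omega> q] and ab = C_plus_bounds[OF \<Omega> a]
 have c: "compact (closure \<Omega>)" "closure \<Omega> \<noteq> {}" using \<Omega> by (auto simp: compact_closure)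
 have qc: "continuous_on (closure \<Omega>) q" and ac: "continuous_on (closure \<Omega>) a" using q a by (auto simp: C_plus_def)
 define g where "g x = a x - ?n * (a x / q x - 1)" for x
 have gpos: "0 < g x" if x: "x \<in> closure \<Omega>" for x
  using subcritical_iff[of "q x" "a x" ?n] sub x q a by (simp add: g_def C_plus_def crit_exp_def)
 have "continuous_on (closure \<Omega>) g" unfolding g_def using q by (intro continuous_intros qc ac) (force simp: C_plus_def)
 then obtain x0 where x0: "x0 \<in> closure \<Omega>" "\<And>x. x \<in> closure \<Omega> ==> g x0 <= g x" using continuous_attains_inf[OF c] by blast
 define g0 where "g0 = g x0"
 have g0: "0 < g0" "\<And>x. x \<in> closure \<Omega> ==> g0 <= g x" using x0 gpos by (auto simp: g0_def)
 define H where "H = sup_exp \<Omega> a"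
 have H: "1 < H" using ab x0(1) by (force simp: H_def)
 \<comment> \<open>The first bound keeps q - \<omega> >= 1; the second makes the increase of n a/q
   under this shift, at most n H \<omega>, no larger than g0/2.\<close>
 define \<omega> where "\<omega> = min (inf_exp \<Omega> q - 1) (g0 / (2 * ?n * H))"
 have \<omega>: "0 < \<omega>" "\<omega> <= inf_exp \<Omega> q - 1" "\<omega> <= g0 / (2 * ?n * H)" using qb(1) g0 H n by (auto simp: \<omega>_def)
 have "?n * H * \<omega> <= ?n * H * (g0 / (2 * ?n * H))" using \<omega> H by (intro mult_left_mono) auto
 also have "... = g0 / 2" using H by simp
 finally have \<omega>g: "?n * H * \<omega> <= g0 / 2" .
 define \<kappa> where "\<kappa> = min (1/2) (g0 / (2 * H))"
 have \<kappa>: "0 < \<kappa>" "\<kappa> < 1" using g0 H by (auto simp: \<kappa>_def)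
 have "\<kappa> * H <= g0 / (2 * H) * H" using H by (intro mult_right_mono) (auto simp: \<kappa>_def)
 then have \<kappa>H: "\<kappa> * H <= g0 / 2" using H by simp
 obtain d where d: "0 < d" "\<And>x z. x \<in> closure \<Omega> ==> z \<in> closure \<Omega> ==> dist z x < d ==> dist (q z) (q x) < \<omega>"
  using compact_uniformly_continuous[OF qc c(1)] \<omega>(1) unfolding uniformly_continuous_on_def by metis
 show thesis
 proof (rule that[of \<omega> \<kappa> "min 1 (d/2)"])
  show "0 <= \<omega>" "0 < \<kappa>" "\<kappa> < 1" "0 < min 1 (d/2)" "min 1 (d/2) <= 1" using \<omega> \<kappa> d by auto
  show q1: "1 <= q x - \<omega>" if "x \<in> closure \<Omega>" for x using qb(2)[OF that] \<omega> by linarith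
  show "q x - \<omega> <= q z" if "x \<in> closure \<Omega>" "z \<in> closure \<Omega>" "norm (z - x) <= min 1 (d/2)" for x z
   using d(2)[OF that(1,2)] that(3) d(1) by (auto simp: dist_norm abs_if split: if_splits)
  fix x assume x: "x \<in> closure \<Omega>"
  note q1 = q1[OF x]
  have ax: "1 < a x" "a x <= H" using ab(1) ab(2,3)[OF x] by (auto simp: H_def)
  have "a x / (q x - \<omega>) - a x / q x = a x * \<omega> / ((q x - \<omega>) * q x)" using q1 \<omega> by (simp add: field_simps)
  also have "... <= H * \<omega> / 1" using q1 \<omega> ax mult_mono[of 1 "q x - \<omega>" 1 "q x"] by (intro frac_le mult_right_mono) auto
  finally have "?n * (a x / (q x - \<omega>) - a x / q x) <= ?n * (H * \<omega>)" by (intro mult_left_mono) auto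
  moreover have "\<kappa> * a x <= \<kappa> * H" using ax \<kappa> by (intro mult_left_mono) auto
  ultimately show "?n * (a x / (q x - \<omega>) - 1) <= (1 - \<kappa>) * a x"
   using g0(2)[OF x] \<omega>g \<kappa>H by (simp add: g_def algebra_simps)
 qed
qed

theorem theorem3p6:
  fixes \<Omega> :: "'a::euclidean_space set"
    and p1 p2 \<alpha> :: "'a \<Rightarrow> real"
    and f :: "'a \<Rightarrow> real \<Rightarrow> real"
    and C1 C2 M \<theta> :: real
  defines "pM \<equiv> (\<lambda>x. max (p1 x) (p2 x))"
  assumes dom: "bounded_smooth_domain \<Omega>"
    and p1: "C_plus \<Omega> p1" and p2: "C_plus \<Omega> p2"
    and f0_car: "caratheodory \<Omega> f"
    and f0_growth: "\<forall>x\<in>\<Omega>. \<forall>t. \<bar>f x t\<bar> \<le> C1 + C2 * \<bar>t\<bar> powr (\<alpha> x - 1)"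
    and f0_alpha: "C_plus \<Omega> \<alpha>"
    and f0_subcrit: "\<forall>x\<in>closure \<Omega>. ereal (\<alpha> x) < crit_exp DIM('a) (pM x)"
    and f0_inf: "inf_exp \<Omega> \<alpha> > sup_exp \<Omega> pM"
    and f1: "M > 0" "\<theta> > sup_exp \<Omega> pM"
      "\<forall>x\<in>\<Omega>. \<forall>t. \<bar>t\<bar> \<ge> M \<longrightarrow> 0 < \<theta> * primitive f x t \<and> \<theta> * primitive f x t \<le> t * f x t"
    and f2: "\<forall>\<epsilon>>0. \<exists>\<delta>>0. \<forall>x\<in>\<Omega>. \<forall>t. 0 < \<bar>t\<bar> \<and> \<bar>t\<bar> < \<delta> \<longrightarrow>
               \<bar>f x t\<bar> \<le> \<epsilon> * \<bar>t\<bar> powr (sup_exp \<Omega> pM - 1)"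
  shows "\<exists>u. weak_solution \<Omega> p1 p2 f u \<and> \<not> (AE x in lebesgue_on \<Omega>. u x = 0)"
proof -
 have \<Omega>: "bounded \<Omega>" "\<Omega> \<noteq> {}" "open \<Omega>"
 proof -
  obtain \<rho> where \<rho>: "smooth_fun \<rho>" "\<Omega> = {x. \<rho> x < 0}" using dom by (auto simp: bounded_smooth_domain_def)
  have "Ck 0 \<rho>" using \<rho>(1) by (simp only: smooth_fun_def)
  then show "open \<Omega>" unfolding \<rho>(2) by (intro open_Collect_less) auto
 qed (use dom in \<open>auto simp: bounded_smooth_domain_def\<close>)
 have \<Omega>m: "\<Omega> \<in> sets lebesgue" using \<Omega> by simp
 have cl: "x \<in> closure \<Omega>" if "x \<in> \<Omega>" for x using that closure_subset by blast
 have pM: "C_plus \<Omega> pM" using p1 p2 unfolding C_plus_def pM_def by (auto intro!: continuous_on_max simp: less_max_iff_disj)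
 note b1 = C_plus_bounds[OF \<Omega>(1,2) p1] and b2 = C_plus_bounds[OF \<Omega>(1,2) p2]
  and bA = C_plus_bounds[OF \<Omega>(1,2) f0_alpha] and bM = C_plus_bounds[OF \<Omega>(1,2) pM]
 obtain y where y: "y \<in> \<Omega>" using \<Omega> by blast
 define lo where "lo = Min {inf_exp \<Omega> p1, inf_exp \<Omega> p2, inf_exp \<Omega> \<alpha>}"
 define hi where "hi = Max {sup_exp \<Omega> p1, sup_exp \<Omega> p2, sup_exp \<Omega> \<alpha>}"
 have lo: "1 < lo" "lo <= inf_exp \<Omega> p1" "lo <= inf_exp \<Omega> p2" "lo <= inf_exp \<Omega> \<alpha>" using b1 b2 bA by (auto simp: lo_def)
 have hi: "sup_exp \<Omega> p1 <= hi" "sup_exp \<Omega> p2 <= hi" "sup_exp \<Omega> \<alpha> <= hi" by (auto simp: hi_def)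
 have range: "lo <= p1 x" "p1 x <= hi" "lo <= p2 x" "p2 x <= hi" "lo <= \<alpha> x" "\<alpha> x <= hi" "p1 x <= sup_exp \<Omega> pM" "p2 x <= sup_exp \<Omega> pM" "inf_exp \<Omega> \<alpha> <= \<alpha> x"
  if "x \<in> \<Omega>" for x
  using b1(2,3)[OF cl[OF that]] b2(2,3)[OF cl[OF that]] bA(2,3)[OF cl[OF that]] bM(3)[OF cl[OF that]] lo hi by (auto simp: pM_def)
 have lohi: "lo <= hi" using range[OF y] by linarith
 have pp: "lo <= sup_exp \<Omega> pM" "sup_exp \<Omega> pM <= hi"
 proof -
  show "lo <= sup_exp \<Omega> pM" using range[OF y] by linarith
  have "pM x <= hi" if "x \<in> closure \<Omega>" for x using b1(3)[OF that] b2(3)[OF that] hi by (simp add: pM_def)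
  then show "sup_exp \<Omega> pM <= hi" unfolding sup_exp_def using y cl by (intro cSup_least) auto
 qed
 obtain \<omega> \<kappa> \<eta> where par: "0 <= \<omega>" "0 < \<kappa>" "\<kappa> < 1" "0 < \<eta>" "\<eta> <= 1" "\<And>x. x \<in> closure \<Omega> ==> 1 <= pM x - \<omega>"
  "\<And>x z. x \<in> closure \<Omega> ==> z \<in> closure \<Omega> ==> norm (z - x) <= \<eta> ==> pM x - \<omega> <= pM z"
  "\<And>x. x \<in> closure \<Omega> ==> real DIM('a) * (\<alpha> x / (pM x - \<omega>) - 1) <= (1 - \<kappa>) * \<alpha> x"
  by (rule subcritical_parameters[OF \<Omega>(1,2) pM f0_alpha f0_subcrit]) (rule that)
 obtain R0 where R0: "\<And>x. x \<in> \<Omega> ==> norm x <= R0" using \<Omega>(1) by (auto simp: bounded_iff)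
 define R where "R = \<bar>R0\<bar> + 1"
 \<comment> \<open>Extension by 0 yields Borel functions on the whole space, as the averaging
   estimates on \<open>lborel\<close> require.\<close>
 define P where "P x = (if x \<in> \<Omega> then pM x else 0)" for x
 define A where "A x = (if x \<in> \<Omega> then \<alpha> x else 0)" for x
 have cont: "continuous_on \<Omega> p1" "continuous_on \<Omega> p2" "continuous_on \<Omega> \<alpha>" "continuous_on \<Omega> pM"
  using p1 p2 f0_alpha pM by (auto simp: C_plus_def intro: continuous_on_subset[OF _ closure_subset])
 define G where "G = {x \<in> \<Omega>. continuous_on UNIV (f x)}"
 \<comment> \<open>On the null set where continuity in t fails, f is replaced by 0; integrals over
   \<Omega> do not change.\<close>
 define f' where "f' x t = (if x \<in> G then f x t else 0)" for x t
 define C where "C = max 1 (\<bar>C1\<bar> + \<bar>C2\<bar>)"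
 have AEG: "AE x in lebesgue_on \<Omega>. x \<in> G"
 proof -
  have "AE x in lebesgue_on \<Omega>. continuous_on UNIV (f x)" using f0_car by (simp add: caratheodory_def)
  with AE_space show ?thesis by eventually_elim (simp add: G_def)
 qed
 interpret s: superlinear \<Omega> p1 p2 \<alpha> P A lo hi R \<eta> \<omega> \<kappa> "inf_exp \<Omega> \<alpha>" "sup_exp \<Omega> pM" f' C G M \<theta>
 proof
  show "open \<Omega>" "bounded \<Omega>" "continuous_on \<Omega> p1" "continuous_on \<Omega> p2" "continuous_on \<Omega> \<alpha>" "1 < lo" "lo <= hi" by fact+
  show "0 < \<eta>" "\<eta> <= 1" "0 < \<kappa>" "\<kappa> < 1" "0 <= \<omega>" "1 < inf_exp \<Omega> \<alpha>" "lo <= sup_exp \<Omega> pM" "sup_exp \<Omega> pM <= hi" "sup_exp \<Omega> pM < inf_exp \<Omega> \<alpha>" by fact+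
  show "lo <= p1 x" "p1 x <= hi" "lo <= p2 x" "p2 x <= hi" "lo <= \<alpha> x" "\<alpha> x <= hi" "p1 x <= sup_exp \<Omega> pM" "p2 x <= sup_exp \<Omega> pM" if "x \<in> \<Omega>" for x
   by (rule range[OF that])+
  show "0 < R" by (simp add: R_def)
  show "norm x < R" if "x \<in> \<Omega>" for x using R0[OF that] by (simp add: R_def)
  show "P \<in> borel_measurable borel" "A \<in> borel_measurable borel"
   unfolding P_def A_def using \<Omega> cont by (auto intro!: borel_measurable_continuous_on_if)
  show "1 <= P x - \<omega>" "A x <= hi" "P x - \<omega> <= A x" "inf_exp \<Omega> \<alpha> <= A x" "real DIM('a) * (A x / (P x - \<omega>) - 1) <= (1 - \<kappa>) * A x"
   "P x = max (p1 x) (p2 x)" "A x = \<alpha> x" if "x \<in> \<Omega>" for x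
   using par(1) par(6,8)[OF cl[OF that]] range[OF that] f0_inf bM(3)[OF cl[OF that]] that by (auto simp: P_def A_def pM_def)
  show "P x - \<omega> <= P z" if "x \<in> \<Omega>" "z \<in> \<Omega>" "norm (z - x) <= \<eta>" for x z
   using par(7)[OF cl[OF that(1)] cl[OF that(2)] that(3)] that by (simp add: P_def)
  show cf': "continuous_on UNIV (f' x)" for x by (cases "x \<in> G") (auto simp: f'_def G_def)
  show "case_prod f' \<in> borel_measurable (lebesgue_on \<Omega> \<Otimes>\<^sub>M borel)"
  proof (rule caratheodory_joint_measurable)
   show "(\<lambda>x. f' x t) \<in> borel_measurable (lebesgue_on \<Omega>)" for t
   proof (rule borel_measurable_lebesgue_on_AE[OF \<Omega>m])
    show "(\<lambda>x. f x t) \<in> borel_measurable (lebesgue_on \<Omega>)" using f0_car by (simp add: caratheodory_def)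
    show "AE x in lebesgue_on \<Omega>. f x t = f' x t" using AEG by eventually_elim (simp add: f'_def)
   qed
  qed (rule cf')
  show "1 <= C" by (simp add: C_def)
  show "\<bar>f' x t\<bar> <= C * (1 + \<bar>t\<bar> powr (\<alpha> x - 1))" if "x \<in> \<Omega>" for x t
  proof -
   let ?z = "\<bar>t\<bar> powr (\<alpha> x - 1)"
   have "\<bar>f' x t\<bar> <= \<bar>f x t\<bar>" by (simp add: f'_def)
   also have "... <= C1 + C2 * ?z" using f0_growth that by blast
   also have "... <= C + C * ?z" by (intro add_mono mult_right_mono) (auto simp: C_def)
   finally show ?thesis by (simp add: distrib_left)
  qed
  show "AE x in lebesgue_on \<Omega>. x \<in> G" "0 < M" "sup_exp \<Omega> pM < \<theta>" "\<Omega> \<noteq> {}" by fact+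
  show "0 < \<theta> * primitive f' x t \<and> \<theta> * primitive f' x t <= t * f' x t" if "x \<in> \<Omega>" "x \<in> G" "M <= \<bar>t\<bar>" for x t
  proof -
   have "f' x = f x" using that by (simp add: f'_def fun_eq_iff)
   then show ?thesis using f1(3) that unfolding primitive_def by simp
  qed
  fix e :: real assume e: "0 < e"
  then obtain d where d: "0 < d" "\<forall>x\<in>\<Omega>. \<forall>t. 0 < \<bar>t\<bar> \<and> \<bar>t\<bar> < d --> \<bar>f x t\<bar> <= e * \<bar>t\<bar> powr (sup_exp \<Omega> pM - 1)" using f2 by blast
  have "\<bar>f' x t\<bar> <= e * \<bar>t\<bar> powr (sup_exp \<Omega> pM - 1)" if x: "x \<in> \<Omega>" and t: "\<bar>t\<bar> < d" for x t
  \<comment> \<open>The hypothesis at the origin concerns t \<noteq> 0. By continuity it forces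
    f(x,0) = 0, since the right-hand side tends to 0 with t, so t = 0 can be included.\<close>
  proof (cases "t = 0 \<and> x \<in> G")
   case True
   have lim: "((\<lambda>t. f x t) \<longlongrightarrow> f x 0) (at 0)" using True by (simp add: G_def continuous_on_eq_continuous_at isCont_def)
   have "\<forall>\<^sub>F t in at 0. \<bar>t\<bar> < d" using d(1) by (auto simp: eventually_at dist_norm)
   then have "\<forall>\<^sub>F t in at 0. norm (f x t) <= e * \<bar>t\<bar> powr (sup_exp \<Omega> pM - 1)"
    using eventually_neq_at_within[of 0 0 UNIV] by eventually_elim (use d(2) x in auto)
   moreover have "((\<lambda>t. e * \<bar>t\<bar> powr (sup_exp \<Omega> pM - 1)) \<longlongrightarrow> e * \<bar>0\<bar> powr (sup_exp \<Omega> pM - 1)) (at 0)"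
    using bM(1) bM(2,3)[OF cl[OF y]] by (intro tendsto_intros) auto
   ultimately have "((\<lambda>t. f x t) \<longlongrightarrow> 0) (at 0)" using Lim_null_comparison[of "f x"] by simp
   then have "f x 0 = 0" using tendsto_unique[OF _ lim] by simp
   then show ?thesis using True by (simp add: f'_def)
  next
   case False
   then show ?thesis using d(2) x t e by (auto simp: f'_def)
  qed
  then show "\<exists>\<delta>>0. \<forall>x\<in>\<Omega>. \<forall>t. \<bar>t\<bar> < \<delta> --> \<bar>f' x t\<bar> <= e * \<bar>t\<bar> powr (sup_exp \<Omega> pM - 1)" using d(1) by blast
 qed
 obtain w where w: "w \<in> s.E" "\<not> (AE x in lebesgue_on \<Omega>. fst (w x) = 0)" "\<And>v. v \<in> s.E ==> s.D w v = 0"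
  by (rule s.nontrivial_critical_point) (rule that)
 have W: "s.d1.W0 w" "s.d2.W0 w" using w(1) by (auto simp: s.E_def)
 have "weak_solution \<Omega> p1 p2 f (\<lambda>x. fst (w x))"
  unfolding weak_solution_def X_space_def[of _ _ _ "\<lambda>x. fst (w x)"]
 proof (intro conjI exI[of _ "\<lambda>x. snd (w x)"] allI impI)
  show "W01p \<Omega> p1 (\<lambda>x. fst (w x))" by (rule s.d1.W0_imp_W01p[OF W(1)])
  show "W01p \<Omega> p2 (\<lambda>x. fst (w x))" by (rule s.d2.W0_imp_W01p[OF W(2)])
  show "weak_grad \<Omega> (\<lambda>x. fst (w x)) (\<lambda>x. snd (w x))" by (rule s.d1.W0_weak_grad[OF W(1)])
  fix v h assume "X_space \<Omega> p1 p2 v \<and> weak_grad \<Omega> v h"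
  then obtain e where e: "e \<in> s.E" "\<And>x. fst (e x) = v x" "AE x in lebesgue_on \<Omega>. snd (e x) = h x"
   using s.X_space_in_E[of v h] by metis
  \<comment> \<open>The derivative of the energy is expressed with the second component of e, which
    agrees almost everywhere with the prescribed weak gradient h.\<close>
  have p: "(LINT x|(lebesgue_on \<Omega>). pvec (q x) (snd (w x)) \<bullet> snd (e x)) = (LINT x|(lebesgue_on \<Omega>). norm (snd (w x)) powr (q x - 2) * (snd (w x) \<bullet> h x))"
   if "(\<lambda>x. pvec (q x) (snd (w x)) \<bullet> snd (e x)) \<in> borel_measurable (lebesgue_on \<Omega>)" for q
   by (rule integral_lebesgue_on_cong_AE[OF \<Omega>m that]) (use e(3) in eventually_elim, simp add: pvec_def)
  have r: "(LINT x|(lebesgue_on \<Omega>). f' x (fst (w x)) * fst (e x)) = (LINT x|(lebesgue_on \<Omega>). f x (fst (w x)) * v x)"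
   by (rule integral_lebesgue_on_cong_AE[OF \<Omega>m s.measurable_parts(3)[OF w(1) e(1)]]) (use AEG in eventually_elim, simp add: f'_def e(2))
  show "(LINT x|(lebesgue_on \<Omega>). norm (snd (w x)) powr (p1 x - 2) * (snd (w x) \<bullet> h x)) + (LINT x|(lebesgue_on \<Omega>). norm (snd (w x)) powr (p2 x - 2) * (snd (w x) \<bullet> h x))
   = (LINT x|(lebesgue_on \<Omega>). f x (fst (w x)) * v x)"
   using s.D_parts[OF w(1) e(1)] w(3)[OF e(1)] p[OF s.measurable_parts(1)[OF w(1) e(1)]] p[OF s.measurable_parts(2)[OF w(1) e(1)]] r by simp
 qed
 with w(2) show ?thesis by blast
qed

end
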